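(* Let $K\ge1$ and let $n\ge2$ be an integer. Then there is $r=r(K,n)>n$ such that the following holds: if $m\ge n$, $\omega\in\Lambda^n\mathbb{R}^m$ is a calibration, $\Omega\subset\mathbb{R}^n$ is open, and $f\in W^{1,n}_{loc}(\Omega,\mathbb{R}^m)$ satisfies $$\|Df\|^n\le K\star f^\star\omega\quad\text{almost everywhere},$$ then $f\in W^{1,s'}_{loc}(\Omega,\mathbb{R}^m)$ for every $s'\in[n,r(K,n))$.
   Context: $\Lambda^n\mathbb{R}^m$ denotes the $n$-covectors on $\mathbb{R}^m$, identified with constant-coefficient $n$-forms. The comass of $\omega$ is $\|\omega\|=\sup\{\omega(v_1\wedge\dots\wedge v_n):(v_1,\dots,v_n)\text{ orthonormal}\}$; $\omega$ is a calibration if $\|\omega\|=1$. $\|Df\|$ is the operator norm of the weak differential, and $\star f^\star\omega=\omega(Df e_1\wedge\dots\wedge Df e_n)$ almost everywhere. The exponent $r$ depends only on $K$ and $n$ (not on $m$, $\omega$, $\Omega$ or $f$). *)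

theory Defs
  imports "HOL-Analysis.Analysis"
begin

text \<open>
  The domain is a subset of \<open>real ^ 'n\<close>, with \<open>n = CARD('n)\<close>. The target dimension \<open>m\<close> has to be
  quantified inside formulas, so it cannot be a type: \<open>\<real>\<^sup>m\<close> is the carrier
  \<open>topspace (Euclidean_space m)\<close>, the functions \<open>nat \<Rightarrow> real\<close> vanishing at all indices \<open>\<ge> m\<close>,
  with Euclidean norm \<open>L2_set v {..<m}\<close>.
\<close>

definition scalar_prod_Rm :: "nat \<Rightarrow> (nat \<Rightarrow> real) \<Rightarrow> (nat \<Rightarrow> real) \<Rightarrow> real" where
  "scalar_prod_Rm m v w = (\<Sum>i<m. v i * w i)"


subsection \<open>Covectors and comass\<close>

text \<open>
  An \<open>n\<close>-covector on \<open>\<real>\<^sup>m\<close> is an alternating \<open>n\<close>-linear form; \<open>\<omega> v\<close> stands for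
  \<open>\<omega>(v\<^sub>1 \<and> \<dots> \<and> v\<^sub>n)\<close>. The arguments are indexed by \<open>'n\<close>, the type that also indexes the standard
  basis \<open>axis j 1\<close> of the domain, so no enumeration of \<open>'n\<close> has to be chosen: any
  enumeration may be used simultaneously for the arguments of \<open>\<omega>\<close> and for the basis. Only
  the values of \<open>\<omega>\<close> on families in \<open>topspace (Euclidean_space m)\<close> matter.
\<close>

definition covector :: "nat \<Rightarrow> (('n::finite \<Rightarrow> nat \<Rightarrow> real) \<Rightarrow> real) \<Rightarrow> bool" where
  "covector m \<omega> \<longleftrightarrow>
     (\<forall>v. range v \<subseteq> topspace (Euclidean_space m) \<longrightarrow>
        (\<forall>j. \<forall>x\<in>topspace (Euclidean_space m). \<forall>y\<in>topspace (Euclidean_space m). \<forall>a b.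
           \<omega> (v(j := (\<lambda>i. a * x i + b * y i))) = a * \<omega> (v(j := x)) + b * \<omega> (v(j := y))) \<and>
        (\<forall>j k. j \<noteq> k \<longrightarrow> v j = v k \<longrightarrow> \<omega> v = 0))"

definition orthonormal_families :: "nat \<Rightarrow> ('n::finite \<Rightarrow> nat \<Rightarrow> real) set" where
  "orthonormal_families m =
     {v. range v \<subseteq> topspace (Euclidean_space m) \<and>
         (\<forall>j k. scalar_prod_Rm m (v j) (v k) = (if j = k then 1 else 0))}"

text \<open>
  For a covector and \<open>CARD('n) \<le> m\<close> this is the supremum of a nonempty bounded set.
\<close>

definition comass :: "nat \<Rightarrow> (('n::finite \<Rightarrow> nat \<Rightarrow> real) \<Rightarrow> real) \<Rightarrow> real" where
  "comass m \<omega> = (SUP v\<in>orthonormal_families m. \<omega> v)"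

definition calibration :: "nat \<Rightarrow> (('n::finite \<Rightarrow> nat \<Rightarrow> real) \<Rightarrow> real) \<Rightarrow> bool" where
  "calibration m \<omega> \<longleftrightarrow> covector m \<omega> \<and> comass m \<omega> = 1"


subsection \<open>Local Sobolev spaces\<close>

fun C_diff :: "nat \<Rightarrow> (real ^ 'n::finite \<Rightarrow> real) \<Rightarrow> bool" where
  "C_diff 0 \<phi> \<longleftrightarrow> continuous_on UNIV \<phi>"
| "C_diff (Suc k) \<phi> \<longleftrightarrow>
     (\<forall>x. \<phi> differentiable at x) \<and> (\<forall>j. C_diff k (\<lambda>x. frechet_derivative \<phi> (at x) (axis j 1)))"

definition test_fun :: "(real ^ 'n::finite) set \<Rightarrow> (real ^ 'n \<Rightarrow> real) \<Rightarrow> bool" where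
  "test_fun \<Omega> \<phi> \<longleftrightarrow>
     (\<forall>k. C_diff k \<phi>) \<and> compact (closure {x. \<phi> x \<noteq> 0}) \<and> closure {x. \<phi> x \<noteq> 0} \<subseteq> \<Omega>"

definition Lp_loc ::
  "(real ^ 'n::finite) set \<Rightarrow> real \<Rightarrow> (real ^ 'n \<Rightarrow> 'b::euclidean_space) \<Rightarrow> bool" where
  "Lp_loc \<Omega> p u \<longleftrightarrow>
     u \<in> borel_measurable (lebesgue_on \<Omega>) \<and>
     (\<forall>C. compact C \<longrightarrow> C \<subseteq> \<Omega> \<longrightarrow> integrable (lebesgue_on C) (\<lambda>x. norm (u x) powr p))"

definition weak_gradient ::
  "(real ^ 'n::finite) set \<Rightarrow> (real ^ 'n \<Rightarrow> real) \<Rightarrow> (real ^ 'n \<Rightarrow> real ^ 'n) \<Rightarrow> bool" where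
  "weak_gradient \<Omega> u g \<longleftrightarrow>
     Lp_loc \<Omega> 1 u \<and> Lp_loc \<Omega> 1 g \<and>
     (\<forall>\<phi> j. test_fun \<Omega> \<phi> \<longrightarrow>
        integral\<^sup>L (lebesgue_on \<Omega>) (\<lambda>x. u x * frechet_derivative \<phi> (at x) (axis j 1)) =
        - integral\<^sup>L (lebesgue_on \<Omega>) (\<lambda>x. g x $ j * \<phi> x))"

definition W1p_loc :: "(real ^ 'n::finite) set \<Rightarrow> real \<Rightarrow> (real ^ 'n \<Rightarrow> real) \<Rightarrow> bool" where
  "W1p_loc \<Omega> p u \<longleftrightarrow> Lp_loc \<Omega> p u \<and> (\<exists>g. weak_gradient \<Omega> u g \<and> Lp_loc \<Omega> p g)"

definition W1p_loc_map ::
  "(real ^ 'n::finite) set \<Rightarrow> nat \<Rightarrow> real \<Rightarrow> (real ^ 'n \<Rightarrow> nat \<Rightarrow> real) \<Rightarrow> bool" where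
  "W1p_loc_map \<Omega> m p f \<longleftrightarrow>
     (\<forall>x\<in>\<Omega>. f x \<in> topspace (Euclidean_space m)) \<and> (\<forall>i<m. W1p_loc \<Omega> p (\<lambda>x. f x i))"


subsection \<open>Weak differential, operator norm and pullback\<close>

text \<open>
  The differential at a point is given by its \<open>m\<close> rows \<open>A i\<close>, \<open>i < m\<close>. For a weak differential
  \<open>D\<close> of \<open>f\<close>, the row \<open>D x i\<close> is the weak gradient at \<open>x\<close> of the \<open>i\<close>-th component of \<open>f\<close>; it is
  determined by \<open>f\<close> up to a null set.
\<close>

definition weak_differential ::
  "(real ^ 'n::finite) set \<Rightarrow> nat \<Rightarrow> (real ^ 'n \<Rightarrow> nat \<Rightarrow> real) \<Rightarrow> (real ^ 'n \<Rightarrow> nat \<Rightarrow> real ^ 'n) \<Rightarrow> bool"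
  where
  "weak_differential \<Omega> m f D \<longleftrightarrow> (\<forall>i<m. weak_gradient \<Omega> (\<lambda>x. f x i) (\<lambda>x. D x i))"

definition row_map :: "nat \<Rightarrow> (nat \<Rightarrow> real ^ 'n::finite) \<Rightarrow> real ^ 'n \<Rightarrow> nat \<Rightarrow> real" where
  "row_map m A v = (\<lambda>i. if i < m then A i \<bullet> v else 0)"

definition op_norm :: "nat \<Rightarrow> (nat \<Rightarrow> real ^ 'n::finite) \<Rightarrow> real" where
  "op_norm m A = (SUP v\<in>sphere 0 1. L2_set (row_map m A v) {..<m})"

definition star_pullback ::
  "nat \<Rightarrow> (('n::finite \<Rightarrow> nat \<Rightarrow> real) \<Rightarrow> real) \<Rightarrow> (nat \<Rightarrow> real ^ 'n) \<Rightarrow> real" where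
  "star_pullback m \<omega> A = \<omega> (\<lambda>j. row_map m A (axis j 1))"

end

theory Submission
  imports Defs
begin

text \<open>
  Write \<open>n = CARD('n)\<close>. The proof runs along the classical route from a Caccioppoli inequality
  over a reverse Hoelder inequality to Gehring's lemma. What makes it work for curves into \<open>\<real>\<^sup>m\<close>
  is that \<open>\<omega>\<close> has constant coefficients, so \<open>f\<^sup>*\<omega>\<close> is an exact form.

  \<^item> \<^emph>\<open>Null Lagrangian.\<close> Let \<open>\<Phi>\<close> be a cut-off function and \<open>c\<close> a constant vector. For smooth \<open>f\<close> the
    field whose \<open>j\<close>-th entry is \<open>\<Phi>\<close> times \<open>\<omega>\<close> at \<open>\<partial>\<^sub>1f, \<dots>, \<partial>\<^sub>nf\<close>, with \<open>\<partial>\<^sub>jf\<close> replaced by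
    \<open>f - c\<close>, has a divergence in which the second derivatives of \<open>f\<close> cancel, because \<open>\<omega>\<close> is
    antisymmetric. Hence \<open>n \<integral> \<Phi> \<omega>(Df)\<close> is minus the sum over \<open>j\<close> of the integrals of \<open>\<partial>\<^sub>j\<Phi>\<close> times
    \<open>\<omega>\<close> at those arguments. Both sides are of degree \<open>n\<close> in \<open>(f, Df)\<close>, so mollification carries
    the identity over to \<open>W\<^sup>1\<^sup>,\<^sup>n\<close> (\<open>weak_pullback_identity\<close>).
  \<^item> \<^emph>\<open>Caccioppoli.\<close> A covector of comass at most 1 satisfies Hadamard's inequality with constant 1
    (\<open>covector_Hadamard\<close>), so the right-hand side is at most a multiple of
    \<open>\<integral> |\<nabla>\<Phi>| |f - c| |Df|\<^sup>n\<^sup>-\<^sup>1\<close>. The distortion inequality bounds \<open>|Df|\<^sup>n\<close> by \<open>K \<omega>(Df)\<close>, and with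
    \<open>\<Phi> = \<phi>\<^sup>n\<close> Young's inequality gives \<open>\<integral> |Df|\<^sup>n \<le> C r\<^sup>-\<^sup>n \<integral> |f - c|\<^sup>n\<close>, the first integral over half
    of the ball (\<open>caccioppoli\<close>).
  \<^item> \<^emph>\<open>Reverse Hoelder.\<close> The Sobolev-Poincare inequality from \<open>L\<^sup>3\<^sup>n\<^sup>/\<^sup>4\<close> to \<open>L\<^sup>n\<close> bounds the right-hand side
    by a power of the integral of \<open>|Df|\<^sup>3\<^sup>n\<^sup>/\<^sup>4\<close> over a larger ball (\<open>reverse_hoelder\<close>).
  \<^item> \<^emph>\<open>Gehring.\<close> Reverse Hoelder inequalities improve themselves (\<open>gehring\<close>): \<open>|Df|\<close> is locally in
    \<open>L\<^sup>s\<close> for \<open>s < n + \<epsilon>\<close>. The Sobolev-Poincare inequality from \<open>L\<^sup>n\<close> to \<open>L\<^sup>s\<close> gives the same for \<open>f\<close>.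

  The number \<open>\<epsilon>\<close> depends on \<open>K\<close> and \<open>n\<close> only. For this no constant may depend on \<open>m\<close>: Hadamard's
  inequality has constant 1, the Hilbert-Schmidt norm of a map defined on \<open>\<real>\<^sup>n\<close> is at most \<open>\<surd>n\<close> times
  its operator norm, and the Sobolev-Poincare inequality for maps into \<open>\<real>\<^sup>m\<close> is derived from estimates of
  scalar functions by testing with the unit vectors of \<open>\<real>\<^sup>m\<close>.

  The Sobolev-Poincare inequality itself comes from telescoping the mollifications of \<open>f\<close> over
  the radii \<open>\<rho> / 2\<^sup>j\<close>. Consecutive ones differ by at most \<open>C r\<close> times the mean of \<open>|Df|\<close> over the ball of
  radius \<open>r\<close> (\<open>mollify_halving\<close>), and for subcritical exponents the \<open>L\<^sup>p\<close> norms of these bounds decay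
  geometrically in \<open>j\<close>.
\<close>

section \<open>Mollification of integrable functions\<close>

lemma balls_borel [measurable]:
  "ball x r \<in> sets borel" "cball x r \<in> sets borel" for x :: "'a::metric_space"
  by auto

lemma tendsto_0_obtain:
  fixes a :: "nat \<Rightarrow> real"
  assumes "a \<longlonglongrightarrow> 0" "e > 0"
  obtains N where "a N < e"
  using order_tendstoD(2)[OF assms(1), of e] assms(2) eventually_happens[of "\<lambda>x. a x < e" sequentially] by auto

text \<open>
  Truncating \<open>f\<close> at a large height changes it little in \<open>L\<^sup>1\<close>. A measurable function is almost
  everywhere the limit of continuous functions, and if these are truncated at the same height,
  they converge in \<open>L\<^sup>1\<close> on the ball by dominated convergence.
\<close>

lemma L1_approx_continuous:
  fixes f :: "'a::euclidean_space \<Rightarrow> real"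
  assumes f: "integrable lborel f" and e: "e > 0"
  shows "\<exists>g. continuous_on UNIV g \<and> (\<integral>\<^sup>+x. ennreal \<bar>f x - g x\<bar> * indicator (cball 0 R) x \<partial>lborel) < ennreal e"
proof -
  have [measurable]: "f \<in> borel_measurable borel" using f by auto
  define cl where "cl N t = max (- real N) (min (real N) t)" for N :: nat and t :: real
  have cl_meas[measurable]: "cl N \<in> borel_measurable borel" for N unfolding cl_def by measurable
  have cl_b1: "\<bar>t - cl N t\<bar> \<le> \<bar>t\<bar>" and cl_b2: "\<bar>cl N t\<bar> \<le> real N" for N t
    by (auto simp: cl_def max_def min_def)
  have cl_b3: "\<bar>cl N s - cl N t\<bar> \<le> 2 * real N" for N s t
    using cl_b2[of N s] cl_b2[of N t] by linarith
  have cl_cont: "continuous_on UNIV (cl N)" for N unfolding cl_def by (intro continuous_intros)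
  have "(\<lambda>N. integral\<^sup>L lborel (\<lambda>x. \<bar>f x - cl N (f x)\<bar>)) \<longlonglongrightarrow> integral\<^sup>L lborel (\<lambda>x::'a. 0)"
  proof (rule integral_dominated_convergence[where w="\<lambda>x. \<bar>f x\<bar>"])
    show "AE x in lborel. (\<lambda>N. \<bar>f x - cl N (f x)\<bar>) \<longlonglongrightarrow> 0"
    proof (rule AE_I2)
      fix x
      obtain N0 :: nat where "\<bar>f x\<bar> \<le> real N0" using real_arch_simple by blast
      then have "\<forall>\<^sub>F N in sequentially. \<bar>f x - cl N (f x)\<bar> = 0"
        by (intro eventually_sequentiallyI[of N0]) (auto simp: cl_def max_def min_def)
      then show "(\<lambda>N. \<bar>f x - cl N (f x)\<bar>) \<longlonglongrightarrow> 0" by (rule tendsto_eventually)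
    qed
    show "AE x in lborel. norm \<bar>f x - cl N (f x)\<bar> \<le> \<bar>f x\<bar>" for N
      by (simp add: cl_b1)
  qed (use f in auto)
  then have L1: "(\<lambda>N. integral\<^sup>L lborel (\<lambda>x. \<bar>f x - cl N (f x)\<bar>)) \<longlonglongrightarrow> 0" by simp
  obtain N where N: "integral\<^sup>L lborel (\<lambda>x. \<bar>f x - cl N (f x)\<bar>) < e/2"
    using tendsto_0_obtain[OF L1 half_gt_zero[OF e]] by blast
  have int1: "integrable lborel (\<lambda>x. \<bar>f x - cl N (f x)\<bar>)"
    by (rule Bochner_Integration.integrable_bound[OF f]) (auto simp: cl_b1)
  have "f measurable_on UNIV"
    by (rule lebesgue_measurable_imp_measurable_on) (simp_all add: measurable_completion)
  then obtain M g where M: "negligible M" and g: "\<And>n. continuous_on UNIV (g n)"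
     and lim: "\<And>x. x \<notin> M \<Longrightarrow> (\<lambda>n. g n x) \<longlonglongrightarrow> f x"
    unfolding measurable_on_def by auto
  have [measurable]: "g n \<in> borel_measurable borel" for n using g by (rule borel_measurable_continuous_onI)
  have AEM: "AE x in lborel. x \<notin> M"
    using AE_not_in[of M lebesgue] M unfolding negligible_iff_null_sets AE_completion_iff by simp
  have finB: "emeasure lborel (cball 0 R :: 'a set) < \<infinity>" by (rule emeasure_lborel_cball_finite)
  have "(\<lambda>n. integral\<^sup>L lborel (\<lambda>x. \<bar>cl N (f x) - cl N (g n x)\<bar> * indicator (cball 0 R) x)) \<longlonglongrightarrow> integral\<^sup>L lborel (\<lambda>x::'a. 0)"
  proof (rule integral_dominated_convergence[where w="\<lambda>x. 2 * real N * indicator (cball 0 R) x"])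
    show "integrable lborel (\<lambda>x::'a. 2 * real N * indicator (cball 0 R) x)"
      using finB by (intro integrable_mult_right integrable_real_indicator) auto
    show "AE x in lborel. (\<lambda>n. \<bar>cl N (f x) - cl N (g n x)\<bar> * indicator (cball 0 R) x) \<longlonglongrightarrow> 0"
      using AEM
    proof eventually_elim
      case (elim x)
      have "(\<lambda>n. cl N (g n x)) \<longlonglongrightarrow> cl N (f x)"
        using continuous_on_tendsto_compose[OF cl_cont lim[OF elim]] by auto
      then have "(\<lambda>n. \<bar>cl N (f x) - cl N (g n x)\<bar> * indicator (cball 0 R) x) \<longlonglongrightarrow> \<bar>cl N (f x) - cl N (f x)\<bar> * indicator (cball 0 R) x"
        by (intro tendsto_intros)
      then show ?case by simp
    qed
    show "AE x in lborel. norm (\<bar>cl N (f x) - cl N (g n x)\<bar> * indicator (cball 0 R) x) \<le> 2 * real N * indicator (cball 0 R) x" for n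
      by (auto simp: cl_b3 indicator_def)
  qed auto
  then have L2: "(\<lambda>n. integral\<^sup>L lborel (\<lambda>x. \<bar>cl N (f x) - cl N (g n x)\<bar> * indicator (cball 0 R) x)) \<longlonglongrightarrow> 0" by simp
  obtain n where n: "integral\<^sup>L lborel (\<lambda>x. \<bar>cl N (f x) - cl N (g n x)\<bar> * indicator (cball 0 R) x) < e/2"
    using tendsto_0_obtain[OF L2 half_gt_zero[OF e]] by blast
  have int2: "integrable lborel (\<lambda>x. \<bar>cl N (f x) - cl N (g n x)\<bar> * indicator (cball 0 R) x)"
    by (rule Bochner_Integration.integrable_bound[where f="\<lambda>x. 2 * real N * indicator (cball 0 R) x"])
       (use finB in \<open>auto simp: cl_b3 indicator_times_eq_if intro!: integrable_real_indicator split: split_indicator\<close>)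
  let ?h = "\<lambda>x. cl N (g n x)"
  have "(\<integral>\<^sup>+x. ennreal \<bar>f x - ?h x\<bar> * indicator (cball 0 R) x \<partial>lborel)
     \<le> (\<integral>\<^sup>+x. ennreal (\<bar>f x - cl N (f x)\<bar> + \<bar>cl N (f x) - cl N (g n x)\<bar> * indicator (cball 0 R) x) \<partial>lborel)"
    by (intro nn_integral_mono) (auto simp: indicator_def simp del: ennreal_plus intro!: ennreal_leI)
  also have "\<dots> = ennreal (integral\<^sup>L lborel (\<lambda>x. \<bar>f x - cl N (f x)\<bar> + \<bar>cl N (f x) - cl N (g n x)\<bar> * indicator (cball 0 R) x))"
    by (intro nn_integral_eq_integral Bochner_Integration.integrable_add int1 int2) auto
  also have "\<dots> < ennreal e"
    using N n e by (intro ennreal_lessI) (auto simp: int1 int2)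
  finally show ?thesis
    using continuous_on_compose2[OF cl_cont[of N] g[of n]] by (intro exI[of _ ?h]) auto
qed

lemma nn_integral_lborel_translate:
  fixes f :: "'a::euclidean_space \<Rightarrow> ennreal"
  assumes [measurable]: "f \<in> borel_measurable borel"
  shows "(\<integral>\<^sup>+x. f (x - h) \<partial>lborel) = (\<integral>\<^sup>+x. f x \<partial>lborel)"
proof -
  have "(\<integral>\<^sup>+x. f x \<partial>lborel) = (\<integral>\<^sup>+x. f x \<partial>distr lborel borel ((+) (-h)))"
    by (simp add: lborel_distr_plus)
  also have "\<dots> = (\<integral>\<^sup>+x. f (x - h) \<partial>lborel)"
    by (subst nn_integral_distr) auto
  finally show ?thesis by simp
qed

text \<open>
  On a large ball \<open>f\<close> is close in \<open>L\<^sup>1\<close> to a continuous function, which is uniformly continuous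
  there. The support condition makes both \<open>f\<close> and its translates vanish outside that ball.
\<close>

lemma L1_translation_continuous:
  fixes f :: "'a::euclidean_space \<Rightarrow> real"
  assumes f: "integrable lborel f" and supp: "\<And>x. norm x > R \<Longrightarrow> f x = 0" and e: "e > 0"
  shows "\<exists>d>0. \<forall>h. norm h < d \<longrightarrow> (\<integral>\<^sup>+x. ennreal \<bar>f (x - h) - f x\<bar> \<partial>lborel) \<le> ennreal e"
proof -
  have [measurable]: "f \<in> borel_measurable borel" using f by auto
  \<comment> \<open>only translations by less than 1 are considered, so both points in a difference stay in this ball\<close>
  define R' where "R' = \<bar>R\<bar> + 2"
  let ?B = "cball 0 R' :: 'a set" let ?B1 = "cball 0 (\<bar>R\<bar> + 1) :: 'a set"
  obtain g where g: "continuous_on UNIV g" and gf: "(\<integral>\<^sup>+x. ennreal \<bar>f x - g x\<bar> * indicator ?B x \<partial>lborel) < ennreal (e/3)"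
    using L1_approx_continuous[OF f, of "e/3" R'] e by auto
  have [measurable]: "g \<in> borel_measurable borel" using g by (rule borel_measurable_continuous_onI)
  define c where "c = measure lborel ?B1"
  have c: "c \<ge> 0" "emeasure lborel ?B1 = ennreal c"
    using emeasure_lborel_cball_finite[of "0::'a" "\<bar>R\<bar>+1"]
    by (simp_all add: c_def emeasure_eq_ennreal_measure less_top[symmetric])
  have "uniformly_continuous_on ?B g"
    by (rule compact_uniformly_continuous) (use g continuous_on_subset in auto)
  then obtain d where d: "d > 0" "\<And>x y. x \<in> ?B \<Longrightarrow> y \<in> ?B \<Longrightarrow> dist y x < d \<Longrightarrow> dist (g y) (g x) < e/(3*(c+1))"
    unfolding uniformly_continuous_on_def using e c(1) by (auto dest!: spec[of _ "e/(3*(c+1))"])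
  show ?thesis
  proof (intro exI conjI allI impI)
    show "min d 1 > 0" using d by auto
    fix h :: 'a assume h: "norm h < min d 1"
    define F where "F x = ennreal \<bar>f x - g x\<bar> * indicator ?B x" for x
    have [measurable]: "F \<in> borel_measurable borel" unfolding F_def by measurable
    have pw: "ennreal \<bar>f (x - h) - f x\<bar> \<le> F (x-h) + F x
        + ennreal (e/(3*(c+1))) * indicator ?B1 x" for x
    proof (cases "norm x \<le> \<bar>R\<bar> + 1")
      case True
      have n: "norm (x - h) \<le> R'" using norm_triangle_ineq4[of x h] h True by (auto simp: R'_def)
      have "\<bar>g (x-h) - g x\<bar> < e/(3*(c+1))"
        using d(2)[of x "x-h"] True n h by (auto simp: R'_def dist_norm norm_minus_commute)
      then have "\<bar>f (x - h) - f x\<bar> \<le> \<bar>f (x-h) - g (x-h)\<bar> + \<bar>f x - g x\<bar> + e/(3*(c+1))" by linarith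
      then have "ennreal \<bar>f (x - h) - f x\<bar> \<le> ennreal (\<bar>f (x-h) - g (x-h)\<bar> + \<bar>f x - g x\<bar> + e/(3*(c+1)))" by (rule ennreal_leI)
      also have "\<dots> = ennreal \<bar>f (x-h) - g (x-h)\<bar> + ennreal \<bar>f x - g x\<bar> + ennreal (e/(3*(c+1)))"
        using e c by (simp add: ennreal_plus)
      finally show ?thesis using True n by (auto simp: R'_def F_def)
    next
      case False
      have "norm x \<le> norm (x-h) + norm h" using norm_triangle_ineq[of "x-h" h] by simp
      then have "norm (x-h) > R" "norm x > R" using False h by auto
      then show ?thesis using supp by simp
    qed
    have "(\<integral>\<^sup>+x. ennreal \<bar>f (x - h) - f x\<bar> \<partial>lborel) \<le>
      (\<integral>\<^sup>+x. F (x-h) + F x + ennreal (e/(3*(c+1))) * indicator ?B1 x \<partial>lborel)"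
      by (intro nn_integral_mono pw)
    also have "\<dots> = (\<integral>\<^sup>+x. F (x-h) \<partial>lborel) + (\<integral>\<^sup>+x. F x \<partial>lborel)
        + (\<integral>\<^sup>+x. ennreal (e/(3*(c+1))) * indicator ?B1 x \<partial>lborel)"
      by (simp add: nn_integral_add)
    also have "(\<integral>\<^sup>+x. F (x-h) \<partial>lborel) = (\<integral>\<^sup>+x. F x \<partial>lborel)"
      by (rule nn_integral_lborel_translate) simp
    also have "(\<integral>\<^sup>+x. ennreal (e/(3*(c+1))) * indicator ?B1 x \<partial>lborel) = ennreal (e/(3*(c+1)) * c)"
      using e c by (subst nn_integral_cmult_indicator) (auto simp: ennreal_mult[symmetric])
    also have "\<dots> \<le> ennreal (e/3)"
      using e c by (intro ennreal_leI) (simp add: field_simps)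
    also have "(\<integral>\<^sup>+x. F x \<partial>lborel) + (\<integral>\<^sup>+x. F x \<partial>lborel) + ennreal (e/3)
        \<le> ennreal (e/3) + ennreal (e/3) + ennreal (e/3)"
      using gf by (intro add_mono) (auto simp: F_def)
    also have "\<dots> = ennreal e" using e by (simp add: ennreal_plus[symmetric] del: ennreal_plus)
    finally show "(\<integral>\<^sup>+x. ennreal \<bar>f (x - h) - f x\<bar> \<partial>lborel) \<le> ennreal e" by (simp add: add_mono)
  qed
qed

text \<open>
  Besides smooth kernels this admits the normalized indicator of the unit ball, whose
  mollifications are the means over balls.
\<close>

definition mollifier :: "('a::euclidean_space \<Rightarrow> real) \<Rightarrow> bool" where
  "mollifier K \<longleftrightarrow> K \<in> borel_measurable borel \<and> (\<forall>z. 0 \<le> K z) \<and> (\<exists>B. \<forall>z. K z \<le> B) \<and>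
     (\<forall>z. norm z > 1 \<longrightarrow> K z = 0) \<and> integral\<^sup>L lborel K = 1"

definition mollify :: "('a::euclidean_space \<Rightarrow> real) \<Rightarrow> real \<Rightarrow> ('a \<Rightarrow> real) \<Rightarrow> 'a \<Rightarrow> real" where
  "mollify K r u x = (\<integral>z. K z * u (x - r *\<^sub>R z) \<partial>lborel)"

lemma mollifier_integrable:
  assumes "mollifier K" shows "integrable lborel K"
proof (rule ccontr)
  assume "\<not> integrable lborel K"
  then have "integral\<^sup>L lborel K = 0" by (rule not_integrable_integral_eq)
  then show False using assms by (simp add: mollifier_def)
qed

lemma mollifier_nn_integral:
  assumes K: "mollifier K" shows "(\<integral>\<^sup>+z. ennreal (K z) \<partial>lborel) = 1"
proof -
  have "(\<integral>\<^sup>+z. ennreal (K z) \<partial>lborel) = ennreal (integral\<^sup>L lborel K)"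
    by (rule nn_integral_eq_integral[OF mollifier_integrable[OF K]]) (use K in \<open>simp add: mollifier_def\<close>)
  then show ?thesis using K by (simp add: mollifier_def)
qed

lemma integral_lborel_affine:
  fixes f :: "'a::euclidean_space \<Rightarrow> real"
  assumes [measurable]: "f \<in> borel_measurable borel" and r: "r \<noteq> 0"
  shows "(\<integral>y. f y \<partial>lborel) = \<bar>r\<bar> ^ DIM('a) * (\<integral>z. f (x + r *\<^sub>R z) \<partial>lborel)"
proof -
  have "(\<integral>y. f y \<partial>lborel) = (\<integral>y. f y \<partial>density (distr lborel borel (\<lambda>z. x + r *\<^sub>R z)) (\<lambda>_. ennreal (\<bar>r\<bar> ^ DIM('a))))"
    using lborel_affine[OF r, of x] by simp
  also have "\<dots> = (\<integral>y. (\<bar>r\<bar> ^ DIM('a)) *\<^sub>R f y \<partial>distr lborel borel (\<lambda>z. x + r *\<^sub>R z))"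
    by (rule integral_density) auto
  also have "\<dots> = \<bar>r\<bar> ^ DIM('a) * (\<integral>y. f y \<partial>distr lborel borel (\<lambda>z. x + r *\<^sub>R z))"
    by simp
  also have "(\<integral>y. f y \<partial>distr lborel borel (\<lambda>z. x + r *\<^sub>R z)) = (\<integral>z. f (x + r *\<^sub>R z) \<partial>lborel)"
    by (rule integral_distr) measurable
  finally show ?thesis .
qed

lemma integrable_lborel_affine:
  fixes f :: "'a::euclidean_space \<Rightarrow> real"
  assumes f: "integrable lborel f" and r: "r \<noteq> 0"
  shows "integrable lborel (\<lambda>z. f (x + r *\<^sub>R z))"
proof -
  have [measurable]: "f \<in> borel_measurable borel" using f by auto
  have "integrable (density (distr lborel borel (\<lambda>z. x + r *\<^sub>R z)) (\<lambda>_. ennreal (\<bar>r\<bar> ^ DIM('a)))) f"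
    using f lborel_affine[OF r, of x] by simp
  then show ?thesis using r by (subst (asm) integrable_density) (auto simp: integrable_distr_eq)
qed

lemma mollify_integrable:
  fixes u :: "'a::euclidean_space \<Rightarrow> real"
  assumes K: "mollifier K" and u: "integrable lborel u" and r: "r \<noteq> 0"
  shows "integrable lborel (\<lambda>z. K z * u (x - r *\<^sub>R z))"
proof -
  have [measurable]: "u \<in> borel_measurable borel" "K \<in> borel_measurable borel" using u K by (auto simp: mollifier_def)
  obtain B where B: "\<And>z. K z \<le> B" using K by (auto simp: mollifier_def)
  have "integrable lborel (\<lambda>z. B * u (x + (-r) *\<^sub>R z))"
    using integrable_lborel_affine[OF u, of "-r" x] r by auto
  moreover have "norm (K z * u (x - r *\<^sub>R z)) \<le> norm (B * u (x + (-r) *\<^sub>R z))" for z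
    using K B[of z] order_trans[of "K z" B "\<bar>B\<bar>"] by (auto simp: mollifier_def abs_mult intro!: mult_right_mono)
  ultimately show ?thesis
    by (elim Bochner_Integration.integrable_bound) auto
qed

lemma mollify_eq:
  fixes u :: "'a::euclidean_space \<Rightarrow> real"
  assumes K: "mollifier K" and [measurable]: "u \<in> borel_measurable borel" and r: "r > 0"
  shows "mollify K r u x = (\<integral>y. u y * K ((1/r) *\<^sub>R (x - y)) \<partial>lborel) / r ^ DIM('a)"
proof -
  have [measurable]: "K \<in> borel_measurable borel" using K by (auto simp: mollifier_def)
  have "(\<integral>y. u y * K ((1/r) *\<^sub>R (x - y)) \<partial>lborel) = \<bar>-r\<bar>^DIM('a) * (\<integral>z. u (x + (-r) *\<^sub>R z) * K ((1/r) *\<^sub>R (x - (x + (-r) *\<^sub>R z))) \<partial>lborel)"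
    using r by (intro integral_lborel_affine) auto
  then show ?thesis using r by (simp add: mollify_def mult.commute)
qed

lemma mollify_measurable[measurable]:
  fixes u :: "'a::euclidean_space \<Rightarrow> real"
  assumes [measurable]: "K \<in> borel_measurable borel" "u \<in> borel_measurable borel"
  shows "mollify K r u \<in> borel_measurable borel"
  unfolding mollify_def[abs_def] by measurable

text \<open>
  By Fubini the \<open>L\<^sup>1\<close> error is at most a mean, weighted with \<open>K\<close>, of the \<open>L\<^sup>1\<close> distances between \<open>u\<close> and its
  translates by vectors of norm at most \<open>r\<close>.
\<close>

lemma mollify_L1_convergence:
  fixes u :: "'a::euclidean_space \<Rightarrow> real"
  assumes K: "mollifier K" and u: "integrable lborel u" and supp: "\<And>x. norm x > R \<Longrightarrow> u x = 0" and e: "e > 0"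
  shows "\<exists>d>0. \<forall>r. 0 < r \<and> r < d \<longrightarrow> (\<integral>\<^sup>+x. ennreal \<bar>mollify K r u x - u x\<bar> \<partial>lborel) \<le> ennreal e"
proof -
  have [measurable]: "u \<in> borel_measurable borel" "K \<in> borel_measurable borel" using u K by (auto simp: mollifier_def)
  obtain d where d: "d > 0" "\<And>h. norm h < d \<Longrightarrow> (\<integral>\<^sup>+x. ennreal \<bar>u (x - h) - u x\<bar> \<partial>lborel) \<le> ennreal e"
    using L1_translation_continuous[OF u supp e] by auto
  show ?thesis
  proof (intro exI conjI allI impI)
    fix r assume r: "0 < r \<and> r < d"
    have "ennreal \<bar>mollify K r u x - u x\<bar> \<le> (\<integral>\<^sup>+z. ennreal (K z) * ennreal \<bar>u (x - r *\<^sub>R z) - u x\<bar> \<partial>lborel)" for x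
    proof -
      have "mollify K r u x - u x = (\<integral>z. K z * u (x - r *\<^sub>R z) \<partial>lborel) - (\<integral>z. K z * u x \<partial>lborel)"
        using K by (simp add: mollify_def mollifier_def)
      also have "\<dots> = (\<integral>z. K z * (u (x - r *\<^sub>R z) - u x) \<partial>lborel)"
        using mollify_integrable[OF K u, of r x] r mollifier_integrable[OF K]
        by (subst Bochner_Integration.integral_diff[symmetric]) (auto simp: algebra_simps)
      finally have eq: "mollify K r u x - u x = (\<integral>z. K z * (u (x - r *\<^sub>R z) - u x) \<partial>lborel)" .
      have "ennreal \<bar>mollify K r u x - u x\<bar> \<le> (\<integral>\<^sup>+z. ennreal (norm (K z * (u (x - r *\<^sub>R z) - u x))) \<partial>lborel)"
        using integral_norm_bound_ennreal[of lborel "\<lambda>z. K z * (u (x - r *\<^sub>R z) - u x)"]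
          mollify_integrable[OF K u, of r x] r mollifier_integrable[OF K] unfolding eq by (auto simp: right_diff_distrib)
      also have "\<dots> = (\<integral>\<^sup>+z. ennreal (K z) * ennreal \<bar>u (x - r *\<^sub>R z) - u x\<bar> \<partial>lborel)"
        using K by (intro nn_integral_cong) (auto simp: mollifier_def abs_mult ennreal_mult)
      finally show ?thesis .
    qed
    then have "(\<integral>\<^sup>+x. ennreal \<bar>mollify K r u x - u x\<bar> \<partial>lborel) \<le> (\<integral>\<^sup>+x. (\<integral>\<^sup>+z. ennreal (K z) * ennreal \<bar>u (x - r *\<^sub>R z) - u x\<bar> \<partial>lborel) \<partial>lborel)"
      by (intro nn_integral_mono)
    also have "\<dots> = (\<integral>\<^sup>+z. (\<integral>\<^sup>+x. ennreal (K z) * ennreal \<bar>u (x - r *\<^sub>R z) - u x\<bar> \<partial>lborel) \<partial>lborel)"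
      by (rule lborel_pair.Fubini'[symmetric]) (simp add: case_prod_beta)
    also have "\<dots> = (\<integral>\<^sup>+z. ennreal (K z) * (\<integral>\<^sup>+x. ennreal \<bar>u (x - r *\<^sub>R z) - u x\<bar> \<partial>lborel) \<partial>lborel)"
      by (intro nn_integral_cong nn_integral_cmult) simp
    also have "\<dots> \<le> (\<integral>\<^sup>+z. ennreal (K z) * ennreal e \<partial>lborel)"
    proof (intro nn_integral_mono)
      fix z :: 'a
      show "ennreal (K z) * (\<integral>\<^sup>+x. ennreal \<bar>u (x - r *\<^sub>R z) - u x\<bar> \<partial>lborel) \<le> ennreal (K z) * ennreal e"
      proof (cases "norm z > 1")
        case True then show ?thesis using K by (auto simp: mollifier_def)
      next
        case False
        have "r * norm z \<le> r * 1" using False r by (intro mult_left_mono) auto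
        then have "norm (r *\<^sub>R z) < d" using r by (auto intro: le_less_trans[of _ r])
        then show ?thesis using d(2) by (intro mult_left_mono) auto
      qed
    qed
    also have "\<dots> = ennreal e" using mollifier_nn_integral[OF K] by (simp add: nn_integral_multc)
    finally show "(\<integral>\<^sup>+x. ennreal \<bar>mollify K r u x - u x\<bar> \<partial>lborel) \<le> ennreal e" .
  qed (rule d)
qed

lemma mollify_integrable_lborel:
  fixes u :: "'a::euclidean_space \<Rightarrow> real"
  assumes K: "mollifier K" and u: "integrable lborel u" and r: "r \<noteq> 0"
  shows "integrable lborel (mollify K r u)"
proof -
  have [measurable]: "u \<in> borel_measurable borel" "K \<in> borel_measurable borel" using u K by (auto simp: mollifier_def)
  have "ennreal \<bar>mollify K r u x\<bar> \<le> (\<integral>\<^sup>+z. ennreal (K z) * ennreal \<bar>u (x - r *\<^sub>R z)\<bar> \<partial>lborel)" for x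
  proof -
    have "ennreal \<bar>mollify K r u x\<bar> \<le> (\<integral>\<^sup>+z. ennreal (norm (K z * u (x - r *\<^sub>R z))) \<partial>lborel)"
      using integral_norm_bound_ennreal[OF mollify_integrable[OF K u r, of x]] by (simp add: mollify_def)
    also have "\<dots> = (\<integral>\<^sup>+z. ennreal (K z) * ennreal \<bar>u (x - r *\<^sub>R z)\<bar> \<partial>lborel)"
      using K by (intro nn_integral_cong) (auto simp: mollifier_def abs_mult ennreal_mult)
    finally show ?thesis .
  qed
  then have "(\<integral>\<^sup>+x. ennreal \<bar>mollify K r u x\<bar> \<partial>lborel) \<le> (\<integral>\<^sup>+x. (\<integral>\<^sup>+z. ennreal (K z) * ennreal \<bar>u (x - r *\<^sub>R z)\<bar> \<partial>lborel) \<partial>lborel)"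
    by (intro nn_integral_mono)
  also have "\<dots> = (\<integral>\<^sup>+z. (\<integral>\<^sup>+x. ennreal (K z) * ennreal \<bar>u (x - r *\<^sub>R z)\<bar> \<partial>lborel) \<partial>lborel)"
    by (rule lborel_pair.Fubini'[symmetric]) (simp add: case_prod_beta)
  also have "\<dots> = (\<integral>\<^sup>+z. ennreal (K z) * (\<integral>\<^sup>+x. ennreal \<bar>u (x - r *\<^sub>R z)\<bar> \<partial>lborel) \<partial>lborel)"
    by (intro nn_integral_cong nn_integral_cmult) simp
  also have "\<dots> = (\<integral>\<^sup>+z. ennreal (K z) * (\<integral>\<^sup>+x. ennreal \<bar>u x\<bar> \<partial>lborel) \<partial>lborel)"
    by (simp add: nn_integral_lborel_translate[of "\<lambda>x. ennreal \<bar>u x\<bar>"])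
  also have "\<dots> = (\<integral>\<^sup>+x. ennreal \<bar>u x\<bar> \<partial>lborel)"
    using mollifier_nn_integral[OF K] by (simp add: nn_integral_multc)
  also have "\<dots> < \<infinity>" using u by (simp add: integrable_iff_bounded)
  finally show ?thesis by (simp add: integrable_iff_bounded)
qed

lemma mollify_L1:
  fixes u :: "'a::euclidean_space \<Rightarrow> real"
  assumes K: "mollifier K" and u: "integrable lborel u" and supp: "\<And>x. norm x > R \<Longrightarrow> u x = 0"
    and rs: "\<And>k. rs k > 0" "rs \<longlonglongrightarrow> 0"
  shows "(\<lambda>k. \<integral>x. \<bar>mollify K (rs k) u x - u x\<bar> \<partial>lborel) \<longlonglongrightarrow> 0"
proof (rule LIMSEQ_I)
  fix e :: real assume e: "e > 0"
  obtain d where d: "d > 0" "\<And>r. 0 < r \<and> r < d \<Longrightarrow> (\<integral>\<^sup>+x. ennreal \<bar>mollify K r u x - u x\<bar> \<partial>lborel) \<le> ennreal (e/2)"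
    using mollify_L1_convergence[OF K u supp half_gt_zero[OF e]] by blast
  have "\<forall>\<^sub>F k in sequentially. rs k < d" using order_tendstoD(2)[OF rs(2) d(1)] .
  then obtain k0 where k0: "\<And>k. k \<ge> k0 \<Longrightarrow> rs k < d" by (auto simp: eventually_sequentially)
  show "\<exists>no. \<forall>n\<ge>no. norm ((\<integral>x. \<bar>mollify K (rs n) u x - u x\<bar> \<partial>lborel) - 0) < e"
  proof (intro exI allI impI)
    fix k assume k: "k \<ge> k0"
    have r0: "rs k \<noteq> 0" using rs(1)[of k] by simp
    have int: "integrable lborel (\<lambda>x. \<bar>mollify K (rs k) u x - u x\<bar>)"
      by (intro integrable_abs Bochner_Integration.integrable_diff u mollify_integrable_lborel[OF K u r0])
    have "ennreal (\<integral>x. \<bar>mollify K (rs k) u x - u x\<bar> \<partial>lborel) = (\<integral>\<^sup>+x. ennreal \<bar>mollify K (rs k) u x - u x\<bar> \<partial>lborel)"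
      by (rule nn_integral_eq_integral[symmetric, OF int]) auto
    also have "\<dots> \<le> ennreal (e/2)" using d(2) rs(1) k0[OF k] by blast
    finally have "(\<integral>x. \<bar>mollify K (rs k) u x - u x\<bar> \<partial>lborel) \<le> e/2" using e by (simp add: ennreal_le_iff)
    moreover have "(\<integral>x. \<bar>mollify K (rs k) u x - u x\<bar> \<partial>lborel) \<ge> 0" by simp
    ultimately show "norm ((\<integral>x. \<bar>mollify K (rs k) u x - u x\<bar> \<partial>lborel) - 0) < e"
      using e unfolding diff_0_right real_norm_def abs_less_iff by linarith
  qed
qed

text \<open>
  The sum of the finitely many errors tends to 0 in \<open>L\<^sup>1\<close>, so it tends to 0 almost everywhere along
  a subsequence. Having one sequence of radii for all \<open>u i\<close> allows limits to be taken in expressions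
  that contain all components of a map and of its differential.
\<close>

lemma mollify_AE_subseq:
  fixes u :: "'i \<Rightarrow> 'a::euclidean_space \<Rightarrow> real"
  assumes K: "mollifier K" and I: "finite I" and u: "\<And>i. i \<in> I \<Longrightarrow> integrable lborel (u i)"
    and supp: "\<And>i x. i \<in> I \<Longrightarrow> norm x > R \<Longrightarrow> u i x = 0"
    and rs: "\<And>k. rs k > 0" "rs \<longlonglongrightarrow> 0"
  obtains s :: "nat \<Rightarrow> nat" where "strict_mono s" "AE x in lborel. \<forall>i\<in>I. (\<lambda>k. mollify K (rs (s k)) (u i) x) \<longlonglongrightarrow> u i x"
proof -
  define v where "v k x = (\<Sum>i\<in>I. \<bar>mollify K (rs k) (u i) x - u i x\<bar>)" for k x
  have vn: "v k x \<ge> 0" for k x unfolding v_def by (intro sum_nonneg) auto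
  have r0: "rs k \<noteq> 0" for k using rs(1)[of k] by simp
  have int: "integrable lborel (\<lambda>x. \<bar>mollify K (rs k) (u i) x - u i x\<bar>)" if "i \<in> I" for i k
    by (intro integrable_abs Bochner_Integration.integrable_diff u that mollify_integrable_lborel[OF K _ r0])
  have "(\<lambda>k. \<Sum>i\<in>I. \<integral>x. \<bar>mollify K (rs k) (u i) x - u i x\<bar> \<partial>lborel) \<longlonglongrightarrow> (\<Sum>i\<in>I. 0)"
    by (intro tendsto_sum mollify_L1[OF K u supp rs])
  moreover have "(\<integral>x. norm (v k x) \<partial>lborel) = (\<Sum>i\<in>I. \<integral>x. \<bar>mollify K (rs k) (u i) x - u i x\<bar> \<partial>lborel)" for k
    using vn[of k] int by (simp add: v_def)
  ultimately have L: "(\<lambda>k. \<integral>x. norm (v k x) \<partial>lborel) \<longlonglongrightarrow> 0" by simp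
  have iv: "integrable lborel (v k)" for k
    unfolding v_def[abs_def] by (intro Bochner_Integration.integrable_sum int)
  obtain s where s: "strict_mono s" "AE x in lborel. (\<lambda>k. v (s k) x) \<longlonglongrightarrow> 0"
    using tendsto_L1_AE_subseq[OF iv L] by blast
  have "AE x in lborel. \<forall>i\<in>I. (\<lambda>k. mollify K (rs (s k)) (u i) x) \<longlonglongrightarrow> u i x"
    using s(2)
  proof eventually_elim
    case (elim x)
    show ?case
    proof
      fix i assume i: "i \<in> I"
      have "(\<lambda>k. mollify K (rs (s k)) (u i) x - u i x) \<longlonglongrightarrow> 0"
      proof (rule Lim_null_comparison[OF _ elim])
        show "\<forall>\<^sub>F k in sequentially. norm (mollify K (rs (s k)) (u i) x - u i x) \<le> v (s k) x"
          unfolding v_def real_norm_def using I i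
          by (intro always_eventually allI member_le_sum[where f="\<lambda>i. \<bar>mollify K _ (u i) x - u i x\<bar>"]) auto
      qed
      then show "(\<lambda>k. mollify K (rs (s k)) (u i) x) \<longlonglongrightarrow> u i x" by (rule LIM_zero_cancel)
    qed
  qed
  with s(1) that show thesis by blast
qed

text \<open>
  The majorants may vary with \<open>k\<close> as long as they converge in \<open>L\<^sup>1\<close>; the majorants of interest are
  the mollifications of one integrable function. Clamping \<open>fs k\<close> to \<open>[-G, G]\<close> reduces this to
  ordinary dominated convergence, at the cost of an error of at most \<open>|Gs k - G|\<close>.
\<close>

lemma integral_generalized_dominated_convergence:
  fixes f :: "'a \<Rightarrow> real" and fs Gs :: "nat \<Rightarrow> 'a \<Rightarrow> real"
  assumes [measurable]: "f \<in> borel_measurable M" "\<And>k. fs k \<in> borel_measurable M"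
    and G: "integrable M G" "\<And>k. integrable M (Gs k)" "\<And>x. G x \<ge> 0"
    and dom: "\<And>k. AE x in M. \<bar>fs k x\<bar> \<le> Gs k x"
    and lim: "AE x in M. (\<lambda>k. fs k x) \<longlonglongrightarrow> f x" and fG: "AE x in M. \<bar>f x\<bar> \<le> G x"
    and L1: "(\<lambda>k. \<integral>x. \<bar>Gs k x - G x\<bar> \<partial>M) \<longlonglongrightarrow> 0"
  shows "(\<lambda>k. \<integral>x. fs k x \<partial>M) \<longlonglongrightarrow> (\<integral>x. f x \<partial>M)"
proof -
  have [measurable]: "G \<in> borel_measurable M" "\<And>k. Gs k \<in> borel_measurable M" using G by auto
  define h where "h k x = max (- G x) (min (G x) (fs k x))" for k x
  have [measurable]: "h k \<in> borel_measurable M" for k unfolding h_def[abs_def] by measurable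
  have hb: "\<bar>h k x\<bar> \<le> G x" for k x using G(3)[of x] unfolding h_def by (auto simp: abs_le_iff)
  have hd: "\<bar>fs k x - h k x\<bar> \<le> \<bar>Gs k x - G x\<bar>" if "\<bar>fs k x\<bar> \<le> Gs k x" for k x
    using that G(3)[of x] unfolding h_def max_def min_def by (auto simp: abs_if split: if_splits)
  have hl: "(\<lambda>k. \<integral>x. h k x \<partial>M) \<longlonglongrightarrow> (\<integral>x. f x \<partial>M)"
  proof (rule integral_dominated_convergence[where w=G])
    show "AE x in M. (\<lambda>k. h k x) \<longlonglongrightarrow> f x" using lim fG
    proof eventually_elim
      case (elim x)
      have "(\<lambda>k. h k x) \<longlonglongrightarrow> max (- G x) (min (G x) (f x))"
        unfolding h_def by (intro tendsto_max tendsto_min tendsto_const elim)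
      moreover have "max (- G x) (min (G x) (f x)) = f x" using elim by auto
      ultimately show ?case by simp
    qed
  qed (auto simp: hb G(1))
  have ih: "integrable M (h k)" for k
    by (rule Bochner_Integration.integrable_bound[OF G(1)]) (use hb G(3) in \<open>auto\<close>)
  have ifs: "integrable M (fs k)" for k
    by (rule Bochner_Integration.integrable_bound[OF G(2)[of k]]) (use dom[of k] in \<open>auto elim: eventually_mono\<close>)
  have "(\<lambda>k. (\<integral>x. fs k x \<partial>M) - (\<integral>x. h k x \<partial>M)) \<longlonglongrightarrow> 0"
  proof (rule Lim_null_comparison[OF _ L1], intro always_eventually allI)
    fix k
    have "(\<integral>x. fs k x \<partial>M) - (\<integral>x. h k x \<partial>M) = (\<integral>x. fs k x - h k x \<partial>M)" using ih ifs by simp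
    also have "norm \<dots> \<le> (\<integral>x. norm (fs k x - h k x) \<partial>M)" by (rule integral_norm_bound)
    also have "\<dots> \<le> (\<integral>x. \<bar>Gs k x - G x\<bar> \<partial>M)"
      by (rule integral_mono_AE) (use ih ifs G dom[of k] hd in \<open>auto elim!: eventually_mono\<close>)
    finally show "norm ((\<integral>x. fs k x \<partial>M) - (\<integral>x. h k x \<partial>M)) \<le> (\<integral>x. \<bar>Gs k x - G x\<bar> \<partial>M)" .
  qed
  from tendsto_add[OF this hl] show ?thesis by simp
qed

text \<open>
  Integrating this inequality with \<open>a\<close> equal to the mean of \<open>t\<close> yields Jensen's inequality for means
  over balls and for mollifications.
\<close>

lemma powr_tangent:
  fixes a t p :: real
  assumes "a \<ge> 0" "t \<ge> 0" "p \<ge> 1"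
  shows "a powr p + p * a powr (p - 1) * (t - a) \<le> t powr p"
proof (cases "a = 0 \<or> t = 0")
  case True
  then show ?thesis
  proof
    assume "a = 0" then show ?thesis using assms by (cases "p = 1") auto
  next
    assume t: "t = 0"
    have "a powr (p - 1) * a = a powr p" using assms by (cases "a = 0") (auto simp: powr_diff)
    then have "a powr p + p * a powr (p - 1) * (t - a) = (1 - p) * a powr p" using t by (simp add: algebra_simps)
    also have "\<dots> \<le> 0" using assms by (intro mult_nonpos_nonneg) auto
    finally show ?thesis using t by simp
  qed
next
  case False
  then have a: "a > 0" "t > 0" using assms by auto
  have "p * a powr (p - 1) * (t - a) \<le> t powr p - a powr p"
    by (rule convex_on_imp_above_tangent[OF powr_convex[OF assms(3)]])
       (use a in \<open>auto simp: interior_open intro!: derivative_eq_intros\<close>)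
  then show ?thesis by simp
qed

lemma mollify_jensen:
  fixes u :: "'a::euclidean_space \<Rightarrow> real"
  assumes K: "mollifier K" and r: "r \<noteq> 0" and u: "integrable lborel u" "\<And>x. u x \<ge> 0"
    and up: "integrable lborel (\<lambda>x. u x powr p)" and p: "p \<ge> 1"
  shows "mollify K r u x powr p \<le> mollify K r (\<lambda>y. u y powr p) x" "mollify K r u x \<ge> 0"
proof -
  define a where "a = mollify K r u x"
  have Kn: "K z \<ge> 0" for z using K by (simp add: mollifier_def)
  show a: "mollify K r u x \<ge> 0" unfolding mollify_def using Kn u(2) by (intro integral_nonneg_AE) auto
  have K1: "integral\<^sup>L lborel K = 1" using K by (simp add: mollifier_def)
  note i = mollify_integrable[OF K u(1) r, of x] mollify_integrable[OF K up r, of x] mollifier_integrable[OF K]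
  have "(\<integral>z. a powr p * K z + p * a powr (p-1) * (K z * u (x - r *\<^sub>R z) - a * K z) \<partial>lborel) \<le> (\<integral>z. K z * u (x - r *\<^sub>R z) powr p \<partial>lborel)"
  proof (rule integral_mono)
    fix z
    have "K z * (a powr p + p * a powr (p - 1) * (u (x - r *\<^sub>R z) - a)) \<le> K z * (u (x - r *\<^sub>R z) powr p)"
      using a Kn[of z] p u(2) by (intro mult_left_mono powr_tangent) (auto simp: a_def)
    then show "a powr p * K z + p * a powr (p-1) * (K z * u (x - r *\<^sub>R z) - a * K z) \<le> K z * u (x - r *\<^sub>R z) powr p"
      by (simp add: algebra_simps)
  qed (use i in auto)
  moreover have "(\<integral>z. a powr p * K z + p * a powr (p-1) * (K z * u (x - r *\<^sub>R z) - a * K z) \<partial>lborel)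
      = a powr p + p * a powr (p-1) * ((\<integral>z. K z * u (x - r *\<^sub>R z) \<partial>lborel) - a)"
    using i K1 by simp
  ultimately show "mollify K r u x powr p \<le> mollify K r (\<lambda>y. u y powr p) x"
    by (simp add: a_def mollify_def)
qed

section \<open>Gehring's lemma\<close>

text \<open>
  Where \<open>S\<^sup>k b < H \<le> S\<^sup>k\<^sup>+\<^sup>1 b\<close>, the function \<open>H\<^sup>s\<close> is at most \<open>(S\<^sup>k\<^sup>+\<^sup>1 b)\<^sup>s\<^sup>-\<^sup>p H\<^sup>p\<close>. Summing these bounds over \<open>k\<close>
  gives a geometric series with ratio \<open>S\<^sup>s\<^sup>-\<^sup>p \<theta>\<close>.
\<close>

lemma geometric_decay_imp_higher_integrability:
  fixes H :: "'a \<Rightarrow> real" and \<theta> S p s b :: real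
  assumes [measurable]: "H \<in> borel_measurable M" and H: "\<And>x. H x \<ge> 0"
    and S: "S > 1" and l: "b > 0" and \<theta>: "\<theta> \<ge> 0" and s: "p \<le> s" "S powr (s - p) * \<theta> < 1"
    and F: "F \<ge> 0" and fin: "(\<integral>\<^sup>+x. ennreal (H x powr p) \<partial>M) < \<infinity>"
    and decay: "\<And>k::nat. (\<integral>\<^sup>+x. ennreal (H x powr p) * indicator {x. S ^ k * b < H x} x \<partial>M) \<le> ennreal (\<theta> ^ k * F)"
  shows "(\<integral>\<^sup>+x. ennreal (H x powr s) \<partial>M) < \<infinity>"
proof -
  define c where "c k = (S ^ (Suc k) * b) powr (s - p)" for k
  have c0: "c k \<ge> 0" for k by (simp add: c_def)
  have ceq: "c k = (S * b) powr (s - p) * (S powr (s - p)) ^ k" for k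
    using S l by (simp add: c_def powr_mult powr_power powr_realpow[symmetric] powr_powr mult_ac powr_add[symmetric] add.commute)
  have pw: "ennreal (H x powr s) \<le> ennreal (b powr (s - p)) * ennreal (H x powr p)
      + (\<Sum>k. ennreal (c k) * (ennreal (H x powr p) * indicator {x. S ^ k * b < H x} x))" for x
  proof (cases "H x \<le> b")
    case True
    have "H x powr s = H x powr (s - p) * H x powr p" by (simp add: powr_add[symmetric])
    also have "\<dots> \<le> b powr (s - p) * H x powr p"
      using True H s by (intro mult_right_mono powr_mono2) auto
    finally have "ennreal (H x powr s) \<le> ennreal (b powr (s - p)) * ennreal (H x powr p)"
      by (simp add: ennreal_mult[symmetric] ennreal_leI)
    then show ?thesis by (rule order_trans) simp
  next
    case False
    obtain n where n: "H x / b < S ^ n" using real_arch_pow[OF S] by blast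
    define k where "k = (LEAST n. H x \<le> S ^ n * b)"
    have ex: "H x \<le> S ^ n * b" using n l by (simp add: field_simps)
    have k1: "H x \<le> S ^ k * b" unfolding k_def by (rule LeastI[where P="\<lambda>n. H x \<le> S ^ n * b", OF ex])
    have "k \<noteq> 0" using k1 False by (intro notI) simp
    then obtain j where j: "k = Suc j" by (cases k) auto
    have k2: "S ^ j * b < H x" using not_less_Least[of j "\<lambda>n. H x \<le> S ^ n * b"] j unfolding k_def by auto
    have "H x powr s = H x powr (s - p) * H x powr p" by (simp add: powr_add[symmetric])
    also have "\<dots> \<le> c j * H x powr p"
      unfolding c_def using k1 j H s by (intro mult_right_mono powr_mono2) auto
    finally have "ennreal (H x powr s) \<le> ennreal (c j) * (ennreal (H x powr p) * indicator {x. S ^ j * b < H x} x)"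
      using k2 c0 by (simp add: ennreal_mult[symmetric] ennreal_leI)
    also have "\<dots> = (\<Sum>k\<in>{j}. ennreal (c k) * (ennreal (H x powr p) * indicator {x. S ^ k * b < H x} x))" by simp
    also have "\<dots> \<le> (\<Sum>k. ennreal (c k) * (ennreal (H x powr p) * indicator {x. S ^ k * b < H x} x))"
      by (rule sum_le_suminf) auto
    finally show ?thesis by (rule order_trans) simp
  qed
  have "(\<integral>\<^sup>+x. ennreal (H x powr s) \<partial>M) \<le> (\<integral>\<^sup>+x. ennreal (b powr (s - p)) * ennreal (H x powr p)
      + (\<Sum>k. ennreal (c k) * (ennreal (H x powr p) * indicator {x. S ^ k * b < H x} x)) \<partial>M)"
    by (intro nn_integral_mono pw)
  also have "\<dots> = ennreal (b powr (s - p)) * (\<integral>\<^sup>+x. ennreal (H x powr p) \<partial>M)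
      + (\<Sum>k. ennreal (c k) * (\<integral>\<^sup>+x. ennreal (H x powr p) * indicator {x. S ^ k * b < H x} x \<partial>M))"
  proof -
    have m[measurable]: "(\<lambda>x. ennreal (H x powr p) * indicator {x. S ^ k * b < H x} x) \<in> borel_measurable M" for k
      by (auto simp: indicator_def cong: if_cong intro!: borel_measurable_times_ennreal)
    show ?thesis
      by (simp add: nn_integral_add nn_integral_suminf nn_integral_cmult)
  qed
  also have "\<dots> \<le> ennreal (b powr (s - p)) * (\<integral>\<^sup>+x. ennreal (H x powr p) \<partial>M) + (\<Sum>k. ennreal (c k * (\<theta> ^ k * F)))"
    using decay c0 \<theta> F by (intro add_left_mono suminf_le) (auto simp: ennreal_mult intro!: mult_left_mono)
  also have "\<dots> < \<infinity>"
  proof -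
    have "summable (\<lambda>k. c k * (\<theta> ^ k * F))"
    proof -
      have "summable (\<lambda>k. (S * b) powr (s - p) * F * (S powr (s - p) * \<theta>) ^ k)"
        using s(2) \<theta> by (intro summable_mult summable_geometric) simp
      then show ?thesis by (simp add: ceq power_mult_distrib mult_ac)
    qed
    then have "(\<Sum>k. ennreal (c k * (\<theta> ^ k * F))) \<noteq> \<infinity>"
      using c0 \<theta> F by (subst suminf_ennreal2) auto
    moreover have "ennreal (b powr (s - p)) * (\<integral>\<^sup>+x. ennreal (H x powr p) \<partial>M) < \<infinity>"
      using fin by (simp add: ennreal_mult_less_top)
    ultimately show ?thesis by (simp add: less_top)
  qed
  finally show ?thesis .
qed

definition int_on :: "('a::euclidean_space \<Rightarrow> real) \<Rightarrow> 'a set \<Rightarrow> real" where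
  "int_on f S = (\<integral>x. indicator S x * f x \<partial>lborel)"

context
  fixes f :: "'a::euclidean_space \<Rightarrow> real"
  assumes f: "integrable lborel f" and f0: "\<And>x. f x \<ge> 0"
begin

lemma int_on_integrable: "S \<in> sets borel \<Longrightarrow> integrable lborel (\<lambda>x. indicator S x * f x)"
  using integrable_mult_indicator[of S lborel f] f by simp

lemma int_on_nonneg: "int_on f S \<ge> 0"
  unfolding int_on_def using f0 by (intro integral_nonneg_AE) (auto simp: indicator_def)

lemma int_on_mono: "S \<in> sets borel \<Longrightarrow> T \<in> sets borel \<Longrightarrow> S \<subseteq> T \<Longrightarrow> int_on f S \<le> int_on f T"
  unfolding int_on_def using f0 by (intro integral_mono int_on_integrable) (auto simp: indicator_def)

lemma int_on_split: "S \<in> sets borel \<Longrightarrow> T \<in> sets borel \<Longrightarrow> int_on f S = int_on f (S \<inter> T) + int_on f (S - T)"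
  unfolding int_on_def
proof (subst Bochner_Integration.integral_add[symmetric])
  assume [measurable]: "S \<in> sets borel" "T \<in> sets borel"
  show "integrable lborel (\<lambda>x. indicator (S \<inter> T) x * f x)" "integrable lborel (\<lambda>x. indicator (S - T) x * f x)"
    by (intro int_on_integrable; measurable)+
  show "(\<integral>x. indicator S x * f x \<partial>lborel) = (\<integral>x. indicator (S \<inter> T) x * f x + indicator (S - T) x * f x \<partial>lborel)"
    by (rule Bochner_Integration.integral_cong) (auto simp: indicator_def)
qed

lemma int_on_UN_le:
  assumes "finite I" "\<And>i. i \<in> I \<Longrightarrow> S i \<in> sets borel"
  shows "int_on f (\<Union>i\<in>I. S i) \<le> (\<Sum>i\<in>I. int_on f (S i))"
proof -
  have "int_on f (\<Union>i\<in>I. S i) \<le> (\<integral>x. (\<Sum>i\<in>I. indicator (S i) x * f x) \<partial>lborel)"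
    unfolding int_on_def
  proof (rule integral_mono)
    fix x show "indicator (\<Union>i\<in>I. S i) x * f x \<le> (\<Sum>i\<in>I. indicator (S i) x * f x)"
    proof (cases "x \<in> (\<Union>i\<in>I. S i)")
      case True
      then obtain i where i: "i \<in> I" "x \<in> S i" by auto
      have "indicator (S i) x * f x \<le> (\<Sum>i\<in>I. indicator (S i) x * f x)"
        using assms(1) i f0 by (intro member_le_sum) auto
      then show ?thesis using i True by simp
    qed (use f0 in \<open>auto intro!: sum_nonneg\<close>)
  next
    show "integrable lborel (\<lambda>x. indicator (\<Union>i\<in>I. S i) x * f x)"
      using assms by (intro int_on_integrable sets.finite_UN) auto
    show "integrable lborel (\<lambda>x. \<Sum>i\<in>I. indicator (S i) x * f x)"
      using assms by (intro int_on_integrable Bochner_Integration.integrable_sum) auto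
  qed
  also have "\<dots> = (\<Sum>i\<in>I. int_on f (S i))"
    unfolding int_on_def using assms(2) by (intro Bochner_Integration.integral_sum int_on_integrable) auto
  finally show ?thesis .
qed

lemma int_on_UN_disjoint:
  assumes "finite I" "\<And>i. i \<in> I \<Longrightarrow> S i \<in> sets borel" "disjoint_family_on S I"
  shows "int_on f (\<Union>i\<in>I. S i) = (\<Sum>i\<in>I. int_on f (S i))"
  unfolding int_on_def
proof (subst Bochner_Integration.integral_sum[symmetric])
  show "(\<integral>x. indicator (\<Union>i\<in>I. S i) x * f x \<partial>lborel) = (\<integral>x. (\<Sum>i\<in>I. indicator (S i) x * f x) \<partial>lborel)"
    by (simp add: sum_distrib_right[symmetric] indicator_UN_disjoint[OF assms(1,3)])
qed (use assms in \<open>auto intro!: int_on_integrable\<close>)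

lemma int_on_incseq_le:
  assumes S: "\<And>k. S k \<in> sets borel" "incseq S" and T: "T \<in> sets borel" "T \<subseteq> (\<Union>k. S k)" and b: "\<And>k::nat. int_on f (S k) \<le> b"
  shows "int_on f T \<le> b"
proof -
  have "(\<lambda>k. int_on f (S k)) \<longlonglongrightarrow> int_on f (\<Union>k. S k)"
    unfolding int_on_def
  proof (rule integral_dominated_convergence[where w=f])
    show "AE x in lborel. (\<lambda>k. indicator (S k) x * f x) \<longlonglongrightarrow> indicator (\<Union>k. S k) x * f x"
      by (intro AE_I2 tendsto_mult tendsto_const LIMSEQ_indicator_incseq S(2))
  qed (use f f0 S in \<open>auto simp: indicator_def\<close>)
  then have "int_on f (\<Union>k. S k) \<le> b" by (rule LIMSEQ_le_const2) (use b in auto)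
  moreover have "int_on f T \<le> int_on f (\<Union>k. S k)" using S T by (intro int_on_mono) auto
  ultimately show ?thesis by simp
qed

end

lemma int_on_cmult: "int_on (\<lambda>x. c * f x) S = c * int_on f S"
  unfolding int_on_def by (simp add: mult.left_commute)

lemma int_on_mono_fun:
  assumes "integrable lborel f" "integrable lborel g" "S \<in> sets borel" "\<And>x. x \<in> S \<Longrightarrow> f x \<le> g x"
  shows "int_on f S \<le> int_on g S"
  unfolding int_on_def
  by (intro integral_mono) (use assms integrable_mult_indicator[of S lborel f] integrable_mult_indicator[of S lborel g] in \<open>auto simp: indicator_def\<close>)

text \<open>
  The Vitali covering lemma selects disjoint balls \<open>ball x (r x)\<close> whose enlargements by the factor 5
  cover \<open>E\<close>. The covering bounds the left-hand side by the sum of the local integrals of \<open>f\<close>, and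
  disjointness bounds the sum of the local integrals of \<open>g\<close> by the integral over \<open>T\<close>.
\<close>

lemma Vitali_sum_bound:
  fixes f g :: "'a::euclidean_space \<Rightarrow> real"
  assumes f: "integrable lborel f" "\<And>x. f x \<ge> 0" and g: "integrable lborel g" "\<And>x. g x \<ge> 0"
    and E: "E \<in> sets borel" and T: "T \<in> sets borel" and c: "c \<ge> 0"
    and r: "\<And>x. x \<in> E \<Longrightarrow> 0 < r x \<and> r x \<le> B"
    and bd: "\<And>x. x \<in> E \<Longrightarrow> int_on f (ball x (5 * r x)) \<le> c * int_on g (ball x (r x) \<inter> T)"
  shows "int_on f E \<le> c * int_on g T"
proof -
  have sub: "E \<subseteq> (\<Union>i\<in>E. ball i (r i))" using r by force
  obtain C where C: "countable C" "C \<subseteq> E" "pairwise (\<lambda>i j. disjnt (ball i (r i)) (ball j (r j))) C"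
     and cov: "E \<subseteq> (\<Union>i\<in>C. ball i (5 * r i))"
    using Vitali_covering_lemma_balls[where S=E and K=E and a="\<lambda>x. x" and r=r and B=B] sub r by auto
  show ?thesis
  proof (cases "C = {}")
    case True
    then have "E = {}" using cov by auto
    then show ?thesis using c int_on_nonneg[OF g, of T] by (simp add: int_on_def)
  next
    case False
    define e where "e = from_nat_into C"
    have rng: "range e = C" unfolding e_def by (rule range_from_nat_into[OF False C(1)])
    define S where "S k = (\<Union>i\<in>e ` {..k}. ball i (5 * r i))" for k :: nat
    show ?thesis
    proof (rule int_on_incseq_le[OF f, of S])
      show "S k \<in> sets borel" for k unfolding S_def by (intro sets.finite_UN) auto
      show "incseq S" unfolding S_def incseq_def by force
      show "E \<subseteq> (\<Union>k. S k)"
      proof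
        fix x assume "x \<in> E"
        then obtain i where i: "i \<in> C" "x \<in> ball i (5 * r i)" using cov by auto
        then obtain k where "e k = i" using rng by auto
        then show "x \<in> (\<Union>k. S k)" using i unfolding S_def by auto
      qed
      fix k
      let ?F = "e ` {..k}"
      have FC: "?F \<subseteq> C" using rng by auto
      have "int_on f (S k) \<le> (\<Sum>i\<in>?F. int_on f (ball i (5 * r i)))"
        unfolding S_def by (rule int_on_UN_le[OF f]) auto
      also have "\<dots> \<le> (\<Sum>i\<in>?F. c * int_on g (ball i (r i) \<inter> T))"
        using FC C(2) bd by (intro sum_mono) auto
      also have "\<dots> = c * int_on g (\<Union>i\<in>?F. ball i (r i) \<inter> T)"
      proof (subst int_on_UN_disjoint[OF g])
        show "disjoint_family_on (\<lambda>i. ball i (r i) \<inter> T) ?F"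
          using C(3) FC unfolding disjoint_family_on_def pairwise_def disjnt_def by blast
      qed (auto simp: sum_distrib_left T)
      also have "\<dots> \<le> c * int_on g T"
        by (intro mult_left_mono int_on_mono[OF g] c) (auto intro!: sets.finite_UN T)
      finally show "int_on f (S k) \<le> c * int_on g T" .
    qed (rule E)
  qed
qed

text \<open>
  A weak form of Lebesgue's differentiation theorem: the mean over balls is the mollification by
  the normalized indicator of the unit ball, which converges almost everywhere along a sequence of
  radii. One null set serves all levels \<open>l\<close>.
\<close>

lemma small_balls_average:
  fixes f :: "'a::euclidean_space \<Rightarrow> real"
  assumes f: "integrable lborel f" and supp: "\<And>x. norm x > R \<Longrightarrow> f x = 0"
  shows "AE x in lborel. \<forall>l e. l < f x \<longrightarrow> 0 < e \<longrightarrow> (\<exists>r. 0 < r \<and> r < e \<and> l * (measure lborel (ball (0::'a) 1) * r ^ DIM('a)) < int_on f (ball x r))"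
proof -
  have [measurable]: "f \<in> borel_measurable borel" using f by auto
  define w where "w = measure lborel (ball (0::'a) 1)"
  have w: "w > 0" unfolding w_def by simp
  define K where "K z = indicator (ball (0::'a) 1) z / w" for z
  have wint: "integrable lborel (\<lambda>z::'a. indicator (ball (0::'a) 1) z :: real)"
    using emeasure_lborel_ball_finite by (intro integrable_real_indicator) auto
  have K: "mollifier K" unfolding mollifier_def
  proof (intro conjI allI impI)
    show "K \<in> borel_measurable borel" unfolding K_def[abs_def] by measurable
    show "0 \<le> K z" for z using w by (simp add: K_def)
    show "\<exists>B. \<forall>z. K z \<le> B" using w by (intro exI[of _ "1/w"]) (auto simp: K_def indicator_def)
    show "K z = 0" if "1 < norm z" for z using that by (simp add: K_def indicator_def)
    show "integral\<^sup>L lborel K = 1"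
      using w emeasure_lborel_ball_finite[of "0::'a" 1] unfolding K_def[abs_def] by (simp add: w_def)
  qed
  define rs where "rs k = 1 / real (Suc k)" for k
  have rs: "rs k > 0" "rs \<longlonglongrightarrow> 0" for k
    unfolding rs_def[abs_def] using LIMSEQ_inverse_real_of_nat[unfolded inverse_eq_divide] by simp_all
  obtain s where s: "strict_mono s" "AE x in lborel. \<forall>i\<in>{()}. (\<lambda>k. mollify K (rs (s k)) f x) \<longlonglongrightarrow> f x"
    using mollify_AE_subseq[OF K, of "{()}" "\<lambda>_. f" R rs] f supp rs by auto
  have mo: "mollify K r f x = int_on f (ball x r) / (w * r ^ DIM('a))" if r: "r > 0" for r x
  proof -
    have "f y * K ((1/r) *\<^sub>R (x - y)) = (indicator (ball x r) y * f y) / w" for y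
    proof -
      have "norm ((1/r) *\<^sub>R (x - y)) < 1 \<longleftrightarrow> dist x y < r"
        using r unfolding norm_scaleR dist_norm by (simp add: field_simps)
      then show ?thesis by (simp add: K_def indicator_def del: scaleR_right_diff_distrib)
    qed
    then show ?thesis using w r unfolding mollify_eq[OF K \<open>f \<in> borel_measurable borel\<close> r] int_on_def
      by (simp only: integral_divide_zero divide_divide_eq_left mult.commute)
  qed
  show ?thesis using s(2)
  proof eventually_elim
    case (elim x)
    show ?case
    proof (intro allI impI)
      fix l e :: real assume l: "l < f x" and e: "0 < e"
      have "(\<lambda>k. mollify K (rs (s k)) f x) \<longlonglongrightarrow> f x" using elim by simp
      then have e1: "\<forall>\<^sub>F k in sequentially. l < mollify K (rs (s k)) f x" using l by (rule order_tendstoD)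
      have "(\<lambda>k. rs (s k)) \<longlonglongrightarrow> 0" using LIMSEQ_subseq_LIMSEQ[OF rs(2) s(1)] by (simp add: o_def)
      then have e2: "\<forall>\<^sub>F k in sequentially. rs (s k) < e" using e by (rule order_tendstoD)
      obtain k where k: "l < mollify K (rs (s k)) f x" "rs (s k) < e"
        using eventually_happens[OF eventually_conj[OF e1 e2]] by auto
      have "w * rs (s k) ^ DIM('a) > 0" using w rs by simp
      then have "l * (w * rs (s k) ^ DIM('a)) < int_on f (ball x (rs (s k)))"
        using k(1) mo[OF rs(1), of "s k" x] by (simp add: pos_less_divide_eq)
      then show "\<exists>r. 0 < r \<and> r < e \<and> l * (measure lborel (ball (0::'a) 1) * r ^ DIM('a)) < int_on f (ball x r)"
        using k(2) rs(1) unfolding w_def by blast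
    qed
  qed
qed

lemma content_ball_scale:
  fixes x :: "'a::euclidean_space"
  assumes "r \<ge> 0"
  shows "measure lborel (ball x r) = measure lborel (ball (0::'a) 1) * r ^ DIM('a)"
  using content_ball_conv_unit_ball[OF assms, of x] by simp

text \<open>
  The reverse Hoelder inequality is available only on balls inside \<open>ball z R\<close>. The weight in
  \<open>H\<close>, the \<open>N\<close>-th power of the distance to the boundary, compensates for this: for levels \<open>l\<close> above a
  multiple of the integral of \<open>G\<close>, almost every \<open>x\<close> with \<open>H x > l\<close> has a stopping radius \<open>r\<close> such that the
  mean of \<open>H\<close> exceeds \<open>l\<close> on \<open>ball x r\<close>, is at most \<open>l\<close> on \<open>ball x (L * r)\<close>, and the latter ball stays well
  inside \<open>ball z R\<close>. On it the weight is comparable to a constant, so the reverse Hoelder inequality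
  for \<open>G\<close> bounds the integral of \<open>H\<^sup>p\<close> over \<open>ball x (5 * r)\<close> by \<open>l\<^sup>p r\<^sup>N\<close>. As the mean on \<open>ball x r\<close> exceeds \<open>l\<close>,
  at least half of the integral of \<open>H\<close> over this ball comes from points with \<open>H > l/2\<close>, so \<open>l r\<^sup>N\<close> is at
  most a multiple of that part. The Vitali covering lemma adds up these estimates.
\<close>

lemma gehring_level_estimate:
  fixes p C A w :: real and G H :: "'a::euclidean_space \<Rightarrow> real"
  defines "w \<equiv> measure lborel (ball (0::'a) 1)"
  defines "N \<equiv> DIM('a)"
  assumes p: "p > 1" and C: "C > 0" and A: "A \<ge> 1" and R: "R > 0"
    and G: "integrable lborel G" and Gp: "integrable lborel (\<lambda>x. G x powr p)" and G0: "\<And>x. 0 \<le> G x"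
    and supp: "\<And>x. x \<notin> ball z R \<Longrightarrow> G x = 0"
    and RH: "\<And>x \<rho>. \<rho> > 0 \<Longrightarrow> ball x (A * \<rho>) \<subseteq> ball z R \<Longrightarrow>
        int_on (\<lambda>x. G x powr p) (ball x \<rho>) \<le> C * \<rho> ^ N * (int_on G (ball x (A * \<rho>)) / \<rho> ^ N) powr p"
  defines "H \<equiv> (\<lambda>x. (R - dist z x) ^ N * G x)"
  shows "integrable lborel H" "integrable lborel (\<lambda>x. H x powr p)" "\<And>x. H x \<ge> 0"
    "\<And>l. l > 0 \<Longrightarrow> l \<ge> (15 * A) ^ N * integral\<^sup>L lborel G / w \<Longrightarrow>
       int_on (\<lambda>x. H x powr p) {x. l < H x} \<le> 2 * ((3 ^ N) powr p * C * 5 ^ N * (w * A ^ N) powr p) / w * l powr (p - 1) * int_on H {x. l/2 < H x}"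
proof -
  have [measurable]: "G \<in> borel_measurable borel" using G by auto
  have Hm[measurable]: "H \<in> borel_measurable borel" unfolding H_def by measurable
  have w: "w > 0" unfolding w_def by simp
  have w0: "w \<noteq> 0" using w by simp
  show H0: "H x \<ge> 0" for x
    using supp[of x] G0[of x] by (cases "x \<in> ball z R") (auto simp: H_def)
  have HR: "H x \<le> R ^ N * G x" for x
    using supp[of x] G0[of x] by (cases "x \<in> ball z R") (auto simp: H_def intro!: mult_right_mono power_mono)
  show Hi: "integrable lborel H"
    by (rule Bochner_Integration.integrable_bound[where f="\<lambda>x. R ^ N * G x"])
       (use G H0 HR G0 R in \<open>auto simp: abs_mult\<close>)
  show Hpi: "integrable lborel (\<lambda>x. H x powr p)"
  proof (rule Bochner_Integration.integrable_bound[where f="\<lambda>x. (R ^ N) powr p * G x powr p"])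
    have "H x powr p \<le> (R ^ N) powr p * G x powr p" for x
      using powr_mono2[of p "H x" "R ^ N * G x"] HR[of x] H0[of x] p G0[of x] R by (simp add: powr_mult)
    then show "AE x in lborel. norm (H x powr p) \<le> norm ((R ^ N) powr p * G x powr p)" by simp
  qed (use Gp in auto)
  \<comment> \<open>the Vitali covering lemma enlarges by 5, the reverse Hoelder inequality by \<open>A\<close>\<close>
  define L where "L = 5 * A"
  have L: "L \<ge> 5" using A by (simp add: L_def)
  define g where "g = integral\<^sup>L lborel G"
  have gb: "int_on G S \<le> g" if "S \<in> sets borel" for S
    unfolding int_on_def g_def using int_on_integrable[OF G, of S] that G G0
    by (intro integral_mono) (auto simp: indicator_def)
  define C1 where "C1 = (3 ^ N) powr p * C * 5 ^ N * (w * A ^ N) powr p"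
  have C1: "C1 \<ge> 0" using C unfolding C1_def by simp
  fix l :: real assume l: "l > 0" and ll: "l \<ge> (15 * A) ^ N * integral\<^sup>L lborel G / w"
  \<comment> \<open>on a ball of radius at most half the distance to the boundary the weight is comparable to its central value\<close>
  have dcomp: "R - dist z y \<le> 3 * ((R - dist z x)/2)" "R - dist z y \<ge> (R - dist z x)/2"
    if "y \<in> ball x r" "r \<le> (R - dist z x)/2" for x y r
    using that dist_triangle[of z y x] dist_triangle[of z x y] by (auto simp: dist_commute)
  \<comment> \<open>stopping radius: the largest radius of the form \<open>L ^ j * e\<close>, up to half the distance to the boundary, at which the mean of \<open>H\<close> exceeds \<open>l\<close>\<close>
  have stop: "\<exists>r. 0 < r \<and> L * r \<le> (R - dist z x) / 2 \<and> l * (w * r ^ N) < int_on H (ball x r) \<and> int_on H (ball x (L * r)) \<le> l * (w * (L * r) ^ N)"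
    if x: "l < H x" and sm: "\<forall>l e. l < H x \<longrightarrow> 0 < e \<longrightarrow> (\<exists>r. 0 < r \<and> r < e \<and> l * (w * r ^ N) < int_on H (ball x r))" for x
  proof -
    define d where "d = R - dist z x"
    have d: "d > 0"
    proof (rule ccontr)
      assume "\<not> d > 0" then have "H x = 0" using supp[of x] by (auto simp: d_def H_def)
      then show False using x l by simp
    qed
    obtain e where e: "0 < e" "e < d/2" "l * (w * e ^ N) < int_on H (ball x e)"
      using sm x d by (meson half_gt_zero)
    define P where "P j \<longleftrightarrow> L ^ j * e \<le> d/2 \<and> l * (w * (L ^ j * e) ^ N) < int_on H (ball x (L ^ j * e))" for j
    have P0: "P 0" using e by (simp add: P_def)
    obtain n where n: "d/2/e < L ^ n" using real_arch_pow[of L "d/2/e"] L by auto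
    have bnd: "j \<le> n" if "P j" for j
    proof (rule ccontr)
      assume "\<not> j \<le> n"
      then have "L ^ n \<le> L ^ j" using L by (intro power_increasing) auto
      moreover have "L ^ j \<le> d/2/e" using that e by (simp add: P_def field_simps)
      ultimately show False using n by simp
    qed
    define j where "j = (GREATEST j. P j)"
    have Pj: "P j" unfolding j_def by (rule GreatestI_nat[where P=P and b=n, OF P0]) (use bnd in auto)
    have nP: "\<not> P (Suc j)" using Greatest_le_nat[of P "Suc j" n] bnd unfolding j_def by (auto simp: Suc_le_eq)
    define r where "r = L ^ j * e"
    have r: "r > 0" "r \<le> d/2" "l * (w * r ^ N) < int_on H (ball x r)"
      using Pj e L by (auto simp: P_def r_def)
    have Lr: "L ^ Suc j * e = L * r" by (simp add: r_def)
    \<comment> \<open>otherwise the ball is so large that the mean of \<open>H\<close> is controlled by the integral of \<open>G\<close>, hence at most \<open>l\<close>\<close>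
    have "L * r \<le> d/2"
    proof (rule ccontr)
      assume a: "\<not> L * r \<le> d/2"
      have "int_on H (ball x r) \<le> int_on (\<lambda>y. (3 * (d/2)) ^ N * G y) (ball x r)"
      proof (rule int_on_mono_fun)
        fix y assume y: "y \<in> ball x r"
        have "0 \<le> R - dist z y" "R - dist z y \<le> 3 * (d/2)" using dcomp[OF y] r(2) d by (auto simp: d_def)
        then show "H y \<le> (3 * (d/2)) ^ N * G y" unfolding H_def using G0 by (intro mult_right_mono power_mono) auto
      qed (use Hi G in auto)
      also have "\<dots> \<le> (3 * (d/2)) ^ N * g"
        unfolding int_on_cmult using d by (intro mult_left_mono gb) auto
      also have "\<dots> \<le> (3 * (L * r)) ^ N * g"
        using a d gb[of "{}"] by (intro mult_right_mono power_mono) (auto simp: int_on_def)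
      also have "\<dots> = (15 * A) ^ N * g / w * (w * r ^ N)"
      proof -
        have "3 * (L * r) = 15 * A * r" by (simp add: L_def)
        show ?thesis using w unfolding \<open>3 * (L * r) = 15 * A * r\<close> power_mult_distrib[of "15 * A" r] by simp
      qed
      also have "\<dots> \<le> l * (w * r ^ N)"
        using ll w r by (intro mult_right_mono) (auto simp: g_def)
      finally show False using r(3) by simp
    qed
    moreover have "int_on H (ball x (L * r)) \<le> l * (w * (L * r) ^ N)"
      using nP calculation unfolding P_def Lr by auto
    ultimately show ?thesis using r(1,3) unfolding d_def by blast
  qed
  have est: "int_on (\<lambda>x. H x powr p) (ball x (5 * r)) \<le> (2 * C1 / w * l powr (p - 1)) * int_on H (ball x r \<inter> {x. l/2 < H x})"
    if r: "0 < r" "L * r \<le> (R - dist z x) / 2" "l * (w * r ^ N) < int_on H (ball x r)" "int_on H (ball x (L * r)) \<le> l * (w * (L * r) ^ N)" for x r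
  proof -
    define d where "d = (R - dist z x)/2"
    have L5: "5 * r \<le> L * r" using r L by (intro mult_right_mono) auto
    have d: "5 * r \<le> d" using r(2) L5 unfolding d_def by linarith
    then have d: "d > 0" "5 * r \<le> d" using r(1) by auto
    have "int_on G (ball x (A * (5 * r))) \<le> int_on (\<lambda>y. 1 / d ^ N * H y) (ball x (L * r))"
      unfolding L_def mult.assoc mult.left_commute[of A 5 r]
    proof (rule int_on_mono_fun)
      fix y assume "y \<in> ball x (5 * (A * r))"
      then have y: "y \<in> ball x (L * r)" by (simp add: L_def mult_ac)
      have "d ^ N \<le> (R - dist z y) ^ N" using dcomp(2)[OF y r(2)] d by (intro power_mono) (auto simp: d_def)
      then have "d ^ N * G y \<le> H y" unfolding H_def using G0 by (intro mult_right_mono) auto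
      then show "G y \<le> 1 / d ^ N * H y" using d by (simp add: field_simps)
    qed (use Hi G in auto)
    also have "\<dots> = 1 / d ^ N * int_on H (ball x (L * r))" by (rule int_on_cmult)
    also have "\<dots> \<le> 1 / d ^ N * (l * (w * (L * r) ^ N))"
      using r d by (intro mult_left_mono) auto
    finally have GH: "int_on G (ball x (A * (5 * r))) \<le> 1 / d ^ N * (l * (w * (L * r) ^ N))" .
    have "int_on (\<lambda>x. H x powr p) (ball x (5 * r)) \<le> int_on (\<lambda>y. ((3 * d) ^ N) powr p * G y powr p) (ball x (5 * r))"
    proof (rule int_on_mono_fun)
      fix y assume y: "y \<in> ball x (5 * r)"
      have "0 \<le> R - dist z y" "R - dist z y \<le> 3 * d" using dcomp[OF y] d by (auto simp: d_def)
      then have "H y \<le> (3 * d) ^ N * G y" unfolding H_def using G0 by (intro mult_right_mono power_mono) auto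
      then have "H y powr p \<le> ((3 * d) ^ N * G y) powr p" using H0 p by (intro powr_mono2) auto
      then show "H y powr p \<le> ((3 * d) ^ N) powr p * G y powr p" using d G0 by (simp add: powr_mult)
    qed (use Hpi Gp in auto)
    also have "\<dots> = ((3 * d) ^ N) powr p * int_on (\<lambda>y. G y powr p) (ball x (5 * r))" by (rule int_on_cmult)
    also have "\<dots> \<le> ((3 * d) ^ N) powr p * (C * (5 * r) ^ N * (int_on G (ball x (A * (5 * r))) / (5 * r) ^ N) powr p)"
    proof (intro mult_left_mono RH)
      show "ball x (A * (5 * r)) \<subseteq> ball z R"
      proof
        fix y assume "y \<in> ball x (A * (5 * r))"
        then have y: "y \<in> ball x (L * r)" by (simp add: L_def mult_ac)
        show "y \<in> ball z R" using dcomp(2)[OF y r(2)] d by (auto simp: d_def)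
      qed
    qed (use r in auto)
    also have "\<dots> \<le> ((3 * d) ^ N) powr p * (C * (5 * r) ^ N * ((1 / d ^ N * (l * (w * (L * r) ^ N))) / (5 * r) ^ N) powr p)"
      using r C p d GH int_on_nonneg[OF G G0] by (intro mult_left_mono powr_mono2 divide_right_mono) auto
    also have "((3 * d) ^ N) powr p * (C * (5 * r) ^ N * ((1 / d ^ N * (l * (w * (L * r) ^ N))) / (5 * r) ^ N) powr p) = C1 * r ^ N * l powr p"
    proof -
      have "(1 / d ^ N * (l * (w * (L * r) ^ N))) / (5 * r) ^ N = l * (w * A ^ N) / d ^ N"
        using r d by (simp add: L_def power_mult_distrib)
      moreover have "((3 * d) ^ N) powr p = (3 ^ N) powr p * (d ^ N) powr p" using d by (simp add: power_mult_distrib powr_mult)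
      ultimately show ?thesis using d l w A
        by (simp add: C1_def powr_divide powr_mult power_mult_distrib mult_ac)
    qed
    finally have *: "int_on (\<lambda>x. H x powr p) (ball x (5 * r)) \<le> C1 * r ^ N * l powr p" .
    have "int_on H (ball x r) = int_on H (ball x r \<inter> {x. l/2 < H x}) + int_on H (ball x r - {x. l/2 < H x})"
      by (rule int_on_split[OF Hi H0]) auto
    also have "int_on H (ball x r - {x. l/2 < H x}) \<le> l/2 * (w * r ^ N)"
    proof -
      have ib: "integrable lborel (\<lambda>y. indicator (ball x r) y :: real)"
        using emeasure_lborel_ball_finite by (intro integrable_real_indicator) auto
      have "int_on H (ball x r - {x. l/2 < H x}) \<le> (\<integral>y. l/2 * indicator (ball x r) y \<partial>lborel)"
        unfolding int_on_def
        using int_on_integrable[OF Hi H0, of "ball x r - {x. l/2 < H x}"] ib l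
        by (intro integral_mono) (auto simp: indicator_def)
      also have "\<dots> = l/2 * (w * r ^ N)"
        using content_ball_scale[of r x] r by (simp add: w_def N_def)
      finally show ?thesis .
    qed
    finally have "l * (w * r ^ N) / 2 \<le> int_on H (ball x r \<inter> {x. l/2 < H x})" using r(3) by simp
    then have "r ^ N \<le> 2 / (w * l) * int_on H (ball x r \<inter> {x. l/2 < H x})"
      using w l by (simp add: field_simps)
    then have "C1 * r ^ N * l powr p \<le> C1 * (2 / (w * l) * int_on H (ball x r \<inter> {x. l/2 < H x})) * l powr p"
      using C1 by (intro mult_right_mono mult_left_mono) auto
    also have "\<dots> = (2 * C1 / w * l powr (p - 1)) * int_on H (ball x r \<inter> {x. l/2 < H x})"
      using l w by (simp add: powr_diff field_simps)
    finally show ?thesis using * by simp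
  qed
  define Q where "Q x r \<longleftrightarrow> 0 < r \<and> L * r \<le> (R - dist z x) / 2 \<and> l * (w * r ^ N) < int_on H (ball x r) \<and> int_on H (ball x (L * r)) \<le> l * (w * (L * r) ^ N)" for x r
  have Hsupp: "H x = 0" if "norm x > norm z + R" for x
  proof -
    have "x \<notin> ball z R" using that norm_triangle_ineq[of z "x - z"] by (auto simp: dist_norm norm_minus_commute)
    then show ?thesis using supp by (simp add: H_def)
  qed
  have AEs: "AE x in lborel. \<forall>l e. l < H x \<longrightarrow> 0 < e \<longrightarrow> (\<exists>r. 0 < r \<and> r < e \<and> l * (w * r ^ N) < int_on H (ball x r))"
    using small_balls_average[OF Hi Hsupp] by (simp add: w_def N_def)
  have "AE x in lborel. l < H x \<longrightarrow> (\<exists>r. Q x r)"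
    using AEs
  proof (rule eventually_mono, intro impI)
    fix x assume "\<forall>l e. l < H x \<longrightarrow> 0 < e \<longrightarrow> (\<exists>r. 0 < r \<and> r < e \<and> l * (w * r ^ N) < int_on H (ball x r))" "l < H x"
    then show "\<exists>r. Q x r" unfolding Q_def by (intro stop)
  qed
  then obtain Z where Z: "{x \<in> space lborel. \<not> (l < H x \<longrightarrow> (\<exists>r. Q x r))} \<subseteq> Z" "emeasure lborel Z = 0" "Z \<in> sets lborel"
    by (rule AE_E)
  \<comment> \<open>stopping radii exist outside of the Borel null set \<open>Z\<close>\<close>
  define E where "E = {x. l < H x} - Z"
  have E: "E \<in> sets borel" unfolding E_def using Z(3) by (intro sets.Diff) simp_all
  define rad where "rad x = (SOME r. Q x r)" for x
  have Qr: "Q x (rad x)" if "x \<in> E" for x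
  proof -
    have "x \<notin> Z" "l < H x" using that by (simp_all add: E_def)
    then have "\<exists>r. Q x r" using Z(1) by (simp add: subset_iff) blast
    then show ?thesis unfolding rad_def by (rule someI_ex)
  qed
  have eqE: "int_on (\<lambda>x. H x powr p) {x. l < H x} = int_on (\<lambda>x. H x powr p) E"
  proof -
    have "AE x in lborel. x \<notin> Z" using Z(2,3) by (intro AE_not_in) (simp add: null_sets_def)
    then have "AE x in lborel. indicator {x. l < H x} x * H x powr p = indicator E x * H x powr p"
      by (rule eventually_mono) (simp add: E_def indicator_def)
    then show ?thesis unfolding int_on_def using E by (intro integral_cong_AE) auto
  qed
  also have "\<dots> \<le> (2 * C1 / w * l powr (p - 1)) * int_on H {x. l/2 < H x}"
  proof (rule Vitali_sum_bound[OF Hpi _ Hi H0 E, where r=rad and B=R])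
    fix x assume x: "x \<in> E"
    note q = Qr[OF x, unfolded Q_def]
    have "5 * rad x \<le> L * rad x" using q L by (intro mult_right_mono) auto
    also have "L * rad x \<le> (R - dist z x) / 2" using q by simp
    finally have "5 * rad x \<le> (R - dist z x) / 2" .
    then have "5 * rad x + dist z x / 2 \<le> R / 2" by (simp add: diff_divide_distrib)
    moreover have pos: "0 < rad x" using q by simp
    moreover have "0 \<le> dist z x / 2" by simp
    ultimately have "rad x \<le> R" using R by argo
    with pos show "0 < rad x \<and> rad x \<le> R" by simp
    show "int_on (\<lambda>x. H x powr p) (ball x (5 * rad x)) \<le> (2 * C1 / w * l powr (p - 1)) * int_on H (ball x (rad x) \<inter> {x. l/2 < H x})"
      using q by (intro est) auto
  qed (use C1 w in auto)
  finally show "int_on (\<lambda>x. H x powr p) {x. l < H x} \<le> 2 * ((3 ^ N) powr p * C * 5 ^ N * (w * A ^ N) powr p) / w * l powr (p - 1) * int_on H {x. l/2 < H x}"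
    by (simp add: C1_def)
qed

text \<open>
  Hole filling. Let \<open>\<Phi> l\<close> be the integral of \<open>H\<^sup>p\<close> over \<open>{H > l}\<close>, and split \<open>{H > l/2}\<close> at the height
  \<open>T * l\<close>. Above it \<open>H\<close> is at most \<open>(T l)\<^sup>1\<^sup>-\<^sup>p H\<^sup>p\<close>, and \<open>T\<close> is so large that this contributes at most
  \<open>\<Phi> (T * l) / 2\<close>. Below it \<open>H\<close> is at most \<open>(l/2)\<^sup>1\<^sup>-\<^sup>p H\<^sup>p\<close>, which contributes a multiple of
  \<open>\<Phi> (l/2) - \<Phi> (T * l)\<close>. Moving the negative term to the left yields \<open>\<Phi> (T * l) \<le> \<theta> \<Phi> (l/2)\<close> with \<open>\<theta> < 1\<close>.
\<close>

lemma level_estimate_imp_decay: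
  fixes H :: "'a::euclidean_space \<Rightarrow> real"
  assumes H: "integrable lborel H" "\<And>x. H x \<ge> 0" and Hp: "integrable lborel (\<lambda>x. H x powr p)" and p: "p > 1"
    and c: "c > 0" and l0: "l0 > 0"
    and lev: "\<And>l. l \<ge> l0 \<Longrightarrow> int_on (\<lambda>x. H x powr p) {x. l < H x} \<le> c * l powr (p - 1) * int_on H {x. l/2 < H x}"
  defines "T \<equiv> max 1 ((2 * c) powr (1 / (p - 1)))"
  defines "\<theta> \<equiv> c * 2 powr (p - 1) / (c * 2 powr (p - 1) + 1/2)"
  shows "int_on (\<lambda>x. H x powr p) {x. (2 * T) ^ k * l0 < H x} \<le> \<theta> ^ k * int_on (\<lambda>x. H x powr p) {x. l0 < H x}"
proof -
  have [measurable]: "H \<in> borel_measurable borel" using H by auto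
  have lset[measurable]: "{x. l < H x} \<in> sets borel" for l by measurable
  define \<Phi> where "\<Phi> l = int_on (\<lambda>x. H x powr p) {x. l < H x}" for l
  have Hp0: "H x powr p \<ge> 0" for x by simp
  have mono: "\<Phi> l' \<le> \<Phi> l" if "l \<le> l'" for l l'
    unfolding \<Phi>_def using that by (intro int_on_mono[OF Hp Hp0] lset) auto
  define c3 where "c3 = c * 2 powr (p - 1)"
  have c3: "c3 > 0" using c by (simp add: c3_def)
  have T1: "T \<ge> 1" by (simp add: T_def)
  have \<theta>: "\<theta> \<ge> 0" "\<theta> = c3 / (c3 + 1/2)" using c3 by (simp_all add: \<theta>_def c3_def)
  have Tp: "c * T powr (1 - p) \<le> 1/2"
  proof -
    have "2 * c = ((2 * c) powr (1 / (p - 1))) powr (p - 1)" using c p by (simp add: powr_powr)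
    also have "\<dots> \<le> T powr (p - 1)" using p by (intro powr_mono2) (auto simp: T_def)
    finally have "c / T powr (p - 1) \<le> 1/2" using T1 by (simp add: divide_simps)
    moreover have "T powr (1 - p) = 1 / T powr (p - 1)" using powr_minus_divide[of T "p - 1"] by simp
    ultimately show ?thesis by simp
  qed
  have step: "\<Phi> (2 * T * m) \<le> \<theta> * \<Phi> m" if m: "m \<ge> l0" for m
  proof -
    define l where "l = 2 * m"
    have l: "l \<ge> l0" "l > 0" using m l0 by (auto simp: l_def)
    let ?A = "{x. l/2 < H x} \<inter> {x. T * l < H x}" and ?B = "{x. l/2 < H x} - {x. T * l < H x}"
    have Tl: "l/2 \<le> T * l" "0 < T * l" "l \<le> T * l" using T1 l mult_right_mono[OF T1, of l] by auto
    have pw: "H x \<le> a powr (1 - p) * H x powr p" if "a < H x" "a > 0" for x a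
    proof -
      have "H x powr (1 - p) \<le> a powr (1 - p)" using that p by (intro powr_mono2') auto
      then have "H x powr (1 - p) * H x powr p \<le> a powr (1 - p) * H x powr p" by (intro mult_right_mono) auto
      then show ?thesis using that by (simp add: powr_add[symmetric])
    qed
    have "\<Phi> l \<le> c * l powr (p - 1) * int_on H {x. l/2 < H x}" unfolding \<Phi>_def by (rule lev[OF l(1)])
    also have "int_on H {x. l/2 < H x} = int_on H ?A + int_on H ?B" by (rule int_on_split[OF H lset lset])
    also have "int_on H ?A \<le> int_on (\<lambda>x. (T * l) powr (1 - p) * H x powr p) ?A"
      using H Hp pw Tl by (intro int_on_mono_fun) auto
    also have "\<dots> = (T * l) powr (1 - p) * int_on (\<lambda>x. H x powr p) ?A" by (rule int_on_cmult)
    also have "?A = {x. T * l < H x}" using Tl by auto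
    also have "int_on H ?B \<le> int_on (\<lambda>x. (l/2) powr (1 - p) * H x powr p) ?B"
      using H Hp pw l by (intro int_on_mono_fun) auto
    also have "\<dots> = (l/2) powr (1 - p) * int_on (\<lambda>x. H x powr p) ?B" by (rule int_on_cmult)
    also have "int_on (\<lambda>x. H x powr p) ?B = \<Phi> (l/2) - \<Phi> (T * l)"
      using int_on_split[OF Hp Hp0, of "{x. l/2 < H x}" "{x. T * l < H x}"] \<open>?A = {x. T * l < H x}\<close> by (simp add: \<Phi>_def)
    also have "int_on (\<lambda>x. H x powr p) {x. T * l < H x} = \<Phi> (T * l)" by (simp add: \<Phi>_def)
    also have "c * l powr (p - 1) * ((T * l) powr (1 - p) * \<Phi> (T * l) + (l/2) powr (1 - p) * (\<Phi> (l/2) - \<Phi> (T * l)))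
      = c * T powr (1 - p) * \<Phi> (T * l) + c3 * (\<Phi> (l/2) - \<Phi> (T * l))"
    proof -
      have e1: "l powr (p - 1) * (T * l) powr (1 - p) = T powr (1 - p)"
        using l T1 powr_add[of l "p - 1" "1 - p"] by (simp add: powr_mult)
      have e2: "l powr (p - 1) * (l/2) powr (1 - p) = 2 powr (p - 1)"
        using l powr_add[of l "p - 1" "1 - p"] powr_minus_divide[of 2 "p - 1"] by (simp add: powr_divide)
      have "c * l powr (p - 1) * ((T * l) powr (1 - p) * \<Phi> (T * l) + (l/2) powr (1 - p) * (\<Phi> (l/2) - \<Phi> (T * l)))
        = c * (l powr (p - 1) * (T * l) powr (1 - p)) * \<Phi> (T * l) + c * (l powr (p - 1) * (l/2) powr (1 - p)) * (\<Phi> (l/2) - \<Phi> (T * l))"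
        by (simp add: algebra_simps)
      then show ?thesis unfolding e1 e2 by (simp add: c3_def)
    qed
    finally have le: "\<Phi> l \<le> c * T powr (1 - p) * \<Phi> (T * l) + c3 * (\<Phi> (l/2) - \<Phi> (T * l))"
      using c l by (simp add: mult_left_mono add_mono)
    have "\<Phi> (T * l) \<ge> 0" unfolding \<Phi>_def by (rule int_on_nonneg[OF Hp Hp0])
    then have "c * T powr (1 - p) * \<Phi> (T * l) \<le> 1/2 * \<Phi> (T * l)" using Tp by (rule mult_right_mono[rotated])
    then have "\<Phi> (T * l) * (c3 + 1/2) \<le> c3 * \<Phi> (l/2)"
      using le mono[OF Tl(3)] by (simp add: algebra_simps)
    then have "\<Phi> (T * l) \<le> \<theta> * \<Phi> (l/2)" using c3 unfolding \<theta>(2) by (simp add: pos_le_divide_eq)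
    then show ?thesis by (simp add: l_def mult_ac)
  qed
  have "\<Phi> ((2 * T) ^ k * l0) \<le> \<theta> ^ k * \<Phi> l0"
  proof (induction k)
    case (Suc k)
    have "1 \<le> (2 * T) ^ k" using T1 by (intro one_le_power) auto
    then have "l0 \<le> (2 * T) ^ k * l0" using l0 by simp
    then have "\<Phi> (2 * T * ((2 * T) ^ k * l0)) \<le> \<theta> * \<Phi> ((2 * T) ^ k * l0)" by (rule step)
    also have "\<dots> \<le> \<theta> * (\<theta> ^ k * \<Phi> l0)" using \<theta>(1) Suc by (intro mult_left_mono)
    finally show ?case by (simp add: mult_ac)
  qed simp
  then show ?thesis by (simp add: \<Phi>_def)
qed

text \<open>
  The level sets of the weighted function \<open>H\<close> from \<open>gehring_level_estimate\<close> carry geometrically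
  decaying parts of the integral of \<open>H\<^sup>p\<close>, with ratio \<open>\<theta>\<close> per factor \<open>S\<close> in the level. This makes \<open>H\<^sup>s\<close>
  integrable as long as \<open>S\<^sup>s\<^sup>-\<^sup>p \<theta> < 1\<close>, which determines \<open>\<epsilon>\<close>. On the ball of half the radius \<open>H\<close> is bounded below
  by a multiple of \<open>G\<close>.
\<close>

lemma gehring:
  fixes p C A :: real
  assumes p: "p > 1" and C: "C > 0" and A: "A \<ge> 1"
  shows "\<exists>\<epsilon>>0. \<forall>(G::'a::euclidean_space \<Rightarrow> real) z R s.
    0 < R \<longrightarrow> integrable lborel G \<longrightarrow> integrable lborel (\<lambda>x. G x powr p) \<longrightarrow> (\<forall>x. 0 \<le> G x) \<longrightarrow>
    (\<forall>x. x \<notin> ball z R \<longrightarrow> G x = 0) \<longrightarrow>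
    (\<forall>x \<rho>. \<rho> > 0 \<longrightarrow> ball x (A * \<rho>) \<subseteq> ball z R \<longrightarrow>
        int_on (\<lambda>x. G x powr p) (ball x \<rho>) \<le> C * \<rho> ^ DIM('a) * (int_on G (ball x (A * \<rho>)) / \<rho> ^ DIM('a)) powr p) \<longrightarrow>
    p \<le> s \<longrightarrow> s < p + \<epsilon> \<longrightarrow>
    (\<integral>\<^sup>+x. ennreal (G x powr s) * indicator (ball z (R/2)) x \<partial>lborel) < \<infinity>"
proof -
  define N where "N = DIM('a)"
  define w where "w = measure lborel (ball (0::'a) 1)"
  have w: "w > 0" unfolding w_def by simp
  define c where "c = 2 * ((3 ^ N) powr p * C * 5 ^ N * (w * A ^ N) powr p) / w"
  have c: "c > 0" using C w A unfolding c_def by simp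
  define S where "S = 2 * max 1 ((2 * c) powr (1 / (p - 1)))"
  define \<theta> where "\<theta> = c * 2 powr (p - 1) / (c * 2 powr (p - 1) + 1/2)"
  have S: "S > 1" by (simp add: S_def)
  have c2: "c * 2 powr (p - 1) > 0" using c by simp
  have \<theta>: "0 < \<theta>" "\<theta> < 1" using c2 unfolding \<theta>_def by (auto simp: divide_simps)
  \<comment> \<open>the solution of \<open>S powr \<epsilon> * \<theta> = 1\<close>\<close>
  define \<epsilon> where "\<epsilon> = - ln \<theta> / ln S"
  have eps: "\<epsilon> > 0" using \<theta> S unfolding \<epsilon>_def by (simp add: divide_neg_pos)
  show ?thesis
  proof (intro exI[of _ \<epsilon>] conjI allI impI)
    fix G :: "'a \<Rightarrow> real" and z R s
    assume R: "0 < R" and G: "integrable lborel G" and Gp: "integrable lborel (\<lambda>x. G x powr p)" and G0: "\<forall>x. 0 \<le> G x"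
      and supp: "\<forall>x. x \<notin> ball z R \<longrightarrow> G x = 0"
      and RH: "\<forall>x \<rho>. \<rho> > 0 \<longrightarrow> ball x (A * \<rho>) \<subseteq> ball z R \<longrightarrow>
        int_on (\<lambda>x. G x powr p) (ball x \<rho>) \<le> C * \<rho> ^ DIM('a) * (int_on G (ball x (A * \<rho>)) / \<rho> ^ DIM('a)) powr p"
      and s: "p \<le> s" "s < p + \<epsilon>"
    have [measurable]: "G \<in> borel_measurable borel" using G by auto
    define H where "H = (\<lambda>x. (R - dist z x) ^ N * G x)"
    note lev = gehring_level_estimate[where G=G and z=z and R=R and p=p and C=C and A=A,
        OF p C A R G Gp G0[rule_format] supp[rule_format] RH[rule_format], folded N_def w_def, folded c_def]
    define l0 where "l0 = max 1 ((15 * A) ^ N * integral\<^sup>L lborel G / w)"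
    have l0: "l0 > 0" by (simp add: l0_def)
    have H: "integrable lborel H" "\<And>x. H x \<ge> 0" "integrable lborel (\<lambda>x. H x powr p)" using lev(1-3) by (simp_all add: H_def)
    have [measurable]: "H \<in> borel_measurable borel" using H by auto
    have lev2: "int_on (\<lambda>x. H x powr p) {x. l < H x} \<le> c * l powr (p - 1) * int_on H {x. l/2 < H x}" if "l \<ge> l0" for l
      using lev(4)[of l] that by (simp add: l0_def H_def)
    note dec = level_estimate_imp_decay[OF H p c l0 lev2, folded S_def \<theta>_def]
    have nn: "(\<integral>\<^sup>+x. ennreal (H x powr p) * indicator {x. l < H x} x \<partial>lborel) = ennreal (int_on (\<lambda>x. H x powr p) {x. l < H x})" for l
    proof -
      have "(\<integral>\<^sup>+x. ennreal (H x powr p) * indicator {x. l < H x} x \<partial>lborel) = (\<integral>\<^sup>+x. ennreal (indicator {x. l < H x} x * H x powr p) \<partial>lborel)"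
        by (intro nn_integral_cong) (auto simp: indicator_def)
      also have "\<dots> = ennreal (int_on (\<lambda>x. H x powr p) {x. l < H x})"
        unfolding int_on_def using int_on_integrable[OF H(3), of "{x. l < H x}"]
        by (intro nn_integral_eq_integral) auto
      finally show ?thesis .
    qed
    have "(\<integral>\<^sup>+x. ennreal (H x powr s) \<partial>lborel) < \<infinity>"
    proof (rule geometric_decay_imp_higher_integrability[where S=S and \<theta>=\<theta> and p=p and b=l0 and F="int_on (\<lambda>x. H x powr p) {x. l0 < H x}"])
      show "S powr (s - p) * \<theta> < 1"
      proof -
        have "(s - p) * ln S < - ln \<theta>" using s S unfolding \<epsilon>_def by (simp add: pos_less_divide_eq[symmetric])
        then have "S powr (s - p) < exp (- ln \<theta>)" using S by (simp add: powr_def)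
        then show ?thesis using \<theta> by (simp add: exp_minus field_simps)
      qed
      show "(\<integral>\<^sup>+x. ennreal (H x powr p) \<partial>lborel) < \<infinity>" using H(3) by (simp add: integrable_iff_bounded)
      show "(\<integral>\<^sup>+x. ennreal (H x powr p) * indicator {x. S ^ k * l0 < H x} x \<partial>lborel) \<le> ennreal (\<theta> ^ k * int_on (\<lambda>x. H x powr p) {x. l0 < H x})" for k
        unfolding nn by (intro ennreal_leI dec)
      show "0 \<le> int_on (\<lambda>x. H x powr p) {x. l0 < H x}" by (rule int_on_nonneg[OF H(3)]) auto
    qed (use H S l0 \<theta> s in auto)
    define b where "b = ((2/R) ^ N) powr s"
    have "(\<integral>\<^sup>+x. ennreal (G x powr s) * indicator (ball z (R/2)) x \<partial>lborel) \<le> (\<integral>\<^sup>+x. ennreal b * ennreal (H x powr s) \<partial>lborel)"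
    proof (rule nn_integral_mono)
      fix x
      show "ennreal (G x powr s) * indicator (ball z (R/2)) x \<le> ennreal b * ennreal (H x powr s)"
      proof (cases "x \<in> ball z (R/2)")
        case True
        have "(R/2) ^ N * G x \<le> H x" unfolding H_def using True R G0 by (intro mult_right_mono power_mono) auto
        then have "G x \<le> (2/R) ^ N * H x" using R by (simp add: field_simps)
        then have "G x powr s \<le> ((2/R) ^ N * H x) powr s" using G0 s p by (intro powr_mono2) auto
        also have "\<dots> = b * H x powr s" using R H(2) by (simp add: b_def powr_mult)
        finally show ?thesis using True by (simp add: ennreal_mult[symmetric] b_def ennreal_leI)
      qed simp
    qed
    also have "\<dots> = ennreal b * (\<integral>\<^sup>+x. ennreal (H x powr s) \<partial>lborel)" by (rule nn_integral_cmult) measurable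
    also have "\<dots> < \<infinity>" using \<open>(\<integral>\<^sup>+x. ennreal (H x powr s) \<partial>lborel) < \<infinity>\<close> by (simp add: ennreal_mult_less_top)
    finally show "(\<integral>\<^sup>+x. ennreal (G x powr s) * indicator (ball z (R/2)) x \<partial>lborel) < \<infinity>" .
  qed (rule eps)
qed

section \<open>Covectors and Hadamard's inequality\<close>

lemma mem_Em: "x \<in> topspace (Euclidean_space m) \<longleftrightarrow> (\<forall>i\<ge>m. x i = 0)"
  by (simp add: topspace_Euclidean_space)

definition unit_Rm :: "nat \<Rightarrow> nat \<Rightarrow> real" where
  "unit_Rm l = (\<lambda>i. if i = l then 1 else 0)"

lemma scalar_prod_Rm_self: "scalar_prod_Rm m v v = (L2_set v {..<m})\<^sup>2"
  by (simp add: scalar_prod_Rm_def L2_set_def power2_eq_square[symmetric] sum_nonneg)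

lemma scalar_prod_Rm_le: "\<bar>scalar_prod_Rm m v w\<bar> \<le> L2_set v {..<m} * L2_set w {..<m}"
proof -
  have "\<bar>scalar_prod_Rm m v w\<bar> \<le> (\<Sum>i<m. \<bar>v i\<bar> * \<bar>w i\<bar>)"
    unfolding scalar_prod_Rm_def by (rule order_trans[OF sum_abs]) (simp add: abs_mult)
  also have "\<dots> \<le> L2_set v {..<m} * L2_set w {..<m}" by (rule L2_set_mult_ineq)
  finally show ?thesis .
qed

context
  fixes m :: nat and \<omega> :: "('n::finite \<Rightarrow> nat \<Rightarrow> real) \<Rightarrow> real"
  assumes cov: "covector m \<omega>"
begin

lemma covector_linear:
  assumes "range v \<subseteq> topspace (Euclidean_space m)" "x \<in> topspace (Euclidean_space m)" "y \<in> topspace (Euclidean_space m)"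
  shows "\<omega> (v(j := (\<lambda>i. a * x i + b * y i))) = a * \<omega> (v(j := x)) + b * \<omega> (v(j := y))"
  using cov assms unfolding covector_def by blast

lemma covector_alternating:
  assumes "range v \<subseteq> topspace (Euclidean_space m)" "j \<noteq> k" "v j = v k"
  shows "\<omega> v = 0"
  using cov assms unfolding covector_def by blast

lemma covector_scale:
  assumes "range v \<subseteq> topspace (Euclidean_space m)" "x \<in> topspace (Euclidean_space m)"
  shows "\<omega> (v(j := (\<lambda>i. a * x i))) = a * \<omega> (v(j := x))"
  using covector_linear[OF assms(1,2,2), of j a 0] by simp

lemma covector_sum:
  assumes v: "range v \<subseteq> topspace (Euclidean_space m)" and L: "finite L" and y: "\<And>l. l \<in> L \<Longrightarrow> y l \<in> topspace (Euclidean_space m)"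
  shows "\<omega> (v(j := (\<lambda>i. \<Sum>l\<in>L. a l * y l i))) = (\<Sum>l\<in>L. a l * \<omega> (v(j := y l)))"
  using L y
proof (induction L rule: finite_induct)
  case empty
  have "(\<lambda>i. 0) \<in> topspace (Euclidean_space m)" by (simp add: mem_Em)
  from covector_scale[OF v this, of j 0] show ?case by (simp only: sum.empty mult_zero_left)
next
  case (insert l0 L)
  have sE: "(\<lambda>i. \<Sum>l\<in>L. a l * y l i) \<in> topspace (Euclidean_space m)" using insert.prems by (simp add: mem_Em)
  have e: "(\<lambda>i. \<Sum>l\<in>insert l0 L. a l * y l i) = (\<lambda>i. a l0 * y l0 i + 1 * (\<Sum>l\<in>L. a l * y l i))"
    using insert.hyps by auto
  have IH: "\<omega> (v(j := (\<lambda>i. \<Sum>l\<in>L. a l * y l i))) = (\<Sum>l\<in>L. a l * \<omega> (v(j := y l)))"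
    using insert.prems by (intro insert.IH) auto
  have y0: "y l0 \<in> topspace (Euclidean_space m)" using insert.prems by auto
  have "\<omega> (v(j := (\<lambda>i. a l0 * y l0 i + 1 * (\<Sum>l\<in>L. a l * y l i)))) =
      a l0 * \<omega> (v(j := y l0)) + 1 * (\<Sum>l\<in>L. a l * \<omega> (v(j := y l)))"
    unfolding IH[symmetric] by (rule covector_linear[OF v y0 sE])
  then show ?case unfolding e sum.insert[OF insert.hyps] mult_1 .
qed

text \<open>
  The slots in \<open>S\<close> are expanded in the standard basis one after the other.
\<close>

lemma covector_expand_on:
  assumes v: "range v \<subseteq> topspace (Euclidean_space m)" and S: "finite S"
  shows "\<omega> v = (\<Sum>\<sigma>\<in>PiE S (\<lambda>_. {..<m}). (\<Prod>k\<in>S. v k (\<sigma> k)) * \<omega> (\<lambda>k. if k \<in> S then unit_Rm (\<sigma> k) else v k))"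
  using S
proof (induction S rule: finite_induct)
  case empty then show ?case by simp
next
  case (insert j S)
  have vj: "v j = (\<lambda>i. \<Sum>l<m. v j l * unit_Rm l i)"
  proof
    fix i
    have "(\<Sum>l<m. v j l * unit_Rm l i) = (\<Sum>l<m. if l = i then v j i else 0)" by (intro sum.cong) (auto simp: unit_Rm_def)
    also have "\<dots> = v j i" using v by (auto simp: mem_Em image_subset_iff)
    finally show "v j i = (\<Sum>l<m. v j l * unit_Rm l i)" ..
  qed
  have step: "\<omega> (\<lambda>k. if k \<in> S then unit_Rm (\<sigma> k) else v k) =
     (\<Sum>l<m. v j l * \<omega> (\<lambda>k. if k \<in> insert j S then unit_Rm ((\<sigma>(j := l)) k) else v k))"
    if \<sigma>: "\<sigma> \<in> PiE S (\<lambda>_. {..<m})" for \<sigma>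
  proof -
    let ?u = "\<lambda>k. if k \<in> S then unit_Rm (\<sigma> k) else v k"
    have u: "range ?u \<subseteq> topspace (Euclidean_space m)"
      using v \<sigma> by (auto simp: mem_Em image_subset_iff unit_Rm_def PiE_iff)
    have "\<omega> ?u = \<omega> (?u(j := (\<lambda>i. \<Sum>l<m. v j l * unit_Rm l i)))"
      unfolding vj[symmetric] using insert.hyps by (intro arg_cong[where f=\<omega>]) auto
    also have "\<dots> = (\<Sum>l<m. v j l * \<omega> (?u(j := unit_Rm l)))"
      by (rule covector_sum[OF u]) (auto simp: mem_Em unit_Rm_def)
    also have "\<dots> = (\<Sum>l<m. v j l * \<omega> (\<lambda>k. if k \<in> insert j S then unit_Rm ((\<sigma>(j := l)) k) else v k))"
      using insert.hyps by (intro sum.cong refl arg_cong2[where f="(*)"] arg_cong[where f=\<omega>]) (auto simp: fun_eq_iff)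
    finally show ?thesis .
  qed
  have inj: "inj_on (\<lambda>(y, g). g(j := y)) ({..<m} \<times> PiE S (\<lambda>_. {..<m}))"
    using insert.hyps by (intro inj_combinator) auto
  have "\<omega> v = (\<Sum>\<sigma>\<in>PiE S (\<lambda>_. {..<m}). \<Sum>l<m. (\<Prod>k\<in>insert j S. v k ((\<sigma>(j := l)) k)) * \<omega> (\<lambda>k. if k \<in> insert j S then unit_Rm ((\<sigma>(j := l)) k) else v k))"
  proof (subst insert.IH, intro sum.cong refl)
    fix \<sigma> assume \<sigma>: "\<sigma> \<in> PiE S (\<lambda>_. {..<m})"
    have pr: "(\<Prod>k\<in>insert j S. v k ((\<sigma>(j := l)) k)) = (\<Prod>k\<in>S. v k (\<sigma> k)) * v j l" for l
    proof -
      have "(\<Prod>k\<in>S. v k ((\<sigma>(j := l)) k)) = (\<Prod>k\<in>S. v k (\<sigma> k))"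
        using insert.hyps by (intro prod.cong) auto
      then show ?thesis using insert.hyps by simp
    qed
    show "(\<Prod>k\<in>S. v k (\<sigma> k)) * \<omega> (\<lambda>k. if k \<in> S then unit_Rm (\<sigma> k) else v k) =
       (\<Sum>l<m. (\<Prod>k\<in>insert j S. v k ((\<sigma>(j := l)) k)) * \<omega> (\<lambda>k. if k \<in> insert j S then unit_Rm ((\<sigma>(j := l)) k) else v k))"
      unfolding pr step[OF \<sigma>] sum_distrib_left by (simp add: mult_ac)
  qed
  also have "\<dots> = (\<Sum>l<m. \<Sum>\<sigma>\<in>PiE S (\<lambda>_. {..<m}). (\<Prod>k\<in>insert j S. v k ((\<sigma>(j := l)) k)) * \<omega> (\<lambda>k. if k \<in> insert j S then unit_Rm ((\<sigma>(j := l)) k) else v k))"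
    by (rule sum.swap)
  also have "\<dots> = (\<Sum>\<sigma>\<in>PiE (insert j S) (\<lambda>_. {..<m}). (\<Prod>k\<in>insert j S. v k (\<sigma> k)) * \<omega> (\<lambda>k. if k \<in> insert j S then unit_Rm (\<sigma> k) else v k))"
    unfolding PiE_insert_eq sum.reindex[OF inj] sum.cartesian_product
    by (rule sum.cong[OF refl]) (simp only: comp_apply case_prod_beta)
  finally show ?case .
qed

text \<open>
  A covector is a polynomial in the entries of its arguments. Its derivatives, limits and
  measurability are read off from this formula.
\<close>

lemma covector_expand:
  assumes "range v \<subseteq> topspace (Euclidean_space m)"
  shows "\<omega> v = (\<Sum>\<sigma>\<in>PiE UNIV (\<lambda>_. {..<m}). (\<Prod>k\<in>UNIV. v k (\<sigma> k)) * \<omega> (\<lambda>k. unit_Rm (\<sigma> k)))"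
  using covector_expand_on[OF assms finite_class.finite_UNIV] by simp

text \<open>
  Polarization: expand \<open>\<omega>\<close> with \<open>x + y\<close> in both slots, where it vanishes.
\<close>

lemma covector_antisym:
  assumes v: "range v \<subseteq> topspace (Euclidean_space m)" and x: "x \<in> topspace (Euclidean_space m)" and y: "y \<in> topspace (Euclidean_space m)"
    and jk: "j \<noteq> k"
  shows "\<omega> (v(j := x, k := y)) = - \<omega> (v(j := y, k := x))"
proof -
  have r: "range (v(j := a)) \<subseteq> topspace (Euclidean_space m)" if "a \<in> topspace (Euclidean_space m)" for a j
    using v that by auto
  define s where "s = (\<lambda>i. 1 * x i + 1 * y i)"
  have s: "s \<in> topspace (Euclidean_space m)" using x y by (auto simp: mem_Em s_def)
  have lk: "\<omega> (v(j := a, k := s)) = \<omega> (v(j := a, k := x)) + \<omega> (v(j := a, k := y))" if "a \<in> topspace (Euclidean_space m)" for a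
    using covector_linear[OF r[OF that] x y, of j k 1 1] by (simp add: s_def)
  have lj: "\<omega> (v(j := s, k := a)) = \<omega> (v(j := x, k := a)) + \<omega> (v(j := y, k := a))" if "a \<in> topspace (Euclidean_space m)" for a
    using covector_linear[OF r[OF that, of k] x y, of j 1 1] jk by (simp add: s_def fun_upd_twist)
  have z: "\<omega> (v(j := a, k := a)) = 0" if "a \<in> topspace (Euclidean_space m)" for a
    using v that jk by (intro covector_alternating[of _ j k]) auto
  have "0 = \<omega> (v(j := s, k := s))" using z s by simp
  also have "\<dots> = \<omega> (v(j := x, k := y)) + \<omega> (v(j := y, k := x))"
    unfolding lj[OF s] lk[OF x] lk[OF y] z[OF x] z[OF y] by simp
  finally show ?thesis by simp
qed

lemma covector_has_derivative:
  assumes w: "\<And>t. range (w t) \<subseteq> topspace (Euclidean_space m)" and w': "range w' \<subseteq> topspace (Euclidean_space m)"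
    and d: "\<And>k i. i < m \<Longrightarrow> ((\<lambda>t. w t k i) has_real_derivative w' k i) (at t0)"
  shows "((\<lambda>t. \<omega> (w t)) has_real_derivative (\<Sum>k\<in>UNIV. \<omega> ((w t0)(k := w' k)))) (at t0)"
proof -
  have "((\<lambda>t. (\<Sum>\<sigma>\<in>PiE UNIV (\<lambda>_. {..<m}). (\<Prod>k\<in>UNIV. w t k (\<sigma> k)) * \<omega> (\<lambda>k. unit_Rm (\<sigma> k)))) has_real_derivative
     (\<Sum>\<sigma>\<in>PiE UNIV (\<lambda>_. {..<m}). (\<Sum>k\<in>UNIV. w' k (\<sigma> k) * (\<Prod>l\<in>UNIV - {k}. w t0 l (\<sigma> l))) * \<omega> (\<lambda>k. unit_Rm (\<sigma> k)))) (at t0)"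
    by (intro DERIV_sum DERIV_cmult_right has_field_derivative_prod d) (auto simp: PiE_iff)
  moreover have "(\<Sum>\<sigma>\<in>PiE UNIV (\<lambda>_. {..<m}). (\<Sum>k\<in>UNIV. w' k (\<sigma> k) * (\<Prod>l\<in>UNIV - {k}. w t0 l (\<sigma> l))) * \<omega> (\<lambda>k. unit_Rm (\<sigma> k)))
    = (\<Sum>k\<in>UNIV. \<omega> ((w t0)(k := w' k)))"
  proof -
    have "\<omega> ((w t0)(k := w' k)) = (\<Sum>\<sigma>\<in>PiE UNIV (\<lambda>_. {..<m}). (w' k (\<sigma> k) * (\<Prod>l\<in>UNIV - {k}. w t0 l (\<sigma> l))) * \<omega> (\<lambda>k. unit_Rm (\<sigma> k)))" for k
    proof (subst covector_expand)
      show "range ((w t0)(k := w' k)) \<subseteq> topspace (Euclidean_space m)" using w[of t0] w' by auto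
      have "(\<Prod>l\<in>UNIV. ((w t0)(k := w' k)) l (\<sigma> l)) = w' k (\<sigma> k) * (\<Prod>l\<in>UNIV - {k}. w t0 l (\<sigma> l))" for \<sigma>
        by (subst prod.remove[of UNIV k]) (auto intro!: prod.cong)
      then show "(\<Sum>\<sigma>\<in>PiE UNIV (\<lambda>_. {..<m}). (\<Prod>l\<in>UNIV. ((w t0)(k := w' k)) l (\<sigma> l)) * \<omega> (\<lambda>k. unit_Rm (\<sigma> k))) =
        (\<Sum>\<sigma>\<in>PiE UNIV (\<lambda>_. {..<m}). (w' k (\<sigma> k) * (\<Prod>l\<in>UNIV - {k}. w t0 l (\<sigma> l))) * \<omega> (\<lambda>k. unit_Rm (\<sigma> k)))" by simp
    qed
    then show ?thesis by (simp add: sum_distrib_right) (rule sum.swap)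
  qed
  moreover have "(\<lambda>t. \<omega> (w t)) = (\<lambda>t. (\<Sum>\<sigma>\<in>PiE UNIV (\<lambda>_. {..<m}). (\<Prod>k\<in>UNIV. w t k (\<sigma> k)) * \<omega> (\<lambda>k. unit_Rm (\<sigma> k))))"
    using covector_expand[OF w] by auto
  ultimately show ?thesis by simp
qed

lemma covector_tendsto:
  assumes w: "\<And>t. range (w t) \<subseteq> topspace (Euclidean_space m)" and w': "range w' \<subseteq> topspace (Euclidean_space m)"
    and d: "\<And>k i. i < m \<Longrightarrow> ((\<lambda>t. w t k i) \<longlongrightarrow> w' k i) F"
  shows "((\<lambda>t. \<omega> (w t)) \<longlongrightarrow> \<omega> w') F"
  unfolding covector_expand[OF w] covector_expand[OF w']
  by (intro tendsto_sum tendsto_mult tendsto_const tendsto_prod d) (auto simp: PiE_iff)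

lemma covector_measurable:
  assumes w: "\<And>t. range (w t) \<subseteq> topspace (Euclidean_space m)"
    and d: "\<And>k i. i < m \<Longrightarrow> (\<lambda>t. w t k i) \<in> borel_measurable M"
  shows "(\<lambda>t. \<omega> (w t)) \<in> borel_measurable M"
  unfolding covector_expand[OF w]
  by (intro borel_measurable_sum borel_measurable_times borel_measurable_prod borel_measurable_const d) (auto simp: PiE_iff)

lemma orthonormal_bounded: "bdd_above (\<omega> ` orthonormal_families m)"
proof (rule bdd_aboveI2)
  fix v assume v: "v \<in> (orthonormal_families m :: ('n \<Rightarrow> nat \<Rightarrow> real) set)"
  then have r: "range v \<subseteq> topspace (Euclidean_space m)" by (auto simp: orthonormal_families_def)
  have c: "\<bar>v k i\<bar> \<le> 1" if "i < m" for k i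
  proof -
    have "(L2_set (v k) {..<m})\<^sup>2 = 1" using v by (simp add: orthonormal_families_def scalar_prod_Rm_self[symmetric])
    then have "L2_set (v k) {..<m} = 1" using power2_eq_imp_eq[of "L2_set (v k) {..<m}" 1] by simp
    moreover have "\<bar>v k i\<bar> \<le> L2_set (\<lambda>i. \<bar>v k i\<bar>) {..<m}" using that by (intro member_le_L2_set) auto
    ultimately show ?thesis by (simp add: L2_set_def)
  qed
  have "\<omega> v \<le> (\<Sum>\<sigma>\<in>PiE UNIV (\<lambda>_. {..<m}). \<bar>(\<Prod>k\<in>UNIV. v k (\<sigma> k)) * \<omega> (\<lambda>k. unit_Rm (\<sigma> k))\<bar>)"
    by (subst covector_expand[OF r]) (rule order_trans[OF abs_ge_self sum_abs])
  also have "\<dots> \<le> (\<Sum>\<sigma>\<in>PiE UNIV (\<lambda>_. {..<m}). \<bar>\<omega> (\<lambda>k. unit_Rm (\<sigma> k))\<bar>)"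
  proof (rule sum_mono)
    fix \<sigma> :: "'n \<Rightarrow> nat" assume \<sigma>: "\<sigma> \<in> PiE UNIV (\<lambda>_. {..<m})"
    have "\<bar>\<Prod>k\<in>UNIV. v k (\<sigma> k)\<bar> \<le> 1" unfolding abs_prod using c \<sigma> by (intro prod_le_1) (auto simp: PiE_iff)
    then show "\<bar>(\<Prod>k\<in>UNIV. v k (\<sigma> k)) * \<omega> (\<lambda>k. unit_Rm (\<sigma> k))\<bar> \<le> \<bar>\<omega> (\<lambda>k. unit_Rm (\<sigma> k))\<bar>"
      by (simp add: abs_mult mult_left_le_one_le)
  qed
  finally show "\<omega> v \<le> (\<Sum>\<sigma>\<in>PiE UNIV (\<lambda>_. {..<m}). \<bar>\<omega> (\<lambda>k. unit_Rm (\<sigma> k))\<bar>)" .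
qed

text \<open>
  The comass bounds \<open>\<omega>\<close> from above; changing the sign of one vector of the family bounds it from below.
\<close>

lemma covector_orthonormal_le:
  assumes "comass m \<omega> \<le> 1" and v: "v \<in> orthonormal_families m"
  shows "\<bar>\<omega> v\<bar> \<le> 1"
proof -
  have le: "\<omega> v \<le> 1" if "v \<in> orthonormal_families m" for v
    using cSUP_upper[OF that orthonormal_bounded] assms(1) by (simp add: comass_def)
  obtain j :: 'n where True by simp
  have r: "range v \<subseteq> topspace (Euclidean_space m)" using v by (auto simp: orthonormal_families_def)
  define v' where "v' = v(j := (\<lambda>i. -1 * v j i))"
  have "v' \<in> orthonormal_families m"
    using v by (auto simp: v'_def orthonormal_families_def mem_Em image_subset_iff scalar_prod_Rm_def sum_negf)
  then have "\<omega> v' \<le> 1" by (rule le)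
  moreover have "\<omega> v' = - \<omega> v" using covector_scale[OF r, of "v j" j "-1"] r by (auto simp: v'_def)
  ultimately show ?thesis using le[OF v] by simp
qed

text \<open>
  Gram-Schmidt with the orthonormal part of the family growing from \<open>S\<close> to \<open>UNIV\<close>: subtracting from
  \<open>v j\<close> its projection to the span of the vectors in \<open>S\<close> does not change \<open>\<omega>\<close> and does not increase the
  norm of \<open>v j\<close>; normalizing the difference adds \<open>j\<close> to the orthonormal part. For \<open>S = UNIV\<close> the bound is
  the one by the comass.
\<close>

lemma covector_Hadamard_aux:
  assumes com: "comass m \<omega> \<le> 1"
  shows "range v \<subseteq> topspace (Euclidean_space m) \<Longrightarrow>
    (\<And>j k. j \<in> S \<Longrightarrow> k \<in> S \<Longrightarrow> scalar_prod_Rm m (v j) (v k) = (if j = k then 1 else 0)) \<Longrightarrow>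
    \<bar>\<omega> v\<bar> \<le> (\<Prod>j\<in>- S. L2_set (v j) {..<m})"
proof (induction "card (- S)" arbitrary: S v)
  case 0
  then have "S = UNIV" by auto
  then have "v \<in> orthonormal_families m" using 0 by (auto simp: orthonormal_families_def)
  then show ?case using covector_orthonormal_le[OF com] \<open>S = UNIV\<close> by simp
next
  case (Suc d)
  obtain j where j: "j \<notin> S" using Suc.hyps(2) by (metis Compl_UNIV_eq UNIV_eq_I card.empty nat.distinct(1))
  note r = Suc.prems(1)
  have vE: "v k \<in> topspace (Euclidean_space m)" for k using r by auto
  define c where "c k = scalar_prod_Rm m (v j) (v k)" for k
  define w where "w = (\<lambda>i. v j i - (\<Sum>k\<in>S. c k * v k i))"
  have wE: "w \<in> topspace (Euclidean_space m)" using vE by (auto simp: mem_Em w_def)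
  have wl: "scalar_prod_Rm m w (v l) = 0" if l: "l \<in> S" for l
  proof -
    have "scalar_prod_Rm m w (v l) = scalar_prod_Rm m (v j) (v l) - (\<Sum>k\<in>S. c k * scalar_prod_Rm m (v k) (v l))"
      unfolding scalar_prod_Rm_def w_def
      by (simp add: left_diff_distrib sum_subtractf sum_distrib_left sum_distrib_right mult.assoc sum.swap[of _ S])
    also have "(\<Sum>k\<in>S. c k * scalar_prod_Rm m (v k) (v l)) = (\<Sum>k\<in>S. if k = l then c l else 0)"
      using Suc.prems(2) l by (intro sum.cong) auto
    also have "\<dots> = c l" using l by simp
    finally show ?thesis by (simp add: c_def)
  qed
  have ww: "scalar_prod_Rm m w w = scalar_prod_Rm m w (v j)"
  proof -
    have "scalar_prod_Rm m w w = scalar_prod_Rm m w (v j) - (\<Sum>k\<in>S. c k * scalar_prod_Rm m w (v k))"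
      unfolding scalar_prod_Rm_def
      by (subst (2) w_def) (simp add: right_diff_distrib sum_subtractf sum_distrib_left mult.left_commute sum.swap[of _ S])
    then show ?thesis using wl by simp
  qed
  have wle: "L2_set w {..<m} \<le> L2_set (v j) {..<m}"
  proof (cases "L2_set w {..<m} = 0")
    case False
    then have pos: "L2_set w {..<m} > 0" using L2_set_nonneg[of w "{..<m}"] by linarith
    have "(L2_set w {..<m})\<^sup>2 \<le> L2_set w {..<m} * L2_set (v j) {..<m}"
      using scalar_prod_Rm_le[of m w "v j"] ww unfolding scalar_prod_Rm_self by simp
    then show ?thesis using pos by (simp add: power2_eq_square)
  qed simp
  have ow: "\<omega> (v(j := w)) = \<omega> v"
  proof -
    have sE: "(\<lambda>i. \<Sum>k\<in>S. c k * v k i) \<in> topspace (Euclidean_space m)" using vE by (auto simp: mem_Em)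
    have "\<omega> (v(j := w)) = \<omega> (v(j := (\<lambda>i. 1 * v j i + (-1) * (\<Sum>k\<in>S. c k * v k i))))" by (simp add: w_def)
    also have "\<dots> = \<omega> v - \<omega> (v(j := (\<lambda>i. \<Sum>k\<in>S. c k * v k i)))"
      by (subst covector_linear[OF r vE sE]) simp
    also have "\<omega> (v(j := (\<lambda>i. \<Sum>k\<in>S. c k * v k i))) = (\<Sum>k\<in>S. c k * \<omega> (v(j := v k)))"
      by (rule covector_sum[OF r]) (use vE in auto)
    also have "\<dots> = 0"
    proof (intro sum.neutral ballI)
      fix k assume "k \<in> S"
      then have "k \<noteq> j" using j by auto
      then have "\<omega> (v(j := v k)) = 0" using r by (intro covector_alternating[of _ j k]) auto
      then show "c k * \<omega> (v(j := v k)) = 0" by simp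
    qed
    finally show ?thesis by (simp only: diff_0_right)
  qed
  have cmp: "- S = insert j (- insert j S)" using j by auto
  have prod_eq: "(\<Prod>k\<in>- S. L2_set (v k) {..<m}) = L2_set (v j) {..<m} * (\<Prod>k\<in>- insert j S. L2_set (v k) {..<m})"
    by (subst cmp) simp
  have pn: "(\<Prod>k\<in>- insert j S. L2_set (v k) {..<m}) \<ge> 0" by (intro prod_nonneg) auto
  show ?case
  proof (cases "L2_set w {..<m} = 0")
    case True
    then have "w i = 0" for i using wE by (cases "i < m") (auto simp: L2_set_eq_0_iff mem_Em)
    then have "w = (\<lambda>i. 0 * v j i)" by auto
    then have "\<omega> v = 0" using ow covector_scale[OF r vE, of j 0 j] by simp
    then show ?thesis by (simp add: prod_nonneg)
  next
    case False
    define \<nu> where "\<nu> = L2_set w {..<m}"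
    have \<nu>: "\<nu> > 0" using False L2_set_nonneg[of w "{..<m}"] unfolding \<nu>_def by linarith
    define u where "u = (\<lambda>i. 1/\<nu> * w i)"
    have uE: "u \<in> topspace (Euclidean_space m)" using wE by (auto simp: mem_Em u_def)
    have ul: "scalar_prod_Rm m u (v l) = 0" "scalar_prod_Rm m (v l) u = 0" if "l \<in> S" for l
      using wl[OF that] \<nu> unfolding scalar_prod_Rm_def u_def by (simp_all add: mult.assoc sum_divide_distrib[symmetric] mult.commute)
    have uu: "scalar_prod_Rm m u u = 1"
    proof -
      have "scalar_prod_Rm m u u = scalar_prod_Rm m w w / \<nu>\<^sup>2"
        unfolding scalar_prod_Rm_def u_def by (simp add: sum_divide_distrib power2_eq_square)
      then show ?thesis using \<nu> by (simp add: scalar_prod_Rm_self \<nu>_def)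
    qed
    have rr: "range (v(j := u)) \<subseteq> topspace (Euclidean_space m)" using r uE by auto
    have "\<bar>\<omega> (v(j := u))\<bar> \<le> (\<Prod>k\<in>- insert j S. L2_set ((v(j := u)) k) {..<m})"
    proof (rule Suc.hyps(1)[OF _ rr])
      have "card (- S) = Suc (card (- insert j S))" by (subst cmp) (simp add: card_insert_disjoint)
      then show "d = card (- insert j S)" using Suc.hyps(2) by simp
      fix a b assume "a \<in> insert j S" "b \<in> insert j S"
      then show "scalar_prod_Rm m ((v(j := u)) a) ((v(j := u)) b) = (if a = b then 1 else 0)"
        using ul uu Suc.prems(2) j by auto
    qed
    also have "\<dots> = (\<Prod>k\<in>- insert j S. L2_set (v k) {..<m})" by (intro prod.cong) auto
    finally have le: "\<bar>\<omega> (v(j := u))\<bar> \<le> (\<Prod>k\<in>- insert j S. L2_set (v k) {..<m})" .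
    have "w = (\<lambda>i. \<nu> * u i)" using \<nu> by (auto simp: u_def)
    then have "\<omega> v = \<nu> * \<omega> (v(j := u))" using ow covector_scale[OF r uE, of j \<nu>] by simp
    then have "\<bar>\<omega> v\<bar> = \<nu> * \<bar>\<omega> (v(j := u))\<bar>" using \<nu> by (simp add: abs_mult)
    also have "\<dots> \<le> L2_set (v j) {..<m} * (\<Prod>k\<in>- insert j S. L2_set (v k) {..<m})"
      using le wle \<nu> pn by (intro mult_mono) (auto simp: \<nu>_def)
    finally show ?thesis using prod_eq by simp
  qed
qed

lemma covector_Hadamard:
  assumes "comass m \<omega> \<le> 1" "range v \<subseteq> topspace (Euclidean_space m)"
  shows "\<bar>\<omega> v\<bar> \<le> (\<Prod>j\<in>UNIV. L2_set (v j) {..<m})"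
  using covector_Hadamard_aux[OF assms, of "{}"] by simp

end

section \<open>Smooth bump functions\<close>

text \<open>
  The functions \<open>p(1/t) exp(-1/t)\<close> for \<open>t > 0\<close>, extended by 0, form a family that is closed under
  differentiation and contains the standard smooth function vanishing on the negative axis (\<open>p = 1\<close>).
\<close>

definition poly_exp_inv :: "real poly \<Rightarrow> real \<Rightarrow> real" where
  "poly_exp_inv p t = (if t > 0 then poly p (inverse t) * exp (- inverse t) else 0)"

lemma poly_times_exp_minus_tendsto_0:
  "((\<lambda>s::real. poly p s * exp (- s)) \<longlongrightarrow> 0) at_top"
proof -
  have "((\<lambda>s::real. \<Sum>i\<le>degree p. coeff p i * (s ^ i / exp s)) \<longlongrightarrow> (\<Sum>i\<le>degree p. coeff p i * 0)) at_top"
    by (intro tendsto_sum tendsto_mult tendsto_const tendsto_power_div_exp_0)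
  moreover have "(\<Sum>i\<le>degree p. coeff p i * (s ^ i / exp s)) = poly p s * exp (- s)" for s
    by (simp only: poly_altdef exp_minus sum_distrib_right divide_inverse mult.assoc)
  ultimately show ?thesis by simp
qed

lemma poly_exp_inv_has_derivative:
  "(poly_exp_inv p has_real_derivative poly_exp_inv ([:0,0,1:] * (p - pderiv p)) t) (at t)"
proof (cases "t = 0")
  case False
  show ?thesis
  proof (cases "t > 0")
    case True
    have "((\<lambda>t. poly p (inverse t) * exp (- inverse t)) has_real_derivative
        poly (pderiv p) (inverse t) * (- (inverse t)\<^sup>2) * exp (- inverse t) + exp (- inverse t) * (inverse t)\<^sup>2 * poly p (inverse t)) (at t)"
      using True by (auto intro!: derivative_eq_intros simp: power2_eq_square)
    then have "(poly_exp_inv p has_real_derivative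
        poly (pderiv p) (inverse t) * (- (inverse t)\<^sup>2) * exp (- inverse t) + exp (- inverse t) * (inverse t)\<^sup>2 * poly p (inverse t)) (at t)"
      by (rule DERIV_cong_ev[THEN iffD1, rotated -1, OF _ refl _ refl])
         (use True eventually_nhds_in_open[of "{0<..}" t] in \<open>auto elim!: eventually_mono simp: poly_exp_inv_def\<close>)
    moreover have "poly (pderiv p) (inverse t) * (- (inverse t)\<^sup>2) * exp (- inverse t) + exp (- inverse t) * (inverse t)\<^sup>2 * poly p (inverse t)
       = poly_exp_inv ([:0,0,1:] * (p - pderiv p)) t"
      using True by (simp add: poly_exp_inv_def algebra_simps power2_eq_square)
    ultimately show ?thesis by simp
  next
    case f: False
    have "((\<lambda>t. 0) has_real_derivative 0) (at t)" by simp
    then have "(poly_exp_inv p has_real_derivative 0) (at t)"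
      by (rule DERIV_cong_ev[THEN iffD1, rotated -1, OF _ refl _ refl])
         (use f False eventually_nhds_in_open[of "{..<0}" t] in \<open>auto elim!: eventually_mono simp: poly_exp_inv_def\<close>)
    then show ?thesis using f by (simp add: poly_exp_inv_def)
  qed
next
  case True
  have "((\<lambda>h. (poly_exp_inv p (0 + h) - poly_exp_inv p 0) / h) \<longlongrightarrow> 0) (at 0)"
  proof (rule filterlim_split_at)
    have "\<forall>\<^sub>F h in at_left (0::real). (poly_exp_inv p (0 + h) - poly_exp_inv p 0) / h = 0"
      by (auto simp: eventually_at_filter poly_exp_inv_def)
    then show "((\<lambda>h. (poly_exp_inv p (0 + h) - poly_exp_inv p 0) / h) \<longlongrightarrow> 0) (at_left 0)" by (rule tendsto_eventually)
    have "((\<lambda>h. poly ([:0,1:] * p) (inverse h) * exp (- inverse h)) \<longlongrightarrow> 0) (at_right (0::real))"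
      using filterlim_compose[OF poly_times_exp_minus_tendsto_0[of "[:0,1:] * p"] filterlim_inverse_at_top_right] .
    moreover have "\<forall>\<^sub>F h in at_right (0::real). poly ([:0,1:] * p) (inverse h) * exp (- inverse h) = (poly_exp_inv p (0 + h) - poly_exp_inv p 0) / h"
      by (auto simp: eventually_at_filter poly_exp_inv_def divide_inverse mult_ac)
    ultimately show "((\<lambda>h. (poly_exp_inv p (0 + h) - poly_exp_inv p 0) / h) \<longlongrightarrow> 0) (at_right 0)"
      by (rule Lim_transform_eventually)
  qed
  then show ?thesis using True by (simp add: DERIV_def poly_exp_inv_def)
qed

definition partial_deriv :: "'n \<Rightarrow> (real ^ 'n::finite \<Rightarrow> real) \<Rightarrow> real ^ 'n \<Rightarrow> real" where
  "partial_deriv j f = (\<lambda>x. frechet_derivative f (at x) (axis j 1))"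

text \<open>
  An algebra of functions generated so that it is closed under partial derivatives. All its
  elements are therefore smooth, and it contains the bump functions used as mollifiers, cut-off
  functions and test functions.
\<close>

inductive bump_alg :: "(real ^ 'n::finite \<Rightarrow> real) \<Rightarrow> bool" where
  const: "bump_alg (\<lambda>x. c)"
| coord: "bump_alg (\<lambda>x. x $ i)"
| add: "bump_alg f \<Longrightarrow> bump_alg g \<Longrightarrow> bump_alg (\<lambda>x. f x + g x)"
| mult: "bump_alg f \<Longrightarrow> bump_alg g \<Longrightarrow> bump_alg (\<lambda>x. f x * g x)"
| comp: "bump_alg f \<Longrightarrow> bump_alg (\<lambda>x. poly_exp_inv p (f x))"

lemma has_derivative_partial_deriv:
  assumes "(f has_derivative f') (at x)" shows "partial_deriv j f x = f' (axis j 1)"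
  using frechet_derivative_at[OF assms] by (simp add: partial_deriv_def)

lemma partial_deriv_zero_outside:
  fixes \<phi> :: "real ^ 'n::finite \<Rightarrow> real"
  assumes C: "closed C" and z: "\<And>y. y \<notin> C \<Longrightarrow> \<phi> y = 0" and x: "x \<notin> C"
  shows "partial_deriv j \<phi> x = 0"
proof -
  have "(\<phi> has_derivative (\<lambda>v. 0)) (at x)"
    by (rule has_derivative_transform_within_open[OF has_derivative_const[of 0] open_Compl[OF C]]) (use x z in simp_all)
  then show ?thesis by (rule has_derivative_partial_deriv)
qed

lemma partial_deriv_const: "partial_deriv j (\<lambda>x. c) x = 0"
  using has_derivative_partial_deriv[OF has_derivative_const] .

lemma partial_deriv_coord: "partial_deriv j (\<lambda>x. x $ i) x = (if i = j then 1 else 0)"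
  using has_derivative_partial_deriv[OF bounded_linear_imp_has_derivative[OF bounded_linear_vec_nth], of j i x]
  by (simp add: axis_def)

lemma partial_deriv_add:
  assumes "f differentiable (at x)" "g differentiable (at x)"
  shows "partial_deriv j (\<lambda>x. f x + g x) x = partial_deriv j f x + partial_deriv j g x"
  using assms has_derivative_partial_deriv[OF has_derivative_add[OF assms[unfolded frechet_derivative_works]]] by (simp add: partial_deriv_def)

lemma partial_deriv_mult:
  assumes "f differentiable (at x)" "g differentiable (at x)"
  shows "partial_deriv j (\<lambda>x. f x * g x) x = f x * partial_deriv j g x + partial_deriv j f x * g x"
  using assms has_derivative_partial_deriv[OF has_derivative_mult[OF assms[unfolded frechet_derivative_works]]] by (simp add: partial_deriv_def)

lemma poly_exp_inv_comp_has_derivative: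
  assumes "f differentiable (at x)"
  shows "((\<lambda>x. poly_exp_inv p (f x)) has_derivative (\<lambda>v. poly_exp_inv ([:0,0,1:] * (p - pderiv p)) (f x) * frechet_derivative f (at x) v)) (at x)"
  using has_derivative_compose[OF assms[unfolded frechet_derivative_works] poly_exp_inv_has_derivative[unfolded has_field_derivative_def]] .

lemma partial_deriv_comp:
  assumes "f differentiable (at x)"
  shows "partial_deriv j (\<lambda>x. poly_exp_inv p (f x)) x = poly_exp_inv ([:0,0,1:] * (p - pderiv p)) (f x) * partial_deriv j f x"
  using has_derivative_partial_deriv[OF poly_exp_inv_comp_has_derivative[OF assms]] by (simp add: partial_deriv_def)

lemma bump_alg_differentiable: "bump_alg f \<Longrightarrow> f differentiable (at x)"
proof (induction rule: bump_alg.induct)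
  case (coord i)
  show ?case using bounded_linear_imp_differentiable[OF bounded_linear_vec_nth] .
next
  case (comp f p) then show ?case using poly_exp_inv_comp_has_derivative[OF comp.IH] unfolding differentiable_def by blast
qed auto

lemma bump_alg_partial_deriv: "bump_alg f \<Longrightarrow> bump_alg (partial_deriv j f)"
proof (induction rule: bump_alg.induct)
  case (const c)
  have "partial_deriv j (\<lambda>x. c) = (\<lambda>x. 0)" by (intro ext partial_deriv_const)
  then show ?case using bump_alg.const[of 0] by simp
next
  case (coord i)
  have "partial_deriv j (\<lambda>x. x $ i) = (\<lambda>x. if i = j then 1 else 0)" by (intro ext partial_deriv_coord)
  then show ?case using bump_alg.const[of "if i = j then 1 else 0"] by simp
next
  case (add f g)
  have "partial_deriv j (\<lambda>x. f x + g x) = (\<lambda>x. partial_deriv j f x + partial_deriv j g x)"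
    by (intro ext partial_deriv_add bump_alg_differentiable add)
  moreover have "bump_alg (\<lambda>x. partial_deriv j f x + partial_deriv j g x)" by (intro bump_alg.add add)
  ultimately show ?case by simp
next
  case (mult f g)
  have "partial_deriv j (\<lambda>x. f x * g x) = (\<lambda>x. f x * partial_deriv j g x + partial_deriv j f x * g x)"
    by (intro ext partial_deriv_mult bump_alg_differentiable mult)
  moreover have "bump_alg (\<lambda>x. f x * partial_deriv j g x + partial_deriv j f x * g x)"
    by (intro bump_alg.add bump_alg.mult mult)
  ultimately show ?case by simp
next
  case (comp f p)
  have "partial_deriv j (\<lambda>x. poly_exp_inv p (f x)) = (\<lambda>x. poly_exp_inv ([:0,0,1:] * (p - pderiv p)) (f x) * partial_deriv j f x)"
    by (intro ext partial_deriv_comp bump_alg_differentiable comp)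
  moreover have "bump_alg (\<lambda>x. poly_exp_inv ([:0,0,1:] * (p - pderiv p)) (f x) * partial_deriv j f x)"
    by (intro bump_alg.mult bump_alg.comp comp)
  ultimately show ?case by simp
qed

text \<open>
  Symmetry of second derivatives, proved by induction over the generation of the algebra; it is
  the source of the cancellation in \<open>covector_mixed_cancel\<close>.
\<close>

lemma bump_alg_partial_deriv_commute:
  fixes f :: "real ^ 'a::finite \<Rightarrow> real"
  shows "bump_alg f \<Longrightarrow> partial_deriv j (partial_deriv k f) = partial_deriv k (partial_deriv j f)"
proof (induction rule: bump_alg.induct)
  case (const c)
  have "partial_deriv i (\<lambda>x::real^'a. c) = (\<lambda>x. 0)" for i c by (intro ext partial_deriv_const)
  then show ?case by simp
next
  case (coord i)
  have "partial_deriv l (\<lambda>x. x $ i) = (\<lambda>x. if i = l then 1 else 0)" for l by (intro ext partial_deriv_coord)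
  moreover have "partial_deriv l (\<lambda>x::real^'a. c) = (\<lambda>x. 0)" for l c by (intro ext partial_deriv_const)
  ultimately show ?case by simp
next
  case (add f g)
  have d: "partial_deriv l (\<lambda>x. f x + g x) = (\<lambda>x. partial_deriv l f x + partial_deriv l g x)" for l
    by (intro ext partial_deriv_add bump_alg_differentiable add)
  have "partial_deriv l (\<lambda>x. partial_deriv l' f x + partial_deriv l' g x) = (\<lambda>x. partial_deriv l (partial_deriv l' f) x + partial_deriv l (partial_deriv l' g) x)" for l l'
    by (intro ext partial_deriv_add bump_alg_differentiable bump_alg_partial_deriv add)
  then show ?case unfolding d using add.IH by simp
next
  case (mult f g)
  have d: "partial_deriv l (\<lambda>x. f x * g x) = (\<lambda>x. f x * partial_deriv l g x + partial_deriv l f x * g x)" for l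
    by (intro ext partial_deriv_mult bump_alg_differentiable mult)
  have "partial_deriv l (\<lambda>x. f x * partial_deriv l' g x + partial_deriv l' f x * g x) = (\<lambda>x. (f x * partial_deriv l (partial_deriv l' g) x + partial_deriv l f x * partial_deriv l' g x) + (partial_deriv l' f x * partial_deriv l g x + partial_deriv l (partial_deriv l' f) x * g x))" for l l'
    by (intro ext) (simp add: partial_deriv_add partial_deriv_mult bump_alg_differentiable bump_alg_partial_deriv mult.hyps bump_alg.mult)
  then show ?case unfolding d using mult.IH by (auto simp: algebra_simps)
next
  case (comp f p)
  define q where "q p = [:0,0,1:] * (p - pderiv p)" for p :: "real poly"
  have d: "partial_deriv l (\<lambda>x. poly_exp_inv p (f x)) = (\<lambda>x. poly_exp_inv (q p) (f x) * partial_deriv l f x)" for l p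
    unfolding q_def by (intro ext partial_deriv_comp bump_alg_differentiable comp)
  have "partial_deriv l (\<lambda>x. poly_exp_inv (q p) (f x) * partial_deriv l' f x) = (\<lambda>x. poly_exp_inv (q p) (f x) * partial_deriv l (partial_deriv l' f) x + poly_exp_inv (q (q p)) (f x) * partial_deriv l f x * partial_deriv l' f x)" for l l'
    by (intro ext) (simp add: d partial_deriv_mult bump_alg_differentiable bump_alg_partial_deriv comp.hyps bump_alg.comp)
  then show ?case unfolding d using comp.IH by (auto simp: algebra_simps)
qed

lemma bump_alg_C_diff: "bump_alg f \<Longrightarrow> C_diff k f"
proof (induction k arbitrary: f)
  case 0
  have "f differentiable_on UNIV"
    unfolding differentiable_on_def using bump_alg_differentiable[OF 0] by simp
  then show ?case by (simp add: differentiable_imp_continuous_on)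
next
  case (Suc k)
  then show ?case using bump_alg_differentiable[OF Suc.prems] Suc.IH[OF bump_alg_partial_deriv[OF Suc.prems]] by (simp add: partial_deriv_def)
qed

lemma bump_alg_continuous: "bump_alg f \<Longrightarrow> continuous_on UNIV f"
  using bump_alg_C_diff[of f 0] by simp

lemma bump_alg_measurable: "bump_alg f \<Longrightarrow> f \<in> borel_measurable borel"
  by (rule borel_measurable_continuous_onI[OF bump_alg_continuous])

lemma bump_alg_has_derivative:
  assumes f: "bump_alg f"
  shows "(f has_derivative (\<lambda>v. \<Sum>j\<in>UNIV. v $ j * partial_deriv j f x)) (at x)"
proof -
  have D: "(f has_derivative frechet_derivative f (at x)) (at x)"
    using bump_alg_differentiable[OF f] by (simp add: frechet_derivative_works)
  have "frechet_derivative f (at x) v = (\<Sum>j\<in>UNIV. v $ j * partial_deriv j f x)" for v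
  proof -
    have "frechet_derivative f (at x) v = frechet_derivative f (at x) (\<Sum>j\<in>UNIV. v $ j *\<^sub>R axis j 1)"
      using basis_expansion[of v] by (simp add: scalar_mult_eq_scaleR)
    also have "\<dots> = (\<Sum>j\<in>UNIV. v $ j * partial_deriv j f x)"
      using has_derivative_linear[OF D] by (simp add: linear_sum linear_cmul partial_deriv_def)
    finally show ?thesis .
  qed
  then have "frechet_derivative f (at x) = (\<lambda>v. \<Sum>j\<in>UNIV. v $ j * partial_deriv j f x)" by (rule ext)
  then show ?thesis using D by simp
qed

lemma bump_alg_curve:
  assumes f: "bump_alg f" and g: "(\<gamma> has_vector_derivative v) (at t)"
  shows "((\<lambda>t. f (\<gamma> t)) has_real_derivative (\<Sum>j\<in>UNIV. v $ j * partial_deriv j f (\<gamma> t))) (at t)"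
proof -
  have "((\<lambda>t. f (\<gamma> t)) has_derivative (\<lambda>h. \<Sum>j\<in>UNIV. (h *\<^sub>R v) $ j * partial_deriv j f (\<gamma> t))) (at t)"
    using has_derivative_compose[OF g[unfolded has_vector_derivative_def] bump_alg_has_derivative[OF f]] .
  moreover have "(\<lambda>h. \<Sum>j\<in>UNIV. (h *\<^sub>R v) $ j * partial_deriv j f (\<gamma> t)) = (*) (\<Sum>j\<in>UNIV. v $ j * partial_deriv j f (\<gamma> t))"
    by (simp add: fun_eq_iff sum_distrib_left mult_ac)
  ultimately show ?thesis unfolding has_field_derivative_def by simp
qed

lemma bump_alg_sum:
  assumes "finite I" "\<And>i. i \<in> I \<Longrightarrow> bump_alg (f i)"
  shows "bump_alg (\<lambda>x. \<Sum>i\<in>I. f i x)"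
  using assms
proof (induction I rule: finite_induct)
  case empty show ?case using bump_alg.const[of 0] by simp
next
  case (insert i I)
  have "bump_alg (\<lambda>x. f i x + (\<Sum>i\<in>I. f i x))"
    using insert.prems by (intro bump_alg.add insert.IH) auto
  then show ?case using insert.hyps by simp
qed

lemma bump_alg_affine: "bump_alg f \<Longrightarrow> bump_alg (\<lambda>y. f (a *\<^sub>R (x - y)))"
proof (induction rule: bump_alg.induct)
  case (const c) show ?case by (rule bump_alg.const)
next
  case (coord i)
  have "bump_alg (\<lambda>y. a * x $ i + (-a) * y $ i)"
    by (rule bump_alg.add[OF bump_alg.const bump_alg.mult[OF bump_alg.const bump_alg.coord]])
  then show ?case by (simp add: algebra_simps)
next
  case (add f g) show ?case by (rule bump_alg.add[OF add.IH])
next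
  case (mult f g) show ?case by (rule bump_alg.mult[OF mult.IH])
next
  case (comp f p) show ?case by (rule bump_alg.comp[OF comp.IH])
qed

lemma partial_deriv_affine:
  assumes f: "bump_alg f"
  shows "partial_deriv j (\<lambda>y. f (a *\<^sub>R (x - y))) y = - a * partial_deriv j f (a *\<^sub>R (x - y))"
proof -
  have "((\<lambda>y. a *\<^sub>R (x - y)) has_derivative (\<lambda>v. a *\<^sub>R (- v))) (at y)"
    by (auto intro!: derivative_eq_intros)
  from has_derivative_partial_deriv[OF has_derivative_compose[OF this bump_alg_has_derivative[OF f]], of j]
  have "partial_deriv j (\<lambda>y. f (a *\<^sub>R (x - y))) y = (\<Sum>i\<in>UNIV. (a *\<^sub>R (- axis j 1)) $ i * partial_deriv i f (a *\<^sub>R (x - y)))" .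
  also have "\<dots> = (\<Sum>i\<in>UNIV. if i = j then - a * partial_deriv j f (a *\<^sub>R (x - y)) else 0)"
    by (intro sum.cong) (auto simp: axis_def)
  finally show ?thesis by simp
qed

definition bump :: "(real ^ 'n::finite \<Rightarrow> real) \<Rightarrow> bool" where
  "bump K \<longleftrightarrow> bump_alg K \<and> (\<forall>z. norm z > 1 \<longrightarrow> K z = 0)"

lemma bump_partial_deriv: fixes K :: "real ^ 'a::finite \<Rightarrow> real" assumes "bump K" shows "bump (partial_deriv j K)"
  unfolding bump_def
proof (intro conjI allI impI)
  show "bump_alg (partial_deriv j K)" using assms by (auto simp: bump_def bump_alg_partial_deriv)
  fix z :: "real ^ 'a" assume z: "norm z > 1"
  show "partial_deriv j K z = 0"
    by (rule partial_deriv_zero_outside[of "cball 0 1"]) (use z assms in \<open>auto simp: bump_def\<close>)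
qed

lemma bump_coord_mult: "bump K \<Longrightarrow> bump (\<lambda>z. z $ j * K z)"
  unfolding bump_def using bump_alg.mult[OF bump_alg.coord, of K j] by simp

lemma bump_bounded: assumes "bump K" obtains B where "B > 0" "\<And>z. \<bar>K z\<bar> \<le> B"
proof -
  have "bounded (K ` cball 0 1)"
    using assms bump_alg_continuous[of K]
    by (intro compact_imp_bounded compact_continuous_image) (auto simp: bump_def intro: continuous_on_subset)
  then obtain B where B: "B > 0" "\<And>z. z \<in> cball 0 1 \<Longrightarrow> \<bar>K z\<bar> \<le> B" by (auto simp: bounded_pos)
  have "\<bar>K z\<bar> \<le> B" for z using B assms by (cases "norm z \<le> 1") (auto simp: bump_def)
  with B(1) that show thesis by blast
qed

text \<open>
  The test functions through which weak derivatives enter: as functions of \<open>y\<close>, the kernels of the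
  convolutions at the point \<open>x\<close>.
\<close>

lemma bump_test_fun:
  assumes K: "bump K" and r: "r > 0" and S: "cball x r \<subseteq> S"
  shows "test_fun S (\<lambda>y. K ((1/r) *\<^sub>R (x - y)))"
proof -
  have sub: "closure {y. K ((1/r) *\<^sub>R (x - y)) \<noteq> 0} \<subseteq> cball x r"
  proof (rule closure_minimal)
    show "{y. K ((1/r) *\<^sub>R (x - y)) \<noteq> 0} \<subseteq> cball x r"
    proof
      fix y assume "y \<in> {y. K ((1/r) *\<^sub>R (x - y)) \<noteq> 0}"
      then have "\<not> norm ((1/r) *\<^sub>R (x - y)) > 1" using K by (auto simp: bump_def)
      then show "y \<in> cball x r" using r unfolding norm_scaleR by (simp add: dist_norm field_simps)
    qed
  qed simp
  have "compact (closure {y. K ((1/r) *\<^sub>R (x - y)) \<noteq> 0})"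
    by (rule compact_closure[THEN iffD2, OF bounded_subset[OF bounded_cball[of x r] order_trans[OF closure_subset sub]]])
  moreover have "C_diff k (\<lambda>y. K ((1/r) *\<^sub>R (x - y)))" for k
    using K by (intro bump_alg_C_diff bump_alg_affine) (simp add: bump_def)
  ultimately show ?thesis using order_trans[OF sub S] unfolding test_fun_def by simp
qed

definition eta0 :: "real ^ 'n::finite \<Rightarrow> real" where
  "eta0 x = poly_exp_inv 1 (1 + (- 1) * (\<Sum>i\<in>UNIV. x $ i * x $ i))"

lemma eta0_eq: "eta0 x = (if norm x < 1 then exp (- inverse (1 - (norm x)\<^sup>2)) else 0)"
proof -
  have e: "(\<Sum>i\<in>UNIV. x $ i * x $ i) = (norm x)\<^sup>2"
    by (simp add: power2_norm_eq_inner inner_vec_def)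
  have "0 < 1 - (norm x)\<^sup>2 \<longleftrightarrow> norm x < 1" by (simp add: power_less_one_iff abs_square_less_1)
  then show ?thesis unfolding eta0_def poly_exp_inv_def e by simp
qed

lemma eta0_bump: "bump (eta0 :: real ^ 'n::finite \<Rightarrow> real)"
proof -
  have "bump_alg (eta0 :: real ^ 'n \<Rightarrow> real)"
    unfolding eta0_def[abs_def]
    by (rule bump_alg.comp[OF bump_alg.add[OF bump_alg.const bump_alg.mult[OF bump_alg.const
          bump_alg_sum[OF finite_class.finite_UNIV bump_alg.mult[OF bump_alg.coord bump_alg.coord]]]]])
  then show ?thesis by (auto simp: bump_def eta0_eq)
qed

lemma bump_integrable: assumes "bump K" shows "integrable lborel K"
proof -
  obtain B where B: "B > 0" "\<And>z. \<bar>K z\<bar> \<le> B" using bump_bounded[OF assms] by blast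
  have [measurable]: "K \<in> borel_measurable borel" using assms bump_alg_measurable by (auto simp: bump_def)
  have "integrable lborel (\<lambda>z. B * indicator (cball 0 1) z)"
    using emeasure_lborel_cball_finite by (intro integrable_mult_right integrable_real_indicator) auto
  then show ?thesis
    by (rule Bochner_Integration.integrable_bound) (use B assms in \<open>auto simp: indicator_def bump_def abs_of_pos not_le\<close>)
qed

lemma eta0_integral_pos: "integral\<^sup>L lborel (eta0 :: real ^ 'n::finite \<Rightarrow> real) > 0"
proof -
  have n: "eta0 x \<ge> 0" for x :: "real ^ 'n" by (simp add: eta0_eq)
  have "integral\<^sup>L lborel (eta0 :: real ^ 'n \<Rightarrow> real) \<noteq> 0"
  proof
    assume "integral\<^sup>L lborel (eta0 :: real ^ 'n \<Rightarrow> real) = 0"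
    then have "AE x in lborel. (eta0 :: real ^ 'n \<Rightarrow> real) x = 0"
      using integral_nonneg_eq_0_iff_AE[OF bump_integrable[OF eta0_bump]] n by auto
    then have "AE x in lborel. x \<notin> ball (0 :: real ^ 'n) 1"
      by (rule eventually_mono) (auto simp: eta0_eq)
    then have "emeasure lborel (ball (0 :: real ^ 'n) 1) = 0"
      by (subst (asm) AE_iff_measurable[where N="ball 0 1"]) auto
    then have "measure lborel (ball (0 :: real ^ 'n) 1) = 0" by (simp add: measure_def)
    then show False by simp
  qed
  moreover have "integral\<^sup>L lborel (eta0 :: real ^ 'n \<Rightarrow> real) \<ge> 0" using n by (intro integral_nonneg_AE) auto
  ultimately show ?thesis by simp
qed

definition eta :: "real ^ 'n::finite \<Rightarrow> real" where
  "eta x = (1 / integral\<^sup>L lborel (eta0 :: real ^ 'n \<Rightarrow> real)) * eta0 x"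

lemma eta_bump: "bump (eta :: real ^ 'n::finite \<Rightarrow> real)"
  unfolding bump_def eta_def[abs_def]
proof (intro conjI allI impI)
  show "bump_alg (\<lambda>x::real^'n. 1 / integral\<^sup>L lborel (eta0 :: real^'n \<Rightarrow> real) * eta0 x)"
    using eta0_bump unfolding bump_def by (intro bump_alg.mult[OF bump_alg.const]) auto
qed (use eta0_bump[where 'n='n] in \<open>auto simp: bump_def\<close>)

lemma eta_nonneg: "eta (x :: real ^ 'n::finite) \<ge> 0"
  unfolding eta_def
  by (rule mult_nonneg_nonneg)
    (use eta0_integral_pos[where 'n='n] in \<open>simp_all add: eta0_eq\<close>)

lemma eta_mollifier: "mollifier (eta :: real ^ 'n::finite \<Rightarrow> real)"
proof -
  obtain B where B: "B > 0" "\<And>z::real^'n. \<bar>eta z\<bar> \<le> B" using bump_bounded[OF eta_bump] by blast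
  have "eta z \<le> B" for z :: "real^'n" using B(2)[of z] by linarith
  moreover have "integral\<^sup>L lborel (eta :: real ^ 'n \<Rightarrow> real) = 1"
    using eta0_integral_pos[where 'n='n] unfolding eta_def[abs_def] by simp
  moreover have "bump_alg (eta :: real ^ 'n \<Rightarrow> real)" "\<forall>z::real^'n. norm z > 1 \<longrightarrow> eta z = 0"
    using eta_bump[where 'n='n] by (simp_all add: bump_def)
  ultimately show ?thesis unfolding mollifier_def
    by (intro conjI allI exI[of _ B] eta_nonneg bump_alg_measurable) simp_all
qed

section \<open>Mollification of weakly differentiable functions\<close>

text \<open>
  Dominated convergence of the difference quotients, which the mean value theorem bounds by \<open>B\<close>.
\<close>

lemma DERIV_parametric_integral:
  fixes k k' :: "real \<Rightarrow> 'a::euclidean_space \<Rightarrow> real"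
  assumes u: "integrable lborel u" and t0: "t0 \<in> {a<..<b}"
    and d: "\<And>t y. t \<in> {a<..<b} \<Longrightarrow> ((\<lambda>t. k t y) has_real_derivative k' t y) (at t)"
    and B0: "\<And>t y. t \<in> {a<..<b} \<Longrightarrow> \<bar>k t y\<bar> \<le> B0" and B: "\<And>t y. t \<in> {a<..<b} \<Longrightarrow> \<bar>k' t y\<bar> \<le> B"
    and m: "\<And>t. t \<in> {a<..<b} \<Longrightarrow> k t \<in> borel_measurable borel" "k' t0 \<in> borel_measurable borel"
  shows "((\<lambda>t. \<integral>y. u y * k t y \<partial>lborel) has_real_derivative (\<integral>y. u y * k' t0 y \<partial>lborel)) (at t0)"
proof -
  have [measurable]: "u \<in> borel_measurable borel" using u by auto
  have int: "integrable lborel (\<lambda>y. u y * k t y)" if t: "t \<in> {a<..<b}" for t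
  proof (rule Bochner_Integration.integrable_bound[where f="\<lambda>y. B0 * u y"])
    have "\<bar>u y\<bar> * \<bar>k t y\<bar> \<le> \<bar>B0\<bar> * \<bar>u y\<bar>" for y
      using mult_left_mono[OF order_trans[OF B0[OF t, of y] abs_ge_self], of "\<bar>u y\<bar>"] by (simp add: mult.commute)
    then show "AE y in lborel. norm (u y * k t y) \<le> norm (B0 * u y)" by (simp add: abs_mult)
  qed (use u m(1)[OF t] in auto)
  have "((\<lambda>t. ((\<integral>y. u y * k t y \<partial>lborel) - (\<integral>y. u y * k t0 y \<partial>lborel)) / (t - t0)) \<longlongrightarrow> (\<integral>y. u y * k' t0 y \<partial>lborel)) (at t0)"
    unfolding tendsto_at_iff_sequentially
  proof (intro allI impI)
    fix X :: "nat \<Rightarrow> real" assume X: "\<forall>i. X i \<in> UNIV - {t0}" and lim: "X \<longlonglongrightarrow> t0"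
    have "\<forall>\<^sub>F i in sequentially. X i \<in> {a<..<b}" using topological_tendstoD[OF lim open_greaterThanLessThan t0] .
    then obtain n where n: "\<And>i. i \<ge> n \<Longrightarrow> X i \<in> {a<..<b}" by (auto simp: eventually_sequentially)
    define Y where "Y i = X (i + n)" for i
    have Y: "Y i \<in> {a<..<b}" "Y i \<noteq> t0" for i using n[of "i+n"] X by (auto simp: Y_def)
    have Yl: "Y \<longlonglongrightarrow> t0" unfolding Y_def[abs_def] using lim by (rule LIMSEQ_ignore_initial_segment)
    have conv: "(\<lambda>i. \<integral>y. u y * ((k (Y i) y - k t0 y) / (Y i - t0)) \<partial>lborel) \<longlonglongrightarrow> (\<integral>y. u y * k' t0 y \<partial>lborel)"
    proof (rule integral_dominated_convergence[where w="\<lambda>y. B * \<bar>u y\<bar>"])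
      show "(\<lambda>y. u y * k' t0 y) \<in> borel_measurable lborel" using m(2) by measurable
      show "(\<lambda>y. u y * ((k (Y i) y - k t0 y) / (Y i - t0))) \<in> borel_measurable lborel" for i
        using m(1)[OF Y(1)[of i]] m(1)[OF t0] by measurable
      show "integrable lborel (\<lambda>y. B * \<bar>u y\<bar>)" using u by simp
      show "AE y in lborel. (\<lambda>i. u y * ((k (Y i) y - k t0 y) / (Y i - t0))) \<longlonglongrightarrow> u y * k' t0 y"
      proof (intro AE_I2 tendsto_mult tendsto_const)
        fix y
        have "((\<lambda>t. (k t y - k t0 y) / (t - t0)) \<longlongrightarrow> k' t0 y) (at t0)"
          using d[OF t0, of y] by (simp add: has_field_derivative_iff)
        then show "(\<lambda>i. (k (Y i) y - k t0 y) / (Y i - t0)) \<longlonglongrightarrow> k' t0 y"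
          unfolding tendsto_at_iff_sequentially using Y(2) Yl by (auto simp: o_def)
      qed
      show "AE y in lborel. norm (u y * ((k (Y i) y - k t0 y) / (Y i - t0))) \<le> B * \<bar>u y\<bar>" for i
      proof (rule AE_I2)
        fix y
        have "norm (k (Y i) y - k t0 y) \<le> B * norm (Y i - t0)"
          by (rule field_differentiable_bound[where S="{a<..<b}" and f="\<lambda>t. k t y" and f'="\<lambda>t. k' t y"])
             (use d B Y(1) t0 in \<open>auto intro: has_field_derivative_at_within\<close>)
        then have "\<bar>(k (Y i) y - k t0 y) / (Y i - t0)\<bar> \<le> B"
          using Y(2)[of i] by (simp add: pos_divide_le_eq)
        then have "\<bar>u y\<bar> * \<bar>(k (Y i) y - k t0 y) / (Y i - t0)\<bar> \<le> \<bar>u y\<bar> * B" by (rule mult_left_mono) simp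
        then show "norm (u y * ((k (Y i) y - k t0 y) / (Y i - t0))) \<le> B * \<bar>u y\<bar>" by (simp add: abs_mult mult.commute)
      qed
    qed
    have quot: "(\<integral>y. u y * ((k (Y i) y - k t0 y) / (Y i - t0)) \<partial>lborel) = ((\<integral>y. u y * k (Y i) y \<partial>lborel) - (\<integral>y. u y * k t0 y \<partial>lborel)) / (Y i - t0)" for i
      using int[OF Y(1)[of i]] int[OF t0]
      by (subst Bochner_Integration.integral_diff[symmetric]) (auto simp: right_diff_distrib integral_divide_zero[symmetric] simp del: integral_divide_zero)
    from conv have "(\<lambda>i. ((\<lambda>t. ((\<integral>y. u y * k t y \<partial>lborel) - (\<integral>y. u y * k t0 y \<partial>lborel)) / (t - t0)) \<circ> X) (i + n)) \<longlonglongrightarrow> (\<integral>y. u y * k' t0 y \<partial>lborel)"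
      unfolding quot by (simp only: Y_def o_def)
    then show "((\<lambda>t. ((\<integral>y. u y * k t y \<partial>lborel) - (\<integral>y. u y * k t0 y \<partial>lborel)) / (t - t0)) \<circ> X) \<longlonglongrightarrow> (\<integral>y. u y * k' t0 y \<partial>lborel)"
      by (rule LIMSEQ_offset)
  qed
  then show ?thesis by (simp add: has_field_derivative_iff)
qed

text \<open>
  Convolution with the rescaled kernel \<open>r\<^sup>-\<^sup>n K(\<cdot>/r)\<close>. It agrees with \<open>mollify\<close> for the kernel \<open>eta\<close>, but is
  also applied to the partial derivatives of kernels and to \<open>z\<^sub>j K(z)\<close>, which are not mollifiers.
\<close>

definition kconv :: "(real ^ 'n::finite \<Rightarrow> real) \<Rightarrow> real \<Rightarrow> (real ^ 'n \<Rightarrow> real) \<Rightarrow> real ^ 'n \<Rightarrow> real" where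
  "kconv K r u x = (\<integral>y. u y * K ((1/r) *\<^sub>R (x - y)) \<partial>lborel) / r ^ CARD('n)"

lemma mollify_eta:
  assumes "u \<in> borel_measurable borel" "r > 0"
  shows "mollify eta r u x = kconv eta r u x"
  using mollify_eq[OF eta_mollifier assms, of x] by (simp add: kconv_def)

lemma bump_measurable: "bump K \<Longrightarrow> K \<in> borel_measurable borel"
  by (simp add: bump_def bump_alg_measurable)

lemma bump_affine_measurable:
  assumes "bump K" shows "(\<lambda>y. K (a *\<^sub>R (x - y))) \<in> borel_measurable borel"
proof -
  note [measurable] = bump_measurable[OF assms]
  show ?thesis by measurable
qed

lemma kconv_integrable:
  assumes K: "bump K" and u: "integrable lborel u"
  shows "integrable lborel (\<lambda>y. u y * K (a *\<^sub>R (x - y)))"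
proof -
  obtain B where B: "B > 0" "\<And>z. \<bar>K z\<bar> \<le> B" using bump_bounded[OF K] by blast
  show ?thesis
  proof (rule Bochner_Integration.integrable_bound[where f="\<lambda>y. B * u y"])
    show "(\<lambda>y. u y * K (a *\<^sub>R (x - y))) \<in> borel_measurable lborel"
      using bump_affine_measurable[OF K] u by auto
    have "\<bar>u y\<bar> * \<bar>K (a *\<^sub>R (x - y))\<bar> \<le> B * \<bar>u y\<bar>" for y
      using mult_left_mono[OF B(2)[of "a *\<^sub>R (x - y)"], of "\<bar>u y\<bar>"] by (simp only: mult.commute abs_ge_zero)
    then show "AE y in lborel. norm (u y * K (a *\<^sub>R (x - y))) \<le> norm (B * u y)" using B(1) by (simp add: abs_mult)
  qed (use u in auto)
qed

text \<open>
  The derivative falls on the kernel, so the convolution is differentiable for every integrable \<open>u\<close>.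
\<close>

lemma kconv_line:
  fixes K :: "real ^ 'n::finite \<Rightarrow> real"
  assumes K: "bump K" and u: "integrable lborel u" and r: "r > 0"
  shows "((\<lambda>t. kconv K r u (x + t *\<^sub>R v)) has_real_derivative (\<Sum>j\<in>UNIV. v $ j * (kconv (partial_deriv j K) r u (x + t0 *\<^sub>R v) / r))) (at t0)"
proof -
  define k where "k t y = K ((1/r) *\<^sub>R (x + t *\<^sub>R v - y))" for t y
  define k' where "k' t y = (\<Sum>j\<in>UNIV. ((1/r) *\<^sub>R v) $ j * partial_deriv j K ((1/r) *\<^sub>R (x + t *\<^sub>R v - y)))" for t y
  obtain B0 where B0: "B0 > 0" "\<And>z. \<bar>K z\<bar> \<le> B0" using bump_bounded[OF K] by blast
  have "\<exists>Bj. \<forall>j z. \<bar>partial_deriv j K z\<bar> \<le> Bj j"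
  proof (intro choice allI)
    fix j show "\<exists>b. \<forall>z. \<bar>partial_deriv j K z\<bar> \<le> b" using bump_bounded[OF bump_partial_deriv[OF K, of j]] by metis
  qed
  then obtain Bj where Bj: "\<And>j z. \<bar>partial_deriv j K z\<bar> \<le> Bj j" by blast
  have "((\<lambda>t. \<integral>y. u y * k t y \<partial>lborel) has_real_derivative (\<integral>y. u y * k' t0 y \<partial>lborel)) (at t0)"
  proof (rule DERIV_parametric_integral[OF u, where a="t0 - 1" and b="t0 + 1"])
    fix t y
    have "((\<lambda>t. (1/r) *\<^sub>R (x + t *\<^sub>R v - y)) has_vector_derivative ((1/r) *\<^sub>R v)) (at t)"
      by (auto intro!: derivative_eq_intros)
    from bump_alg_curve[OF _ this, of K] K
    show "((\<lambda>t. k t y) has_real_derivative k' t y) (at t)" by (simp add: bump_def k_def k'_def)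
    show "\<bar>k t y\<bar> \<le> B0" unfolding k_def by (rule B0)
    show "\<bar>k' t y\<bar> \<le> (\<Sum>j\<in>UNIV. \<bar>((1/r) *\<^sub>R v) $ j\<bar> * Bj j)"
      unfolding k'_def by (rule order_trans[OF sum_abs]) (intro sum_mono, simp only: abs_mult, intro mult_left_mono Bj abs_ge_zero)
  next
    show "k t \<in> borel_measurable borel" for t unfolding k_def[abs_def] by (rule bump_affine_measurable[OF K])
    show "k' t0 \<in> borel_measurable borel" unfolding k'_def[abs_def]
      by (intro borel_measurable_sum borel_measurable_times borel_measurable_const bump_affine_measurable bump_partial_deriv K)
  qed simp
  moreover have "(\<integral>y. u y * k' t0 y \<partial>lborel) = (\<Sum>j\<in>UNIV. v $ j / r * (\<integral>y. u y * partial_deriv j K ((1/r) *\<^sub>R (x + t0 *\<^sub>R v - y)) \<partial>lborel))"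
  proof -
    have "(\<integral>y. u y * k' t0 y \<partial>lborel) = (\<integral>y. (\<Sum>j\<in>UNIV. v $ j / r * (u y * partial_deriv j K ((1/r) *\<^sub>R (x + t0 *\<^sub>R v - y)))) \<partial>lborel)"
      unfolding k'_def by (intro Bochner_Integration.integral_cong refl) (simp add: sum_distrib_left mult_ac)
    also have "\<dots> = (\<Sum>j\<in>UNIV. v $ j / r * (\<integral>y. u y * partial_deriv j K ((1/r) *\<^sub>R (x + t0 *\<^sub>R v - y)) \<partial>lborel))"
      by (subst Bochner_Integration.integral_sum) (auto intro!: integrable_mult_right kconv_integrable bump_partial_deriv K u)
    finally show ?thesis .
  qed
  ultimately have "((\<lambda>t. \<integral>y. u y * k t y \<partial>lborel) has_real_derivative (\<Sum>j\<in>UNIV. v $ j / r * (\<integral>y. u y * partial_deriv j K ((1/r) *\<^sub>R (x + t0 *\<^sub>R v - y)) \<partial>lborel))) (at t0)"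
    by simp
  from DERIV_cdivide[OF this, of "r ^ CARD('n)"] show ?thesis
    unfolding kconv_def k_def by (simp add: sum_divide_distrib mult_ac)
qed

text \<open>
  In contrast to \<open>weak_gradient\<close>, the functions are integrable on the whole space and only the
  integration by parts formula is local to \<open>S\<close>. So convolutions with them make sense everywhere.
\<close>

definition weak_grad_on :: "(real ^ 'n::finite) set \<Rightarrow> (real ^ 'n \<Rightarrow> real) \<Rightarrow> (real ^ 'n \<Rightarrow> real ^ 'n) \<Rightarrow> bool" where
  "weak_grad_on S u g \<longleftrightarrow> integrable lborel u \<and> (\<forall>j. integrable lborel (\<lambda>x. g x $ j)) \<and>
     (\<forall>\<phi> j. test_fun S \<phi> \<longrightarrow> (\<integral>x. u x * partial_deriv j \<phi> x \<partial>lborel) = - (\<integral>x. g x $ j * \<phi> x \<partial>lborel))"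

lemma neg_div_eq: "- (1/r) * X = - Y \<Longrightarrow> Y = X / r" for r X Y :: real
  by simp

text \<open>
  Integration by parts against the test function \<open>y \<mapsto> K((x - y)/r)\<close>.
\<close>

lemma kconv_weak_grad:
  assumes w: "weak_grad_on S u g" and K: "bump K" and r: "r > 0" and S: "cball x r \<subseteq> S"
  shows "kconv (partial_deriv j K) r u x / r = kconv K r (\<lambda>y. g y $ j) x"
proof -
  have "(\<integral>y. u y * partial_deriv j (\<lambda>y. K ((1/r) *\<^sub>R (x - y))) y \<partial>lborel) = - (\<integral>y. g y $ j * K ((1/r) *\<^sub>R (x - y)) \<partial>lborel)"
    using w bump_test_fun[OF K r S] by (simp add: weak_grad_on_def)
  moreover have "partial_deriv j (\<lambda>y. K ((1/r) *\<^sub>R (x - y))) y = - (1/r) * partial_deriv j K ((1/r) *\<^sub>R (x - y))" for y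
    by (rule partial_deriv_affine) (use K in \<open>simp add: bump_def\<close>)
  moreover have "(\<integral>y. u y * (- (1/r) * partial_deriv j K ((1/r) *\<^sub>R (x - y))) \<partial>lborel) = - (1/r) * (\<integral>y. u y * partial_deriv j K ((1/r) *\<^sub>R (x - y)) \<partial>lborel)"
    by (subst integral_mult_right_zero[symmetric]) (simp only: mult.left_commute)
  ultimately have "- (1/r) * (\<integral>y. u y * partial_deriv j K ((1/r) *\<^sub>R (x - y)) \<partial>lborel) = - (\<integral>y. g y $ j * K ((1/r) *\<^sub>R (x - y)) \<partial>lborel)"
    by (simp only:)
  then have e: "(\<integral>y. g y $ j * K ((1/r) *\<^sub>R (x - y)) \<partial>lborel) = (\<integral>y. u y * partial_deriv j K ((1/r) *\<^sub>R (x - y)) \<partial>lborel) / r"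
    by (rule neg_div_eq)
  show ?thesis unfolding kconv_def e by (simp only: divide_divide_eq_left mult.commute)
qed

lemma kconv_sum_bound:
  fixes g :: "real ^ 'n::finite \<Rightarrow> real ^ 'n" and K :: "'n \<Rightarrow> real ^ 'n \<Rightarrow> real"
  assumes K: "\<And>j. bump (K j)" and g: "\<And>j. integrable lborel (\<lambda>y. g y $ j)" and h: "integrable lborel h" "\<And>y. h y \<ge> 0"
    and r: "r > 0" and b: "\<And>y z. norm z \<le> 1 \<Longrightarrow> \<bar>\<Sum>j\<in>UNIV. c j * (g y $ j * K j z)\<bar> \<le> B * h y"
  shows "\<bar>\<Sum>j\<in>UNIV. c j * kconv (K j) r (\<lambda>y. g y $ j) x\<bar> \<le> B * (int_on h (cball x r) / r ^ CARD('n))"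
proof -
  let ?f = "\<lambda>y. \<Sum>j\<in>UNIV. c j * (g y $ j * K j ((1/r) *\<^sub>R (x - y)))"
  have i: "integrable lborel (\<lambda>y. c j * (g y $ j * K j ((1/r) *\<^sub>R (x - y))))" for j
    by (intro integrable_mult_right kconv_integrable K g)
  have eq: "(\<Sum>j\<in>UNIV. c j * kconv (K j) r (\<lambda>y. g y $ j) x) = (\<integral>y. ?f y \<partial>lborel) / r ^ CARD('n)"
    unfolding kconv_def by (subst Bochner_Integration.integral_sum[OF i]) (simp add: sum_divide_distrib)
  have "norm (\<integral>y. ?f y \<partial>lborel) \<le> (\<integral>y. norm (?f y) \<partial>lborel)" by (rule integral_norm_bound)
  also have "\<dots> \<le> (\<integral>y. B * (indicator (cball x r) y * h y) \<partial>lborel)"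
  proof (rule integral_mono)
    show "integrable lborel (\<lambda>y. norm (?f y))" by (intro integrable_norm Bochner_Integration.integrable_sum i)
    show "integrable lborel (\<lambda>y. B * (indicator (cball x r) y * h y))"
      by (intro integrable_mult_right int_on_integrable[OF h]) auto
    fix y
    show "norm (?f y) \<le> B * (indicator (cball x r) y * h y)"
    proof (cases "y \<in> cball x r")
      case True
      then have "norm ((1/r) *\<^sub>R (x - y)) \<le> 1" unfolding norm_scaleR using r by (simp add: dist_norm)
      from b[OF this, of y] True show ?thesis by simp
    next
      case False
      then have "norm ((1/r) *\<^sub>R (x - y)) > 1" unfolding norm_scaleR using r by (simp add: dist_norm)
      then have "K j ((1/r) *\<^sub>R (x - y)) = 0" for j using K[of j] by (simp add: bump_def)
      then show ?thesis using False by simp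
    qed
  qed
  also have "\<dots> = B * int_on h (cball x r)" by (simp add: int_on_def)
  finally show ?thesis unfolding eq using r by (simp add: abs_divide divide_right_mono)
qed

lemma sum_vec_nth_le_norm: "\<bar>\<Sum>j\<in>UNIV. a $ j * b $ j\<bar> \<le> norm a * norm (b :: real ^ 'n::finite)"
  using Cauchy_Schwarz_ineq2[of a b] by (simp add: inner_vec_def)

text \<open>
  The mean value theorem on the segment from \<open>x0\<close> to \<open>x\<close>; the derivative of the mollification is the
  mollification of the weak gradient.
\<close>

lemma mollify_lipschitz:
  fixes u :: "real ^ 'n::finite \<Rightarrow> real"
  assumes w: "weak_grad_on S u g" and h: "integrable lborel h" and gh: "\<And>y. norm (g y) \<le> h y"
    and r: "r > 0" and S: "cball x0 (r + norm (x - x0)) \<subseteq> S" and B: "\<And>z::real^'n. eta z \<le> B"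
  shows "\<bar>kconv eta r u x - kconv eta r u x0\<bar> \<le> norm (x - x0) * B * (int_on h (cball x0 (r + norm (x - x0))) / r ^ CARD('n))"
proof -
  have h0: "h y \<ge> 0" for y using gh[of y] norm_ge_zero order_trans by blast
  have u: "integrable lborel u" and g: "\<And>j. integrable lborel (\<lambda>x. g x $ j)" using w by (auto simp: weak_grad_on_def)
  define v where "v = x - x0"
  have B0: "B \<ge> 0" using B[of 0] eta_nonneg[of "0::real^'n"] by linarith
  define F where "F t = kconv eta r u (x0 + t *\<^sub>R v)" for t
  define F' where "F' t = (\<Sum>j\<in>UNIV. v $ j * (kconv (partial_deriv j eta) r u (x0 + t *\<^sub>R v) / r))" for t
  have "\<exists>t>0. t < 1 \<and> F 1 - F 0 = (1 - 0) * F' t"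
    by (rule MVT2) (simp_all only: F_def[abs_def] F'_def kconv_line[OF eta_bump u r] zero_less_one)
  then obtain t where t: "0 < t" "t < 1" "F 1 - F 0 = (1 - 0) * F' t" by blast
  let ?y = "x0 + t *\<^sub>R v"
  have sub: "cball ?y r \<subseteq> cball x0 (r + norm (x - x0))"
  proof
    fix y assume "y \<in> cball ?y r"
    then have "dist x0 y \<le> norm (t *\<^sub>R v) + r"
      using dist_triangle[of x0 y ?y] by (simp add: dist_norm)
    also have "norm (t *\<^sub>R v) \<le> norm v" using t by (simp add: mult_left_le_one_le)
    finally show "y \<in> cball x0 (r + norm (x - x0))" by (simp add: v_def)
  qed
  have "F' t = (\<Sum>j\<in>UNIV. v $ j * kconv eta r (\<lambda>y. g y $ j) ?y)"
    unfolding F'_def using kconv_weak_grad[OF w eta_bump r order_trans[OF sub S]] by simp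
  also have "\<bar>\<dots>\<bar> \<le> (norm v * B) * (int_on h (cball ?y r) / r ^ CARD('n))"
  proof (rule kconv_sum_bound[OF eta_bump g h h0 r])
    fix y z :: "real ^ 'n"
    have "(\<Sum>j\<in>UNIV. v $ j * (g y $ j * eta z)) = (\<Sum>j\<in>UNIV. v $ j * g y $ j) * eta z"
      by (simp add: sum_distrib_right mult.assoc)
    then have "\<bar>\<Sum>j\<in>UNIV. v $ j * (g y $ j * eta z)\<bar> = \<bar>\<Sum>j\<in>UNIV. v $ j * g y $ j\<bar> * eta z"
      by (simp add: abs_mult eta_nonneg)
    also have "\<dots> \<le> (norm v * h y) * B"
      using order_trans[OF sum_vec_nth_le_norm mult_left_mono[OF gh norm_ge_zero]] B eta_nonneg h0 by (intro mult_mono) auto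
    finally show "\<bar>\<Sum>j\<in>UNIV. v $ j * (g y $ j * eta z)\<bar> \<le> norm v * B * h y" by (simp add: mult_ac)
  qed
  also have "\<dots> \<le> (norm v * B) * (int_on h (cball x0 (r + norm (x - x0))) / r ^ CARD('n))"
    using B0 r by (intro mult_left_mono divide_right_mono int_on_mono[OF h h0] sub) auto
  finally show ?thesis using t(3) by (simp add: F_def v_def)
qed

text \<open>
  The derivative in \<open>s\<close> of \<open>s\<^sup>-\<^sup>n K(z/s)\<close> is minus \<open>s\<^sup>-\<^sup>n\<^sup>-\<^sup>1\<close> times the divergence of the field \<open>z K(z)\<close>, taken at
  \<open>z/s\<close>. Thus the dependence of a mollification on its radius can also be integrated by parts.
\<close>

lemma kconv_radius_derivative:
  fixes u :: "real ^ 'n::finite \<Rightarrow> real"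
  assumes K: "bump K" and u: "integrable lborel u" and s: "s0 > 0"
  shows "((\<lambda>s. kconv K s u x) has_real_derivative - (\<Sum>j\<in>UNIV. kconv (partial_deriv j (\<lambda>z. z $ j * K z)) s0 u x / s0)) (at s0)"
proof -
  define N where "N = CARD('n)"
  define k where "k s y = K ((1/s) *\<^sub>R (x - y)) / s ^ N" for s y
  define k' where "k' s y = - (1 / s ^ Suc N) * (\<Sum>j\<in>UNIV. partial_deriv j (\<lambda>z. z $ j * K z) ((1/s) *\<^sub>R (x - y)))" for s y
  have bj: "bump (partial_deriv j (\<lambda>z. z $ j * K z))" for j by (intro bump_partial_deriv bump_coord_mult K)
  have pdj: "partial_deriv j (\<lambda>z. z $ j * K z) z = z $ j * partial_deriv j K z + K z" for j z
    using K by (subst partial_deriv_mult) (simp_all add: partial_deriv_coord bump_def bump_alg_differentiable bump_alg.coord)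
  obtain B0 where B0: "B0 > 0" "\<And>z. \<bar>K z\<bar> \<le> B0" using bump_bounded[OF K] by blast
  have "\<exists>Bj. \<forall>j z. \<bar>partial_deriv j (\<lambda>z. z $ j * K z) z\<bar> \<le> Bj j"
  proof (intro choice allI)
    fix j show "\<exists>b. \<forall>z. \<bar>partial_deriv j (\<lambda>z. z $ j * K z) z\<bar> \<le> b" using bump_bounded[OF bj[of j]] by metis
  qed
  then obtain Bj where Bj: "\<And>j z. \<bar>partial_deriv j (\<lambda>z. z $ j * K z) z\<bar> \<le> Bj j" by blast
  have "((\<lambda>s. \<integral>y. u y * k s y \<partial>lborel) has_real_derivative (\<integral>y. u y * k' s0 y \<partial>lborel)) (at s0)"
  proof (rule DERIV_parametric_integral[OF u, where a="s0/2" and b="2 * s0"])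
    show "s0 \<in> {s0/2<..<2 * s0}" using s by simp
    fix t y assume t: "t \<in> {s0/2<..<2 * s0}"
    have t0: "t > 0" "t \<noteq> 0" "s0/2 \<le> t" using t s by auto
    have gam: "((\<lambda>t. (1/t) *\<^sub>R (x - y)) has_vector_derivative (- (1/t\<^sup>2)) *\<^sub>R (x - y)) (at t)"
    proof -
      have "((\<lambda>t. 1/t) has_real_derivative (- (1/t\<^sup>2))) (at t)"
        using t0 by (auto intro!: derivative_eq_intros simp: power2_eq_square)
      from has_vector_derivative_scaleR[OF this has_vector_derivative_const[of "x - y"]] show ?thesis by simp
    qed
    let ?z = "(1/t) *\<^sub>R (x - y)"
    have d1: "((\<lambda>t. K ((1/t) *\<^sub>R (x - y))) has_real_derivative (\<Sum>j\<in>UNIV. ((- (1/t\<^sup>2)) *\<^sub>R (x - y)) $ j * partial_deriv j K ?z)) (at t)"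
      by (rule bump_alg_curve[OF _ gam]) (use K in \<open>simp add: bump_def\<close>)
    have d2: "((\<lambda>t. 1 / t ^ N) has_real_derivative - (real N / t ^ Suc N)) (at t)"
    proof -
      have N: "N = Suc (N - 1)" by (simp add: N_def)
      have "((\<lambda>t. inverse (t ^ N)) has_real_derivative - (inverse (t ^ N) * (real N * t ^ (N - 1)) * inverse (t ^ N))) (at t)"
        using t0 by (auto intro!: derivative_eq_intros)
      moreover have "inverse (t ^ N) * (real N * t ^ (N - 1)) * inverse (t ^ N) = real N / t ^ Suc N"
        using t0 by (subst (1 3) N) (simp add: field_simps)
      ultimately show ?thesis by (simp add: inverse_eq_divide)
    qed
    have "((\<lambda>t. K ((1/t) *\<^sub>R (x - y)) * (1 / t ^ N)) has_real_derivative
       K ?z * (- (real N / t ^ Suc N)) + (\<Sum>j\<in>UNIV. ((- (1/t\<^sup>2)) *\<^sub>R (x - y)) $ j * partial_deriv j K ?z) * (1 / t ^ N)) (at t)"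
      by (rule DERIV_mult'[OF d1 d2])
    moreover have "K ?z * (- (real N / t ^ Suc N)) + (\<Sum>j\<in>UNIV. ((- (1/t\<^sup>2)) *\<^sub>R (x - y)) $ j * partial_deriv j K ?z) * (1 / t ^ N) = k' t y"
    proof -
      have "(\<Sum>j\<in>UNIV. ((- (1/t\<^sup>2)) *\<^sub>R (x - y)) $ j * partial_deriv j K ?z) = - (1/t) * (\<Sum>j\<in>UNIV. ?z $ j * partial_deriv j K ?z)"
        unfolding sum_distrib_left by (intro sum.cong refl) (simp add: power2_eq_square)
      moreover have "(\<Sum>j\<in>UNIV. partial_deriv j (\<lambda>z. z $ j * K z) ?z) = (\<Sum>j\<in>UNIV. ?z $ j * partial_deriv j K ?z) + real N * K ?z"
        unfolding pdj by (simp add: sum.distrib N_def)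
      ultimately show ?thesis unfolding k'_def using t0 by (simp add: field_simps)
    qed
    ultimately show "((\<lambda>t. k t y) has_real_derivative k' t y) (at t)" unfolding k_def by simp
    have p1: "(s0/2) ^ N \<le> t ^ N" "(s0/2) ^ Suc N \<le> t ^ Suc N" using t0 s by (intro power_mono; simp)+
    have p2: "(s0/2) ^ N > 0" "(s0/2) ^ Suc N > 0" using s by (intro zero_less_power; simp)+
    have "\<bar>k t y\<bar> = \<bar>K ?z\<bar> / t ^ N" using t0 by (simp add: k_def abs_divide)
    also have "\<dots> \<le> B0 / (s0/2) ^ N" using p1 p2 B0 by (intro frac_le) auto
    finally show "\<bar>k t y\<bar> \<le> B0 / (s0/2) ^ N" .
    have "\<bar>k' t y\<bar> = \<bar>\<Sum>j\<in>UNIV. partial_deriv j (\<lambda>z. z $ j * K z) ?z\<bar> / t ^ Suc N"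
      using t0 unfolding k'_def by (simp add: abs_mult abs_divide)
    also have "\<dots> \<le> (\<Sum>j\<in>UNIV. Bj j) / (s0/2) ^ Suc N"
    proof (intro frac_le p1 p2)
      show "\<bar>\<Sum>j\<in>UNIV. partial_deriv j (\<lambda>z. z $ j * K z) ?z\<bar> \<le> (\<Sum>j\<in>UNIV. Bj j)"
        by (rule order_trans[OF sum_abs sum_mono]) (rule Bj)
      show "0 \<le> (\<Sum>j\<in>UNIV. Bj j)" by (intro sum_nonneg order_trans[OF abs_ge_zero Bj])
    qed
    finally show "\<bar>k' t y\<bar> \<le> (\<Sum>j\<in>UNIV. Bj j) / (s0/2) ^ Suc N" .
  next
    show "k t \<in> borel_measurable borel" for t unfolding k_def[abs_def]
      by (intro borel_measurable_divide borel_measurable_const bump_affine_measurable K)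
    show "k' s0 \<in> borel_measurable borel" unfolding k'_def[abs_def]
      by (intro borel_measurable_times borel_measurable_sum borel_measurable_const bump_affine_measurable bj)
  qed
  moreover have "(\<lambda>s. \<integral>y. u y * k s y \<partial>lborel) = (\<lambda>s. kconv K s u x)"
    unfolding k_def kconv_def N_def by (simp add: integral_divide_zero[symmetric] del: integral_divide_zero)
  moreover have "(\<integral>y. u y * k' s0 y \<partial>lborel) = - (\<Sum>j\<in>UNIV. kconv (partial_deriv j (\<lambda>z. z $ j * K z)) s0 u x / s0)"
  proof -
    have "(\<integral>y. u y * k' s0 y \<partial>lborel) = (\<integral>y. - (1 / s0 ^ Suc N) * (\<Sum>j\<in>UNIV. u y * partial_deriv j (\<lambda>z. z $ j * K z) ((1/s0) *\<^sub>R (x - y))) \<partial>lborel)"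
      unfolding k'_def sum_distrib_left by (intro Bochner_Integration.integral_cong refl) (simp add: sum_distrib_left mult_ac)
    also have "\<dots> = - (1 / s0 ^ Suc N) * (\<Sum>j\<in>UNIV. \<integral>y. u y * partial_deriv j (\<lambda>z. z $ j * K z) ((1/s0) *\<^sub>R (x - y)) \<partial>lborel)"
      by (subst integral_mult_right_zero) (subst Bochner_Integration.integral_sum[OF kconv_integrable[OF bj u]], rule refl)
    also have "\<dots> = - (\<Sum>j\<in>UNIV. kconv (partial_deriv j (\<lambda>z. z $ j * K z)) s0 u x / s0)"
      unfolding kconv_def N_def by (simp add: sum_divide_distrib sum_negf mult_ac)
    finally show ?thesis .
  qed
  ultimately show ?thesis by simp
qed

text \<open>
  The mean value theorem in the radius. After integration by parts the derivative is a convolution of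
  the weak gradient with the kernels \<open>z\<^sub>j eta(z)\<close>, which live on the unit ball.
\<close>

lemma mollify_halving:
  fixes u :: "real ^ 'n::finite \<Rightarrow> real"
  assumes w: "weak_grad_on S u g" and h: "integrable lborel h" and gh: "\<And>y. norm (g y) \<le> h y"
    and r: "r > 0" and S: "cball x r \<subseteq> S" and B: "\<And>z::real^'n. eta z \<le> B"
  shows "\<bar>kconv eta r u x - kconv eta (r/2) u x\<bar> \<le> 2 ^ CARD('n) * B * r * (int_on h (cball x r) / r ^ CARD('n))"
proof -
  have h0: "h y \<ge> 0" for y using gh[of y] norm_ge_zero order_trans by blast
  have u: "integrable lborel u" and g: "\<And>j. integrable lborel (\<lambda>x. g x $ j)" using w by (auto simp: weak_grad_on_def)
  have B0: "B \<ge> 0" using B[of 0] eta_nonneg[of "0::real^'n"] by linarith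
  define F' where "F' s = - (\<Sum>j\<in>UNIV. kconv (partial_deriv j (\<lambda>z. z $ j * eta z)) s u x / s)" for s
  obtain s where s: "r/2 < s" "s < r" "kconv eta r u x - kconv eta (r/2) u x = (r - r/2) * F' s"
    using MVT2[of "r/2" r "\<lambda>s. kconv eta s u x" F'] kconv_radius_derivative[OF eta_bump u] r unfolding F'_def by auto
  have s0: "s > 0" using s r by linarith
  have sub: "cball x s \<subseteq> cball x r" using s by auto
  have "F' s = (\<Sum>j\<in>UNIV. - 1 * kconv (\<lambda>z. z $ j * eta z) s (\<lambda>y. g y $ j) x)"
    unfolding F'_def using kconv_weak_grad[OF w bump_coord_mult[OF eta_bump] s0 order_trans[OF sub S]] by (simp add: sum_negf)
  also have "\<bar>\<dots>\<bar> \<le> B * (int_on h (cball x s) / s ^ CARD('n))"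
  proof (rule kconv_sum_bound[OF bump_coord_mult[OF eta_bump] g h h0 s0])
    fix y z :: "real ^ 'n" assume z: "norm z \<le> 1"
    have "(\<Sum>j\<in>UNIV. - 1 * (g y $ j * (z $ j * eta z))) = - ((\<Sum>j\<in>UNIV. g y $ j * z $ j) * eta z)"
      by (simp add: sum_distrib_right mult.assoc sum_negf)
    then have "\<bar>\<Sum>j\<in>UNIV. - 1 * (g y $ j * (z $ j * eta z))\<bar> = \<bar>\<Sum>j\<in>UNIV. g y $ j * z $ j\<bar> * eta z"
      by (simp add: abs_mult eta_nonneg)
    also have "\<dots> \<le> h y * B"
    proof (intro mult_mono B)
      have "\<bar>\<Sum>j\<in>UNIV. g y $ j * z $ j\<bar> \<le> norm (g y) * norm z" by (rule sum_vec_nth_le_norm)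
      also have "\<dots> \<le> h y * 1" using gh z h0 by (intro mult_mono) auto
      finally show "\<bar>\<Sum>j\<in>UNIV. g y $ j * z $ j\<bar> \<le> h y" by simp
    qed (auto simp: h0 eta_nonneg)
    finally show "\<bar>\<Sum>j\<in>UNIV. - 1 * (g y $ j * (z $ j * eta z))\<bar> \<le> B * h y" by (simp add: mult.commute)
  qed
  also have "\<dots> \<le> B * (int_on h (cball x r) / (r/2) ^ CARD('n))"
  proof (intro mult_left_mono frac_le B0)
    show "int_on h (cball x s) \<le> int_on h (cball x r)" by (intro int_on_mono[OF h h0] sub) auto
    show "(r/2) ^ CARD('n) \<le> s ^ CARD('n)" using s r by (intro power_mono) auto
  qed (use r int_on_nonneg[OF h h0] in auto)
  finally have "\<bar>F' s\<bar> \<le> 2 ^ CARD('n) * B * (int_on h (cball x r) / r ^ CARD('n))"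
    by (simp add: power_divide mult_ac)
  then have "r * \<bar>F' s\<bar> \<le> r * (2 ^ CARD('n) * B * (int_on h (cball x r) / r ^ CARD('n)))" using r by (intro mult_left_mono) auto
  moreover have "\<bar>kconv eta r u x - kconv eta (r/2) u x\<bar> \<le> r * \<bar>F' s\<bar>" unfolding s(3) abs_mult using r by (intro mult_right_mono) auto
  ultimately show ?thesis by (simp add: mult_ac)
qed

section \<open>A Sobolev-Poincare inequality with constant independent of the target dimension\<close>

text \<open>
  Reduces estimates of vectors in \<open>\<real>\<^sup>m\<close> to scalar ones without a factor depending on \<open>m\<close>.
\<close>

lemma L2_set_dual:
  assumes "\<And>e. L2_set e {..<m} \<le> 1 \<Longrightarrow> \<bar>\<Sum>i<m. e i * a i\<bar> \<le> b" and b: "b \<ge> 0"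
  shows "L2_set a {..<m::nat} \<le> b"
proof (cases "L2_set a {..<m} = 0")
  case False
  define n where "n = L2_set a {..<m}"
  have n: "n > 0" using False L2_set_nonneg[of a "{..<m}"] unfolding n_def by linarith
  have nn: "n * n = (\<Sum>i<m. a i * a i)"
    unfolding n_def L2_set_def by (simp add: sum_nonneg power2_eq_square)
  define e where "e i = a i / n" for i
  have "L2_set e {..<m} = 1"
  proof -
    have "L2_set (\<lambda>i. (1/n) * a i) {..<m} = (1/n) * n"
      unfolding n_def using n by (subst L2_set_right_distrib[symmetric]) (auto simp: n_def)
    then show ?thesis using n by (simp add: e_def[abs_def])
  qed
  then have "\<bar>\<Sum>i<m. e i * a i\<bar> \<le> b" using assms(1)[of e] by simp
  moreover have "(\<Sum>i<m. e i * a i) = n"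
  proof -
    have "(\<Sum>i<m. e i * a i) = (\<Sum>i<m. a i * a i) / n" by (simp add: e_def sum_divide_distrib)
    then show ?thesis using n nn[symmetric] by simp
  qed
  ultimately show ?thesis using n by (simp add: n_def)
qed (use b in simp)

lemma weak_grad_on_sum:
  assumes w: "\<And>i. i < m \<Longrightarrow> weak_grad_on S (U i) (G i)"
  shows "weak_grad_on S (\<lambda>x. \<Sum>i<m::nat. e i * U i x) (\<lambda>x. \<Sum>i<m. e i *\<^sub>R G i x)"
  unfolding weak_grad_on_def
proof (intro conjI allI impI)
  have u: "integrable lborel (U i)" and g: "integrable lborel (\<lambda>x. G i x $ j)" if "i < m" for i j
    using w[OF that] by (auto simp: weak_grad_on_def)
  show "integrable lborel (\<lambda>x. \<Sum>i<m. e i * U i x)"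
    by (intro Bochner_Integration.integrable_sum integrable_mult_right u) simp
  show "integrable lborel (\<lambda>x. (\<Sum>i<m. e i *\<^sub>R G i x) $ j)" for j
    by (simp only: sum_component vector_scaleR_component real_scaleR_def)
       (intro Bochner_Integration.integrable_sum integrable_mult_right g, simp)
  fix \<phi> :: "real ^ 'a \<Rightarrow> real" and j assume t: "test_fun S \<phi>"
  have C01: "C_diff 1 \<phi>" "C_diff 0 \<phi>" using t by (simp_all add: test_fun_def)
  have pdc: "continuous_on UNIV (partial_deriv j \<phi>)" using C01(1) by (simp add: partial_deriv_def)
  have phc: "continuous_on UNIV \<phi>" using C01(2) by simp
  define C where "C = closure {x. \<phi> x \<noteq> 0}"
  have C: "compact C" using t by (simp add: test_fun_def C_def)
  have z1: "\<phi> x = 0" if "x \<notin> C" for x using that closure_subset[of "{x. \<phi> x \<noteq> 0}"] by (auto simp: C_def)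
  have z2: "partial_deriv j \<phi> x = 0" if "x \<notin> C" for x
    using compact_imp_closed[OF C] z1 that by (rule partial_deriv_zero_outside)
  have bd: "\<exists>B. \<forall>x. \<bar>f x\<bar> \<le> B" if f: "continuous_on UNIV f" "\<And>x. x \<notin> C \<Longrightarrow> f x = 0" for f :: "real ^ 'a \<Rightarrow> real"
  proof -
    have "bounded (f ` C)" using C f(1) by (intro compact_imp_bounded compact_continuous_image) (auto intro: continuous_on_subset)
    then obtain B where B: "B > 0" "\<And>x. x \<in> C \<Longrightarrow> \<bar>f x\<bar> \<le> B" by (auto simp: bounded_pos)
    have "\<bar>f x\<bar> \<le> B" for x using B f(2) by (cases "x \<in> C") auto
    then show ?thesis by blast
  qed
  have mi: "integrable lborel (\<lambda>x. u x * f x)" if u: "integrable lborel u" and f: "continuous_on UNIV f" "\<And>x. x \<notin> C \<Longrightarrow> f x = 0" for u f :: "real ^ 'a \<Rightarrow> real"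
  proof -
    obtain B where B: "\<And>x. \<bar>f x\<bar> \<le> B" using bd[OF f] by blast
    have fm: "f \<in> borel_measurable borel" using f(1) by (rule borel_measurable_continuous_onI)
    show ?thesis
    proof (rule Bochner_Integration.integrable_bound[where f="\<lambda>y. B * u y"])
      have "\<bar>u y\<bar> * \<bar>f y\<bar> \<le> \<bar>B\<bar> * \<bar>u y\<bar>" for y
        using mult_left_mono[OF order_trans[OF B[of y] abs_ge_self], of "\<bar>u y\<bar>"] by (simp add: mult.commute)
      then show "AE y in lborel. norm (u y * f y) \<le> norm (B * u y)" by (simp add: abs_mult)
    qed (use u fm in auto)
  qed
  have "(\<integral>x. (\<Sum>i<m. e i * U i x) * partial_deriv j \<phi> x \<partial>lborel) = (\<integral>x. (\<Sum>i<m. e i * (U i x * partial_deriv j \<phi> x)) \<partial>lborel)"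
    by (simp add: sum_distrib_right mult.assoc)
  also have "\<dots> = (\<Sum>i<m. e i * (\<integral>x. U i x * partial_deriv j \<phi> x \<partial>lborel))"
    by (subst Bochner_Integration.integral_sum) (auto intro!: integrable_mult_right mi u pdc z2)
  also have "\<dots> = (\<Sum>i<m. - (e i * (\<integral>x. G i x $ j * \<phi> x \<partial>lborel)))"
    using w t by (intro sum.cong refl) (simp add: weak_grad_on_def)
  also have "\<dots> = - (\<Sum>i<m. e i * (\<integral>x. G i x $ j * \<phi> x \<partial>lborel))" by (rule sum_negf)
  also have "(\<Sum>i<m. e i * (\<integral>x. G i x $ j * \<phi> x \<partial>lborel)) = (\<integral>x. (\<Sum>i<m. e i * (G i x $ j * \<phi> x)) \<partial>lborel)"
    by (subst Bochner_Integration.integral_sum) (auto intro!: integrable_mult_right mi g phc z1)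
  also have "\<dots> = (\<integral>x. (\<Sum>i<m. e i *\<^sub>R G i x) $ j * \<phi> x \<partial>lborel)"
    by (simp add: sum_distrib_right mult.assoc)
  finally show "(\<integral>x. (\<Sum>i<m. e i * U i x) * partial_deriv j \<phi> x \<partial>lborel) = - (\<integral>x. (\<Sum>i<m. e i *\<^sub>R G i x) $ j * \<phi> x \<partial>lborel)" .
qed

definition hs_norm :: "nat \<Rightarrow> (nat \<Rightarrow> real ^ 'n::finite) \<Rightarrow> real" where
  "hs_norm m A = L2_set (\<lambda>i. norm (A i)) {..<m}"

lemma hs_norm_nonneg: "hs_norm m A \<ge> 0"
  by (simp add: hs_norm_def)

text \<open>
  The scalar function \<open>\<Sum>i<m. e i * U i x\<close> has as its gradient the combination on the left; so all
  functions arising from unit vectors \<open>e\<close> have the common gradient bound \<open>hs_norm\<close>.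
\<close>

lemma norm_row_combination:
  assumes "L2_set e {..<m} \<le> 1"
  shows "norm (\<Sum>i<m. e i *\<^sub>R A i) \<le> hs_norm m A"
proof -
  have "norm (\<Sum>i<m. e i *\<^sub>R A i) \<le> (\<Sum>i<m. \<bar>e i\<bar> * \<bar>norm (A i)\<bar>)"
    by (rule order_trans[OF norm_sum]) simp
  also have "\<dots> \<le> L2_set e {..<m} * hs_norm m A"
    unfolding hs_norm_def by (rule L2_set_mult_ineq)
  also have "\<dots> \<le> 1 * hs_norm m A" using assms hs_norm_nonneg by (intro mult_right_mono)
  finally show ?thesis by simp
qed

lemma hs_norm_integrable:
  assumes "\<And>i. i < m \<Longrightarrow> weak_grad_on S (U i) (G i)"
  shows "integrable lborel (\<lambda>x. hs_norm m (\<lambda>i. G i x))"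
proof -
  have g: "integrable lborel (\<lambda>x. G i x $ j)" if "i < m" for i j using assms[OF that] by (auto simp: weak_grad_on_def)
  have gm: "(\<lambda>x. G i x $ j) \<in> borel_measurable borel" if "i < m" for i j using g[OF that, of j] by auto
  show ?thesis
  proof (rule Bochner_Integration.integrable_bound[where f="\<lambda>x. \<Sum>i<m. \<Sum>j\<in>UNIV. \<bar>G i x $ j\<bar>"])
    show "integrable lborel (\<lambda>x. \<Sum>i<m. \<Sum>j\<in>UNIV. \<bar>G i x $ j\<bar>)"
      by (intro Bochner_Integration.integrable_sum integrable_abs g) simp
    show "(\<lambda>x. hs_norm m (\<lambda>i. G i x)) \<in> borel_measurable lborel"
      unfolding hs_norm_def L2_set_def norm_vec_def using gm
      by (intro measurable_compose[OF _ borel_measurable_sqrt] borel_measurable_sum borel_measurable_power measurable_compose[OF _ borel_measurable_norm]) auto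
    have "hs_norm m (\<lambda>i. G i x) \<le> (\<Sum>i<m. \<Sum>j\<in>UNIV. \<bar>G i x $ j\<bar>)" for x
      unfolding hs_norm_def by (rule order_trans[OF L2_set_le_sum]) (auto intro!: sum_mono norm_le_l1_cart)
    then show "AE x in lborel. norm (hs_norm m (\<lambda>i. G i x)) \<le> norm (\<Sum>i<m. \<Sum>j\<in>UNIV. \<bar>G i x $ j\<bar>)"
      unfolding real_norm_def abs_of_nonneg[OF hs_norm_nonneg] by (intro AE_I2) (rule order_trans[OF _ abs_ge_self])
  qed
qed

lemma kconv_sum:
  assumes "bump K" "\<And>i. i < m \<Longrightarrow> integrable lborel (U i)"
  shows "kconv K r (\<lambda>x. \<Sum>i<m::nat. e i * U i x) x = (\<Sum>i<m. e i * kconv K r (U i) x)"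
proof -
  have "(\<integral>y. (\<Sum>i<m. e i * U i y) * K ((1/r) *\<^sub>R (x - y)) \<partial>lborel) = (\<integral>y. (\<Sum>i<m. e i * (U i y * K ((1/r) *\<^sub>R (x - y)))) \<partial>lborel)"
    by (simp add: sum_distrib_right mult.assoc)
  also have "\<dots> = (\<Sum>i<m. e i * (\<integral>y. U i y * K ((1/r) *\<^sub>R (x - y)) \<partial>lborel))"
    by (subst Bochner_Integration.integral_sum) (auto intro!: integrable_mult_right kconv_integrable assms simp del: scaleR_right_diff_distrib)
  finally show ?thesis unfolding kconv_def by (simp only: sum_divide_distrib times_divide_eq_right)
qed

context
  fixes m :: nat and S :: "(real ^ 'n::finite) set" and U G and B :: real
  assumes w: "\<And>i. i < m \<Longrightarrow> weak_grad_on S (U i) (G i)" and B: "\<And>z::real^'n. eta z \<le> B"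
begin

private lemma B0: "B \<ge> 0" using B[of 0] eta_nonneg[of "0::real^'n"] by linarith

lemma mollify_halving_vec:
  assumes r: "r > 0" and S: "cball x r \<subseteq> S"
  shows "L2_set (\<lambda>i. kconv eta r (U i) x - kconv eta (r/2) (U i) x) {..<m}
    \<le> 2 ^ CARD('n) * B * r * (int_on (\<lambda>y. hs_norm m (\<lambda>i. G i y)) (cball x r) / r ^ CARD('n))"
proof (rule L2_set_dual)
  have u: "integrable lborel (U i)" if "i < m" for i using w[OF that] by (simp add: weak_grad_on_def)
  fix e assume e: "L2_set e {..<m} \<le> 1"
  have ksum: "kconv eta s (\<lambda>x. \<Sum>i<m. e i * U i x) y = (\<Sum>i<m. e i * kconv eta s (U i) y)" for s y
    by (rule kconv_sum[OF eta_bump u])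
  show "\<bar>\<Sum>i<m. e i * (kconv eta r (U i) x - kconv eta (r/2) (U i) x)\<bar>
     \<le> 2 ^ CARD('n) * B * r * (int_on (\<lambda>y. hs_norm m (\<lambda>i. G i y)) (cball x r) / r ^ CARD('n))"
    using mollify_halving[OF weak_grad_on_sum[where U=U and G=G and e=e and m=m and S=S, OF w] hs_norm_integrable[where U=U and G=G and m=m and S=S, OF w]
        norm_row_combination[where A="\<lambda>i. G i _", OF e] r S B]
    unfolding ksum by (simp add: right_diff_distrib sum_subtractf)
next
  show "0 \<le> 2 ^ CARD('n) * B * r * (int_on (\<lambda>y. hs_norm m (\<lambda>i. G i y)) (cball x r) / r ^ CARD('n))"
    using B0 r int_on_nonneg[OF hs_norm_integrable[where U=U and G=G and m=m and S=S, OF w] hs_norm_nonneg] by (intro mult_nonneg_nonneg divide_nonneg_nonneg) auto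
qed

lemma mollify_lipschitz_vec:
  assumes r: "r > 0" and S: "cball x0 (r + norm (x - x0)) \<subseteq> S"
  shows "L2_set (\<lambda>i. kconv eta r (U i) x - kconv eta r (U i) x0) {..<m}
    \<le> norm (x - x0) * B * (int_on (\<lambda>y. hs_norm m (\<lambda>i. G i y)) (cball x0 (r + norm (x - x0))) / r ^ CARD('n))"
proof (rule L2_set_dual)
  have u: "integrable lborel (U i)" if "i < m" for i using w[OF that] by (simp add: weak_grad_on_def)
  fix e assume e: "L2_set e {..<m} \<le> 1"
  have ksum: "kconv eta s (\<lambda>x. \<Sum>i<m. e i * U i x) y = (\<Sum>i<m. e i * kconv eta s (U i) y)" for s y
    by (rule kconv_sum[OF eta_bump u])
  show "\<bar>\<Sum>i<m. e i * (kconv eta r (U i) x - kconv eta r (U i) x0)\<bar>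
     \<le> norm (x - x0) * B * (int_on (\<lambda>y. hs_norm m (\<lambda>i. G i y)) (cball x0 (r + norm (x - x0))) / r ^ CARD('n))"
    using mollify_lipschitz[OF weak_grad_on_sum[where U=U and G=G and e=e and m=m and S=S, OF w] hs_norm_integrable[where U=U and G=G and m=m and S=S, OF w]
        norm_row_combination[where A="\<lambda>i. G i _", OF e] r S B]
    unfolding ksum by (simp add: right_diff_distrib sum_subtractf)
next
  show "0 \<le> norm (x - x0) * B * (int_on (\<lambda>y. hs_norm m (\<lambda>i. G i y)) (cball x0 (r + norm (x - x0))) / r ^ CARD('n))"
    using B0 r int_on_nonneg[OF hs_norm_integrable[where U=U and G=G and m=m and S=S, OF w] hs_norm_nonneg] by (intro mult_nonneg_nonneg divide_nonneg_nonneg) auto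
qed

end

lemma content_cball_scale:
  fixes x :: "'a::euclidean_space"
  assumes "r \<ge> 0"
  shows "measure lborel (cball x r) = measure lborel (ball (0::'a) 1) * r ^ DIM('a)"
  using assms by (simp add: content_cball content_ball)

text \<open>
  Jensen's inequality for means over balls; \<open>w\<close> appears since the integrals are divided by \<open>r\<^sup>N\<close> instead
  of the volume of the ball.
\<close>

lemma average_jensen:
  fixes f :: "'a::euclidean_space \<Rightarrow> real"
  defines "w \<equiv> measure lborel (ball (0::'a) 1)"
  assumes f: "integrable lborel f" "\<And>y. f y \<ge> 0" and fq: "integrable lborel (\<lambda>y. f y powr q)"
    and q: "1 \<le> q" and r: "r > 0" and p: "p \<ge> 0"
  shows "(int_on f (cball x r) / r ^ DIM('a)) powr p \<le> w powr ((q - 1) * p / q) * (int_on (\<lambda>y. f y powr q) (cball x r) / r ^ DIM('a)) powr (p / q)"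
proof -
  define N where "N = DIM('a)"
  have w: "w > 0" by (simp add: w_def)
  have rN: "r ^ N > 0" using r by simp
  define M where "M = int_on f (cball x r) / (w * r ^ N)"
  have fn: "int_on f (cball x r) \<ge> 0" by (rule int_on_nonneg[OF f])
  have fqn: "int_on (\<lambda>y. f y powr q) (cball x r) \<ge> 0" by (rule int_on_nonneg[OF fq]) simp
  have M: "M \<ge> 0" using fn w rN by (simp add: M_def)
  have ib: "integrable lborel (\<lambda>y. indicator (cball x r) y :: real)"
    using emeasure_lborel_cball_finite by (intro integrable_real_indicator) auto
  have i1: "integrable lborel (\<lambda>y. indicator (cball x r) y * f y)" by (rule int_on_integrable[OF f]) simp
  have i2: "integrable lborel (\<lambda>y. indicator (cball x r) y * f y powr q)" by (rule int_on_integrable[OF fq]) auto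
  have "(\<integral>y. M powr q * indicator (cball x r) y + q * M powr (q - 1) * (indicator (cball x r) y * f y - M * indicator (cball x r) y) \<partial>lborel)
      \<le> (\<integral>y. indicator (cball x r) y * f y powr q \<partial>lborel)"
  proof (rule integral_mono)
    fix y show "M powr q * indicator (cball x r) y + q * M powr (q - 1) * (indicator (cball x r) y * f y - M * indicator (cball x r) y)
        \<le> indicator (cball x r) y * f y powr q"
      using powr_tangent[OF M f(2) q, of y] by (auto simp: indicator_def)
  qed (use ib i1 i2 in auto)
  moreover have "(\<integral>y. M powr q * indicator (cball x r) y + q * M powr (q - 1) * (indicator (cball x r) y * f y - M * indicator (cball x r) y) \<partial>lborel)
     = M powr q * (w * r ^ N) + q * M powr (q - 1) * (int_on f (cball x r) - M * (w * r ^ N))"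
    using ib i1 content_cball_scale[of r x] r by (simp add: int_on_def w_def N_def)
  moreover have "M * (w * r ^ N) = int_on f (cball x r)"
  proof -
    have "w * r ^ N \<noteq> 0" using mult_pos_pos[OF w rN] less_irrefl by metis
    then show ?thesis unfolding M_def by (rule nonzero_eq_divide_eq[THEN iffD1, OF _ refl])
  qed
  ultimately have "M powr q * (w * r ^ N) \<le> int_on (\<lambda>y. f y powr q) (cball x r)" by (simp add: int_on_def)
  then have Mq: "M powr q \<le> int_on (\<lambda>y. f y powr q) (cball x r) / r ^ N / w" using w rN by (simp add: field_simps)
  have "int_on f (cball x r) / r ^ N = w * M" using w unfolding M_def by simp
  then have "(int_on f (cball x r) / r ^ N) powr p = (w * M) powr p" by simp
  also have "\<dots> = w powr p * (M powr q) powr (p / q)" using w M q by (simp add: powr_mult powr_powr)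
  also have "\<dots> \<le> w powr p * (int_on (\<lambda>y. f y powr q) (cball x r) / r ^ N / w) powr (p / q)"
    using Mq p q by (intro mult_left_mono powr_mono2) auto
  also have "\<dots> = w powr p * ((int_on (\<lambda>y. f y powr q) (cball x r) / r ^ N) powr (p / q) / w powr (p / q))"
    using w rN fqn by (subst powr_divide) auto
  also have "\<dots> = w powr (p - p / q) * (int_on (\<lambda>y. f y powr q) (cball x r) / r ^ N) powr (p / q)"
    by (simp add: powr_diff)
  also have "p - p / q = (q - 1) * p / q" using q by (simp add: field_simps)
  finally show ?thesis by (simp add: N_def)
qed

text \<open>
  Each term is at most \<open>2\<^sup>-\<^sup>j\<^sup>\<gamma>\<close> times the \<open>1/p\<close>-th power of the weighted sum on the right, and these
  factors sum up to the constant. The point is that it does not depend on \<open>k\<close>.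
\<close>

lemma sum_powr_le_weighted:
  fixes t :: "nat \<Rightarrow> real"
  assumes t: "\<And>j. t j \<ge> 0" and p: "p > 0" and g: "\<gamma> > 0"
  shows "(\<Sum>j<k. t j) powr p \<le> (1 / (1 - 2 powr (- \<gamma>))) powr p * (\<Sum>j<k. 2 powr (j * \<gamma> * p) * t j powr p)"
proof -
  define Z where "Z = (\<Sum>j<k. 2 powr (j * \<gamma> * p) * t j powr p)"
  define x where "x = 2 powr (- \<gamma>)"
  have x: "0 < x" "x < 1" using g by (auto simp: x_def powr_less_one)
  have Z: "Z \<ge> 0" by (simp add: Z_def sum_nonneg)
  have tj: "t j \<le> x ^ j * Z powr (1/p)" if j: "j < k" for j
  proof -
    have "2 powr (j * \<gamma> * p) * t j powr p \<le> Z"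
      unfolding Z_def using j by (intro member_le_sum) auto
    then have "(2 powr (j * \<gamma> * p) * t j powr p) powr (1/p) \<le> Z powr (1/p)" using p by (intro powr_mono2) auto
    moreover have "(2 powr (j * \<gamma> * p) * t j powr p) powr (1/p) = 2 powr (j * \<gamma>) * t j"
      using p t by (simp add: powr_mult powr_powr)
    ultimately have a: "2 powr (j * \<gamma>) * t j \<le> Z powr (1/p)" by (simp only:)
    have "x ^ j * 2 powr (j * \<gamma>) = 2 powr (- \<gamma> * j + j * \<gamma>)"
      unfolding powr_add by (simp add: x_def powr_power mult.commute)
    then have one: "x ^ j * 2 powr (j * \<gamma>) = 1" by (simp add: mult.commute)
    have "t j = (x ^ j * 2 powr (j * \<gamma>)) * t j" unfolding one by simp
    also have "\<dots> = x ^ j * (2 powr (j * \<gamma>) * t j)" by (rule mult.assoc)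
    also have "\<dots> \<le> x ^ j * Z powr (1/p)" using x by (intro mult_left_mono[OF a]) auto
    finally show ?thesis .
  qed
  have "(\<Sum>j<k. t j) \<le> (\<Sum>j<k. x ^ j * Z powr (1/p))" by (intro sum_mono tj) simp
  also have "\<dots> = (\<Sum>j<k. x ^ j) * Z powr (1/p)" by (simp add: sum_distrib_right)
  also have "(\<Sum>j<k. x ^ j) \<le> (\<Sum>j. x ^ j)" using x by (intro sum_le_suminf summable_geometric) auto
  also have "(\<Sum>j. x ^ j) = 1 / (1 - x)" using x by (intro suminf_geometric) auto
  finally have "(\<Sum>j<k. t j) \<le> 1 / (1 - x) * Z powr (1/p)" by (simp add: mult_right_mono)
  then have "(\<Sum>j<k. t j) powr p \<le> (1 / (1 - x) * Z powr (1/p)) powr p"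
    using t p by (intro powr_mono2 sum_nonneg) auto
  also have "\<dots> = (1 / (1 - x)) powr p * Z" using x p Z by (simp add: powr_mult powr_powr powr_divide)
  finally show ?thesis by (simp add: Z_def x_def)
qed

lemma int_on_cball_measurable:
  fixes f :: "'a::euclidean_space \<Rightarrow> real"
  assumes [measurable]: "f \<in> borel_measurable borel"
  shows "(\<lambda>x. int_on f (cball x r)) \<in> borel_measurable borel"
proof -
  have "(\<lambda>x. int_on f (cball x r)) = (\<lambda>x. \<integral>y. (if dist x y \<le> r then f y else 0) \<partial>lborel)"
    unfolding int_on_def by (intro ext Bochner_Integration.integral_cong) (auto simp: indicator_def)
  also have "\<dots> \<in> borel_measurable borel" by measurable
  finally show ?thesis .
qed

text \<open>
  Fubini: each \<open>y\<close> lies in \<open>cball x r\<close> for \<open>x\<close> in a set of volume at most \<open>w r\<^sup>N\<close>.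
\<close>

lemma nn_integral_ball_averages:
  fixes f :: "'a::euclidean_space \<Rightarrow> real"
  assumes f: "integrable lborel f" "\<And>y. f y \<ge> 0" and r: "0 \<le> r" "r \<le> \<rho>"
  shows "(\<integral>\<^sup>+x. ennreal (int_on f (cball x r)) * indicator (cball x0 \<rho>) x \<partial>lborel)
     \<le> ennreal (measure lborel (ball (0::'a) 1) * r ^ DIM('a) * int_on f (cball x0 (2 * \<rho>)))"
proof -
  have [measurable]: "f \<in> borel_measurable borel" using f by auto
  let ?C = "cball x0 (2 * \<rho>)"
  have nn: "ennreal (int_on f S) = (\<integral>\<^sup>+y. ennreal (indicator S y * f y) \<partial>lborel)" if "S \<in> sets borel" for S
    unfolding int_on_def by (rule nn_integral_eq_integral[symmetric, OF int_on_integrable[OF f that]]) (simp add: f(2))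
  have "(\<integral>\<^sup>+x. ennreal (int_on f (cball x r)) * indicator (cball x0 \<rho>) x \<partial>lborel)
    \<le> (\<integral>\<^sup>+x. (\<integral>\<^sup>+y. ennreal (indicator ?C y * f y) * (if dist x y \<le> r then 1 else 0) \<partial>lborel) \<partial>lborel)"
  proof (rule nn_integral_mono)
    fix x
    show "ennreal (int_on f (cball x r)) * indicator (cball x0 \<rho>) x \<le> (\<integral>\<^sup>+y. ennreal (indicator ?C y * f y) * (if dist x y \<le> r then 1 else 0) \<partial>lborel)"
    proof (cases "x \<in> cball x0 \<rho>")
      case True
      have "ennreal (int_on f (cball x r)) = (\<integral>\<^sup>+y. ennreal (indicator (cball x r) y * f y) \<partial>lborel)" by (rule nn) simp
      also have "\<dots> \<le> (\<integral>\<^sup>+y. ennreal (indicator ?C y * f y) * (if dist x y \<le> r then 1 else 0) \<partial>lborel)"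
      proof (rule nn_integral_mono)
        fix y
        have "y \<in> ?C" if "dist x y \<le> r" using that True r dist_triangle[of x0 y x] by simp
        then show "ennreal (indicator (cball x r) y * f y) \<le> ennreal (indicator ?C y * f y) * (if dist x y \<le> r then 1 else 0)"
          by (auto simp: indicator_def)
      qed
      finally show ?thesis using True by simp
    qed simp
  qed
  also have "\<dots> = (\<integral>\<^sup>+y. (\<integral>\<^sup>+x. ennreal (indicator ?C y * f y) * (if dist x y \<le> r then 1 else 0) \<partial>lborel) \<partial>lborel)"
    by (rule lborel_pair.Fubini'[symmetric]) measurable
  also have "\<dots> = (\<integral>\<^sup>+y. ennreal (indicator ?C y * f y) * ennreal (measure lborel (ball (0::'a) 1) * r ^ DIM('a)) \<partial>lborel)"
  proof (intro nn_integral_cong)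
    fix y :: 'a
    have "(\<integral>\<^sup>+x. ennreal (indicator ?C y * f y) * (if dist x y \<le> r then 1 else 0) \<partial>lborel) = ennreal (indicator ?C y * f y) * (\<integral>\<^sup>+x. (if dist x y \<le> r then 1 else 0) \<partial>lborel)"
      by (rule nn_integral_cmult) measurable
    also have "(\<integral>\<^sup>+x. (if dist x y \<le> r then 1 else 0) \<partial>lborel) = (\<integral>\<^sup>+x. indicator (cball y r) x \<partial>lborel)"
      by (intro nn_integral_cong) (auto simp: indicator_def dist_commute)
    also have "\<dots> = ennreal (measure lborel (cball y r))"
      using emeasure_lborel_cball_finite[of y r] by (simp add: emeasure_eq_ennreal_measure less_top[symmetric])
    finally show "(\<integral>\<^sup>+x. ennreal (indicator ?C y * f y) * (if dist x y \<le> r then 1 else 0) \<partial>lborel) = ennreal (indicator ?C y * f y) * ennreal (measure lborel (ball (0::'a) 1) * r ^ DIM('a))"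
      using content_cball_scale[OF r(1), of y] by simp
  qed
  also have "\<dots> = (\<integral>\<^sup>+y. ennreal (indicator ?C y * f y) \<partial>lborel) * ennreal (measure lborel (ball (0::'a) 1) * r ^ DIM('a))"
    by (rule nn_integral_multc) measurable
  also have "\<dots> = ennreal (measure lborel (ball (0::'a) 1) * r ^ DIM('a) * int_on f ?C)"
    using r int_on_nonneg[OF f, of ?C] by (subst nn[symmetric]) (auto simp: ennreal_mult mult.commute)
  finally show ?thesis .
qed

lemma powr_add_le: "a \<ge> 0 \<Longrightarrow> b \<ge> 0 \<Longrightarrow> p > 0 \<Longrightarrow> (a + b) powr p \<le> 2 powr p * (a powr p + b powr p)" for a b p :: real
proof -
  assume ab: "a \<ge> 0" "b \<ge> 0" "p > 0"
  have "(a + b) powr p \<le> (2 * max a b) powr p" using ab by (intro powr_mono2) auto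
  also have "\<dots> = 2 powr p * (max a b) powr p" using ab by (simp add: powr_mult)
  also have "\<dots> \<le> 2 powr p * (a powr p + b powr p)" by (intro mult_left_mono) (auto simp: max_def)
  finally show ?thesis .
qed

lemma L2_set_telescope:
  "L2_set (\<lambda>i. v 0 i - v k i) {..<m::nat} \<le> (\<Sum>j<k. L2_set (\<lambda>i. v j i - v (Suc j) i) {..<m})"
proof (induction k)
  case (Suc k)
  have "L2_set (\<lambda>i. (v 0 i - v k i) + (v k i - v (Suc k) i)) {..<m} \<le> L2_set (\<lambda>i. v 0 i - v k i) {..<m} + L2_set (\<lambda>i. v k i - v (Suc k) i) {..<m}"
    by (rule L2_set_triangle_ineq)
  then show ?case using Suc by simp
qed (simp add: L2_set_def)

text \<open>
  Jensen's inequality raises the mean of \<open>h\<close> to the power \<open>p/q\<close> of the integral of \<open>h\<^sup>q\<close>. Only one factor of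
  this integral has to remain local for the later integration in \<open>x\<close>; the other \<open>p/q - 1\<close> powers are
  estimated by the integral \<open>I\<close> over a larger ball.
\<close>

lemma halving_average_powr:
  fixes p q :: real and \<rho> \<kappa> :: real and h :: "'a::euclidean_space \<Rightarrow> real"
  defines "w \<equiv> measure lborel (ball (0::'a) 1)" and "N \<equiv> DIM('a)"
  assumes q: "1 \<le> q" "q \<le> p" and h: "integrable lborel h" "\<And>y. h y \<ge> 0" and hq: "integrable lborel (\<lambda>y. h y powr q)"
    and r: "r > 0" and k: "\<kappa> \<ge> 0" and I: "int_on (\<lambda>y. h y powr q) (cball x r) \<le> I"
  shows "(\<kappa> * r * (int_on h (cball x r) / r ^ N)) powr p \<le>
    \<kappa> powr p * w powr ((q - 1) * p / q) * r powr (p - real N * p / q) * I powr (p / q - 1) * int_on (\<lambda>y. h y powr q) (cball x r)"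
proof -
  define A where "A = int_on (\<lambda>y. h y powr q) (cball x r)"
  have A: "A \<ge> 0" unfolding A_def by (rule int_on_nonneg[OF hq]) simp
  have n: "int_on h (cball x r) / r ^ N \<ge> 0" using int_on_nonneg[OF h] r by simp
  have "(\<kappa> * r * (int_on h (cball x r) / r ^ N)) powr p = \<kappa> powr p * r powr p * (int_on h (cball x r) / r ^ N) powr p"
    using k r n by (simp only: powr_mult)
  also have "\<dots> \<le> \<kappa> powr p * r powr p * (w powr ((q - 1) * p / q) * (A / r ^ N) powr (p / q))"
    unfolding A_def w_def N_def using q by (intro mult_left_mono average_jensen h hq r) auto
  also have "(A / r ^ N) powr (p / q) = A powr (p / q) / r powr (real N * p / q)"
    using A r by (simp add: powr_divide powr_realpow[symmetric] powr_powr)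
  also have "A powr (p / q) \<le> I powr (p / q - 1) * A"
  proof (cases "A = 0")
    case False
    have "A powr (p / q) = A powr (p / q - 1) * A powr 1" unfolding powr_add[symmetric] by simp
    also have "\<dots> \<le> I powr (p / q - 1) * A powr 1"
      using q I A by (intro mult_right_mono powr_mono2) (auto simp: A_def)
    finally show ?thesis using A by simp
  qed simp
  finally have "(\<kappa> * r * (int_on h (cball x r) / r ^ N)) powr p \<le> \<kappa> powr p * r powr p * (w powr ((q - 1) * p / q) * (I powr (p / q - 1) * A / r powr (real N * p / q)))"
    using q by (simp add: mult_left_mono divide_right_mono)
  also have "\<dots> = \<kappa> powr p * w powr ((q - 1) * p / q) * r powr (p - real N * p / q) * I powr (p / q - 1) * A"
    unfolding powr_diff[of r p "real N * p / q"] by simp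
  finally show ?thesis by (simp add: A_def)
qed

text \<open>
  The constant is \<open>c = kconv eta \<rho> U x0\<close>. For \<open>x\<close> in the ball of radius \<open>\<rho>\<close>, the distance of \<open>U x\<close> from \<open>c\<close> is
  at most the distance of \<open>c\<close> to the mollification of \<open>U\<close> at \<open>x\<close> with radius \<open>\<rho>\<close>, which is bounded uniformly, plus the
  differences \<open>T j x\<close> of mollifications for the radii \<open>\<rho>/2\<^sup>j\<close> and \<open>\<rho>/2\<^sup>j\<^sup>+\<^sup>1\<close>. The integral of \<open>T j x\<^sup>p\<close> is at most a
  multiple of \<open>2\<^sup>-\<^sup>j\<^sup>\<beta>\<close>; this leaves room for the weights \<open>2\<^sup>j\<^sup>\<beta>\<^sup>/\<^sup>2\<close> which the summation in \<open>j\<close> costs. The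
  condition \<open>\<beta> > 0\<close> says that \<open>p\<close> is below the Sobolev exponent of \<open>q\<close>, and the constant \<open>C\<close> depends
  on \<open>p\<close>, \<open>q\<close> and the dimension of the domain only.
\<close>

lemma sobolev_poincare:
  fixes p q :: real
  defines "\<beta> \<equiv> p - real CARD('n::finite) * p / q + real CARD('n)"
  assumes q: "1 \<le> q" "q \<le> p" and gap: "0 < \<beta>"
  shows "\<exists>C>0. \<forall>m (U :: nat \<Rightarrow> real ^ 'n \<Rightarrow> real) G S R x0 \<rho>.
    (\<forall>i<m. weak_grad_on S (U i) (G i)) \<longrightarrow> (\<forall>i<m. \<forall>x. norm x > R \<longrightarrow> U i x = 0) \<longrightarrow>
    integrable lborel (\<lambda>y. hs_norm m (\<lambda>i. G i y) powr q) \<longrightarrow> 0 < \<rho> \<longrightarrow> cball x0 (2 * \<rho>) \<subseteq> S \<longrightarrow>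
    (\<exists>c. (\<integral>\<^sup>+x. ennreal (L2_set (\<lambda>i. U i x - c i) {..<m} powr p) * indicator (cball x0 \<rho>) x \<partial>lborel)
       \<le> ennreal (C * \<rho> powr \<beta> * int_on (\<lambda>y. hs_norm m (\<lambda>i. G i y) powr q) (cball x0 (2 * \<rho>)) powr (p / q)))"
proof -
  define N where "N = CARD('n)"
  define w where "w = measure lborel (ball (0::real^'n) 1)"
  have w: "w > 0" by (simp add: w_def)
  have DN: "DIM(real^'n) = N" by (simp add: N_def)
  obtain B where B: "B > 0" "\<And>z::real^'n. \<bar>eta z\<bar> \<le> B" using bump_bounded[OF eta_bump] by blast
  have Be: "eta z \<le> B" for z :: "real^'n" using B(2)[of z] by linarith
  have p: "p \<ge> 1" using q by linarith
  \<comment> \<open>the weights cost \<open>2 powr (j * \<beta> / 2)\<close>, half of the available decay\<close>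
  define \<gamma> where "\<gamma> = \<beta> / (2 * p)"
  have g: "\<gamma> > 0" using gap p by (simp add: \<gamma>_def)
  define Cg where "Cg = (1 / (1 - 2 powr (- \<gamma>))) powr p"
  define x2 where "x2 = 2 powr (- (\<beta>/2))"
  have x2: "0 < x2" "x2 < 1" using gap by (auto simp: x2_def powr_less_one)
  define D where "D = 1 / (1 - x2)"
  have D: "D > 0" using x2 by (simp add: D_def)
  define \<kappa> where "\<kappa> = 2 ^ N * B"
  have k: "\<kappa> > 0" using B by (simp add: \<kappa>_def)
  define E where "E = \<kappa> powr p * w powr ((q - 1) * p / q)"
  have E: "E > 0" using k w by (simp add: E_def)
  define C where "C = 2 powr p * (Cg * (E * w * D) + E * w)"
  have Cg: "Cg \<ge> 0" by (simp add: Cg_def)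
  have C: "C > 0" unfolding C_def using Cg E w D by (intro mult_pos_pos add_nonneg_pos) auto
  show ?thesis
  proof (intro exI[of _ C] conjI allI impI)
    show "C > 0" by (rule C)
    fix m and U :: "nat \<Rightarrow> real ^ 'n \<Rightarrow> real" and G S R x0 \<rho>
    assume w0: "\<forall>i<m. weak_grad_on S (U i) (G i)" and supp0: "\<forall>i<m. \<forall>x. norm x > R \<longrightarrow> U i x = 0"
      and hq: "integrable lborel (\<lambda>y. hs_norm m (\<lambda>i. G i y) powr q)" and rho: "0 < \<rho>" and S: "cball x0 (2 * \<rho>) \<subseteq> S"
    have wg: "weak_grad_on S (U i) (G i)" if "i < m" for i using w0 that by blast
    have Ui: "integrable lborel (U i)" if "i < m" for i using wg[OF that] by (simp add: weak_grad_on_def)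
    define h where "h y = hs_norm m (\<lambda>i. G i y)" for y
    have h: "integrable lborel h" "\<And>y. h y \<ge> 0"
      using hs_norm_integrable[where U=U and G=G and S=S and m=m, OF wg] hs_norm_nonneg unfolding h_def[abs_def] by auto
    have hq: "integrable lborel (\<lambda>y. h y powr q)" using hq by (simp add: h_def)
    have [measurable]: "h \<in> borel_measurable borel" using h by auto
    define I where "I = int_on (\<lambda>y. h y powr q) (cball x0 (2 * \<rho>))"
    have I: "I \<ge> 0" unfolding I_def by (rule int_on_nonneg[OF hq]) simp
    define r where "r j = \<rho> / 2 ^ j" for j :: nat
    have r: "r j > 0" "r j \<le> \<rho>" "r (Suc j) = r j / 2" for j
      using rho by (auto simp: r_def divide_le_eq mult_left_le)
    have rj: "r j = \<rho> * (1/2) powr j" for j by (simp add: r_def powr_realpow power_divide)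
    have rlim: "r \<longlonglongrightarrow> 0"
    proof -
      have "(\<lambda>j. \<rho> * (1/2) ^ j) \<longlonglongrightarrow> \<rho> * 0" by (intro tendsto_mult tendsto_const LIMSEQ_power_zero) auto
      then show ?thesis by (simp add: r_def[abs_def] power_divide)
    qed
    define A where "A j x = int_on (\<lambda>y. h y powr q) (cball x (r j))" for j x
    have A0: "A j x \<ge> 0" for j x unfolding A_def by (rule int_on_nonneg[OF hq]) simp
    have [measurable]: "A j \<in> borel_measurable borel" for j
      unfolding A_def[abs_def] by (rule int_on_cball_measurable) measurable
    define T where "T j x = \<kappa> * r j * (int_on h (cball x (r j)) / r j ^ N)" for j x
    have T0: "T j x \<ge> 0" for j x unfolding T_def using k r(1)[of j] int_on_nonneg[OF h] by simp
    have sub: "cball x (r j) \<subseteq> cball x0 (2 * \<rho>)" if "x \<in> cball x0 \<rho>" for x j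
    proof
      fix y assume "y \<in> cball x (r j)"
      then show "y \<in> cball x0 (2 * \<rho>)" using that r(2)[of j] dist_triangle[of x0 y x] by simp
    qed
    define V where "V j x i = kconv eta (r j) (U i) x" for j x i
    define c where "c i = kconv eta \<rho> (U i) x0" for i
    have V: "L2_set (\<lambda>i. V j x i - V (Suc j) x i) {..<m} \<le> T j x" if "x \<in> cball x0 \<rho>" for j x
      using mollify_halving_vec[where U=U and G=G and m=m and S=S and B=B, OF wg Be r(1)[of j] order_trans[OF sub[OF that] S]]
      by (simp add: V_def T_def \<kappa>_def h_def[abs_def] N_def r(3))
    have Tp: "T j x powr p \<le> E * r j powr (p - real N * p / q) * I powr (p / q - 1) * A j x" if "x \<in> cball x0 \<rho>" for j x
    proof -
      have "A j x \<le> I" unfolding A_def I_def by (rule int_on_mono[OF hq]) (use sub[OF that] in auto)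
      then show ?thesis
        using halving_average_powr[where h=h and r="r j" and \<kappa>=\<kappa> and x=x and I=I, OF q h hq r(1)] k
        unfolding T_def A_def E_def w_def DN by simp
    qed
    define Z where "Z x = (\<Sum>j. ennreal (2 powr (j * \<gamma> * p) * (E * r j powr (p - real N * p / q) * I powr (p / q - 1) * A j x)))" for x
    \<comment> \<open>the partial sums of the telescoping series, bounded uniformly in \<open>k\<close>\<close>
    have part: "ennreal (L2_set (\<lambda>i. V 0 x i - V k x i) {..<m} powr p) \<le> ennreal Cg * Z x" if x: "x \<in> cball x0 \<rho>" for k x
    proof -
      have nn: "0 \<le> 2 powr (j * \<gamma> * p) * (E * r j powr (p - real N * p / q) * I powr (p / q - 1) * A j x)" for j
        using E A0[of j x] by simp
      have "L2_set (\<lambda>i. V 0 x i - V k x i) {..<m} \<le> (\<Sum>j<k. T j x)"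
        by (rule order_trans[OF L2_set_telescope[of "\<lambda>j. V j x"]]) (intro sum_mono V x)
      then have "L2_set (\<lambda>i. V 0 x i - V k x i) {..<m} powr p \<le> (\<Sum>j<k. T j x) powr p"
        using p by (intro powr_mono2) auto
      also have "\<dots> \<le> Cg * (\<Sum>j<k. 2 powr (j * \<gamma> * p) * T j x powr p)"
        unfolding Cg_def using T0 p g by (intro sum_powr_le_weighted) auto
      also have "\<dots> \<le> Cg * (\<Sum>j<k. 2 powr (j * \<gamma> * p) * (E * r j powr (p - real N * p / q) * I powr (p / q - 1) * A j x))"
        using Cg by (intro mult_left_mono sum_mono Tp[OF x]) auto
      finally have "ennreal (L2_set (\<lambda>i. V 0 x i - V k x i) {..<m} powr p)
        \<le> ennreal (Cg * (\<Sum>j<k. 2 powr (j * \<gamma> * p) * (E * r j powr (p - real N * p / q) * I powr (p / q - 1) * A j x)))"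
        by (rule ennreal_leI)
      also have "\<dots> = ennreal Cg * (\<Sum>j<k. ennreal (2 powr (j * \<gamma> * p) * (E * r j powr (p - real N * p / q) * I powr (p / q - 1) * A j x)))"
        by (simp only: sum_ennreal[OF nn] ennreal_mult[OF Cg sum_nonneg[OF nn]])
      also have "\<dots> \<le> ennreal Cg * Z x" unfolding Z_def by (intro mult_left_mono sum_le_suminf) auto
      finally show ?thesis .
    qed
    obtain s where s: "strict_mono s" "AE x in lborel. \<forall>i\<in>{..<m}. (\<lambda>k. mollify eta (r (s k)) (U i) x) \<longlonglongrightarrow> U i x"
      using mollify_AE_subseq[OF eta_mollifier, of "{..<m}" U R r] Ui supp0 r(1) rlim by blast
    have ae: "AE x in lborel. x \<in> cball x0 \<rho> \<longrightarrow> ennreal (L2_set (\<lambda>i. V 0 x i - U i x) {..<m} powr p) \<le> ennreal Cg * Z x"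
      using s(2)
    proof eventually_elim
      case (elim x)
      show ?case
      proof
        assume x: "x \<in> cball x0 \<rho>"
        have "(\<lambda>k. V (s k) x i) \<longlonglongrightarrow> U i x" if "i < m" for i
        proof -
          have eq: "mollify eta (r (s k)) (U i) x = V (s k) x i" for k
            unfolding V_def by (rule mollify_eta[OF _ r(1)]) (use Ui[OF that] in auto)
          have "(\<lambda>k. mollify eta (r (s k)) (U i) x) \<longlonglongrightarrow> U i x" using elim that by blast
          then show ?thesis unfolding eq .
        qed
        then have "(\<lambda>k. L2_set (\<lambda>i. V 0 x i - V (s k) x i) {..<m}) \<longlonglongrightarrow> L2_set (\<lambda>i. V 0 x i - U i x) {..<m}"
          unfolding L2_set_def by (intro tendsto_intros) auto
        then have "(\<lambda>k. L2_set (\<lambda>i. V 0 x i - V (s k) x i) {..<m} powr p) \<longlonglongrightarrow> L2_set (\<lambda>i. V 0 x i - U i x) {..<m} powr p"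
          using p by (intro tendsto_powr' tendsto_const) auto
        then have "(\<lambda>k. ennreal (L2_set (\<lambda>i. V 0 x i - V (s k) x i) {..<m} powr p)) \<longlonglongrightarrow> ennreal (L2_set (\<lambda>i. V 0 x i - U i x) {..<m} powr p)"
          by (rule tendsto_ennrealI)
        then show "ennreal (L2_set (\<lambda>i. V 0 x i - U i x) {..<m} powr p) \<le> ennreal Cg * Z x"
          by (rule LIMSEQ_le_const2) (use part[OF x] in blast)
      qed
    qed
    define F where "F = E * (\<rho> powr (\<beta> - real N) * I powr (p / q))"
    have F: "F \<ge> 0" using E by (simp add: F_def)
    \<comment> \<open>variation in the centre at the fixed radius \<open>\<rho>\<close>\<close>
    have second: "L2_set (\<lambda>i. V 0 x i - c i) {..<m} powr p \<le> F" if x: "x \<in> cball x0 \<rho>" for x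
    proof -
      have nx: "norm (x - x0) \<le> \<rho>" using x by (simp add: dist_norm norm_minus_commute)
      have sb: "cball x0 (\<rho> + norm (x - x0)) \<subseteq> cball x0 (2 * \<rho>)" using nx by auto
      have hn: "int_on h (cball x0 (2 * \<rho>)) \<ge> 0" by (rule int_on_nonneg[OF h])
      have "L2_set (\<lambda>i. V 0 x i - c i) {..<m} \<le> norm (x - x0) * B * (int_on h (cball x0 (\<rho> + norm (x - x0))) / \<rho> ^ N)"
        using mollify_lipschitz_vec[where U=U and G=G and m=m and S=S and B=B, OF wg Be rho order_trans[OF sb S]]
        by (simp add: V_def c_def r_def h_def[abs_def] N_def)
      also have "\<dots> \<le> \<rho> * B * (int_on h (cball x0 (2 * \<rho>)) / \<rho> ^ N)"
        using nx rho B int_on_nonneg[OF h] by (intro mult_mono divide_right_mono int_on_mono[OF h] sb) auto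
      also have "\<dots> = (\<kappa> / 2) * (2 * \<rho>) * (int_on h (cball x0 (2 * \<rho>)) / (2 * \<rho>) ^ N)"
        using rho by (simp add: \<kappa>_def power_mult_distrib)
      finally have "L2_set (\<lambda>i. V 0 x i - c i) {..<m} powr p \<le> ((\<kappa> / 2) * (2 * \<rho>) * (int_on h (cball x0 (2 * \<rho>)) / (2 * \<rho>) ^ N)) powr p"
        using p by (intro powr_mono2) auto
      also have "\<dots> \<le> (\<kappa> / 2) powr p * w powr ((q - 1) * p / q) * (2 * \<rho>) powr (p - real N * p / q) * I powr (p / q - 1) * I"
        using halving_average_powr[where h=h and r="2 * \<rho>" and \<kappa>="\<kappa> / 2" and x=x0 and I=I, OF q h hq] k rho
        unfolding w_def DN by (simp add: I_def)
      also have "\<dots> = \<kappa> powr p * w powr ((q - 1) * p / q) * (2 powr (- (real N * p / q)) * \<rho> powr (p - real N * p / q)) * I powr (p / q)"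
      proof -
        have "I powr (p / q - 1) * I = I powr (p / q - 1) * I powr 1" using I by simp
        also have "\<dots> = I powr (p / q)" unfolding powr_add[symmetric] by simp
        finally have e1: "I powr (p / q - 1) * I = I powr (p / q)" .
        have e2: "(\<kappa> / 2) powr p = \<kappa> powr p / 2 powr p" using k by (simp add: powr_divide)
        have e3: "(2 * \<rho>) powr (p - real N * p / q) = 2 powr p * 2 powr (- (real N * p / q)) * \<rho> powr (p - real N * p / q)"
          using rho by (simp add: powr_mult powr_add[symmetric])
        show ?thesis unfolding mult.assoc e1 e2 e3 by (simp add: mult.assoc)
      qed
      also have "\<dots> \<le> \<kappa> powr p * w powr ((q - 1) * p / q) * (1 * \<rho> powr (p - real N * p / q)) * I powr (p / q)"
        using p q by (intro mult_right_mono mult_left_mono) (auto simp: powr_minus_divide divide_le_eq ge_one_powr_ge_zero)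
      also have "\<dots> = F" by (simp add: F_def E_def \<beta>_def N_def)
      finally show ?thesis .
    qed
    have Zint: "(\<integral>\<^sup>+x. Z x * indicator (cball x0 \<rho>) x \<partial>lborel) \<le> ennreal (E * w * D * \<rho> powr \<beta> * I powr (p / q))"
    proof -
      define a where "a j = 2 powr (j * \<gamma> * p) * (E * r j powr (p - real N * p / q) * I powr (p / q - 1))" for j :: nat
      have a0: "a j \<ge> 0" for j using E by (simp add: a_def)
      have "Z x * indicator (cball x0 \<rho>) x = (\<Sum>j. ennreal (a j) * (ennreal (A j x) * indicator (cball x0 \<rho>) x))" for x
      proof -
        have "Z x = (\<Sum>j. ennreal (a j) * ennreal (A j x))"
          unfolding Z_def a_def using E A0 by (simp add: ennreal_mult[symmetric] mult.assoc)
        then show ?thesis by (cases "x \<in> cball x0 \<rho>") auto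
      qed
      then have "(\<integral>\<^sup>+x. Z x * indicator (cball x0 \<rho>) x \<partial>lborel) = (\<Sum>j. ennreal (a j) * (\<integral>\<^sup>+x. ennreal (A j x) * indicator (cball x0 \<rho>) x \<partial>lborel))"
        by (simp add: nn_integral_suminf nn_integral_cmult)
      also have "\<dots> \<le> (\<Sum>j. ennreal (a j) * ennreal (w * r j ^ N * I))"
        unfolding A_def I_def w_def DN[symmetric] using r(1)[THEN less_imp_le] r(2) hq
        by (intro suminf_le mult_left_mono nn_integral_ball_averages) auto
      also have "\<dots> = (\<Sum>j. ennreal (E * w * \<rho> powr \<beta> * I powr (p / q) * x2 ^ j))"
      proof (intro arg_cong[where f=suminf] ext)
        fix j
        have e1: "I powr (p / q - 1) * I = I powr (p / q)"
        proof -
          have "I powr (p / q - 1) * I = I powr (p / q - 1) * I powr 1" using I by simp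
          also have "\<dots> = I powr (p / q)" unfolding powr_add[symmetric] by simp
          finally show ?thesis .
        qed
        have e2: "r j powr (p - real N * p / q) * r j ^ N = r j powr \<beta>"
          using r(1)[of j] by (simp add: powr_realpow[symmetric] powr_add[symmetric] \<beta>_def N_def)
        have e3: "2 powr (j * \<gamma> * p) * r j powr \<beta> = \<rho> powr \<beta> * x2 ^ j"
        proof -
          have a: "j * \<gamma> * p = j * (\<beta> / 2)" using p by (simp add: \<gamma>_def)
          have b: "r j powr \<beta> = \<rho> powr \<beta> * 2 powr (- (j * \<beta>))"
            using rho by (simp add: rj powr_mult powr_powr powr_divide powr_minus_divide)
          have c: "2 powr (j * (\<beta> / 2)) * 2 powr (- (j * \<beta>)) = x2 ^ j"
            unfolding powr_add[symmetric] x2_def powr_power[symmetric] by (simp add: powr_power algebra_simps)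
          show ?thesis unfolding a b c[symmetric] by (rule mult.left_commute)
        qed
        have "a j * (w * r j ^ N * I) = E * w * (2 powr (j * \<gamma> * p) * (r j powr (p - real N * p / q) * r j ^ N)) * (I powr (p / q - 1) * I)"
          by (simp add: a_def mult_ac)
        also have "\<dots> = E * w * \<rho> powr \<beta> * I powr (p / q) * x2 ^ j" unfolding e1 e2 e3 by (simp add: mult_ac)
        finally have eq: "a j * (w * r j ^ N * I) = E * w * \<rho> powr \<beta> * I powr (p / q) * x2 ^ j" .
        have "0 \<le> w * r j ^ N * I" using w r(1)[of j] I by simp
        then show "ennreal (a j) * ennreal (w * r j ^ N * I) = ennreal (E * w * \<rho> powr \<beta> * I powr (p / q) * x2 ^ j)"
          unfolding eq[symmetric] by (rule ennreal_mult[OF a0, symmetric])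
      qed
      also have "\<dots> = ennreal (\<Sum>j. E * w * \<rho> powr \<beta> * I powr (p / q) * x2 ^ j)"
        using E w x2 by (intro suminf_ennreal2 summable_mult summable_geometric) auto
      also have "(\<Sum>j. E * w * \<rho> powr \<beta> * I powr (p / q) * x2 ^ j) = E * w * \<rho> powr \<beta> * I powr (p / q) * D"
        using x2 by (simp add: suminf_mult suminf_geometric D_def)
      finally show ?thesis by (simp add: mult_ac)
    qed
    have Zm[measurable]: "Z \<in> borel_measurable borel" unfolding Z_def[abs_def] by measurable
    have "AE x in lborel. ennreal (L2_set (\<lambda>i. U i x - c i) {..<m} powr p) * indicator (cball x0 \<rho>) x
       \<le> ennreal (2 powr p) * (ennreal Cg * (Z x * indicator (cball x0 \<rho>) x) + ennreal F * indicator (cball x0 \<rho>) x)"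
      using ae
    proof eventually_elim
      case (elim x)
      show ?case
      proof (cases "x \<in> cball x0 \<rho>")
        case True
        have "L2_set (\<lambda>i. U i x - c i) {..<m} = L2_set (\<lambda>i. c i - U i x) {..<m}"
          unfolding L2_set_def by (simp add: power2_commute)
        also have "\<dots> = L2_set (\<lambda>i. (V 0 x i - U i x) + (c i - V 0 x i)) {..<m}" by simp
        also have "\<dots> \<le> L2_set (\<lambda>i. V 0 x i - U i x) {..<m} + L2_set (\<lambda>i. c i - V 0 x i) {..<m}" by (rule L2_set_triangle_ineq)
        also have "L2_set (\<lambda>i. c i - V 0 x i) {..<m} = L2_set (\<lambda>i. V 0 x i - c i) {..<m}"
          unfolding L2_set_def by (simp add: power2_commute)
        finally have "L2_set (\<lambda>i. U i x - c i) {..<m} powr p \<le> (L2_set (\<lambda>i. V 0 x i - U i x) {..<m} + L2_set (\<lambda>i. V 0 x i - c i) {..<m}) powr p"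
          using p by (intro powr_mono2) auto
        also have "\<dots> \<le> 2 powr p * (L2_set (\<lambda>i. V 0 x i - U i x) {..<m} powr p + L2_set (\<lambda>i. V 0 x i - c i) {..<m} powr p)"
          using p by (intro powr_add_le) auto
        also have "\<dots> \<le> 2 powr p * (L2_set (\<lambda>i. V 0 x i - U i x) {..<m} powr p + F)"
          using second[OF True] by (intro mult_left_mono add_left_mono) auto
        finally have "ennreal (L2_set (\<lambda>i. U i x - c i) {..<m} powr p) \<le> ennreal (2 powr p * (L2_set (\<lambda>i. V 0 x i - U i x) {..<m} powr p + F))"
          by (rule ennreal_leI)
        also have "\<dots> = ennreal (2 powr p) * (ennreal (L2_set (\<lambda>i. V 0 x i - U i x) {..<m} powr p) + ennreal F)"
          using F by (simp add: ennreal_mult ennreal_plus)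
        also have "\<dots> \<le> ennreal (2 powr p) * (ennreal Cg * Z x + ennreal F)"
          using elim True by (intro mult_left_mono add_right_mono) auto
        finally show ?thesis using True by simp
      qed simp
    qed
    then have "(\<integral>\<^sup>+x. ennreal (L2_set (\<lambda>i. U i x - c i) {..<m} powr p) * indicator (cball x0 \<rho>) x \<partial>lborel)
      \<le> (\<integral>\<^sup>+x. ennreal (2 powr p) * (ennreal Cg * (Z x * indicator (cball x0 \<rho>) x) + ennreal F * indicator (cball x0 \<rho>) x) \<partial>lborel)"
      by (rule nn_integral_mono_AE)
    also have "\<dots> = ennreal (2 powr p) * (ennreal Cg * (\<integral>\<^sup>+x. Z x * indicator (cball x0 \<rho>) x \<partial>lborel) + ennreal F * emeasure lborel (cball x0 \<rho>))"
      by (simp add: nn_integral_cmult nn_integral_add nn_integral_cmult_indicator)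
    also have "emeasure lborel (cball x0 \<rho>) = ennreal (w * \<rho> ^ N)"
      using emeasure_lborel_cball_finite[of x0 \<rho>] content_cball_scale[of \<rho> x0] rho
      by (simp add: emeasure_eq_ennreal_measure less_top[symmetric] w_def N_def)
    also have "ennreal (2 powr p) * (ennreal Cg * (\<integral>\<^sup>+x. Z x * indicator (cball x0 \<rho>) x \<partial>lborel) + ennreal F * ennreal (w * \<rho> ^ N))
      \<le> ennreal (2 powr p) * (ennreal Cg * ennreal (E * w * D * \<rho> powr \<beta> * I powr (p / q)) + ennreal F * ennreal (w * \<rho> ^ N))"
      by (intro mult_left_mono add_right_mono Zint) auto
    also have "\<dots> = ennreal (2 powr p * (Cg * (E * w * D * \<rho> powr \<beta> * I powr (p / q)) + F * (w * \<rho> ^ N)))"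
      using Cg E w D F rho by (simp add: ennreal_mult ennreal_plus)
    also have "2 powr p * (Cg * (E * w * D * \<rho> powr \<beta> * I powr (p / q)) + F * (w * \<rho> ^ N)) = C * \<rho> powr \<beta> * I powr (p / q)"
    proof -
      have "\<rho> powr (\<beta> - real N) * \<rho> ^ N = \<rho> powr \<beta>" using rho by (simp add: powr_realpow[symmetric] powr_add[symmetric])
      then have "F * (w * \<rho> ^ N) = E * w * \<rho> powr \<beta> * I powr (p / q)" unfolding F_def by (metis (no_types, opaque_lifting) mult.assoc mult.commute)
      then show ?thesis unfolding C_def by (simp add: algebra_simps)
    qed
    finally show "\<exists>c. (\<integral>\<^sup>+x. ennreal (L2_set (\<lambda>i. U i x - c i) {..<m} powr p) * indicator (cball x0 \<rho>) x \<partial>lborel)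
       \<le> ennreal (C * \<rho> powr \<beta> * int_on (\<lambda>y. hs_norm m (\<lambda>i. G i y) powr q) (cball x0 (2 * \<rho>)) powr (p / q))"
      unfolding I_def h_def[abs_def] by blast
  qed
qed

section \<open>Pullbacks of constant-coefficient forms as null Lagrangians\<close>

lemma integrable_bounded_support:
  fixes F :: "'a::euclidean_space \<Rightarrow> real"
  assumes "F \<in> borel_measurable borel" "\<And>y. \<bar>F y\<bar> \<le> B" "\<And>y. y \<notin> cball x0 R \<Longrightarrow> F y = 0"
  shows "integrable lborel F"
proof (rule Bochner_Integration.integrable_bound[where f="\<lambda>y. \<bar>B\<bar> * indicator (cball x0 R) y"])
  show "integrable lborel (\<lambda>y. \<bar>B\<bar> * indicator (cball x0 R) y)"
    using emeasure_lborel_cball_finite by (intro integrable_mult_right integrable_real_indicator) auto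
  have "norm (F y) \<le> norm (\<bar>B\<bar> * indicator (cball x0 R) y)" for y
    using assms(2)[of y] assms(3)[of y] by (cases "y \<in> cball x0 R") auto
  then show "AE y in lborel. norm (F y) \<le> norm (\<bar>B\<bar> * indicator (cball x0 R) y)" by simp
qed (use assms in simp)

lemma integral_lborel_translate:
  fixes f :: "'a::euclidean_space \<Rightarrow> real"
  assumes [measurable]: "f \<in> borel_measurable borel"
  shows "(\<integral>x. f (x + a) \<partial>lborel) = (\<integral>x. f x \<partial>lborel)"
  using integral_lborel_affine[of f 1 a] by (simp add: add.commute)

text \<open>
  The difference quotients of \<open>F\<close> have integral 0 by translation invariance and converge boundedly
  with uniformly bounded support.
\<close>

lemma integral_directional_derivative_zero:
  fixes F F' :: "'a::euclidean_space \<Rightarrow> real"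
  assumes d: "\<And>y. ((\<lambda>t. F (y + t *\<^sub>R e)) has_real_derivative F' y) (at 0)" and e: "norm e = 1"
    and m[measurable]: "F \<in> borel_measurable borel" "F' \<in> borel_measurable borel"
    and b: "\<And>y. \<bar>F y\<bar> \<le> B0" "\<And>y. \<bar>F' y\<bar> \<le> B" and supp: "\<And>y. y \<notin> cball x0 R \<Longrightarrow> F y = 0"
  shows "(\<integral>y. F' y \<partial>lborel) = 0"
proof -
  have d': "((\<lambda>t. F (y + t *\<^sub>R e)) has_real_derivative F' (y + s *\<^sub>R e)) (at s)" for y s
  proof -
    have "((\<lambda>t. F ((y + s *\<^sub>R e) + t *\<^sub>R e)) has_real_derivative F' (y + s *\<^sub>R e)) (at (s - s))" using d[of "y + s *\<^sub>R e"] by simp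
    then have "((\<lambda>t. F ((y + s *\<^sub>R e) + (t - s) *\<^sub>R e)) has_real_derivative F' (y + s *\<^sub>R e)) (at s)"
      using DERIV_shift[of "\<lambda>t. F ((y + s *\<^sub>R e) + t *\<^sub>R e)" "F' (y + s *\<^sub>R e)" s "-s"] by simp
    then show ?thesis by (simp add: algebra_simps)
  qed
  define X where "X k = 1 / real (Suc k)" for k
  have X: "X k > 0" "X k \<le> 1" for k by (auto simp: X_def)
  have Xl: "X \<longlonglongrightarrow> 0" unfolding X_def[abs_def] using LIMSEQ_inverse_real_of_nat[unfolded inverse_eq_divide] .
  have Fi: "integrable lborel F" by (rule integrable_bounded_support[OF m(1) b(1) supp])
  have B: "B \<ge> 0" using b(2)[of 0] by linarith
  have "(\<lambda>k. \<integral>y. (F (y + X k *\<^sub>R e) - F y) / X k \<partial>lborel) \<longlonglongrightarrow> (\<integral>y. F' y \<partial>lborel)"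
  proof (rule integral_dominated_convergence[where w="\<lambda>y. B * indicator (cball x0 (R + 1)) y"])
    show "integrable lborel (\<lambda>y. B * indicator (cball x0 (R + 1)) y)"
      using emeasure_lborel_cball_finite by (intro integrable_mult_right integrable_real_indicator) auto
    show "AE y in lborel. (\<lambda>k. (F (y + X k *\<^sub>R e) - F y) / X k) \<longlonglongrightarrow> F' y"
    proof (rule AE_I2)
      fix y
      have "((\<lambda>t. (F (y + t *\<^sub>R e) - F y) / t) \<longlongrightarrow> F' y) (at 0)"
        using d[of y] by (simp add: has_field_derivative_iff)
      then show "(\<lambda>k. (F (y + X k *\<^sub>R e) - F y) / X k) \<longlonglongrightarrow> F' y"
        unfolding tendsto_at_iff_sequentially using X(1) Xl by (auto simp: o_def less_imp_neq[symmetric])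
    qed
    show "AE y in lborel. norm ((F (y + X k *\<^sub>R e) - F y) / X k) \<le> B * indicator (cball x0 (R + 1)) y" for k
    proof (rule AE_I2)
      fix y
      show "norm ((F (y + X k *\<^sub>R e) - F y) / X k) \<le> B * indicator (cball x0 (R + 1)) y"
      proof (cases "y \<in> cball x0 (R + 1)")
        case True
        obtain s where s: "F (y + X k *\<^sub>R e) - F (y + 0 *\<^sub>R e) = (X k - 0) * F' (y + s *\<^sub>R e)"
          using MVT2[of 0 "X k" "\<lambda>t. F (y + t *\<^sub>R e)" "\<lambda>s. F' (y + s *\<^sub>R e)"] X(1)[of k] d' by blast
        then have "(F (y + X k *\<^sub>R e) - F y) / X k = F' (y + s *\<^sub>R e)" using X(1)[of k] by simp
        then show ?thesis using True b(2) by simp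
      next
        case False
        have "dist x0 y \<le> dist x0 (y + X k *\<^sub>R e) + X k"
          using dist_triangle[of x0 y "y + X k *\<^sub>R e"] X(1)[of k] e by (simp add: dist_norm)
        then have "y \<notin> cball x0 R" "y + X k *\<^sub>R e \<notin> cball x0 R" using False X(2)[of k] X(1)[of k] by auto
        then show ?thesis using supp False by simp
      qed
    qed
  qed auto
  moreover have "(\<integral>y. (F (y + X k *\<^sub>R e) - F y) / X k \<partial>lborel) = 0" for k
  proof -
    have "integrable lborel (\<lambda>y. F (y + X k *\<^sub>R e))"
      using integrable_lborel_affine[OF Fi, of 1 "X k *\<^sub>R e"] by (simp add: add.commute)
    then show ?thesis using Fi integral_lborel_translate[OF m(1), of "X k *\<^sub>R e"]
      by (simp add: integral_divide_zero)
  qed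
  ultimately have "(\<lambda>k::nat. 0) \<longlonglongrightarrow> (\<integral>y. F' y \<partial>lborel)" by (simp only:)
  then show ?thesis by (simp add: LIMSEQ_const_iff)
qed

lemma kconv_measurable[measurable]:
  assumes K: "bump K" and u[measurable]: "u \<in> borel_measurable borel"
  shows "kconv K r u \<in> borel_measurable borel"
proof -
  note [measurable] = bump_measurable[OF K]
  show ?thesis unfolding kconv_def[abs_def] by measurable
qed

lemma kconv_bounded:
  assumes K: "bump K" and u: "integrable lborel u" and r: "r > 0"
  shows "\<exists>B. \<forall>x. \<bar>kconv K r u x\<bar> \<le> B"
proof -
  obtain B where B: "B > 0" "\<And>z. \<bar>K z\<bar> \<le> B" using bump_bounded[OF K] by blast
  have "\<bar>kconv K r u x\<bar> \<le> (\<integral>y. B * \<bar>u y\<bar> \<partial>lborel) / r ^ CARD('a)" for x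
  proof -
    have "norm (\<integral>y. u y * K ((1/r) *\<^sub>R (x - y)) \<partial>lborel) \<le> (\<integral>y. norm (u y * K ((1/r) *\<^sub>R (x - y))) \<partial>lborel)"
      by (rule integral_norm_bound)
    also have "\<dots> \<le> (\<integral>y. B * \<bar>u y\<bar> \<partial>lborel)"
    proof (rule integral_mono)
      show "integrable lborel (\<lambda>y. norm (u y * K ((1/r) *\<^sub>R (x - y))))" by (intro integrable_norm kconv_integrable K u)
      show "integrable lborel (\<lambda>y. B * \<bar>u y\<bar>)" using u by simp
      fix y show "norm (u y * K ((1/r) *\<^sub>R (x - y))) \<le> B * \<bar>u y\<bar>"
        using mult_left_mono[OF B(2)[of "(1/r) *\<^sub>R (x - y)"], of "\<bar>u y\<bar>"] by (simp only: real_norm_def abs_mult mult.commute abs_ge_zero)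
    qed
    finally show ?thesis unfolding kconv_def using r by (simp add: abs_divide divide_right_mono)
  qed
  then show ?thesis by blast
qed

lemma kconv_axis_derivative:
  fixes K :: "real ^ 'n::finite \<Rightarrow> real"
  assumes K: "bump K" and u: "integrable lborel u" and r: "r > 0"
  shows "((\<lambda>t. kconv K r u (y + t *\<^sub>R axis j 1)) has_real_derivative kconv (partial_deriv j K) r u y / r) (at 0)"
proof -
  have "(\<Sum>l\<in>UNIV. axis j 1 $ l * (kconv (partial_deriv l K) r u (y + 0 *\<^sub>R axis j 1) / r)) = (\<Sum>l\<in>UNIV. if l = j then kconv (partial_deriv j K) r u y / r else 0)"
    by (intro sum.cong) (auto simp: axis_def)
  then show ?thesis using kconv_line[OF K u r, of y "axis j 1" 0] by simp
qed

lemma covector_bound: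
  fixes \<omega> :: "('n::finite \<Rightarrow> nat \<Rightarrow> real) \<Rightarrow> real"
  assumes "covector m \<omega>" "comass m \<omega> \<le> 1" "range v \<subseteq> topspace (Euclidean_space m)" "\<And>k. (\<Sum>i<m. \<bar>v k i\<bar>) \<le> M"
  shows "\<bar>\<omega> v\<bar> \<le> M ^ CARD('n)"
proof -
  have "\<bar>\<omega> v\<bar> \<le> (\<Prod>j\<in>UNIV. L2_set (v j) {..<m})" by (rule covector_Hadamard[OF assms(1,2,3)])
  also have "\<dots> \<le> (\<Prod>j\<in>(UNIV::'n set). M)"
    by (intro prod_mono conjI L2_set_nonneg order_trans[OF L2_set_le_sum_abs assms(4)])
  finally show ?thesis by simp
qed

text \<open>
  Exchanging \<open>j\<close> and \<open>k\<close> exchanges two arguments of \<open>\<omega>\<close>, since \<open>s\<close> is symmetric, so the double sum equals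
  its own negative. With second derivatives for \<open>s\<close> this is \<open>d(f\<^sup>*\<omega>) = 0\<close>.
\<close>

lemma covector_mixed_cancel:
  fixes \<omega> :: "('n::finite \<Rightarrow> nat \<Rightarrow> real) \<Rightarrow> real"
  assumes cov: "covector m \<omega>" and v: "range v \<subseteq> topspace (Euclidean_space m)" and f: "f \<in> topspace (Euclidean_space m)"
    and s: "\<And>j k. s j k \<in> topspace (Euclidean_space m)" "\<And>j k. s j k = s k j"
  shows "(\<Sum>j\<in>UNIV. \<Sum>k\<in>UNIV - {j}. \<omega> (v(j := f, k := s j k))) = 0"
proof -
  let ?g = "\<lambda>j k. if k = j then 0 else \<omega> (v(j := f, k := s j k))"
  have eq: "(\<Sum>k\<in>UNIV - {j}. \<omega> (v(j := f, k := s j k))) = (\<Sum>k\<in>UNIV. ?g j k)" for j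
    by (rule sum.mono_neutral_cong_left) auto
  have anti: "?g j k = - ?g k j" for j k
    using covector_antisym[OF cov v f s(1)[of j k], of j k] s(2)[of j k] by (auto simp: fun_upd_twist)
  have "(\<Sum>j\<in>UNIV. \<Sum>k\<in>UNIV. ?g j k) = (\<Sum>j\<in>UNIV. \<Sum>k\<in>UNIV. - ?g k j)" using anti by (intro sum.cong refl)
  also have "\<dots> = - (\<Sum>j\<in>UNIV. \<Sum>k\<in>UNIV. ?g k j)" by (simp only: sum_negf)
  also have "(\<Sum>j\<in>UNIV. \<Sum>k\<in>UNIV. ?g k j) = (\<Sum>j\<in>UNIV. \<Sum>k\<in>UNIV. ?g j k)" by (rule sum.swap)
  finally have "(\<Sum>j\<in>UNIV. \<Sum>k\<in>UNIV. ?g j k) = 0" by simp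
  then show ?thesis unfolding eq .
qed

definition tuple :: "nat \<Rightarrow> (nat \<Rightarrow> real) \<Rightarrow> nat \<Rightarrow> real" where
  "tuple m a = (\<lambda>i. if i < m then a i else 0)"

lemma tuple_mem: "tuple m a \<in> topspace (Euclidean_space m)"
  by (simp add: tuple_def mem_Em)

lemma tuple_nth: "i < m \<Longrightarrow> tuple m a i = a i"
  by (simp add: tuple_def)

lemma continuous_vanishing_bounded:
  fixes f :: "real ^ 'n::finite \<Rightarrow> real"
  assumes "continuous_on UNIV f" "\<And>y. y \<notin> cball x0 r \<Longrightarrow> f y = 0"
  shows "\<exists>B. \<forall>y. \<bar>f y\<bar> \<le> B"
proof -
  have "bounded (f ` cball x0 r)" using assms(1) by (intro compact_imp_bounded compact_continuous_image) (auto intro: continuous_on_subset)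
  then obtain B where B: "B > 0" "\<And>y. y \<in> cball x0 r \<Longrightarrow> \<bar>f y\<bar> \<le> B" by (auto simp: bounded_pos)
  have "\<bar>f y\<bar> \<le> B" for y using B assms(2) by (cases "y \<in> cball x0 r") auto
  then show ?thesis by blast
qed

text \<open>
  The integrand is the divergence of the field with entries \<open>\<Phi> y * \<omega> ((P y)(j := f y))\<close>: differentiating the
  entry \<open>f\<close> in direction \<open>j\<close> restores \<open>\<omega> (P y)\<close>, once for each \<open>j\<close>, and the derivatives of the remaining
  columns of \<open>P\<close> cancel by \<open>covector_mixed_cancel\<close>.
\<close>

lemma smooth_pullback_identity:
  fixes \<omega> :: "('n::finite \<Rightarrow> nat \<Rightarrow> real) \<Rightarrow> real" and U :: "nat \<Rightarrow> real ^ 'n \<Rightarrow> real" and c :: "nat \<Rightarrow> real"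
  assumes cov: "covector m \<omega>" and com: "comass m \<omega> \<le> 1" and U: "\<And>i. i < m \<Longrightarrow> integrable lborel (U i)"
    and \<Phi>: "bump_alg \<Phi>" and supp: "\<And>y. y \<notin> cball ctr r \<Longrightarrow> \<Phi> y = 0" and eps: "\<epsilon> > 0"
  defines "P \<equiv> \<lambda>y k. tuple m (\<lambda>i. kconv (partial_deriv k eta) \<epsilon> (U i) y / \<epsilon>)"
    and "f \<equiv> \<lambda>y. tuple m (\<lambda>i. kconv eta \<epsilon> (U i) y - c i)"
  shows "(\<integral>y. real CARD('n) * (\<Phi> y * \<omega> (P y)) + (\<Sum>j\<in>UNIV. partial_deriv j \<Phi> y * \<omega> ((P y)(j := f y))) \<partial>lborel) = 0"
proof -
  \<comment> \<open>the second derivatives of the mollified map\<close>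
  define s where "s y j k = tuple m (\<lambda>i. kconv (partial_deriv j (partial_deriv k eta)) \<epsilon> (U i) y / \<epsilon> / \<epsilon>)" for y j k
  have PE: "range (P y) \<subseteq> topspace (Euclidean_space m)" for y by (auto simp: P_def tuple_mem)
  have fE: "f y \<in> topspace (Euclidean_space m)" for y by (auto simp: f_def tuple_mem)
  have sE: "s y j k \<in> topspace (Euclidean_space m)" for y j k by (auto simp: s_def tuple_mem)
  have ssym: "s y j k = s y k j" for y j k
    using bump_alg_partial_deriv_commute[of eta j k] eta_bump[where 'n='n] by (simp add: s_def bump_def)
  have Um[measurable]: "U i \<in> borel_measurable borel" if "i < m" for i using U[OF that] by auto
  note bb = eta_bump bump_partial_deriv[OF eta_bump] bump_partial_deriv[OF bump_partial_deriv[OF eta_bump]]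
  have Pfm: "(\<lambda>y. P y k i) \<in> borel_measurable borel" "(\<lambda>y. f y i) \<in> borel_measurable borel" "(\<lambda>y. s y j k i) \<in> borel_measurable borel" if "i < m" for i j k
    unfolding P_def f_def s_def tuple_def using that
    by (simp_all add: borel_measurable_divide borel_measurable_diff kconv_measurable bb Um)
  have "\<exists>M. \<forall>i<m. \<forall>j k y. \<bar>P y k i\<bar> \<le> M i \<and> \<bar>f y i\<bar> \<le> M i \<and> \<bar>s y j k i\<bar> \<le> M i"
  proof -
    have "\<exists>Mi. \<forall>j k y. \<bar>P y k i\<bar> \<le> Mi \<and> \<bar>f y i\<bar> \<le> Mi \<and> \<bar>s y j k i\<bar> \<le> Mi" if i: "i < m" for i
    proof -
      obtain b0 where b0: "\<And>y. \<bar>kconv eta \<epsilon> (U i) y\<bar> \<le> b0" using kconv_bounded[OF bb(1) U[OF i] eps] by blast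
      have "\<exists>b. \<forall>k y. \<bar>kconv (partial_deriv k eta) \<epsilon> (U i) y\<bar> \<le> b k"
        using kconv_bounded[OF bb(2) U[OF i] eps] by (intro choice allI) blast
      then obtain b1 where b1: "\<And>k y. \<bar>kconv (partial_deriv k eta) \<epsilon> (U i) y\<bar> \<le> b1 k" by blast
      have "\<forall>jk. \<exists>b. \<forall>y. \<bar>kconv (partial_deriv (fst jk) (partial_deriv (snd jk) eta)) \<epsilon> (U i) y\<bar> \<le> b"
        using kconv_bounded[OF bb(3) U[OF i] eps] by blast
      then obtain b2 where b2: "\<And>jk y. \<bar>kconv (partial_deriv (fst jk) (partial_deriv (snd jk) eta)) \<epsilon> (U i) y\<bar> \<le> b2 jk" by metis
      define Mi where "Mi = b0 + \<bar>c i\<bar> + (\<Sum>k\<in>UNIV. b1 k / \<epsilon>) + (\<Sum>jk\<in>UNIV. b2 jk / \<epsilon> / \<epsilon>)"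
      have n0: "b0 \<ge> 0" "b1 k \<ge> 0" "b2 jk \<ge> 0" for k jk
        using order_trans[OF abs_ge_zero b0] order_trans[OF abs_ge_zero b1] order_trans[OF abs_ge_zero b2] by auto
      have n1: "(\<Sum>k\<in>UNIV. b1 k / \<epsilon>) \<ge> 0" "(\<Sum>jk\<in>UNIV. b2 jk / \<epsilon> / \<epsilon>) \<ge> 0" using n0 eps by (auto intro!: sum_nonneg)
      have "\<bar>P y k i\<bar> \<le> Mi" for y k
      proof -
        have "\<bar>P y k i\<bar> \<le> b1 k / \<epsilon>" using b1[of k y] eps i by (simp add: P_def tuple_def divide_right_mono)
        also have "\<dots> \<le> (\<Sum>k\<in>UNIV. b1 k / \<epsilon>)" using n0 eps by (intro member_le_sum) auto
        finally show ?thesis using n0(1) n1 unfolding Mi_def by linarith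
      qed
      moreover have "\<bar>f y i\<bar> \<le> Mi" for y
      proof -
        have "\<bar>f y i\<bar> \<le> b0 + \<bar>c i\<bar>" using b0[of y] i unfolding f_def tuple_nth[OF i] by linarith
        then show ?thesis using n1 unfolding Mi_def by linarith
      qed
      moreover have "\<bar>s y j k i\<bar> \<le> Mi" for y j k
      proof -
        have "\<bar>s y j k i\<bar> \<le> b2 (j, k) / \<epsilon> / \<epsilon>" using b2[of "(j, k)" y] eps i by (simp add: s_def tuple_def divide_right_mono)
        also have "\<dots> \<le> (\<Sum>jk\<in>UNIV. b2 jk / \<epsilon> / \<epsilon>)" using n0 eps by (intro member_le_sum) auto
        finally show ?thesis using n0(1) n1 unfolding Mi_def by linarith
      qed
      ultimately show ?thesis by blast
    qed
    then show ?thesis by metis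
  qed
  then obtain M where M: "\<And>i y k. i < m \<Longrightarrow> \<bar>P y k i\<bar> \<le> M i" "\<And>i y. i < m \<Longrightarrow> \<bar>f y i\<bar> \<le> M i" "\<And>i y j k. i < m \<Longrightarrow> \<bar>s y j k i\<bar> \<le> M i" by blast
  \<comment> \<open>a uniform bound for \<open>\<omega>\<close> at all families that occur below\<close>
  define MM where "MM = (\<Sum>i<m. M i) ^ CARD('n)"
  have wb: "\<bar>\<omega> v\<bar> \<le> MM" if "range v \<subseteq> topspace (Euclidean_space m)" "\<And>k i. i < m \<Longrightarrow> \<bar>v k i\<bar> \<le> M i" for v
    unfolding MM_def using that(2) by (intro covector_bound[OF cov com that(1)] sum_mono) auto
  have pdc: "continuous_on UNIV (partial_deriv j \<Phi>)" "continuous_on UNIV \<Phi>" for j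
    using bump_alg_continuous[OF bump_alg_partial_deriv[OF \<Phi>]] bump_alg_continuous[OF \<Phi>] by auto
  obtain B0 where B0: "\<And>y. \<bar>\<Phi> y\<bar> \<le> B0" using continuous_vanishing_bounded[OF pdc(2) supp] by blast
  have pdz: "partial_deriv j \<Phi> y = 0" if "y \<notin> cball ctr r" for j y
    using closed_cball supp that by (rule partial_deriv_zero_outside)
  have [measurable]: "\<Phi> \<in> borel_measurable borel" "partial_deriv j \<Phi> \<in> borel_measurable borel" for j
    using bump_alg_measurable[OF \<Phi>] bump_alg_measurable[OF bump_alg_partial_deriv[OF \<Phi>]] by auto
  define F where "F j y = \<Phi> y * \<omega> ((P y)(j := f y))" for j y
  define F' where "F' j y = partial_deriv j \<Phi> y * \<omega> ((P y)(j := f y)) + \<Phi> y * (\<omega> (P y) + (\<Sum>k\<in>UNIV - {j}. \<omega> ((P y)(j := f y, k := s y j k))))" for j y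
  have r1: "range ((P y)(j := f y)) \<subseteq> topspace (Euclidean_space m)" for y j using PE[of y] fE[of y] by auto
  have r2: "range ((P y)(j := f y, k := s y j k)) \<subseteq> topspace (Euclidean_space m)" for y j k using PE[of y] fE[of y] sE by auto
  have wm: "(\<lambda>y. \<omega> (P y)) \<in> borel_measurable borel" "(\<lambda>y. \<omega> ((P y)(j := f y))) \<in> borel_measurable borel"
     "(\<lambda>y. \<omega> ((P y)(j := f y, k := s y j k))) \<in> borel_measurable borel" for j k
  proof -
    show "(\<lambda>y. \<omega> (P y)) \<in> borel_measurable borel"
      by (rule covector_measurable[OF cov PE]) (use Pfm in auto)
    show "(\<lambda>y. \<omega> ((P y)(j := f y))) \<in> borel_measurable borel"
    proof (rule covector_measurable[OF cov r1])
      fix l i assume "i < m" then show "(\<lambda>y. ((P y)(j := f y)) l i) \<in> borel_measurable borel"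
        using Pfm by (cases "l = j") auto
    qed
    show "(\<lambda>y. \<omega> ((P y)(j := f y, k := s y j k))) \<in> borel_measurable borel"
    proof (rule covector_measurable[OF cov r2])
      fix l i assume "i < m" then show "(\<lambda>y. ((P y)(j := f y, k := s y j k)) l i) \<in> borel_measurable borel"
        using Pfm by (cases "l = k"; cases "l = j") auto
    qed
  qed
  have Fm: "F j \<in> borel_measurable borel" "F' j \<in> borel_measurable borel" for j
    unfolding F_def[abs_def] F'_def[abs_def] using wm by (auto intro!: borel_measurable_times borel_measurable_add borel_measurable_sum)
  have Fb: "\<bar>F j y\<bar> \<le> B0 * MM" for j y
    unfolding F_def abs_mult using B0[of y] wb[OF r1[of y j]] M by (intro mult_mono) auto
  have "\<exists>B. \<forall>y. \<bar>F' j y\<bar> \<le> B" for j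
  proof -
    obtain B1 where B1: "\<And>y. \<bar>partial_deriv j \<Phi> y\<bar> \<le> B1" using continuous_vanishing_bounded[OF pdc(1) pdz] by blast
    have "\<bar>F' j y\<bar> \<le> B1 * MM + B0 * (MM + (\<Sum>k\<in>UNIV - {j}. MM))" for y
    proof -
      have a: "\<bar>\<omega> ((P y)(j := f y))\<bar> \<le> MM" "\<bar>\<omega> (P y)\<bar> \<le> MM" using wb[OF r1[of y j]] wb[OF PE[of y]] M by auto
      have b: "\<bar>\<Sum>k\<in>UNIV - {j}. \<omega> ((P y)(j := f y, k := s y j k))\<bar> \<le> (\<Sum>k\<in>UNIV - {j}. MM)"
      proof (rule order_trans[OF sum_abs], rule sum_mono)
        fix k
        have "\<bar>((P y)(j := f y, k := s y j k)) l i\<bar> \<le> M i" if "i < m" for l i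
          using M that by (cases "l = k"; cases "l = j") auto
        then show "\<bar>\<omega> ((P y)(j := f y, k := s y j k))\<bar> \<le> MM" by (intro wb r2)
      qed
      have "\<bar>F' j y\<bar> \<le> \<bar>partial_deriv j \<Phi> y\<bar> * \<bar>\<omega> ((P y)(j := f y))\<bar> + \<bar>\<Phi> y\<bar> * (\<bar>\<omega> (P y)\<bar> + \<bar>\<Sum>k\<in>UNIV - {j}. \<omega> ((P y)(j := f y, k := s y j k))\<bar>)"
        unfolding F'_def abs_mult[symmetric]
        by (rule order_trans[OF abs_triangle_ineq]) (simp add: abs_mult mult_left_mono abs_triangle_ineq)
      also have "\<dots> \<le> B1 * MM + B0 * (MM + (\<Sum>k\<in>UNIV - {j}. MM))"
        using B1[of y] B0[of y] a b by (intro add_mono mult_mono) auto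
      finally show ?thesis .
    qed
    then show ?thesis by blast
  qed
  then obtain BF where BF: "\<And>j y. \<bar>F' j y\<bar> \<le> BF j" by metis
  have Fz: "F j y = 0" "F' j y = 0" if "y \<notin> cball ctr r" for j y
    using supp[OF that] pdz[OF that] by (auto simp: F_def F'_def)
  have deriv: "((\<lambda>t. F j (y + t *\<^sub>R axis j 1)) has_real_derivative F' j y) (at 0)" for j y
  proof -
    define w where "w t = (P (y + t *\<^sub>R axis j 1))(j := f (y + t *\<^sub>R axis j 1))" for t
    define w' where "w' k = (if k = j then P y j else s y j k)" for k
    have wE: "range (w t) \<subseteq> topspace (Euclidean_space m)" for t unfolding w_def by (rule r1)
    have w'E: "range w' \<subseteq> topspace (Euclidean_space m)" by (auto simp: w'_def P_def tuple_mem sE)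
    have D: "((\<lambda>t. w t k i) has_real_derivative w' k i) (at 0)" if i: "i < m" for k i
    proof (cases "k = j")
      case True
      have "((\<lambda>t. kconv eta \<epsilon> (U i) (y + t *\<^sub>R axis j 1) - c i) has_real_derivative kconv (partial_deriv j eta) \<epsilon> (U i) y / \<epsilon> - 0) (at 0)"
        by (intro DERIV_diff kconv_axis_derivative bb U i eps DERIV_const)
      then show ?thesis using True i by (simp add: w_def w'_def f_def P_def tuple_def)
    next
      case False
      have "((\<lambda>t. kconv (partial_deriv k eta) \<epsilon> (U i) (y + t *\<^sub>R axis j 1) / \<epsilon>) has_real_derivative kconv (partial_deriv j (partial_deriv k eta)) \<epsilon> (U i) y / \<epsilon> / \<epsilon>) (at 0)"
        by (intro DERIV_cdivide kconv_axis_derivative bb U i eps)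
      then show ?thesis using False i by (simp add: w_def w'_def s_def P_def tuple_def)
    qed
    have "((\<lambda>t. \<omega> (w t)) has_real_derivative (\<Sum>k\<in>UNIV. \<omega> ((w 0)(k := w' k)))) (at 0)"
      by (rule covector_has_derivative[OF cov wE w'E D])
    moreover have "((\<lambda>t. \<Phi> (y + t *\<^sub>R axis j 1)) has_real_derivative partial_deriv j \<Phi> y) (at 0)"
    proof -
      have "((\<lambda>t. y + t *\<^sub>R axis j 1) has_vector_derivative axis j 1) (at 0)" by (auto intro!: derivative_eq_intros)
      from bump_alg_curve[OF \<Phi> this]
      have "((\<lambda>t. \<Phi> (y + t *\<^sub>R axis j 1)) has_real_derivative (\<Sum>l\<in>UNIV. axis j 1 $ l * partial_deriv l \<Phi> y)) (at 0)" by simp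
      moreover have "(\<Sum>l\<in>UNIV. axis j 1 $ l * partial_deriv l \<Phi> y) = (\<Sum>l\<in>UNIV. if l = j then partial_deriv j \<Phi> y else 0)"
        by (intro sum.cong) (auto simp: axis_def)
      ultimately show ?thesis by simp
    qed
    ultimately have "((\<lambda>t. \<Phi> (y + t *\<^sub>R axis j 1) * \<omega> (w t)) has_real_derivative
       \<Phi> (y + 0 *\<^sub>R axis j 1) * (\<Sum>k\<in>UNIV. \<omega> ((w 0)(k := w' k))) + partial_deriv j \<Phi> y * \<omega> (w 0)) (at 0)"
      by (rule DERIV_mult'[rotated])
    moreover have "(\<Sum>k\<in>UNIV. \<omega> ((w 0)(k := w' k))) = \<omega> (P y) + (\<Sum>k\<in>UNIV - {j}. \<omega> ((P y)(j := f y, k := s y j k)))"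
    proof -
      have "(\<Sum>k\<in>UNIV. \<omega> ((w 0)(k := w' k))) = \<omega> ((w 0)(j := w' j)) + (\<Sum>k\<in>UNIV - {j}. \<omega> ((w 0)(k := w' k)))"
        by (rule sum.remove) auto
      also have "(w 0)(j := w' j) = P y" by (simp add: w_def w'_def)
      also have "(\<Sum>k\<in>UNIV - {j}. \<omega> ((w 0)(k := w' k))) = (\<Sum>k\<in>UNIV - {j}. \<omega> ((P y)(j := f y, k := s y j k)))"
        by (intro sum.cong refl arg_cong[where f=\<omega>]) (auto simp: w_def w'_def)
      finally show ?thesis .
    qed
    ultimately show ?thesis unfolding F_def F'_def w_def by (simp add: add.commute)
  qed
  have zero: "(\<integral>y. F' j y \<partial>lborel) = 0" for j
    by (rule integral_directional_derivative_zero[OF deriv _ Fm Fb BF Fz(1)]) simp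
  have int: "integrable lborel (F' j)" for j by (rule integrable_bounded_support[OF Fm(2) BF Fz(2)])
  have "real CARD('n) * (\<Phi> y * \<omega> (P y)) + (\<Sum>j\<in>UNIV. partial_deriv j \<Phi> y * \<omega> ((P y)(j := f y))) = (\<Sum>j\<in>UNIV. F' j y)" for y
  proof -
    have "(\<Sum>j\<in>UNIV. F' j y) = (\<Sum>j\<in>UNIV. partial_deriv j \<Phi> y * \<omega> ((P y)(j := f y))) + (\<Sum>j\<in>(UNIV::'n set). \<Phi> y * \<omega> (P y))
        + \<Phi> y * (\<Sum>j\<in>UNIV. \<Sum>k\<in>UNIV - {j}. \<omega> ((P y)(j := f y, k := s y j k)))"
      unfolding F'_def by (simp only: distrib_left sum.distrib sum_distrib_left add.assoc)
    also have "(\<Sum>j\<in>UNIV. \<Sum>k\<in>UNIV - {j}. \<omega> ((P y)(j := f y, k := s y j k))) = 0"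
      by (rule covector_mixed_cancel[OF cov PE fE sE ssym])
    finally show ?thesis by (simp only: sum_constant mult_zero_right add_0_right add.commute)
  qed
  then show ?thesis using zero int by (simp add: Bochner_Integration.integral_sum)
qed

lemma mollify_mono:
  fixes u g :: "'a::euclidean_space \<Rightarrow> real"
  assumes K: "mollifier K" and u: "integrable lborel u" and g: "integrable lborel g" and le: "\<And>y. \<bar>u y\<bar> \<le> g y" and r: "r \<noteq> 0"
  shows "\<bar>mollify K r u x\<bar> \<le> mollify K r g x"
proof -
  have Kn: "K z \<ge> 0" for z using K by (simp add: mollifier_def)
  have "norm (mollify K r u x) \<le> (\<integral>z. norm (K z * u (x - r *\<^sub>R z)) \<partial>lborel)"
    unfolding mollify_def by (rule integral_norm_bound)
  also have "\<dots> \<le> mollify K r g x"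
    unfolding mollify_def
  proof (rule integral_mono)
    fix z show "norm (K z * u (x - r *\<^sub>R z)) \<le> K z * g (x - r *\<^sub>R z)"
      using mult_left_mono[OF le Kn] Kn by (simp add: abs_mult)
  qed (intro integrable_norm mollify_integrable K u g r)+
  finally show ?thesis by simp
qed

text \<open>
  Passage to the limit in \<open>smooth_pullback_identity\<close>. The integrands for the mollified functions are
  bounded by the \<open>n\<close>-th power of the mollification of \<open>g = |U| + |G|\<close>, hence by Jensen's inequality by the mollification
  of \<open>g\<^sup>n\<close>, which converges in \<open>L\<^sup>1\<close>.
\<close>

lemma weak_pullback_identity:
  fixes \<omega> :: "('n::finite \<Rightarrow> nat \<Rightarrow> real) \<Rightarrow> real" and U :: "nat \<Rightarrow> real ^ 'n \<Rightarrow> real" and c :: "nat \<Rightarrow> real"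
  assumes cov: "covector m \<omega>" and com: "comass m \<omega> \<le> 1" and wg: "\<And>i. i < m \<Longrightarrow> weak_grad_on S (U i) (G i)"
    and suppU: "\<And>i x. i < m \<Longrightarrow> norm x > R \<Longrightarrow> U i x = 0 \<and> G i x = 0"
    and \<Phi>: "bump_alg \<Phi>" and supp: "\<And>y. y \<notin> cball x0 r \<Longrightarrow> \<Phi> y = 0"
    and \<delta>: "\<delta> > 0" "cball x0 (r + \<delta>) \<subseteq> S"
    and gn: "integrable lborel (\<lambda>y. (\<Sum>i<m. \<bar>U i y\<bar> + (\<Sum>k\<in>UNIV. \<bar>G i y $ k\<bar>)) ^ CARD('n))"
  defines "P0 \<equiv> \<lambda>y k. tuple m (\<lambda>i. G i y $ k)" and "f0 \<equiv> \<lambda>y. tuple m (\<lambda>i. U i y - c i)"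
  shows "integrable lborel (\<lambda>y. real CARD('n) * (\<Phi> y * \<omega> (P0 y)) + (\<Sum>j\<in>UNIV. partial_deriv j \<Phi> y * \<omega> ((P0 y)(j := f0 y))))"
    and "(\<integral>y. real CARD('n) * (\<Phi> y * \<omega> (P0 y)) + (\<Sum>j\<in>UNIV. partial_deriv j \<Phi> y * \<omega> ((P0 y)(j := f0 y))) \<partial>lborel) = 0"
proof -
  define N where "N = CARD('n)"
  have N: "N > 0" by (simp add: N_def)
  have U: "integrable lborel (U i)" and G: "integrable lborel (\<lambda>y. G i y $ k)" if "i < m" for i k
    using wg[OF that] by (auto simp: weak_grad_on_def)
  have [measurable]: "U i \<in> borel_measurable borel" "(\<lambda>y. G i y $ k) \<in> borel_measurable borel" if "i < m" for i k
    using U[OF that] G[OF that, of k] by auto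
  define g where "g y = (\<Sum>i<m. \<bar>U i y\<bar> + (\<Sum>k\<in>UNIV. \<bar>G i y $ k\<bar>))" for y
  have gi: "integrable lborel g"
    unfolding g_def[abs_def] by (intro Bochner_Integration.integrable_sum Bochner_Integration.integrable_add integrable_abs U G) auto
  have g0: "g y \<ge> 0" for y unfolding g_def by (intro sum_nonneg add_nonneg_nonneg) auto
  have gp: "integrable lborel (\<lambda>y. g y ^ N)" using gn by (simp add: g_def N_def)
  have gpw: "g y powr real N = g y ^ N" for y using g0 N by (simp add: powr_realpow')
  have gsupp: "g y ^ N = 0" if "norm y > R" for y
    using suppU[OF _ that] N by (simp add: g_def)
  have Ug: "\<bar>U i y\<bar> \<le> g y" and Gg: "\<bar>G i y $ k\<bar> \<le> g y" if i: "i < m" for i y k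
  proof -
    have "\<bar>U i y\<bar> + (\<Sum>k\<in>UNIV. \<bar>G i y $ k\<bar>) \<le> g y" unfolding g_def
      using i by (intro member_le_sum[where f="\<lambda>i. \<bar>U i y\<bar> + (\<Sum>k\<in>UNIV. \<bar>G i y $ k\<bar>)"]) (auto intro!: add_nonneg_nonneg sum_nonneg)
    moreover have "\<bar>G i y $ k\<bar> \<le> (\<Sum>k\<in>UNIV. \<bar>G i y $ k\<bar>)" by (rule member_le_sum[where f="\<lambda>k. \<bar>G i y $ k\<bar>"]) auto
    ultimately show "\<bar>U i y\<bar> \<le> g y" "\<bar>G i y $ k\<bar> \<le> g y"
      using sum_nonneg[of UNIV "\<lambda>k. \<bar>G i y $ k\<bar>"] by auto
  qed
  define rs where "rs k = \<delta> / real (Suc k)" for k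
  have rs: "rs k > 0" "rs k \<le> \<delta>" for k using \<delta>(1) by (auto simp: rs_def divide_le_eq mult_le_cancel_left1)
  have rsl: "rs \<longlonglongrightarrow> 0"
  proof -
    have "(\<lambda>k. \<delta> * (1 / real (Suc k))) \<longlonglongrightarrow> \<delta> * 0"
      using LIMSEQ_inverse_real_of_nat[unfolded inverse_eq_divide] by (intro tendsto_mult tendsto_const)
    then show ?thesis by (simp add: rs_def[abs_def])
  qed
  \<comment> \<open>the components and all entries of the differential as one finite family, to obtain a common subsequence\<close>
  define u where "u ik = (case snd ik of None \<Rightarrow> U (fst ik) | Some k \<Rightarrow> (\<lambda>y. G (fst ik) y $ k))" for ik :: "nat \<times> 'n option"
  obtain s where s: "strict_mono s" "AE y in lborel. \<forall>ik\<in>{..<m} \<times> UNIV. (\<lambda>k. mollify eta (rs (s k)) (u ik) y) \<longlonglongrightarrow> u ik y"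
  proof (rule mollify_AE_subseq[OF eta_mollifier, of "{..<m} \<times> UNIV" u R rs])
    show "finite ({..<m} \<times> (UNIV :: 'n option set))" by simp
    show "integrable lborel (u ik)" if "ik \<in> {..<m} \<times> UNIV" for ik
      using that U G by (auto simp: u_def split: option.splits)
    show "u ik x = 0" if "ik \<in> {..<m} \<times> UNIV" "norm x > R" for ik x
      using that suppU by (auto simp: u_def split: option.splits)
  qed (use rs rsl that in auto)
  define e where "e k = rs (s k)" for k
  have e: "e k > 0" "e k \<le> \<delta>" "e k \<noteq> 0" for k using rs[of "s k"] by (auto simp: e_def)
  have el: "e \<longlonglongrightarrow> 0" unfolding e_def[abs_def] using LIMSEQ_subseq_LIMSEQ[OF rsl s(1)] by (simp add: o_def)
  define P where "P k y l = tuple m (\<lambda>i. kconv (partial_deriv l eta) (e k) (U i) y / e k)" for k y l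
  define f where "f k y = tuple m (\<lambda>i. kconv eta (e k) (U i) y - c i)" for k y
  define Q where "Q v a y = real N * (\<Phi> y * \<omega> v) + (\<Sum>j\<in>UNIV. partial_deriv j \<Phi> y * \<omega> (v(j := a)))" for v a y
  have zero: "(\<integral>y. Q (P k y) (f k y) y \<partial>lborel) = 0" for k
    unfolding Q_def P_def[abs_def] f_def N_def
    by (rule smooth_pullback_identity[where ctr=x0 and r=r, OF cov com U \<Phi> supp e(1)])
  have fm: "f k y i = mollify eta (e k) (U i) y - c i" if "i < m" for k y i
    using that mollify_eta[of "U i" "e k" y] e(1) by (simp add: f_def tuple_def)
  have Pm: "P k y l i = mollify eta (e k) (\<lambda>y. G i y $ l) y" if i: "i < m" and y: "y \<in> cball x0 r" for k y l i
  proof -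
    have "cball y (e k) \<subseteq> S"
    proof (rule order_trans[OF _ \<delta>(2)], rule subsetI)
      fix z assume "z \<in> cball y (e k)"
      then show "z \<in> cball x0 (r + \<delta>)" using y e(2)[of k] dist_triangle[of x0 z y] by simp
    qed
    then have "kconv (partial_deriv l eta) (e k) (U i) y / e k = kconv eta (e k) (\<lambda>y. G i y $ l) y"
      by (rule kconv_weak_grad[OF wg[OF i] eta_bump e(1)])
    also have "\<dots> = mollify eta (e k) (\<lambda>y. G i y $ l) y" using i e(1) by (intro mollify_eta[symmetric]) auto
    finally show ?thesis using i by (simp add: P_def tuple_def)
  qed
  have PE: "range (P k y) \<subseteq> topspace (Euclidean_space m)" "range (P0 y) \<subseteq> topspace (Euclidean_space m)" for k y
    by (auto simp: P_def P0_def tuple_mem)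
  have fE: "f k y \<in> topspace (Euclidean_space m)" "f0 y \<in> topspace (Euclidean_space m)" for k y
    by (auto simp: f_def f0_def tuple_mem)
  have pdz: "partial_deriv j \<Phi> y = 0" if "y \<notin> cball x0 r" for j y
    using closed_cball supp that by (rule partial_deriv_zero_outside)
  have pdc: "continuous_on UNIV (partial_deriv j \<Phi>)" "continuous_on UNIV \<Phi>" for j
    using bump_alg_continuous[OF bump_alg_partial_deriv[OF \<Phi>]] bump_alg_continuous[OF \<Phi>] by auto
  have Phm: "\<Phi> \<in> borel_measurable borel" "partial_deriv j \<Phi> \<in> borel_measurable borel" for j
    using bump_alg_measurable[OF \<Phi>] bump_alg_measurable[OF bump_alg_partial_deriv[OF \<Phi>]] by auto
  obtain B0 where B0: "\<And>y. \<bar>\<Phi> y\<bar> \<le> B0" using continuous_vanishing_bounded[OF pdc(2) supp] by blast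
  have "\<exists>B. \<forall>j y. \<bar>partial_deriv j \<Phi> y\<bar> \<le> B j"
    using continuous_vanishing_bounded[OF pdc(1) pdz] by (intro choice allI) blast
  then obtain B1 where B1: "\<And>j y. \<bar>partial_deriv j \<Phi> y\<bar> \<le> B1 j" by blast
  have B0n: "B0 \<ge> 0" "B1 j \<ge> 0" for j using order_trans[OF abs_ge_zero B0] order_trans[OF abs_ge_zero B1] by auto
  define CC where "CC = (\<Sum>i<m. \<bar>c i\<bar>)"
  have CC: "CC \<ge> 0" by (simp add: CC_def sum_nonneg)
  define Ct where "Ct = (real N * B0 + (\<Sum>j\<in>UNIV. B1 j)) * 2 ^ N"
  have Ct: "Ct \<ge> 0" unfolding Ct_def using B0n by (auto intro!: mult_nonneg_nonneg add_nonneg_nonneg sum_nonneg)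
  have Qb: "\<bar>Q v a y\<bar> \<le> Ct * (real m ^ N * t ^ N + CC ^ N)"
    if v: "range v \<subseteq> topspace (Euclidean_space m)" "a \<in> topspace (Euclidean_space m)" and t: "t \<ge> 0"
      and b: "\<And>l i. i < m \<Longrightarrow> \<bar>v l i\<bar> \<le> t" "\<And>i. i < m \<Longrightarrow> \<bar>a i\<bar> \<le> t + \<bar>c i\<bar>" for v a y t
  proof -
    define M where "M = real m * t + CC"
    have M: "M \<ge> 0" using t CC by (simp add: M_def)
    have s1: "(\<Sum>i<m. \<bar>v l i\<bar>) \<le> M" for l
    proof -
      have "(\<Sum>i<m. \<bar>v l i\<bar>) \<le> (\<Sum>i<m. t)" by (intro sum_mono b) simp
      then show ?thesis using CC by (simp add: M_def)
    qed
    have s2: "(\<Sum>i<m. \<bar>a i\<bar>) \<le> M"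
    proof -
      have "(\<Sum>i<m. \<bar>a i\<bar>) \<le> (\<Sum>i<m. t + \<bar>c i\<bar>)" by (intro sum_mono b) simp
      then show ?thesis by (simp add: M_def CC_def sum.distrib)
    qed
    have w1: "\<bar>\<omega> v\<bar> \<le> M ^ N" unfolding N_def by (rule covector_bound[OF cov com v(1) s1])
    have w2: "\<bar>\<omega> (v(j := a))\<bar> \<le> M ^ N" for j unfolding N_def
      by (rule covector_bound[OF cov com]) (use v s1 s2 in auto)
    have "\<bar>Q v a y\<bar> \<le> real N * (\<bar>\<Phi> y\<bar> * \<bar>\<omega> v\<bar>) + (\<Sum>j\<in>UNIV. \<bar>partial_deriv j \<Phi> y\<bar> * \<bar>\<omega> (v(j := a))\<bar>)"
      unfolding Q_def by (rule order_trans[OF abs_triangle_ineq])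
        (intro add_mono order_trans[OF sum_abs]; simp add: abs_mult)
    also have "\<dots> \<le> real N * (B0 * M ^ N) + (\<Sum>j\<in>UNIV. B1 j * M ^ N)"
      using B0n B0 B1 w1 w2 by (intro add_mono mult_left_mono sum_mono mult_mono) auto
    also have "\<dots> = (real N * B0 + (\<Sum>j\<in>UNIV. B1 j)) * M ^ N" by (simp add: distrib_right sum_distrib_right)
    also have "M ^ N \<le> 2 ^ N * ((real m * t) ^ N + CC ^ N)"
    proof -
      have "M ^ N \<le> (2 * max (real m * t) CC) ^ N" using M by (intro power_mono) (auto simp: M_def)
      also have "\<dots> = 2 ^ N * (max (real m * t) CC) ^ N" by (simp add: power_mult_distrib)
      also have "\<dots> \<le> 2 ^ N * ((real m * t) ^ N + CC ^ N)" using t CC by (intro mult_left_mono) (auto simp: max_def)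
      finally show ?thesis .
    qed
    finally show ?thesis using B0n by (simp add: Ct_def power_mult_distrib mult_left_mono sum_nonneg mult.assoc)
  qed
  have Qz: "Q v a y = 0" if "y \<notin> cball x0 r" for v a y using supp[OF that] pdz[OF that] by (simp add: Q_def)
  define GG where "GG y = Ct * (real m ^ N * g y ^ N + CC ^ N * indicator (cball x0 r) y)" for y
  define Gs where "Gs k y = Ct * (real m ^ N * mollify eta (e k) (\<lambda>y. g y ^ N) y + CC ^ N * indicator (cball x0 r) y)" for k y
  have ib: "integrable lborel (\<lambda>y. indicator (cball x0 r) y :: real)"
    using emeasure_lborel_cball_finite by (intro integrable_real_indicator) auto
  have mgn: "mollify eta (e k) g y \<ge> 0" "mollify eta (e k) g y ^ N \<le> mollify eta (e k) (\<lambda>y. g y ^ N) y" for k y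
  proof -
    note J = mollify_jensen[OF eta_mollifier e(3)[of k] gi g0, of "real N" y, unfolded gpw, OF gp]
    show a: "mollify eta (e k) g y \<ge> 0" using J(2) N by simp
    show "mollify eta (e k) g y ^ N \<le> mollify eta (e k) (\<lambda>y. g y ^ N) y" using J(1) N a by (simp add: powr_realpow')
  qed
  have mgp: "mollify eta (e k) (\<lambda>y. g y ^ N) y \<ge> 0" for k y
    using order_trans[OF zero_le_power[OF mgn(1)] mgn(2)] .
  have wm: "(\<lambda>y. Q (P k y) (f k y) y) \<in> borel_measurable borel" "(\<lambda>y. Q (P0 y) (f0 y) y) \<in> borel_measurable borel" for k
  proof -
    have pm: "(\<lambda>y. P k y l i) \<in> borel_measurable borel" "(\<lambda>y. f k y i) \<in> borel_measurable borel"
       "(\<lambda>y. P0 y l i) \<in> borel_measurable borel" "(\<lambda>y. f0 y i) \<in> borel_measurable borel" if "i < m" for l i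
      unfolding P_def f_def P0_def f0_def tuple_def using that
      by (simp_all add: borel_measurable_divide borel_measurable_diff kconv_measurable eta_bump bump_partial_deriv)
    have a: "(\<lambda>y. \<omega> (P k y)) \<in> borel_measurable borel" "(\<lambda>y. \<omega> (P0 y)) \<in> borel_measurable borel"
      using pm by (auto intro!: covector_measurable[OF cov PE(1)] covector_measurable[OF cov PE(2)])
    have b: "(\<lambda>y. \<omega> ((P k y)(j := f k y))) \<in> borel_measurable borel" for j
    proof (rule covector_measurable[OF cov])
      show "range ((P k y)(j := f k y)) \<subseteq> topspace (Euclidean_space m)" for y using PE(1)[of k y] fE(1)[of k y] by auto
      fix l i assume "i < m" then show "(\<lambda>y. ((P k y)(j := f k y)) l i) \<in> borel_measurable borel"
        using pm by (cases "l = j") auto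
    qed
    have c: "(\<lambda>y. \<omega> ((P0 y)(j := f0 y))) \<in> borel_measurable borel" for j
    proof (rule covector_measurable[OF cov])
      show "range ((P0 y)(j := f0 y)) \<subseteq> topspace (Euclidean_space m)" for y using PE(2)[of y] fE(2)[of y] by auto
      fix l i assume "i < m" then show "(\<lambda>y. ((P0 y)(j := f0 y)) l i) \<in> borel_measurable borel"
        using pm by (cases "l = j") auto
    qed
    show "(\<lambda>y. Q (P k y) (f k y) y) \<in> borel_measurable borel" "(\<lambda>y. Q (P0 y) (f0 y) y) \<in> borel_measurable borel"
      unfolding Q_def by (intro borel_measurable_add borel_measurable_times borel_measurable_sum borel_measurable_const Phm a b c)+
  qed
  have GGi: "integrable lborel GG" unfolding GG_def[abs_def] using gp ib by (intro integrable_mult_right Bochner_Integration.integrable_add) auto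
  have GGb: "AE y in lborel. \<bar>Q (P0 y) (f0 y) y\<bar> \<le> GG y"
  proof (rule AE_I2)
    fix y
    show "\<bar>Q (P0 y) (f0 y) y\<bar> \<le> GG y"
    proof (cases "y \<in> cball x0 r")
      case True
      have b1: "\<bar>P0 y l i\<bar> \<le> g y" if "i < m" for l i using Gg[OF that] that by (simp add: P0_def tuple_def)
      have b2: "\<bar>f0 y i\<bar> \<le> g y + \<bar>c i\<bar>" if "i < m" for i
        using Ug[OF that, of y] that unfolding f0_def tuple_nth[OF that] by linarith
      show ?thesis using Qb[OF PE(2) fE(2) g0 b1 b2, of y] True by (simp add: GG_def)
    next
      case False then show ?thesis using Qz[OF False] Ct g0 by (simp add: GG_def)
    qed
  qed
  have "(\<lambda>k. \<integral>y. Q (P k y) (f k y) y \<partial>lborel) \<longlonglongrightarrow> (\<integral>y. Q (P0 y) (f0 y) y \<partial>lborel)"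
  proof (rule integral_generalized_dominated_convergence[where G=GG and Gs=Gs])
    show "integrable lborel GG" by (rule GGi)
    show "integrable lborel (Gs k)" for k unfolding Gs_def[abs_def]
      using mollify_integrable_lborel[OF eta_mollifier gp e(3)] ib by (intro integrable_mult_right Bochner_Integration.integrable_add) auto
    show "GG y \<ge> 0" for y unfolding GG_def using Ct g0 CC by simp
    show "AE y in lborel. \<bar>Q (P k y) (f k y) y\<bar> \<le> Gs k y" for k
    proof (rule AE_I2)
      fix y
      show "\<bar>Q (P k y) (f k y) y\<bar> \<le> Gs k y"
      proof (cases "y \<in> cball x0 r")
        case True
        let ?t = "mollify eta (e k) g y"
        have b1: "\<bar>P k y l i\<bar> \<le> ?t" if "i < m" for l i
          unfolding Pm[OF that True] by (rule mollify_mono[OF eta_mollifier G[OF that] gi Gg[OF that] e(3)])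
        have b2: "\<bar>f k y i\<bar> \<le> ?t + \<bar>c i\<bar>" if "i < m" for i
          using mollify_mono[OF eta_mollifier U[OF that] gi Ug[OF that] e(3), of k y] unfolding fm[OF that] by linarith
        have "\<bar>Q (P k y) (f k y) y\<bar> \<le> Ct * (real m ^ N * ?t ^ N + CC ^ N)"
          by (rule Qb[OF PE(1) fE(1) mgn(1) b1 b2])
        also have "\<dots> \<le> Ct * (real m ^ N * mollify eta (e k) (\<lambda>y. g y ^ N) y + CC ^ N)"
          using Ct mgn(2) by (intro mult_left_mono add_right_mono) auto
        finally show ?thesis using True by (simp add: Gs_def)
      next
        case False then show ?thesis using Qz[OF False] Ct mgp by (simp add: Gs_def)
      qed
    qed
    show "AE y in lborel. \<bar>Q (P0 y) (f0 y) y\<bar> \<le> GG y" by (rule GGb)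
    show "AE y in lborel. (\<lambda>k. Q (P k y) (f k y) y) \<longlonglongrightarrow> Q (P0 y) (f0 y) y"
      using s(2)
    proof eventually_elim
      case (elim y)
      show ?case
      proof (cases "y \<in> cball x0 r")
        case True
        have c1: "(\<lambda>k. P k y l i) \<longlonglongrightarrow> P0 y l i" if i: "i < m" for l i
        proof -
          have "(\<lambda>k. mollify eta (rs (s k)) (u (i, Some l)) y) \<longlonglongrightarrow> u (i, Some l) y" using elim i by blast
          then show ?thesis unfolding Pm[OF i True] using i by (simp add: u_def e_def P0_def tuple_def)
        qed
        have c2: "(\<lambda>k. f k y i) \<longlonglongrightarrow> f0 y i" if i: "i < m" for i
        proof -
          have "(\<lambda>k. mollify eta (rs (s k)) (u (i, None)) y) \<longlonglongrightarrow> u (i, None) y" using elim i by blast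
          then have "(\<lambda>k. mollify eta (e k) (U i) y - c i) \<longlonglongrightarrow> U i y - c i"
            by (intro tendsto_diff tendsto_const) (simp add: u_def e_def)
          then show ?thesis unfolding fm[OF i] using i by (simp add: f0_def tuple_def)
        qed
        have d1: "(\<lambda>k. \<omega> (P k y)) \<longlonglongrightarrow> \<omega> (P0 y)" by (rule covector_tendsto[OF cov PE(1) PE(2) c1])
        have d2: "(\<lambda>k. \<omega> ((P k y)(j := f k y))) \<longlonglongrightarrow> \<omega> ((P0 y)(j := f0 y))" for j
        proof (rule covector_tendsto[OF cov])
          show "range ((P k y)(j := f k y)) \<subseteq> topspace (Euclidean_space m)" for k using PE(1)[of k y] fE(1)[of k y] by auto
          show "range ((P0 y)(j := f0 y)) \<subseteq> topspace (Euclidean_space m)" using PE(2)[of y] fE(2)[of y] by auto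
          fix l i assume "i < m" then show "(\<lambda>k. ((P k y)(j := f k y)) l i) \<longlonglongrightarrow> ((P0 y)(j := f0 y)) l i"
            using c1 c2 by (cases "l = j") auto
        qed
        show ?thesis unfolding Q_def by (intro tendsto_intros d1 d2)
      next
        case False then show ?thesis by (simp add: Qz)
      qed
    qed
    show "(\<lambda>k. \<integral>y. \<bar>Gs k y - GG y\<bar> \<partial>lborel) \<longlonglongrightarrow> 0"
    proof -
      have "\<bar>Gs k y - GG y\<bar> = Ct * real m ^ N * \<bar>mollify eta (e k) (\<lambda>y. g y ^ N) y - g y ^ N\<bar>" for k y
      proof -
        have "Gs k y - GG y = (Ct * real m ^ N) * (mollify eta (e k) (\<lambda>y. g y ^ N) y - g y ^ N)"
          by (simp add: Gs_def GG_def algebra_simps)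
        then show ?thesis using Ct by (simp add: abs_mult)
      qed
      moreover have "(\<lambda>k. Ct * real m ^ N * (\<integral>y. \<bar>mollify eta (e k) (\<lambda>y. g y ^ N) y - g y ^ N\<bar> \<partial>lborel)) \<longlonglongrightarrow> Ct * real m ^ N * 0"
        by (intro tendsto_mult tendsto_const mollify_L1[OF eta_mollifier gp gsupp e(1) el])
      ultimately show ?thesis by simp
    qed
  qed (use wm in simp_all)
  then have "(\<lambda>k::nat. 0) \<longlonglongrightarrow> (\<integral>y. Q (P0 y) (f0 y) y \<partial>lborel)" unfolding zero .
  then have "(\<integral>y. Q (P0 y) (f0 y) y \<partial>lborel) = 0" by (simp add: LIMSEQ_const_iff)
  then show "(\<integral>y. real CARD('n) * (\<Phi> y * \<omega> (P0 y)) + (\<Sum>j\<in>UNIV. partial_deriv j \<Phi> y * \<omega> ((P0 y)(j := f0 y))) \<partial>lborel) = 0" by (simp add: Q_def N_def)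
  have "integrable lborel (\<lambda>y. Q (P0 y) (f0 y) y)"
    by (rule Bochner_Integration.integrable_bound[OF GGi]) (use wm GGb in \<open>auto elim: eventually_mono\<close>)
  then show "integrable lborel (\<lambda>y. real CARD('n) * (\<Phi> y * \<omega> (P0 y)) + (\<Sum>j\<in>UNIV. partial_deriv j \<Phi> y * \<omega> ((P0 y)(j := f0 y))))" by (simp add: Q_def N_def)
qed

section \<open>From the Caccioppoli inequality to local higher integrability\<close>

lemma bump_alg_power: "bump_alg f \<Longrightarrow> bump_alg (\<lambda>y. f y ^ n)"
proof (induction n)
  case 0 show ?case using bump_alg.const[of 1] by simp
next
  case (Suc n) then show ?case using bump_alg.mult[of f "\<lambda>y. f y ^ n"] by simp
qed

lemma partial_deriv_power:
  assumes f: "bump_alg f"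
  shows "partial_deriv j (\<lambda>y. f y ^ Suc n) y = real (Suc n) * f y ^ n * partial_deriv j f y"
proof (induction n)
  case (Suc n)
  have "partial_deriv j (\<lambda>y. f y * f y ^ Suc n) y = f y * partial_deriv j (\<lambda>y. f y ^ Suc n) y + partial_deriv j f y * f y ^ Suc n"
    by (intro partial_deriv_mult bump_alg_differentiable bump_alg_power f)
  then have "partial_deriv j (\<lambda>y. f y ^ Suc (Suc n)) y = f y * partial_deriv j (\<lambda>y. f y ^ Suc n) y + partial_deriv j f y * f y ^ Suc n" by simp
  also have "\<dots> = real (Suc (Suc n)) * f y ^ Suc n * partial_deriv j f y" unfolding Suc.IH by (simp add: algebra_simps)
  finally show ?case .
qed simp

text \<open>
  Young's inequality in the form that allows the first term to be absorbed. It distinguishes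
  \<open>b \<le> a/2\<close> from its negation.
\<close>

lemma young_power:
  fixes a b :: real
  assumes "a \<ge> 0" "b \<ge> 0"
  shows "a ^ n * b \<le> a ^ Suc n / 2 + 2 ^ n * b ^ Suc n"
proof (cases "b \<le> a / 2")
  case True
  have "a ^ n * b \<le> a ^ n * (a / 2)" using True assms by (intro mult_left_mono) auto
  also have "\<dots> = a ^ Suc n / 2" by simp
  finally show ?thesis using assms by (simp add: add_increasing2)
next
  case False
  have "a ^ n \<le> (2 * b) ^ n" using False assms by (intro power_mono) auto
  then have "a ^ n * b \<le> (2 * b) ^ n * b" using assms by (intro mult_right_mono) auto
  also have "\<dots> = 2 ^ n * b ^ Suc n" by (simp add: power_mult_distrib mult_ac)
  finally show ?thesis using assms by (simp add: add_increasing)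
qed

lemma eta_lower_bound: "\<exists>c>0. \<forall>z :: real ^ 'n::finite. norm z \<le> 1/2 \<longrightarrow> c \<le> eta z"
proof (intro exI conjI allI impI)
  let ?I = "integral\<^sup>L lborel (eta0 :: real ^ 'n \<Rightarrow> real)"
  have I: "?I > 0" by (rule eta0_integral_pos)
  show "exp (- 2) / ?I > 0" using I by simp
  fix z :: "real ^ 'n" assume z: "norm z \<le> 1/2"
  have "(norm z)\<^sup>2 \<le> (1/2)\<^sup>2" using z by (intro power_mono) auto
  then have a: "1/2 \<le> 1 - (norm z)\<^sup>2" by (simp add: power2_eq_square)
  then have "inverse (1 - (norm z)\<^sup>2) \<le> inverse (1/2)" by (intro le_imp_inverse_le) auto
  then have "exp (- 2) \<le> eta0 z" using z by (simp add: eta0_eq)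
  then show "exp (- 2) / ?I \<le> eta z" using I by (simp add: eta_def divide_right_mono)
qed

text \<open>
  Hadamard's inequality, with the columns of \<open>A\<close> estimated by its Hilbert-Schmidt norm.
\<close>

lemma pullback_mixed_bound:
  fixes \<omega> :: "('n::finite \<Rightarrow> nat \<Rightarrow> real) \<Rightarrow> real"
  assumes cov: "covector m \<omega>" and com: "comass m \<omega> \<le> 1"
  shows "\<bar>\<omega> ((\<lambda>k. tuple m (\<lambda>i. A i $ k))(j := tuple m a))\<bar> \<le> L2_set a {..<m} * hs_norm m A ^ (CARD('n) - 1)"
proof -
  let ?v = "(\<lambda>k. tuple m (\<lambda>i. A i $ k))(j := tuple m a)"
  have l2t: "L2_set (tuple m b) {..<m} = L2_set b {..<m}" for b
    by (rule L2_set_cong) (auto simp: tuple_def)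
  have col: "L2_set (\<lambda>i. A i $ k) {..<m} \<le> hs_norm m A" for k
  proof -
    have "L2_set (\<lambda>i. A i $ k) {..<m} = L2_set (\<lambda>i. \<bar>A i $ k\<bar>) {..<m}" by (simp add: L2_set_def)
    also have "\<dots> \<le> hs_norm m A" unfolding hs_norm_def by (intro L2_set_mono component_le_norm_cart) auto
    finally show ?thesis .
  qed
  have "range ?v \<subseteq> topspace (Euclidean_space m)" by (auto simp: tuple_mem)
  from covector_Hadamard[OF cov com this]
  have "\<bar>\<omega> ?v\<bar> \<le> (\<Prod>k\<in>UNIV. L2_set (?v k) {..<m})" .
  also have "\<dots> = L2_set (?v j) {..<m} * (\<Prod>k\<in>UNIV - {j}. L2_set (?v k) {..<m})" by (rule prod.remove) auto
  also have "\<dots> \<le> L2_set a {..<m} * (\<Prod>k\<in>UNIV - {j}. hs_norm m A)"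
    using col by (intro mult_mono prod_mono) (auto simp: l2t prod_nonneg)
  also have "(\<Prod>k\<in>UNIV - {j}. hs_norm m A) = hs_norm m A ^ (CARD('n) - 1)" by (simp add: card_Diff_singleton)
  finally show ?thesis .
qed

lemma hs_norm_le_sum: "hs_norm m A \<le> (\<Sum>i<m. \<Sum>k\<in>UNIV. \<bar>A i $ k\<bar>)"
  unfolding hs_norm_def by (rule order_trans[OF L2_set_le_sum]) (auto intro!: sum_mono norm_le_l1_cart)

text \<open>
  The situation after localization: \<open>U\<close> and its weak gradient \<open>G\<close> in \<open>S\<close> are Borel functions on the
  whole space that vanish outside a ball and are integrable to the power \<open>n\<close>, and the distortion inequality
  holds in \<open>S\<close> with the Hilbert-Schmidt norm, whose \<open>n\<close>-th power is comparable to that of the operator norm.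
\<close>

definition quasiregular_on ::
  "real \<Rightarrow> nat \<Rightarrow> (('n::finite \<Rightarrow> nat \<Rightarrow> real) \<Rightarrow> real) \<Rightarrow> (nat \<Rightarrow> real ^ 'n \<Rightarrow> real) \<Rightarrow>
   (nat \<Rightarrow> real ^ 'n \<Rightarrow> real ^ 'n) \<Rightarrow> real \<Rightarrow> (real ^ 'n) set \<Rightarrow> bool"
  where
  "quasiregular_on K m \<omega> U G R S \<longleftrightarrow>
     covector m \<omega> \<and> comass m \<omega> \<le> 1 \<and> (\<forall>i<m. weak_grad_on S (U i) (G i)) \<and>
     (\<forall>i<m. \<forall>x. norm x > R \<longrightarrow> U i x = 0 \<and> G i x = 0) \<and>
     integrable lborel (\<lambda>y. (\<Sum>i<m. \<bar>U i y\<bar> + (\<Sum>k\<in>UNIV. \<bar>G i y $ k\<bar>)) ^ CARD('n)) \<and>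
     (AE y in lborel. y \<in> S \<longrightarrow> hs_norm m (\<lambda>i. G i y) ^ CARD('n) \<le> K * \<omega> (\<lambda>k. tuple m (\<lambda>i. G i y $ k)))"

lemma quasiregular_onD:
  fixes \<omega> :: "('n::finite \<Rightarrow> nat \<Rightarrow> real) \<Rightarrow> real"
  assumes "quasiregular_on K m \<omega> U G R S"
  shows "covector m \<omega>" "comass m \<omega> \<le> 1" "\<forall>i<m. weak_grad_on S (U i) (G i)"
    "\<forall>i<m. \<forall>x. norm x > R \<longrightarrow> U i x = 0 \<and> G i x = 0"
    "integrable lborel (\<lambda>y. (\<Sum>i<m. \<bar>U i y\<bar> + (\<Sum>k\<in>UNIV. \<bar>G i y $ k\<bar>)) ^ CARD('n))"
    "AE y in lborel. y \<in> S \<longrightarrow> hs_norm m (\<lambda>i. G i y) ^ CARD('n) \<le> K * \<omega> (\<lambda>k. tuple m (\<lambda>i. G i y $ k))"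
  by (insert assms, unfold quasiregular_on_def, (elim conjE, assumption)+)

text \<open>
  In \<open>weak_pullback_identity\<close> take for \<open>\<Phi>\<close> the \<open>n\<close>-th power of a cut-off function \<open>\<phi>\<close>. Then the factor
  \<open>\<phi>\<^sup>n\<^sup>-\<^sup>1\<close> of \<open>\<nabla>\<Phi>\<close> combines with the \<open>n - 1\<close> differentials into \<open>(\<phi> |G|)\<^sup>n\<^sup>-\<^sup>1\<close>, and Young's inequality allows half
  of the integral of \<open>(\<phi> |G|)\<^sup>n\<close> to be absorbed. The hypothesis on \<open>X\<close> is stated with a nonnegative integral, as
  this is the form in which the Sobolev-Poincare inequality supplies it; \<open>\<delta>\<close> leaves room for mollification.
\<close>

lemma caccioppoli:
  fixes K :: real
  assumes K: "K \<ge> 0"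
  shows "\<exists>C>0. \<forall>m (\<omega> :: ('n::finite \<Rightarrow> nat \<Rightarrow> real) \<Rightarrow> real) U (G :: nat \<Rightarrow> real ^ 'n \<Rightarrow> real ^ 'n) S R x0 r \<delta> c X.
    quasiregular_on K m \<omega> U G R S \<longrightarrow>
    0 < r \<longrightarrow> 0 < \<delta> \<longrightarrow> cball x0 (r + \<delta>) \<subseteq> S \<longrightarrow> 0 \<le> X \<longrightarrow>
    (\<integral>\<^sup>+x. ennreal (L2_set (\<lambda>i. U i x - c i) {..<m} ^ CARD('n)) * indicator (cball x0 r) x \<partial>lborel) \<le> ennreal X \<longrightarrow>
    int_on (\<lambda>y. hs_norm m (\<lambda>i. G i y) ^ CARD('n)) (cball x0 (r/2)) \<le> C / r ^ CARD('n) * X"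
proof -
  define N where "N = CARD('n)"
  obtain n where Nn: "N = Suc n" unfolding N_def by (metis card_gt_0_iff finite_class.finite_UNIV UNIV_not_empty gr0_implies_Suc)
  obtain c1 where c1: "c1 > 0" "\<And>z :: real ^ 'n. norm z \<le> 1/2 \<Longrightarrow> c1 \<le> eta z" using eta_lower_bound by blast
  have "\<exists>b. \<forall>j (z :: real ^ 'n). \<bar>partial_deriv j eta z\<bar> \<le> b j"
  proof (intro choice allI)
    fix j :: 'n show "\<exists>b. \<forall>z. \<bar>partial_deriv j eta z\<bar> \<le> b" using bump_bounded[OF bump_partial_deriv[OF eta_bump, of j]] by metis
  qed
  then obtain b where b: "\<And>j (z :: real ^ 'n). \<bar>partial_deriv j eta z\<bar> \<le> b j" by blast
  have bn: "b j \<ge> 0" for j using order_trans[OF abs_ge_zero b] .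
  define B where "B = (\<Sum>j\<in>UNIV. b j)"
  have B: "B \<ge> 0" unfolding B_def using bn by (intro sum_nonneg)
  obtain Be where Be: "\<And>z :: real ^ 'n. \<bar>eta z\<bar> \<le> Be" using bump_bounded[OF eta_bump] by metis
  define C where "C = 2 * 2 ^ n * (K * real N * B) ^ N / c1 ^ N + 1"
  have C: "C > 0" unfolding C_def using K B c1 by (intro add_nonneg_pos) auto
  show ?thesis
  proof (intro exI[of _ C] conjI allI impI)
    show "C > 0" by (rule C)
    fix m and \<omega> :: "('n \<Rightarrow> nat \<Rightarrow> real) \<Rightarrow> real" and U and G :: "nat \<Rightarrow> real ^ 'n \<Rightarrow> real ^ 'n" and S R x0 r \<delta> c X
    assume quasi: "quasiregular_on K m \<omega> U G R S"
      and r: "0 < r" and d: "0 < \<delta>" "cball x0 (r + \<delta>) \<subseteq> S" and X: "0 \<le> X"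
      and bX: "(\<integral>\<^sup>+x. ennreal (L2_set (\<lambda>i. U i x - c i) {..<m} ^ CARD('n)) * indicator (cball x0 r) x \<partial>lborel) \<le> ennreal X"
    note cov = quasiregular_onD(1)[OF quasi] and com = quasiregular_onD(2)[OF quasi] and wg = quasiregular_onD(3)[OF quasi]
      and supp = quasiregular_onD(4)[OF quasi] and gn = quasiregular_onD(5)[OF quasi] and qr = quasiregular_onD(6)[OF quasi]
    have wgi: "weak_grad_on S (U i) (G i)" if "i < m" for i using wg that by blast
    define h where "h y = hs_norm m (\<lambda>i. G i y)" for y
    have h0: "h y \<ge> 0" for y by (simp add: h_def hs_norm_nonneg)
    have hi: "integrable lborel h" unfolding h_def[abs_def]
      by (rule hs_norm_integrable[where U=U and G=G and S=S and m=m, OF wgi])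
    have hm[measurable]: "h \<in> borel_measurable borel" using hi by auto
    have Um: "U i \<in> borel_measurable borel" if "i < m" for i using wgi[OF that] by (auto simp: weak_grad_on_def)
    have hN: "integrable lborel (\<lambda>y. h y ^ N)"
    proof (rule Bochner_Integration.integrable_bound[OF gn])
      have "h y \<le> (\<Sum>i<m. \<bar>U i y\<bar> + (\<Sum>k\<in>UNIV. \<bar>G i y $ k\<bar>))" for y
        unfolding h_def by (rule order_trans[OF hs_norm_le_sum]) (intro sum_mono, simp)
      then have "h y ^ N \<le> (\<Sum>i<m. \<bar>U i y\<bar> + (\<Sum>k\<in>UNIV. \<bar>G i y $ k\<bar>)) ^ N" for y using h0 by (intro power_mono)
      then show "AE y in lborel. norm (h y ^ N) \<le> norm ((\<Sum>i<m. \<bar>U i y\<bar> + (\<Sum>k\<in>UNIV. \<bar>G i y $ k\<bar>)) ^ CARD('n))"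
        unfolding N_def[symmetric] real_norm_def using h0 by (intro AE_I2 order_trans[OF _ abs_ge_self]) simp
    qed simp
    define L where "L y = L2_set (\<lambda>i. U i y - c i) {..<m}" for y
    have L0: "L y \<ge> 0" for y by (simp add: L_def)
    have Lm[measurable]: "L \<in> borel_measurable borel" unfolding L_def[abs_def] L2_set_def using Um
      by (intro measurable_compose[OF _ borel_measurable_sqrt] borel_measurable_sum borel_measurable_power borel_measurable_diff) auto
    define LX where "LX y = L y ^ N * indicator (cball x0 r) y" for y
    have LXm[measurable]: "LX \<in> borel_measurable borel" unfolding LX_def[abs_def] by measurable
    have LXn: "(\<integral>\<^sup>+y. ennreal (LX y) \<partial>lborel) \<le> ennreal X"
    proof -
      have "(\<integral>\<^sup>+y. ennreal (LX y) \<partial>lborel) = (\<integral>\<^sup>+x. ennreal (L2_set (\<lambda>i. U i x - c i) {..<m} ^ CARD('n)) * indicator (cball x0 r) x \<partial>lborel)"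
        by (intro nn_integral_cong) (auto simp: LX_def L_def N_def indicator_def)
      then show ?thesis using bX by simp
    qed
    have LX0: "LX y \<ge> 0" for y using L0 by (simp add: LX_def)
    have LXi: "integrable lborel LX"
      using LXn LX0 by (simp add: integrable_iff_bounded le_less_trans)
    have LXX: "(\<integral>y. LX y \<partial>lborel) \<le> X"
      using LXn X nn_integral_eq_integral[OF LXi] LX0 by (simp add: ennreal_le_iff)
    define \<phi> where "\<phi> y = eta ((1/r) *\<^sub>R (x0 - y))" for y
    have ph0: "\<phi> y \<ge> 0" for y by (simp add: \<phi>_def eta_nonneg)
    have pha: "bump_alg \<phi>" unfolding \<phi>_def[abs_def] using eta_bump[where 'n='n] by (intro bump_alg_affine) (simp add: bump_def)
    have phm[measurable]: "\<phi> \<in> borel_measurable borel" by (rule bump_alg_measurable[OF pha])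
    have phs: "\<phi> y = 0" if "y \<notin> cball x0 r" for y
    proof -
      have "norm ((1/r) *\<^sub>R (x0 - y)) > 1" unfolding norm_scaleR using that r by (simp add: dist_norm)
      then show ?thesis unfolding \<phi>_def using eta_bump[where 'n='n] unfolding bump_def by blast
    qed
    define \<Phi> where "\<Phi> y = \<phi> y ^ N" for y
    have Pha: "bump_alg \<Phi>" unfolding \<Phi>_def[abs_def] by (rule bump_alg_power[OF pha])
    have Phs: "\<Phi> y = 0" if "y \<notin> cball x0 r" for y using phs[OF that] by (simp add: \<Phi>_def Nn)
    have pdPhi: "\<bar>partial_deriv j \<Phi> y\<bar> \<le> real N * \<phi> y ^ n * (b j / r)" for j y
    proof -
      have "partial_deriv j \<phi> y = - (1/r) * partial_deriv j eta ((1/r) *\<^sub>R (x0 - y))"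
        unfolding \<phi>_def[abs_def] by (rule partial_deriv_affine) (use eta_bump[where 'n='n] in \<open>simp add: bump_def\<close>)
      then have "\<bar>partial_deriv j \<phi> y\<bar> = \<bar>partial_deriv j eta ((1/r) *\<^sub>R (x0 - y))\<bar> / r" using r by (simp only: abs_mult abs_minus_cancel) simp
      also have "\<dots> \<le> b j / r" using b r by (intro divide_right_mono) auto
      finally have pb: "\<bar>partial_deriv j \<phi> y\<bar> \<le> b j / r" .
      have "partial_deriv j \<Phi> y = real N * \<phi> y ^ n * partial_deriv j \<phi> y" unfolding \<Phi>_def[abs_def] Nn by (rule partial_deriv_power[OF pha])
      then have "\<bar>partial_deriv j \<Phi> y\<bar> = (real N * \<phi> y ^ n) * \<bar>partial_deriv j \<phi> y\<bar>" using ph0 by (simp add: abs_mult)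
      also have "\<dots> \<le> (real N * \<phi> y ^ n) * (b j / r)" using ph0 by (intro mult_left_mono[OF pb]) simp
      finally show ?thesis .
    qed
    define P0 where "P0 y k = tuple m (\<lambda>i. G i y $ k)" for y k
    define f0 where "f0 y = tuple m (\<lambda>i. U i y - c i)" for y
    define D where "D y = (\<Sum>j\<in>UNIV. partial_deriv j \<Phi> y * \<omega> ((P0 y)(j := f0 y)))" for y
    define Q where "Q y = real N * (\<Phi> y * \<omega> (P0 y)) + D y" for y
    have sU: "U i x = 0 \<and> G i x = 0" if "i < m" "norm x > R" for i x using supp that by blast
    note wpi = weak_pullback_identity[OF cov com wgi sU Pha Phs d gn, where c=c]
    have Qi: "integrable lborel Q" and Qz: "(\<integral>y. Q y \<partial>lborel) = 0"
      using wpi unfolding Q_def[abs_def] D_def[abs_def] P0_def[abs_def] f0_def[abs_def] N_def by auto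
    define a where "a y = \<phi> y * h y" for y
    have a0: "a y \<ge> 0" for y using ph0 h0 by (simp add: a_def)
    define k where "k = K * real N * B / r"
    have k0: "k \<ge> 0" using K B r by (simp add: k_def)
    \<comment> \<open>the factor \<open>1/r\<close> from \<open>\<nabla>\<phi>\<close> is collected in \<open>k\<close>\<close>
    have Db: "K * \<bar>D y\<bar> \<le> a y ^ n * (k * L y)" for y
    proof -
      have "\<bar>D y\<bar> \<le> (\<Sum>j\<in>UNIV. (real N * \<phi> y ^ n * (b j / r)) * (L y * h y ^ n))"
        unfolding D_def
      proof (rule order_trans[OF sum_abs], rule sum_mono)
        fix j
        have "\<bar>\<omega> ((P0 y)(j := f0 y))\<bar> \<le> L y * h y ^ n"
          using pullback_mixed_bound[OF cov com, of "\<lambda>i. G i y" j "\<lambda>i. U i y - c i"] Nn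
          by (simp add: P0_def[abs_def] f0_def L_def h_def N_def)
        then show "\<bar>partial_deriv j \<Phi> y * \<omega> ((P0 y)(j := f0 y))\<bar> \<le> (real N * \<phi> y ^ n * (b j / r)) * (L y * h y ^ n)"
          unfolding abs_mult using pdPhi[of j y] ph0 bn r by (intro mult_mono) auto
      qed
      also have "\<dots> = real N * \<phi> y ^ n * (B / r) * (L y * h y ^ n)"
        by (simp only: B_def sum_divide_distrib sum_distrib_left sum_distrib_right)
      finally have "K * \<bar>D y\<bar> \<le> K * (real N * \<phi> y ^ n * (B / r) * (L y * h y ^ n))" using K by (rule mult_left_mono)
      also have "\<dots> = a y ^ n * (k * L y)" by (simp add: a_def k_def power_mult_distrib)
      finally show ?thesis .
    qed
    have main: "AE y in lborel. a y ^ N / 2 \<le> K * Q y + 2 ^ n * k ^ N * LX y"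
      using qr
    proof eventually_elim
      case (elim y)
      show ?case
      proof (cases "y \<in> cball x0 r")
        case True
        then have yS: "y \<in> S" using d by auto
        have "h y ^ N \<le> K * \<omega> (P0 y)" using elim yS by (simp add: h_def N_def P0_def[abs_def])
        then have "real N * (\<Phi> y * h y ^ N) \<le> real N * (\<Phi> y * (K * \<omega> (P0 y)))"
          using ph0 by (intro mult_left_mono) (auto simp: \<Phi>_def)
        then have "real N * a y ^ N \<le> K * (Q y - D y)"
          by (simp add: Q_def \<Phi>_def a_def power_mult_distrib mult_ac)
        also have "\<dots> \<le> K * Q y + K * \<bar>D y\<bar>" using mult_left_mono[OF abs_ge_minus_self[of "D y"] K] by (simp add: algebra_simps)
        also have "K * \<bar>D y\<bar> \<le> a y ^ N / 2 + 2 ^ n * (k * L y) ^ N"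
          unfolding Nn by (rule order_trans[OF Db young_power[OF a0]]) (use k0 L0 in simp)
        also have "(k * L y) ^ N = k ^ N * LX y" using True by (simp add: LX_def power_mult_distrib)
        finally have "real N * a y ^ N \<le> K * Q y + (a y ^ N / 2 + 2 ^ n * (k ^ N * LX y))" by simp
        moreover have "1 * a y ^ N \<le> real N * a y ^ N" using a0 Nn by (intro mult_right_mono) auto
        ultimately show ?thesis by simp
      next
        case False
        have "Q y = 0" using Phs[OF False] partial_deriv_zero_outside[OF closed_cball Phs False] by (simp add: Q_def D_def)
        then show ?thesis using phs[OF False] k0 LX0[of y] Nn by (simp add: a_def)
      qed
    qed
    have aNi: "integrable lborel (\<lambda>y. a y ^ N)"
    proof (rule Bochner_Integration.integrable_bound[where f="\<lambda>y. Be ^ N * h y ^ N"])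
      have "a y ^ N \<le> Be ^ N * h y ^ N" for y
        unfolding a_def power_mult_distrib using Be[of "(1/r) *\<^sub>R (x0 - y)"] ph0[of y] h0
        by (intro mult_right_mono power_mono) (auto simp: \<phi>_def)
      then show "AE y in lborel. norm (a y ^ N) \<le> norm (Be ^ N * h y ^ N)"
        using a0 unfolding real_norm_def by (intro AE_I2 order_trans[OF _ abs_ge_self]) simp
      show "(\<lambda>y. a y ^ N) \<in> borel_measurable lborel" unfolding a_def[abs_def] by measurable
    qed (use hN in simp)
    have "(\<integral>y. a y ^ N / 2 \<partial>lborel) \<le> (\<integral>y. K * Q y + 2 ^ n * k ^ N * LX y \<partial>lborel)"
      by (rule integral_mono_AE) (use aNi Qi LXi main in auto)
    also have "\<dots> = K * 0 + 2 ^ n * k ^ N * (\<integral>y. LX y \<partial>lborel)" using Qi LXi Qz by simp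
    also have "\<dots> \<le> 2 ^ n * k ^ N * X" using LXX k0 by (simp add: mult_left_mono)
    finally have fin: "(\<integral>y. a y ^ N \<partial>lborel) \<le> 2 * 2 ^ n * k ^ N * X" by simp
    have "c1 ^ N * int_on (\<lambda>y. h y ^ N) (cball x0 (r/2)) \<le> (\<integral>y. a y ^ N \<partial>lborel)"
    proof -
      have hN0: "h y ^ N \<ge> 0" for y using h0 by simp
      have "int_on (\<lambda>y. c1 ^ N * h y ^ N) (cball x0 (r/2)) \<le> (\<integral>y. a y ^ N \<partial>lborel)"
        unfolding int_on_def
      proof (rule integral_mono)
        show "integrable lborel (\<lambda>y. indicator (cball x0 (r/2)) y * (c1 ^ N * h y ^ N))"
          using int_on_integrable[OF hN hN0, of "cball x0 (r/2)"] by (subst mult.left_commute) simp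
        fix y
        show "indicator (cball x0 (r/2)) y * (c1 ^ N * h y ^ N) \<le> a y ^ N"
        proof (cases "y \<in> cball x0 (r/2)")
          case True
          then have "norm ((1/r) *\<^sub>R (x0 - y)) \<le> 1/2" unfolding norm_scaleR using r by (simp add: dist_norm field_simps)
          then have "c1 \<le> \<phi> y" unfolding \<phi>_def by (rule c1(2))
          then have "c1 ^ N * h y ^ N \<le> a y ^ N" unfolding a_def power_mult_distrib using c1(1) h0 by (intro mult_right_mono power_mono) auto
          then show ?thesis using True by simp
        qed (use a0 in simp)
      qed (rule aNi)
      then show ?thesis by (simp add: int_on_cmult)
    qed
    also note fin
    finally have "int_on (\<lambda>y. h y ^ N) (cball x0 (r/2)) \<le> 2 * 2 ^ n * k ^ N * X / c1 ^ N"
      using c1(1) by (simp add: pos_le_divide_eq mult.commute)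
    also have "\<dots> = (2 * 2 ^ n * (K * real N * B) ^ N / c1 ^ N) / r ^ N * X" by (simp add: k_def power_divide)
    also have "\<dots> \<le> C / r ^ N * X" using X r by (intro mult_right_mono divide_right_mono) (auto simp: C_def)
    finally show "int_on (\<lambda>y. hs_norm m (\<lambda>i. G i y) ^ CARD('n)) (cball x0 (r/2)) \<le> C / r ^ CARD('n) * X"
      by (simp add: h_def N_def)
  qed
qed

lemma hs_norm_power_integrable:
  fixes U :: "nat \<Rightarrow> real ^ 'n::finite \<Rightarrow> real" and G :: "nat \<Rightarrow> real ^ 'n \<Rightarrow> real ^ 'n"
  assumes wg: "\<And>i. i < m \<Longrightarrow> weak_grad_on S (U i) (G i)"
    and gn: "integrable lborel (\<lambda>y. (\<Sum>i<m. \<bar>U i y\<bar> + (\<Sum>k\<in>UNIV. \<bar>G i y $ k\<bar>)) ^ CARD('n))"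
    and supp: "\<And>i x. i < m \<Longrightarrow> norm x > R \<Longrightarrow> G i x = 0" and q: "0 < q" "q \<le> real CARD('n)"
  shows "integrable lborel (\<lambda>y. hs_norm m (\<lambda>i. G i y) powr q)"
proof -
  define N where "N = CARD('n)"
  have N: "N > 0" by (simp add: N_def)
  define h where "h y = hs_norm m (\<lambda>i. G i y)" for y
  have h0: "h y \<ge> 0" for y by (simp add: h_def hs_norm_nonneg)
  have hi: "integrable lborel h" unfolding h_def[abs_def]
    by (rule hs_norm_integrable[where U=U and G=G and S=S and m=m, OF wg])
  have hm[measurable]: "h \<in> borel_measurable borel" using hi by auto
  define g where "g y = (\<Sum>i<m. \<bar>U i y\<bar> + (\<Sum>k\<in>UNIV. \<bar>G i y $ k\<bar>))" for y
  have hg: "h y \<le> g y" for y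
    unfolding h_def g_def by (rule order_trans[OF hs_norm_le_sum]) (intro sum_mono, simp)
  have "integrable lborel (\<lambda>y. indicator (cball 0 R) y + g y ^ N)"
    using gn emeasure_lborel_cball_finite by (intro Bochner_Integration.integrable_add integrable_real_indicator) (auto simp: g_def N_def)
  then have "integrable lborel (\<lambda>y. h y powr q)"
  proof (rule Bochner_Integration.integrable_bound)
    have "h y powr q \<le> indicator (cball 0 R) y + g y ^ N" for y
    proof (cases "norm y \<le> R")
      case True
      show ?thesis
      proof (cases "h y \<le> 1")
        case t: True
        have "h y powr q \<le> 1 powr q" using t h0 q by (intro powr_mono2) auto
        moreover have "g y ^ N \<ge> 0" using order_trans[OF h0 hg] by simp
        ultimately show ?thesis using True by simp
      next
        case False
        have "h y powr q \<le> h y powr real N" using False q by (intro powr_mono) (auto simp: N_def)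
        also have "\<dots> = h y ^ N" using h0 N by (simp add: powr_realpow')
        also have "\<dots> \<le> g y ^ N" using h0 hg by (intro power_mono)
        finally show ?thesis by (simp add: add_increasing)
      qed
    next
      case False
      have "h y = 0" using supp False by (simp add: h_def hs_norm_def L2_set_def)
      moreover have "g y ^ N \<ge> 0" using order_trans[OF h0 hg] by simp
      ultimately show ?thesis using q by simp
    qed
    then show "AE y in lborel. norm (h y powr q) \<le> norm (indicator (cball 0 R) y + g y ^ N)"
      unfolding real_norm_def abs_of_nonneg[OF powr_ge_zero] by (intro AE_I2 order_trans[OF _ abs_ge_self])
  qed simp
  then show ?thesis by (simp add: h_def)
qed

text \<open>
  Caccioppoli on the ball of radius \<open>2 * \<rho>\<close>, followed by the Sobolev-Poincare inequality with exponents
  \<open>3n/4\<close> and \<open>n\<close>. The exponent \<open>3n/4\<close> is admissible for every \<open>n \<ge> 2\<close>: it is at least 1, and its Sobolev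
  exponent \<open>3n\<close> exceeds \<open>n\<close>. In terms of \<open>|G|\<^sup>3\<^sup>n\<^sup>/\<^sup>4\<close> this is a reverse Hoelder inequality with exponent \<open>4/3\<close>.
\<close>

lemma reverse_hoelder:
  fixes K :: real
  assumes K: "K \<ge> 0" and n2: "CARD('n::finite) \<ge> 2"
  shows "\<exists>C>0. \<forall>m (\<omega> :: ('n \<Rightarrow> nat \<Rightarrow> real) \<Rightarrow> real) U (G :: nat \<Rightarrow> real ^ 'n \<Rightarrow> real ^ 'n) S R x0 \<rho>.
    quasiregular_on K m \<omega> U G R S \<longrightarrow>
    0 < \<rho> \<longrightarrow> cball x0 (4 * \<rho>) \<subseteq> S \<longrightarrow>
    int_on (\<lambda>y. hs_norm m (\<lambda>i. G i y) powr real CARD('n)) (cball x0 \<rho>) \<le>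
      C * \<rho> ^ CARD('n) * (int_on (\<lambda>y. hs_norm m (\<lambda>i. G i y) powr (3 * real CARD('n) / 4)) (cball x0 (4 * \<rho>)) / \<rho> ^ CARD('n)) powr (4/3)"
proof -
  define N where "N = real CARD('n)"
  have N: "N \<ge> 2" using n2 by (simp add: N_def)
  have gap: "0 < N - N * N / (3 * N / 4) + N" "N - N * N / (3 * N / 4) + N = 2 * N / 3" "N / (3 * N / 4) = 4/3" using N by (auto simp: field_simps)
  obtain C0 where C0: "C0 > 0" and cac: "\<And>m (\<omega> :: ('n \<Rightarrow> nat \<Rightarrow> real) \<Rightarrow> real) U (G :: nat \<Rightarrow> real ^ 'n \<Rightarrow> real ^ 'n) S R x0 r \<delta> c X.
    quasiregular_on K m \<omega> U G R S \<Longrightarrow>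
    0 < r \<Longrightarrow> 0 < \<delta> \<Longrightarrow> cball x0 (r + \<delta>) \<subseteq> S \<Longrightarrow> 0 \<le> X \<Longrightarrow>
    (\<integral>\<^sup>+x. ennreal (L2_set (\<lambda>i. U i x - c i) {..<m} ^ CARD('n)) * indicator (cball x0 r) x \<partial>lborel) \<le> ennreal X \<Longrightarrow>
    int_on (\<lambda>y. hs_norm m (\<lambda>i. G i y) ^ CARD('n)) (cball x0 (r/2)) \<le> C0 / r ^ CARD('n) * X"
    using caccioppoli[OF K, where 'n='n] by blast
  have a: "1 \<le> 3 * N / 4" "3 * N / 4 \<le> N" "0 < 2 * N / 3" using N by auto
  note sp = sobolev_poincare[where 'n='n and p=N and q="3 * N / 4", folded N_def, unfolded gap(2,3), OF a]
  obtain Cs where Cs: "Cs > 0" and sob: "\<And>m (U :: nat \<Rightarrow> real ^ 'n \<Rightarrow> real) G S R x0 \<rho>.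
    (\<forall>i<m. weak_grad_on S (U i) (G i)) \<Longrightarrow> (\<forall>i<m. \<forall>x. norm x > R \<longrightarrow> U i x = 0) \<Longrightarrow>
    integrable lborel (\<lambda>y. hs_norm m (\<lambda>i. G i y) powr (3 * N / 4)) \<Longrightarrow> 0 < \<rho> \<Longrightarrow> cball x0 (2 * \<rho>) \<subseteq> S \<Longrightarrow>
    (\<exists>c. (\<integral>\<^sup>+x. ennreal (L2_set (\<lambda>i. U i x - c i) {..<m} powr N) * indicator (cball x0 \<rho>) x \<partial>lborel)
       \<le> ennreal (Cs * \<rho> powr (2 * N / 3) * int_on (\<lambda>y. hs_norm m (\<lambda>i. G i y) powr (3 * N / 4)) (cball x0 (2 * \<rho>)) powr (4 / 3)))"
    using sp by blast
  define C where "C = C0 * Cs"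
  show ?thesis
  proof (intro exI[of _ C] conjI allI impI)
    show "C > 0" using C0 Cs by (simp add: C_def)
    fix m and \<omega> :: "('n \<Rightarrow> nat \<Rightarrow> real) \<Rightarrow> real" and U and G :: "nat \<Rightarrow> real ^ 'n \<Rightarrow> real ^ 'n" and S R x0 \<rho>
    assume quasi: "quasiregular_on K m \<omega> U G R S"
      and rho: "0 < \<rho>" and S: "cball x0 (4 * \<rho>) \<subseteq> S"
    note wg = quasiregular_onD(3)[OF quasi] and supp = quasiregular_onD(4)[OF quasi] and gn = quasiregular_onD(5)[OF quasi]
    have hq: "integrable lborel (\<lambda>y. hs_norm m (\<lambda>i. G i y) powr (3 * N / 4))"
      using wg supp N by (intro hs_norm_power_integrable[OF _ gn, where S=S and R=R]) (auto simp: N_def)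
    have suppU: "\<forall>i<m. \<forall>x. norm x > R \<longrightarrow> U i x = 0" using supp by blast
    define I where "I = int_on (\<lambda>y. hs_norm m (\<lambda>i. G i y) powr (3 * N / 4)) (cball x0 (4 * \<rho>))"
    have I: "I \<ge> 0" unfolding I_def by (rule int_on_nonneg[OF hq]) simp
    have S2: "cball x0 (2 * (2 * \<rho>)) \<subseteq> S" using S by simp
    have r2: "0 < 2 * \<rho>" using rho by simp
    obtain c where c: "(\<integral>\<^sup>+x. ennreal (L2_set (\<lambda>i. U i x - c i) {..<m} powr N) * indicator (cball x0 (2 * \<rho>)) x \<partial>lborel)
       \<le> ennreal (Cs * (2 * \<rho>) powr (2 * N / 3) * I powr (4 / 3))"
      using sob[OF wg suppU hq r2 S2] unfolding I_def by (auto simp: mult.assoc[symmetric])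
    have cN: "(\<integral>\<^sup>+x. ennreal (L2_set (\<lambda>i. U i x - c i) {..<m} ^ CARD('n)) * indicator (cball x0 (2 * \<rho>)) x \<partial>lborel)
       \<le> ennreal (Cs * (2 * \<rho>) powr (2 * N / 3) * I powr (4 / 3))"
      using c by (simp add: N_def powr_realpow')
    have "cball x0 (2 * \<rho> + \<rho>) \<subseteq> cball x0 (4 * \<rho>)" using rho by (intro subset_cball) simp
    from cac[OF quasi r2 rho order_trans[OF this S] _ cN]
    have "int_on (\<lambda>y. hs_norm m (\<lambda>i. G i y) ^ CARD('n)) (cball x0 (2 * \<rho> / 2)) \<le> C0 / (2 * \<rho>) ^ CARD('n) * (Cs * (2 * \<rho>) powr (2 * N / 3) * I powr (4 / 3))"
      using Cs by simp
    also have "\<dots> = C * (2 * \<rho>) powr (- (N / 3)) * I powr (4/3)"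
    proof -
      have "(2 * \<rho>) powr (2 * N / 3) / (2 * \<rho>) ^ CARD('n) = (2 * \<rho>) powr (2 * N / 3 - N)"
      proof -
        have "(2 * \<rho>) ^ CARD('n) = (2 * \<rho>) powr N" using r2 by (simp only: N_def powr_realpow)
        then show ?thesis unfolding powr_diff by (simp only:)
      qed
      also have "2 * N / 3 - N = - (N / 3)" by simp
      finally have e: "(2 * \<rho>) powr (2 * N / 3) / (2 * \<rho>) ^ CARD('n) = (2 * \<rho>) powr (- (N / 3))" .
      have "C0 / (2 * \<rho>) ^ CARD('n) * (Cs * (2 * \<rho>) powr (2 * N / 3) * I powr (4 / 3)) = C0 * Cs * ((2 * \<rho>) powr (2 * N / 3) / (2 * \<rho>) ^ CARD('n)) * I powr (4/3)"
        by simp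
      then show ?thesis unfolding e C_def .
    qed
    also have "\<dots> \<le> C * \<rho> powr (- (N / 3)) * I powr (4/3)"
      using C0 Cs rho N by (intro mult_right_mono mult_left_mono powr_mono2') (auto simp: C_def)
    also have "\<dots> = C * \<rho> ^ CARD('n) * (I / \<rho> ^ CARD('n)) powr (4/3)"
    proof -
      have e1: "\<rho> ^ CARD('n) = \<rho> powr N" using rho by (simp add: N_def powr_realpow)
      have e2: "\<rho> powr (- (N / 3)) = \<rho> powr N / \<rho> powr (N * (4/3))" unfolding powr_diff[symmetric] by simp
      have e3: "(I / \<rho> powr N) powr (4/3) = I powr (4/3) / \<rho> powr (N * (4/3))"
        using I by (simp only: powr_divide powr_ge_zero powr_powr)
      show ?thesis unfolding e1 e2 e3 by simp
    qed
    finally show "int_on (\<lambda>y. hs_norm m (\<lambda>i. G i y) powr real CARD('n)) (cball x0 \<rho>) \<le>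
      C * \<rho> ^ CARD('n) * (int_on (\<lambda>y. hs_norm m (\<lambda>i. G i y) powr (3 * real CARD('n) / 4)) (cball x0 (4 * \<rho>)) / \<rho> ^ CARD('n)) powr (4/3)"
      by (simp add: I_def N_def powr_realpow' hs_norm_nonneg)
  qed
qed

text \<open>
  Gehring's lemma is applied to \<open>|G|\<^sup>3\<^sup>n\<^sup>/\<^sup>4\<close>, cut off outside the ball. The integrability of \<open>U\<close> follows from the
  Sobolev-Poincare inequality with exponents \<open>n\<close> and \<open>s\<close>, which is subcritical for all finite \<open>s\<close>.
\<close>

lemma local_higher_integrability:
  fixes K :: real
  assumes K: "K \<ge> 0" and n2: "CARD('n::finite) \<ge> 2"
  shows "\<exists>\<epsilon>>0. \<forall>m (\<omega> :: ('n \<Rightarrow> nat \<Rightarrow> real) \<Rightarrow> real) U (G :: nat \<Rightarrow> real ^ 'n \<Rightarrow> real ^ 'n) z R R' s.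
    0 < R \<longrightarrow> quasiregular_on K m \<omega> U G R' (ball z R) \<longrightarrow>
    real CARD('n) \<le> s \<longrightarrow> s < real CARD('n) + \<epsilon> \<longrightarrow>
    (\<integral>\<^sup>+x. ennreal (hs_norm m (\<lambda>i. G i x) powr s) * indicator (ball z (R/2)) x \<partial>lborel) < \<infinity> \<and>
    (\<forall>i<m. (\<integral>\<^sup>+x. ennreal (\<bar>U i x\<bar> powr s) * indicator (cball z (R/3)) x \<partial>lborel) < \<infinity>)"
proof -
  define N where "N = real CARD('n)"
  have N: "N \<ge> 2" using n2 by (simp add: N_def)
  define q where "q = 3 * N / 4"
  have q: "q > 0" "q * (4/3) = N" "q \<le> N" using N by (auto simp: q_def)
  obtain C where C: "C > 0" and rh: "\<And>m (\<omega> :: ('n \<Rightarrow> nat \<Rightarrow> real) \<Rightarrow> real) U (G :: nat \<Rightarrow> real ^ 'n \<Rightarrow> real ^ 'n) S R x0 \<rho>.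
    quasiregular_on K m \<omega> U G R S \<Longrightarrow>
    0 < \<rho> \<Longrightarrow> cball x0 (4 * \<rho>) \<subseteq> S \<Longrightarrow>
    int_on (\<lambda>y. hs_norm m (\<lambda>i. G i y) powr N) (cball x0 \<rho>) \<le>
      C * \<rho> ^ CARD('n) * (int_on (\<lambda>y. hs_norm m (\<lambda>i. G i y) powr q) (cball x0 (4 * \<rho>)) / \<rho> ^ CARD('n)) powr (4/3)"
    using reverse_hoelder[OF K n2] unfolding N_def[symmetric] q_def[symmetric] by blast
  obtain e where e: "e > 0" and geh: "\<And>(G::real^'n \<Rightarrow> real) z R s.
    0 < R \<Longrightarrow> integrable lborel G \<Longrightarrow> integrable lborel (\<lambda>x. G x powr (4/3)) \<Longrightarrow> (\<forall>x. 0 \<le> G x) \<Longrightarrow>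
    (\<forall>x. x \<notin> ball z R \<longrightarrow> G x = 0) \<Longrightarrow>
    (\<forall>x \<rho>. \<rho> > 0 \<longrightarrow> ball x (5 * \<rho>) \<subseteq> ball z R \<longrightarrow>
        int_on (\<lambda>x. G x powr (4/3)) (ball x \<rho>) \<le> C * \<rho> ^ DIM(real^'n) * (int_on G (ball x (5 * \<rho>)) / \<rho> ^ DIM(real^'n)) powr (4/3)) \<Longrightarrow>
    4/3 \<le> s \<Longrightarrow> s < 4/3 + e \<Longrightarrow>
    (\<integral>\<^sup>+x. ennreal (G x powr s) * indicator (ball z (R/2)) x \<partial>lborel) < \<infinity>"
    using gehring[of "4/3" C 5, where 'a="real^'n"] C by auto
  show ?thesis
  proof (intro exI[of _ "q * e"] conjI allI impI)
    show "q * e > 0" using q e by simp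
    fix m and \<omega> :: "('n \<Rightarrow> nat \<Rightarrow> real) \<Rightarrow> real" and U and G :: "nat \<Rightarrow> real ^ 'n \<Rightarrow> real ^ 'n" and z R R' s
    assume R: "0 < R" and quasi: "quasiregular_on K m \<omega> U G R' (ball z R)"
      and s: "real CARD('n) \<le> s" "s < real CARD('n) + q * e"
    note wg = quasiregular_onD(3)[OF quasi] and supp = quasiregular_onD(4)[OF quasi] and gn = quasiregular_onD(5)[OF quasi]
    define h where "h y = hs_norm m (\<lambda>i. G i y)" for y
    have h0: "h y \<ge> 0" for y by (simp add: h_def hs_norm_nonneg)
    have hq: "integrable lborel (\<lambda>y. h y powr q)" "integrable lborel (\<lambda>y. h y powr N)"
      unfolding h_def using wg supp N q
      by (auto intro!: hs_norm_power_integrable[OF _ gn, where S="ball z R" and R=R'] simp: N_def[symmetric])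
    \<comment> \<open>the \<open>4/3\<close>-th power of \<open>F\<close> is \<open>h ^ n\<close> in the ball\<close>
    define F where "F x = indicator (ball z R) x * h x powr q" for x
    have F43: "F x powr (4/3) = indicator (ball z R) x * h x powr N" for x
      using q(2) by (auto simp: F_def powr_powr indicator_def)
    have Fs: "F x powr (s / q) = indicator (ball z R) x * h x powr s" for x
      using q by (auto simp: F_def powr_powr indicator_def)
    have pw0: "h y powr t \<ge> 0" for y t by simp
    have Fi: "integrable lborel F" unfolding F_def[abs_def] by (rule int_on_integrable[OF hq(1) pw0]) simp
    have Fi2: "integrable lborel (\<lambda>x. F x powr (4/3))" unfolding F43 by (rule int_on_integrable[OF hq(2) pw0]) simp
    have F0: "F x \<ge> 0" for x by (simp add: F_def)
    have "(\<integral>\<^sup>+x. ennreal (F x powr (s / q)) * indicator (ball z (R/2)) x \<partial>lborel) < \<infinity>"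
    proof (rule geh[OF R Fi Fi2])
      show "\<forall>x. 0 \<le> F x" using F0 by blast
      show "\<forall>x. x \<notin> ball z R \<longrightarrow> F x = 0" by (simp add: F_def)
      show "4/3 \<le> s / q" using s(1) q by (simp add: N_def[symmetric] field_simps)
      show "s / q < 4/3 + e" using s(2) q by (simp add: N_def[symmetric] field_simps)
      show "\<forall>x \<rho>. \<rho> > 0 \<longrightarrow> ball x (5 * \<rho>) \<subseteq> ball z R \<longrightarrow>
        int_on (\<lambda>x. F x powr (4/3)) (ball x \<rho>) \<le> C * \<rho> ^ DIM(real^'n) * (int_on F (ball x (5 * \<rho>)) / \<rho> ^ DIM(real^'n)) powr (4/3)"
      proof (intro allI impI)
        fix x \<rho> assume rho: "(\<rho>::real) > 0" and sub: "ball x (5 * \<rho>) \<subseteq> ball z R"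
        have c1: "cball x (4 * \<rho>) \<subseteq> ball x (5 * \<rho>)" using rho by auto
        have "int_on (\<lambda>x. F x powr (4/3)) (ball x \<rho>) \<le> int_on (\<lambda>x. h x powr N) (ball x \<rho>)"
          by (rule int_on_mono_fun[OF Fi2 hq(2)]) (auto simp: F43 indicator_def)
        also have "\<dots> \<le> int_on (\<lambda>x. h x powr N) (cball x \<rho>)" by (rule int_on_mono[OF hq(2) pw0]) auto
        also have "\<dots> \<le> C * \<rho> ^ CARD('n) * (int_on (\<lambda>y. h y powr q) (cball x (4 * \<rho>)) / \<rho> ^ CARD('n)) powr (4/3)"
          unfolding h_def by (rule rh[OF quasi rho order_trans[OF c1 sub]])
        also have "\<dots> \<le> C * \<rho> ^ CARD('n) * (int_on F (ball x (5 * \<rho>)) / \<rho> ^ CARD('n)) powr (4/3)"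
        proof -
          have "int_on (\<lambda>y. h y powr q) (cball x (4 * \<rho>)) \<le> int_on F (cball x (4 * \<rho>))"
            using c1 sub by (intro int_on_mono_fun[OF hq(1) Fi]) (auto simp: F_def indicator_def subset_iff)
          also have "\<dots> \<le> int_on F (ball x (5 * \<rho>))" by (rule int_on_mono[OF Fi F0]) (use c1 in auto)
          finally show ?thesis using C rho int_on_nonneg[OF hq(1) pw0]
            by (intro mult_left_mono powr_mono2 divide_right_mono divide_nonneg_nonneg) auto
        qed
        finally show "int_on (\<lambda>x. F x powr (4/3)) (ball x \<rho>) \<le> C * \<rho> ^ DIM(real^'n) * (int_on F (ball x (5 * \<rho>)) / \<rho> ^ DIM(real^'n)) powr (4/3)"
          by simp
      qed
    qed
    also have "(\<integral>\<^sup>+x. ennreal (F x powr (s / q)) * indicator (ball z (R/2)) x \<partial>lborel) = (\<integral>\<^sup>+x. ennreal (h x powr s) * indicator (ball z (R/2)) x \<partial>lborel)"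
      using R by (intro nn_integral_cong) (auto simp: Fs indicator_def)
    finally show "(\<integral>\<^sup>+x. ennreal (hs_norm m (\<lambda>i. G i x) powr s) * indicator (ball z (R/2)) x \<partial>lborel) < \<infinity>"
      by (simp add: h_def)
    fix i assume i: "i < m"
    have s0: "s > 0" using s N by (simp add: N_def)
    have gap: "0 < s - N * s / N + N" using N by simp
    have pq: "1 \<le> N" "N \<le> s" using N s by (auto simp: N_def)
    note sp = sobolev_poincare[where 'n='n and p=s and q=N, folded N_def, OF pq gap]
    have suppU: "\<forall>i<m. \<forall>x. norm x > R' \<longrightarrow> U i x = 0" using supp by blast
    have hN: "integrable lborel (\<lambda>y. hs_norm m (\<lambda>i. G i y) powr N)" using hq(2) by (simp add: h_def)
    have R3: "0 < R/3" "cball z (2 * (R/3)) \<subseteq> ball z R" using R by auto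
    obtain c X where cX: "(\<integral>\<^sup>+x. ennreal (L2_set (\<lambda>i. U i x - c i) {..<m} powr s) * indicator (cball z (R/3)) x \<partial>lborel) \<le> ennreal X"
    proof -
      from sp obtain Cz where "\<And>m (U :: nat \<Rightarrow> real ^ 'n \<Rightarrow> real) G S R x0 \<rho>.
          (\<forall>i<m. weak_grad_on S (U i) (G i)) \<Longrightarrow> (\<forall>i<m. \<forall>x. norm x > R \<longrightarrow> U i x = 0) \<Longrightarrow>
          integrable lborel (\<lambda>y. hs_norm m (\<lambda>i. G i y) powr N) \<Longrightarrow> 0 < \<rho> \<Longrightarrow> cball x0 (2 * \<rho>) \<subseteq> S \<Longrightarrow>
          (\<exists>c. (\<integral>\<^sup>+x. ennreal (L2_set (\<lambda>i. U i x - c i) {..<m} powr s) * indicator (cball x0 \<rho>) x \<partial>lborel)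
             \<le> ennreal (Cz * \<rho> powr (s - N * s / N + N) * int_on (\<lambda>y. hs_norm m (\<lambda>i. G i y) powr N) (cball x0 (2 * \<rho>)) powr (s / N)))"
        by blast
      from this[OF wg suppU hN R3] show ?thesis using that by blast
    qed
    have [measurable]: "U l \<in> borel_measurable borel" if "l < m" for l using wg that by (auto simp: weak_grad_on_def)
    have L2m[measurable]: "(\<lambda>x. L2_set (\<lambda>i. U i x - c i) {..<m}) \<in> borel_measurable borel"
      unfolding L2_set_def
      by (intro measurable_compose[OF _ borel_measurable_sqrt] borel_measurable_sum borel_measurable_power borel_measurable_diff) auto
    have "(\<integral>\<^sup>+x. ennreal (\<bar>U i x\<bar> powr s) * indicator (cball z (R/3)) x \<partial>lborel)
      \<le> (\<integral>\<^sup>+x. ennreal (2 powr s) * (ennreal (L2_set (\<lambda>i. U i x - c i) {..<m} powr s) * indicator (cball z (R/3)) x)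
          + ennreal (2 powr s * \<bar>c i\<bar> powr s) * indicator (cball z (R/3)) x \<partial>lborel)"
    proof (rule nn_integral_mono)
      fix x
      have "\<bar>U i x - c i\<bar> \<le> L2_set (\<lambda>i. \<bar>U i x - c i\<bar>) {..<m}" using i by (intro member_le_L2_set) auto
      then have "\<bar>U i x\<bar> \<le> L2_set (\<lambda>i. U i x - c i) {..<m} + \<bar>c i\<bar>" by (simp add: L2_set_def)
      then have "\<bar>U i x\<bar> powr s \<le> (L2_set (\<lambda>i. U i x - c i) {..<m} + \<bar>c i\<bar>) powr s" using s0 by (intro powr_mono2) auto
      also have "\<dots> \<le> 2 powr s * (L2_set (\<lambda>i. U i x - c i) {..<m} powr s + \<bar>c i\<bar> powr s)" using s0 by (intro powr_add_le) auto
      finally have "ennreal (\<bar>U i x\<bar> powr s) \<le> ennreal (2 powr s * (L2_set (\<lambda>i. U i x - c i) {..<m} powr s + \<bar>c i\<bar> powr s))" by (rule ennreal_leI)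
      also have "\<dots> = ennreal (2 powr s) * ennreal (L2_set (\<lambda>i. U i x - c i) {..<m} powr s) + ennreal (2 powr s * \<bar>c i\<bar> powr s)"
        by (simp add: distrib_left ennreal_mult ennreal_plus)
      finally show "ennreal (\<bar>U i x\<bar> powr s) * indicator (cball z (R/3)) x \<le> ennreal (2 powr s) * (ennreal (L2_set (\<lambda>i. U i x - c i) {..<m} powr s) * indicator (cball z (R/3)) x)
          + ennreal (2 powr s * \<bar>c i\<bar> powr s) * indicator (cball z (R/3)) x"
        by (cases "x \<in> cball z (R/3)") auto
    qed
    also have "\<dots> = ennreal (2 powr s) * (\<integral>\<^sup>+x. ennreal (L2_set (\<lambda>i. U i x - c i) {..<m} powr s) * indicator (cball z (R/3)) x \<partial>lborel)
          + ennreal (2 powr s * \<bar>c i\<bar> powr s) * emeasure lborel (cball z (R/3))"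
      by (simp add: nn_integral_add nn_integral_cmult nn_integral_cmult_indicator)
    also have "\<dots> < \<infinity>"
      using le_less_trans[OF cX ennreal_less_top] emeasure_lborel_cball_finite[of z "R/3"] by (simp add: ennreal_mult_less_top)
    finally show "(\<integral>\<^sup>+x. ennreal (\<bar>U i x\<bar> powr s) * indicator (cball z (R/3)) x \<partial>lborel) < \<infinity>" .
  qed
qed

section \<open>Borel representatives and localization\<close>

lemma row_map_axis: "row_map m A (axis j 1) = tuple m (\<lambda>i. A i $ j)"
  by (simp add: row_map_def tuple_def cart_eq_inner_axis)

lemma op_norm_upper:
  assumes "norm v = 1"
  shows "L2_set (row_map m A v) {..<m} \<le> op_norm m A"
  unfolding op_norm_def
proof (rule cSUP_upper)
  show "bdd_above ((\<lambda>v. L2_set (row_map m A v) {..<m}) ` sphere 0 1)"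
  proof (rule bdd_aboveI2)
    fix v :: "real ^ 'a" assume v: "v \<in> sphere 0 1"
    have "L2_set (row_map m A v) {..<m} = L2_set (\<lambda>i. \<bar>A i \<bullet> v\<bar>) {..<m}" by (simp add: row_map_def L2_set_def)
    also have "\<dots> \<le> L2_set (\<lambda>i. norm (A i)) {..<m}"
    proof (rule L2_set_mono)
      fix i show "\<bar>A i \<bullet> v\<bar> \<le> norm (A i)" using Cauchy_Schwarz_ineq2[of "A i" v] v by simp
    qed simp
    finally show "L2_set (row_map m A v) {..<m} \<le> hs_norm m A" by (simp add: hs_norm_def)
  qed
qed (use assms in simp)

text \<open>
  The Hilbert-Schmidt norm is the Euclidean norm of the \<open>n\<close> column norms, and each column is the image of a
  unit vector. The factor does not involve \<open>m\<close>.
\<close>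

lemma hs_norm_le_op_norm:
  fixes A :: "nat \<Rightarrow> real ^ 'n::finite"
  shows "hs_norm m A \<le> sqrt (real CARD('n)) * op_norm m A"
proof -
  have c: "L2_set (\<lambda>i. A i $ j) {..<m} \<le> op_norm m A" for j
  proof -
    have "L2_set (\<lambda>i. A i $ j) {..<m} = L2_set (row_map m A (axis j 1)) {..<m}"
      unfolding row_map_axis by (rule L2_set_cong) (auto simp: tuple_def)
    also have "\<dots> \<le> op_norm m A" by (rule op_norm_upper) simp
    finally show ?thesis .
  qed
  have op0: "op_norm m A \<ge> 0" using order_trans[OF L2_set_nonneg c] .
  have "(hs_norm m A)\<^sup>2 = (\<Sum>i<m. (norm (A i))\<^sup>2)" by (simp add: hs_norm_def L2_set_def sum_nonneg)
  also have "\<dots> = (\<Sum>i<m. \<Sum>j\<in>UNIV. (A i $ j)\<^sup>2)" by (simp add: norm_vec_def L2_set_def sum_nonneg)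
  also have "\<dots> = (\<Sum>j\<in>UNIV. \<Sum>i<m. (A i $ j)\<^sup>2)" by (rule sum.swap)
  also have "\<dots> = (\<Sum>j\<in>UNIV. (L2_set (\<lambda>i. A i $ j) {..<m})\<^sup>2)" by (simp add: L2_set_def sum_nonneg)
  also have "\<dots> \<le> (\<Sum>j\<in>(UNIV::'n set). (op_norm m A)\<^sup>2)" by (intro sum_mono power_mono c) simp
  also have "\<dots> = (sqrt (real CARD('n)) * op_norm m A)\<^sup>2" by (simp add: power_mult_distrib)
  finally show ?thesis by (rule power2_le_imp_le) (use op0 in simp)
qed

text \<open>
  At a point of \<open>S\<close> the mollifications of both gradients with small radius are the derivatives of the
  mollification of \<open>u\<close>, and almost everywhere they converge to the gradients.
\<close>

lemma weak_grad_on_unique: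
  assumes w1: "weak_grad_on S u g" and w2: "weak_grad_on S u g'" and S: "open S"
    and supp: "\<And>x. norm x > R \<Longrightarrow> g x = 0 \<and> g' x = 0"
  shows "AE x in lborel. x \<in> S \<longrightarrow> g x = g' x"
proof -
  define v where "v jb = (if snd jb then (\<lambda>x. g x $ fst jb) else (\<lambda>x. g' x $ fst jb))" for jb :: "'a \<times> bool"
  define rs where "rs k = 1 / real (Suc k)" for k
  have rs: "rs k > 0" "rs \<longlonglongrightarrow> 0" for k
    unfolding rs_def[abs_def] using LIMSEQ_inverse_real_of_nat[unfolded inverse_eq_divide] by simp_all
  have vi: "integrable lborel (v jb)" for jb using w1 w2 by (auto simp: v_def weak_grad_on_def)
  have vs: "v jb x = 0" if "norm x > R" for jb x using supp[OF that] by (simp add: v_def)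
  obtain s where s: "strict_mono s" "AE x in lborel. \<forall>jb\<in>UNIV. (\<lambda>k. mollify eta (rs (s k)) (v jb) x) \<longlonglongrightarrow> v jb x"
    using mollify_AE_subseq[OF eta_mollifier, of UNIV v R rs] vi vs rs by auto
  show ?thesis using s(2)
  proof eventually_elim
    case (elim x)
    show ?case
    proof
      assume x: "x \<in> S"
      obtain e where e: "e > 0" "cball x e \<subseteq> S" using S x by (meson open_contains_cball)
      have sl: "(\<lambda>k. rs (s k)) \<longlonglongrightarrow> 0" using LIMSEQ_subseq_LIMSEQ[OF rs(2) s(1)] by (simp add: o_def)
      have ev: "\<forall>\<^sub>F k in sequentially. rs (s k) < e" using order_tendstoD(2)[OF sl e(1)] .
      have "g x $ j = g' x $ j" for j
      proof -
        have l1: "(\<lambda>k. mollify eta (rs (s k)) (\<lambda>x. g x $ j) x) \<longlonglongrightarrow> g x $ j"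
          using elim[rule_format, of "(j, True)"] by (simp add: v_def)
        have l2: "(\<lambda>k. mollify eta (rs (s k)) (\<lambda>x. g' x $ j) x) \<longlonglongrightarrow> g' x $ j"
          using elim[rule_format, of "(j, False)"] by (simp add: v_def)
        have "\<forall>\<^sub>F k in sequentially. mollify eta (rs (s k)) (\<lambda>x. g x $ j) x = mollify eta (rs (s k)) (\<lambda>x. g' x $ j) x"
          using ev
        proof eventually_elim
          case (elim k)
          have r: "rs (s k) > 0" by (rule rs(1))
          have sub: "cball x (rs (s k)) \<subseteq> S" using elim e(2) by (meson less_imp_le order_trans subset_cball)
          have m: "(\<lambda>x. g x $ j) \<in> borel_measurable borel" "(\<lambda>x. g' x $ j) \<in> borel_measurable borel"
            using borel_measurable_integrable[OF vi[of "(j, True)"]] borel_measurable_integrable[OF vi[of "(j, False)"]]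
            by (simp_all add: v_def)
          show ?case unfolding mollify_eta[OF m(1) r] mollify_eta[OF m(2) r]
            using kconv_weak_grad[OF w1 eta_bump r sub, of j] kconv_weak_grad[OF w2 eta_bump r sub, of j] by simp
        qed
        then have "(\<lambda>k. mollify eta (rs (s k)) (\<lambda>x. g' x $ j) x) \<longlonglongrightarrow> g x $ j"
          using l1 by (rule Lim_transform_eventually[rotated])
        then show ?thesis using l2 by (rule LIMSEQ_unique)
      qed
      then show "g x = g' x" by (simp add: vec_eq_iff)
    qed
  qed
qed

lemma integrable_power_sum:
  fixes x :: "'i \<Rightarrow> 'a \<Rightarrow> real"
  assumes "finite I" "\<And>i. i \<in> I \<Longrightarrow> x i \<in> borel_measurable M" "\<And>i. i \<in> I \<Longrightarrow> integrable M (\<lambda>y. \<bar>x i y\<bar> ^ n)" "n > 0"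
  shows "integrable M (\<lambda>y. (\<Sum>i\<in>I. \<bar>x i y\<bar>) ^ n)"
  using assms
proof (induction I rule: finite_induct)
  case empty then show ?case by (simp add: zero_power)
next
  case (insert i I)
  have IH: "integrable M (\<lambda>y. (\<Sum>i\<in>I. \<bar>x i y\<bar>) ^ n)" using insert by auto
  have "integrable M (\<lambda>y. 2 ^ n * (\<bar>x i y\<bar> ^ n + (\<Sum>i\<in>I. \<bar>x i y\<bar>) ^ n))"
    using insert.prems IH by auto
  then show ?case
  proof (rule Bochner_Integration.integrable_bound)
    show "(\<lambda>y. (\<Sum>i\<in>insert i I. \<bar>x i y\<bar>) ^ n) \<in> borel_measurable M"
      using insert.prems by (intro borel_measurable_power borel_measurable_sum borel_measurable_abs) auto
    have "(\<Sum>i\<in>insert i I. \<bar>x i y\<bar>) ^ n \<le> 2 ^ n * (\<bar>x i y\<bar> ^ n + (\<Sum>i\<in>I. \<bar>x i y\<bar>) ^ n)" for y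
    proof -
      let ?a = "\<bar>x i y\<bar>" and ?b = "\<Sum>i\<in>I. \<bar>x i y\<bar>"
      have b: "?b \<ge> 0" by (intro sum_nonneg) simp
      have "(?a + ?b) ^ n \<le> (2 * max ?a ?b) ^ n" using b by (intro power_mono) auto
      also have "\<dots> = 2 ^ n * (max ?a ?b) ^ n" by (simp add: power_mult_distrib)
      also have "\<dots> \<le> 2 ^ n * (?a ^ n + ?b ^ n)" using b by (intro mult_left_mono) (auto simp: max_def)
      finally show ?thesis using insert.hyps by simp
    qed
    then show "AE y in M. norm ((\<Sum>i\<in>insert i I. \<bar>x i y\<bar>) ^ n) \<le> norm (2 ^ n * (\<bar>x i y\<bar> ^ n + (\<Sum>i\<in>I. \<bar>x i y\<bar>) ^ n))"
      by (intro AE_I2) (simp add: sum_nonneg)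
  qed
qed

text \<open>
  The definitions of the Sobolev spaces are in terms of Lebesgue measurable functions on \<open>\<Omega>\<close>, whereas
  mollification and Fubini's theorem are for Borel functions on the whole space. Representatives
  that vanish outside a ball \<open>B\<close> mediate between the two.
\<close>

lemma borel_version:
  fixes u :: "'a::euclidean_space \<Rightarrow> real"
  assumes u: "u \<in> borel_measurable (lebesgue_on \<Omega>)" and O: "\<Omega> \<in> sets lebesgue" and B: "B \<in> sets borel" "B \<subseteq> \<Omega>"
  obtains u' where "u' \<in> borel_measurable borel" "\<And>x. x \<notin> B \<Longrightarrow> u' x = 0" "AE x in lborel. x \<in> B \<longrightarrow> u' x = u x"
proof -
  have Bl: "B \<in> sets lebesgue" using B by auto
  have "(\<lambda>x. if x \<in> \<Omega> then u x else 0) \<in> borel_measurable lebesgue" using u O by (simp add: borel_measurable_if)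
  then obtain v where v: "v \<in> borel_measurable lborel" "AE x in lborel. (if x \<in> \<Omega> then u x else 0) = v x"
    using completion_ex_borel_measurable_real by blast
  show thesis
  proof (rule that[of "\<lambda>x. indicator B x * v x"])
    show "(\<lambda>x. indicator B x * v x) \<in> borel_measurable borel" using v(1) B(1) by auto
    show "AE x in lborel. x \<in> B \<longrightarrow> indicator B x * v x = u x"
      using v(2) by eventually_elim (use B in auto)
  qed simp
qed

lemma borel_version_vec:
  fixes g :: "'a::euclidean_space \<Rightarrow> real ^ 'n::finite"
  assumes g: "g \<in> borel_measurable (lebesgue_on \<Omega>)" and O: "\<Omega> \<in> sets lebesgue" and B: "B \<in> sets borel" "B \<subseteq> \<Omega>"
  obtains g' where "\<And>j. (\<lambda>x. g' x $ j) \<in> borel_measurable borel" "\<And>x. x \<notin> B \<Longrightarrow> g' x = 0" "AE x in lborel. x \<in> B \<longrightarrow> g' x = g x"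
proof -
  have "(\<lambda>x. g x $ j) \<in> borel_measurable (lebesgue_on \<Omega>)" for j
    unfolding cart_eq_inner_axis using g by (intro borel_measurable_inner) auto
  then have "\<exists>u'. u' \<in> borel_measurable borel \<and> (\<forall>x. x \<notin> B \<longrightarrow> u' x = 0) \<and> (AE x in lborel. x \<in> B \<longrightarrow> u' x = g x $ j)" for j
    using borel_version[OF _ O B, of "\<lambda>x. g x $ j"] by metis
  then obtain v where v: "\<And>j. v j \<in> borel_measurable borel" "\<And>j x. x \<notin> B \<Longrightarrow> v j x = 0" "\<And>j. AE x in lborel. x \<in> B \<longrightarrow> v j x = g x $ j"
    by metis
  show thesis
  proof (rule that[of "\<lambda>x. \<chi> j. v j x"])
    show "(\<lambda>x. (\<chi> j. v j x) $ j) \<in> borel_measurable borel" for j using v(1) by simp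
    show "(\<chi> j. v j x) = 0" if "x \<notin> B" for x using v(2)[OF that] by (simp add: vec_eq_iff)
    have "AE x in lborel. \<forall>j\<in>UNIV. x \<in> B \<longrightarrow> v j x = g x $ j" by (rule AE_finite_allI) (use v(3) in auto)
    then show "AE x in lborel. x \<in> B \<longrightarrow> (\<chi> j. v j x) = g x" by eventually_elim (auto simp: vec_eq_iff)
  qed
qed

lemma measurable_norm_vec:
  assumes "\<And>j. (\<lambda>x. g x $ j) \<in> borel_measurable M"
  shows "(\<lambda>x. norm (g x :: real ^ 'n::finite)) \<in> borel_measurable M"
  unfolding norm_vec_def L2_set_def using assms
  by (intro measurable_compose[OF _ borel_measurable_sqrt] borel_measurable_sum borel_measurable_power measurable_compose[OF _ borel_measurable_norm]) auto

lemma nn_integral_borel_version: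
  fixes u u' :: "'a::euclidean_space \<Rightarrow> 'b::real_normed_vector"
  assumes m: "(\<lambda>x. norm (u' x)) \<in> borel_measurable borel" and ae: "AE x in lborel. x \<in> B \<longrightarrow> u' x = u x"
    and C: "C \<in> sets borel" "C \<subseteq> B"
  shows "(\<integral>\<^sup>+x. ennreal (norm (u x) powr p) * indicator C x \<partial>lebesgue) = (\<integral>\<^sup>+x. ennreal (norm (u' x) powr p) * indicator C x \<partial>lborel)"
proof -
  have "(\<integral>\<^sup>+x. ennreal (norm (u x) powr p) * indicator C x \<partial>lebesgue) = (\<integral>\<^sup>+x. ennreal (norm (u' x) powr p) * indicator C x \<partial>lebesgue)"
    by (rule nn_integral_cong_AE, rule eventually_mono[OF AE_completion[OF ae]]) (use C in \<open>auto simp: indicator_def\<close>)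
  also have "\<dots> = (\<integral>\<^sup>+x. ennreal (norm (u' x) powr p) * indicator C x \<partial>lborel)"
    by (rule nn_integral_completion) (use m C in measurable)
  finally show ?thesis .
qed

lemma integrable_borel_version:
  fixes u u' :: "'a::euclidean_space \<Rightarrow> 'b::real_normed_vector"
  assumes m: "(\<lambda>x. norm (u' x)) \<in> borel_measurable borel" and ae: "AE x in lborel. x \<in> B \<longrightarrow> u' x = u x"
    and z: "\<And>x. x \<notin> B \<Longrightarrow> u' x = 0" and B: "B \<in> sets borel" "B \<subseteq> C" and C: "C \<in> sets lebesgue"
    and i: "integrable (lebesgue_on C) (\<lambda>x. norm (u x) powr p)" and p: "p > 0"
  shows "integrable lborel (\<lambda>x. norm (u' x) powr p)"
proof -
  have "integrable lebesgue (\<lambda>x. indicator C x *\<^sub>R (norm (u x) powr p))"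
    using i C by (simp add: integrable_restrict_space)
  then have fin: "(\<integral>\<^sup>+x. ennreal (norm (indicator C x *\<^sub>R (norm (u x) powr p))) \<partial>lebesgue) < \<infinity>"
    by (simp add: integrable_iff_bounded)
  have "(\<integral>\<^sup>+x. ennreal (norm (u' x) powr p) \<partial>lborel) = (\<integral>\<^sup>+x. ennreal (norm (u' x) powr p) * indicator B x \<partial>lborel)"
    using z p by (intro nn_integral_cong) (auto simp: indicator_def)
  also have "\<dots> = (\<integral>\<^sup>+x. ennreal (norm (u x) powr p) * indicator B x \<partial>lebesgue)"
    by (rule nn_integral_borel_version[symmetric, OF m ae B(1) order_refl])
  also have "\<dots> \<le> (\<integral>\<^sup>+x. ennreal (norm (indicator C x *\<^sub>R (norm (u x) powr p))) \<partial>lebesgue)"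
    using B by (intro nn_integral_mono) (auto simp: indicator_def)
  also note fin
  finally have "(\<integral>\<^sup>+x. ennreal (norm (u' x) powr p) \<partial>lborel) < \<infinity>" .
  then show ?thesis using m by (simp add: integrable_iff_bounded)
qed

text \<open>
  Here \<open>\<psi>\<close> is a test function or one of its derivatives; both sides of the definition of the weak
  gradient are of this form.
\<close>

lemma integral_borel_version:
  fixes u u' \<psi> :: "'a::euclidean_space \<Rightarrow> real"
  assumes u: "u \<in> borel_measurable (lebesgue_on \<Omega>)" and O: "\<Omega> \<in> sets lebesgue" and B: "B \<subseteq> \<Omega>"
    and u': "u' \<in> borel_measurable borel" and ae: "AE x in lborel. x \<in> B \<longrightarrow> u' x = u x"
    and psi: "\<psi> \<in> borel_measurable borel" "\<And>x. x \<notin> B \<Longrightarrow> \<psi> x = 0"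
  shows "integral\<^sup>L (lebesgue_on \<Omega>) (\<lambda>x. u x * \<psi> x) = (\<integral>x. u' x * \<psi> x \<partial>lborel)"
proof -
  have um: "(\<lambda>x. if x \<in> \<Omega> then u x else 0) \<in> borel_measurable lebesgue" using u O by (simp add: borel_measurable_if)
  have pm: "\<psi> \<in> borel_measurable lebesgue" using psi(1) by (simp add: measurable_completion)
  have "integral\<^sup>L (lebesgue_on \<Omega>) (\<lambda>x. u x * \<psi> x) = (\<integral>x. indicator \<Omega> x *\<^sub>R (u x * \<psi> x) \<partial>lebesgue)"
    using O by (intro integral_restrict_space) simp
  also have "\<dots> = (\<integral>x. (if x \<in> \<Omega> then u x else 0) * \<psi> x \<partial>lebesgue)"
    by (intro Bochner_Integration.integral_cong) (auto simp: indicator_def)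
  also have "\<dots> = (\<integral>x. u' x * \<psi> x \<partial>lebesgue)"
  proof (rule integral_cong_AE)
    show "(\<lambda>x. (if x \<in> \<Omega> then u x else 0) * \<psi> x) \<in> borel_measurable lebesgue" using um pm by (rule borel_measurable_times)
    show "(\<lambda>x. u' x * \<psi> x) \<in> borel_measurable lebesgue" using u' psi(1) by (simp add: measurable_completion)
    show "AE x in lebesgue. (if x \<in> \<Omega> then u x else 0) * \<psi> x = u' x * \<psi> x"
      by (rule eventually_mono[OF AE_completion[OF ae]]) (use B psi(2) in force)
  qed
  also have "\<dots> = (\<integral>x. u' x * \<psi> x \<partial>lborel)" by (rule integral_completion) (use u' psi(1) in measurable)
  finally show ?thesis .
qed

lemma weak_gradient_localize:
  fixes u u' :: "real ^ 'n::finite \<Rightarrow> real"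
  assumes w: "weak_gradient \<Omega> u g" and O: "open \<Omega>" and R: "cball z R \<subseteq> \<Omega>"
    and u': "u' \<in> borel_measurable borel" "\<And>x. x \<notin> ball z R \<Longrightarrow> u' x = 0" "AE x in lborel. x \<in> ball z R \<longrightarrow> u' x = u x"
    and g': "\<And>j. (\<lambda>x. g' x $ j) \<in> borel_measurable borel" "\<And>x. x \<notin> ball z R \<Longrightarrow> g' x = 0" "AE x in lborel. x \<in> ball z R \<longrightarrow> g' x = g x"
  shows "weak_grad_on (ball z R) u' g'"
  unfolding weak_grad_on_def
proof (intro conjI allI impI)
  have Ol: "\<Omega> \<in> sets lebesgue" using O by auto
  have bl: "ball z R \<subseteq> \<Omega>" using R by auto
  have cl: "cball z R \<in> sets lebesgue" by auto
  have L: "Lp_loc \<Omega> 1 u" "Lp_loc \<Omega> 1 g" using w by (auto simp: weak_gradient_def)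
  have iu: "integrable (lebesgue_on (cball z R)) (\<lambda>x. norm (u x) powr 1)" and ig: "integrable (lebesgue_on (cball z R)) (\<lambda>x. norm (g x) powr 1)"
    using L R by (auto simp: Lp_loc_def)
  have "integrable lborel (\<lambda>x. norm (u' x) powr 1)"
    by (rule integrable_borel_version[OF _ u'(3,2) _ _ cl iu]) (use u'(1) in auto)
  then have "integrable lborel (\<lambda>x. \<bar>u' x\<bar>)" by simp
  then show "integrable lborel u'" using u'(1) by (simp add: integrable_iff_bounded)
  have ng: "integrable lborel (\<lambda>x. norm (g' x) powr 1)"
    by (rule integrable_borel_version[OF measurable_norm_vec[OF g'(1)] g'(3,2) _ _ cl ig]) auto
  show "integrable lborel (\<lambda>x. g' x $ j)" for j
    by (rule Bochner_Integration.integrable_bound[OF ng]) (use g'(1) component_le_norm_cart in auto)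
  fix \<phi> :: "real ^ 'n \<Rightarrow> real" and j assume t: "test_fun (ball z R) \<phi>"
  have tO: "test_fun \<Omega> \<phi>" using t bl unfolding test_fun_def by blast
  have C: "C_diff 1 \<phi>" "C_diff 0 \<phi>" using t by (simp_all add: test_fun_def)
  have phm: "\<phi> \<in> borel_measurable borel" using C(2) by (simp add: borel_measurable_continuous_onI)
  have pdm: "partial_deriv j \<phi> \<in> borel_measurable borel" using C(1) by (simp add: borel_measurable_continuous_onI partial_deriv_def)
  have z0: "\<phi> x = 0" if "x \<notin> closure {x. \<phi> x \<noteq> 0}" for x using that closure_subset[of "{x. \<phi> x \<noteq> 0}"] by auto
  have sub: "closure {x. \<phi> x \<noteq> 0} \<subseteq> ball z R" using t by (simp add: test_fun_def)
  have phz: "\<phi> x = 0" if "x \<notin> ball z R" for x using z0 sub that by blast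
  have pdz: "partial_deriv j \<phi> x = 0" if "x \<notin> ball z R" for x
  proof (rule partial_deriv_zero_outside[OF closed_closure])
    show "\<phi> y = 0" if "y \<notin> closure {x. \<phi> x \<noteq> 0}" for y by (rule z0[OF that])
    show "x \<notin> closure {x. \<phi> x \<noteq> 0}" using that sub by blast
  qed
  have um: "u \<in> borel_measurable (lebesgue_on \<Omega>)" using L(1) by (simp add: Lp_loc_def)
  have gm: "(\<lambda>x. g x $ j) \<in> borel_measurable (lebesgue_on \<Omega>)"
    unfolding cart_eq_inner_axis using L(2) by (intro borel_measurable_inner) (auto simp: Lp_loc_def)
  have aeg: "AE x in lborel. x \<in> ball z R \<longrightarrow> g' x $ j = g x $ j" using g'(3) by eventually_elim auto
  have "(\<integral>x. u' x * partial_deriv j \<phi> x \<partial>lborel) = integral\<^sup>L (lebesgue_on \<Omega>) (\<lambda>x. u x * partial_deriv j \<phi> x)"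
    by (rule integral_borel_version[symmetric, OF um Ol bl u'(1,3) pdm pdz])
  also have "\<dots> = - integral\<^sup>L (lebesgue_on \<Omega>) (\<lambda>x. g x $ j * \<phi> x)"
    using w tO by (simp add: weak_gradient_def partial_deriv_def)
  also have "integral\<^sup>L (lebesgue_on \<Omega>) (\<lambda>x. g x $ j * \<phi> x) = (\<integral>x. g' x $ j * \<phi> x \<partial>lborel)"
    by (rule integral_borel_version[OF gm Ol bl g'(1) aeg phm phz])
  finally show "(\<integral>x. u' x * partial_deriv j \<phi> x \<partial>lborel) = - (\<integral>x. g' x $ j * \<phi> x \<partial>lborel)" .
qed

text \<open>
  Finitely many of the balls cover a given compact set.
\<close>

lemma Lp_loc_of_balls:
  fixes u :: "real ^ 'n::finite \<Rightarrow> 'b::euclidean_space"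
  assumes O: "open \<Omega>" and u: "u \<in> borel_measurable (lebesgue_on \<Omega>)"
    and loc: "\<And>z. z \<in> \<Omega> \<Longrightarrow> \<exists>\<rho>>0. (\<integral>\<^sup>+x. ennreal (norm (u x) powr s) * indicator (ball z \<rho>) x \<partial>lebesgue) < \<infinity>"
  shows "Lp_loc \<Omega> s u"
  unfolding Lp_loc_def
proof (intro conjI allI impI u)
  fix C assume C: "compact C" "C \<subseteq> \<Omega>"
  define \<rho> where "\<rho> z = (SOME \<rho>. \<rho> > 0 \<and> (\<integral>\<^sup>+x. ennreal (norm (u x) powr s) * indicator (ball z \<rho>) x \<partial>lebesgue) < \<infinity>)" for z
  have rho0: "\<rho> z > 0 \<and> (\<integral>\<^sup>+x. ennreal (norm (u x) powr s) * indicator (ball z (\<rho> z)) x \<partial>lebesgue) < \<infinity>" if "z \<in> \<Omega>" for z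
    unfolding \<rho>_def by (rule someI_ex[OF loc[OF that]])
  note rho = conjunct1[OF rho0] conjunct2[OF rho0]
  have cover: "C \<subseteq> (\<Union>z\<in>C. ball z (\<rho> z))"
  proof
    fix x assume x: "x \<in> C"
    then have "x \<in> ball x (\<rho> x)" using rho(1) C(2) by (simp add: subset_iff)
    then show "x \<in> (\<Union>z\<in>C. ball z (\<rho> z))" using x by (rule UN_I[rotated])
  qed
  obtain F where F: "F \<subseteq> C" "finite F" "C \<subseteq> (\<Union>z\<in>F. ball z (\<rho> z))"
    by (rule compactE_image[OF C(1) _ cover]) simp_all
  have Ol: "\<Omega> \<in> sets lebesgue" "C \<in> sets lebesgue" using lmeasurable_compact[OF C(1)] O by (simp_all add: fmeasurableD)
  define v where "v x = (if x \<in> \<Omega> then u x else 0)" for x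
  have vm: "v \<in> borel_measurable lebesgue" unfolding v_def[abs_def] using u Ol by (simp add: borel_measurable_if)
  have pm: "(\<lambda>x. norm (v x) powr s) \<in> borel_measurable lebesgue"
    using measurable_compose[OF vm borel_measurable_norm] by (intro powr_real_measurable borel_measurable_const)
  have "(\<integral>\<^sup>+x. ennreal (norm (indicator C x *\<^sub>R (norm (v x) powr s))) \<partial>lebesgue) \<le> (\<integral>\<^sup>+x. (\<Sum>z\<in>F. ennreal (norm (v x) powr s) * indicator (ball z (\<rho> z)) x) \<partial>lebesgue)"
  proof (rule nn_integral_mono)
    fix x
    show "ennreal (norm (indicator C x *\<^sub>R (norm (v x) powr s))) \<le> (\<Sum>z\<in>F. ennreal (norm (v x) powr s) * indicator (ball z (\<rho> z)) x)"
    proof (cases "x \<in> C")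
      case True
      then obtain z where z: "z \<in> F" "x \<in> ball z (\<rho> z)" using F(3) by auto
      have "ennreal (norm (v x) powr s) * indicator (ball z (\<rho> z)) x \<le> (\<Sum>z\<in>F. ennreal (norm (v x) powr s) * indicator (ball z (\<rho> z)) x)"
        using F(2) z(1) by (intro member_le_sum) auto
      then show ?thesis using z(2) True by simp
    qed simp
  qed
  also have "\<dots> = (\<Sum>z\<in>F. \<integral>\<^sup>+x. ennreal (norm (v x) powr s) * indicator (ball z (\<rho> z)) x \<partial>lebesgue)"
    using pm by (intro nn_integral_sum borel_measurable_times_ennreal borel_measurable_indicator measurable_compose[OF _ measurable_ennreal]) auto
  also have "\<dots> < \<infinity>"
  proof -
    have "(\<integral>\<^sup>+x. ennreal (norm (v x) powr s) * indicator (ball z (\<rho> z)) x \<partial>lebesgue) < \<infinity>" if "z \<in> F" for z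
    proof -
      have "(\<integral>\<^sup>+x. ennreal (norm (v x) powr s) * indicator (ball z (\<rho> z)) x \<partial>lebesgue) \<le> (\<integral>\<^sup>+x. ennreal (norm (u x) powr s) * indicator (ball z (\<rho> z)) x \<partial>lebesgue)"
        by (intro nn_integral_mono) (auto simp: v_def indicator_def)
      also have "\<dots> < \<infinity>" using rho(2) that F(1) C(2) by blast
      finally show ?thesis .
    qed
    then show ?thesis using F(2) by simp
  qed
  finally have fin: "(\<integral>\<^sup>+x. ennreal (norm (indicator C x *\<^sub>R (norm (v x) powr s))) \<partial>lebesgue) < \<infinity>" .
  have "integrable lebesgue (\<lambda>x. indicator C x *\<^sub>R (norm (v x) powr s))"
    unfolding integrable_iff_bounded
  proof
    show "(\<lambda>x. indicator C x *\<^sub>R (norm (v x) powr s)) \<in> borel_measurable lebesgue"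
      using pm Ol(2) by (intro borel_measurable_scaleR borel_measurable_indicator)
  qed (rule fin)
  then have "integrable (lebesgue_on C) (\<lambda>x. norm (v x) powr s)" using Ol(2) by (simp add: integrable_restrict_space)
  moreover have "norm (v x) powr s = norm (u x) powr s" if "x \<in> space (lebesgue_on C)" for x
    using that C(2) by (auto simp: v_def space_restrict_space)
  ultimately show "integrable (lebesgue_on C) (\<lambda>x. norm (u x) powr s)"
    by (subst (asm) Bochner_Integration.integrable_cong[OF refl]) auto
qed

section \<open>Higher integrability of quasiregular curves\<close>

theorem theorem1p6:
  fixes K :: real
  assumes "K \<ge> 1" and "CARD('n::finite) \<ge> 2"
  shows "\<exists>r::real. r > real CARD('n) \<and>
    (\<forall>(m::nat) (\<omega> :: ('n \<Rightarrow> nat \<Rightarrow> real) \<Rightarrow> real) (\<Omega> :: (real ^ 'n) set)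
       (f :: real ^ 'n \<Rightarrow> nat \<Rightarrow> real) (D :: real ^ 'n \<Rightarrow> nat \<Rightarrow> real ^ 'n).
       m \<ge> CARD('n) \<longrightarrow>
       calibration m \<omega> \<longrightarrow>
       open \<Omega> \<longrightarrow>
       W1p_loc_map \<Omega> m (real CARD('n)) f \<longrightarrow>
       weak_differential \<Omega> m f D \<longrightarrow>
       (AE x in lebesgue_on \<Omega>. op_norm m (D x) ^ CARD('n) \<le> K * star_pullback m \<omega> (D x)) \<longrightarrow>
       (\<forall>s. real CARD('n) \<le> s \<and> s < r \<longrightarrow> W1p_loc_map \<Omega> m s f))"
proof -
  define N where "N = CARD('n)"
  have N: "N \<ge> 2" "N > 0" using assms(2) by (auto simp: N_def)
  \<comment> \<open>the distortion inequality for the Hilbert-Schmidt norm\<close>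
  define K' where "K' = sqrt (real N) ^ N * K"
  have K': "K' \<ge> 0" using assms(1) by (simp add: K'_def)
  obtain e where e: "e > 0" and lhi: "\<And>m (\<omega> :: ('n \<Rightarrow> nat \<Rightarrow> real) \<Rightarrow> real) U (G :: nat \<Rightarrow> real ^ 'n \<Rightarrow> real ^ 'n) z R R' s.
    0 < R \<Longrightarrow> quasiregular_on K' m \<omega> U G R' (ball z R) \<Longrightarrow>
    real CARD('n) \<le> s \<Longrightarrow> s < real CARD('n) + e \<Longrightarrow>
    (\<integral>\<^sup>+x. ennreal (hs_norm m (\<lambda>i. G i x) powr s) * indicator (ball z (R/2)) x \<partial>lborel) < \<infinity> \<and>
    (\<forall>i<m. (\<integral>\<^sup>+x. ennreal (\<bar>U i x\<bar> powr s) * indicator (cball z (R/3)) x \<partial>lborel) < \<infinity>)"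
    using local_higher_integrability[OF K' assms(2)] by blast
  show ?thesis
  proof (intro exI[of _ "real CARD('n) + e"] conjI allI impI)
    show "real CARD('n) < real CARD('n) + e" using e by simp
    fix m and \<omega> :: "('n \<Rightarrow> nat \<Rightarrow> real) \<Rightarrow> real" and \<Omega> :: "(real ^ 'n) set" and f :: "real ^ 'n \<Rightarrow> nat \<Rightarrow> real" and D :: "real ^ 'n \<Rightarrow> nat \<Rightarrow> real ^ 'n" and s
    assume "CARD('n) \<le> m" and cal: "calibration m \<omega>" and O: "open \<Omega>" and W: "W1p_loc_map \<Omega> m (real CARD('n)) f"
      and D: "weak_differential \<Omega> m f D"
      and qr: "AE x in lebesgue_on \<Omega>. op_norm m (D x) ^ CARD('n) \<le> K * star_pullback m \<omega> (D x)"
      and s: "real CARD('n) \<le> s \<and> s < real CARD('n) + e"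
    have cov: "covector m \<omega>" and com: "comass m \<omega> \<le> 1" using cal by (auto simp: calibration_def)
    have Ol: "\<Omega> \<in> sets lebesgue" using O by auto
    have wD: "weak_gradient \<Omega> (\<lambda>x. f x i) (\<lambda>x. D x i)" if "i < m" for i using D that by (simp add: weak_differential_def)
    have Lf: "Lp_loc \<Omega> (real N) (\<lambda>x. f x i)" if "i < m" for i using W that by (simp add: W1p_loc_map_def W1p_loc_def N_def)
    have "\<exists>g. weak_gradient \<Omega> (\<lambda>x. f x i) g \<and> Lp_loc \<Omega> (real N) g" if "i < m" for i
      using W that by (simp add: W1p_loc_map_def W1p_loc_def N_def)
    then obtain g where g: "\<And>i. i < m \<Longrightarrow> weak_gradient \<Omega> (\<lambda>x. f x i) (g i)" "\<And>i. i < m \<Longrightarrow> Lp_loc \<Omega> (real N) (g i)" by metis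
    have fm: "(\<lambda>x. f x i) \<in> borel_measurable (lebesgue_on \<Omega>)" and Dm: "(\<lambda>x. D x i) \<in> borel_measurable (lebesgue_on \<Omega>)"
      and gm: "g i \<in> borel_measurable (lebesgue_on \<Omega>)" if "i < m" for i
      using wD[OF that] g(2)[OF that] by (auto simp: weak_gradient_def Lp_loc_def)
    have qrb: "AE x in lborel. x \<in> \<Omega> \<longrightarrow> hs_norm m (D x) ^ N \<le> K' * \<omega> (\<lambda>k. tuple m (\<lambda>i. D x i $ k))"
    proof -
      have "AE x in lebesgue. x \<in> \<Omega> \<longrightarrow> op_norm m (D x) ^ CARD('n) \<le> K * star_pullback m \<omega> (D x)"
        using qr Ol by (simp add: AE_restrict_space_iff)
      then have "AE x in lborel. x \<in> \<Omega> \<longrightarrow> op_norm m (D x) ^ CARD('n) \<le> K * star_pullback m \<omega> (D x)"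
        by (simp only: AE_completion_iff)
      then show ?thesis
      proof eventually_elim
        case (elim x)
        show ?case
        proof
          assume "x \<in> \<Omega>"
          then have q: "op_norm m (D x) ^ N \<le> K * \<omega> (\<lambda>k. tuple m (\<lambda>i. D x i $ k))"
            using elim by (simp add: N_def star_pullback_def row_map_axis)
          have "hs_norm m (D x) ^ N \<le> (sqrt (real N) * op_norm m (D x)) ^ N"
            unfolding N_def by (intro power_mono hs_norm_le_op_norm hs_norm_nonneg)
          also have "\<dots> = sqrt (real N) ^ N * op_norm m (D x) ^ N" by (rule power_mult_distrib)
          also have "\<dots> \<le> sqrt (real N) ^ N * (K * \<omega> (\<lambda>k. tuple m (\<lambda>i. D x i $ k)))" by (intro mult_left_mono q) simp
          finally show "hs_norm m (D x) ^ N \<le> K' * \<omega> (\<lambda>k. tuple m (\<lambda>i. D x i $ k))" by (simp add: K'_def mult.assoc)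
        qed
      qed
    qed
    \<comment> \<open>it suffices to find a ball around each point on which the integrals are finite\<close>
    have local: "\<exists>\<rho>>0. \<forall>i<m. (\<integral>\<^sup>+x. ennreal (norm (f x i) powr s) * indicator (ball z \<rho>) x \<partial>lebesgue) < \<infinity> \<and>
        (\<integral>\<^sup>+x. ennreal (norm (D x i) powr s) * indicator (ball z \<rho>) x \<partial>lebesgue) < \<infinity>" if z: "z \<in> \<Omega>" for z
    proof -
      obtain R where R: "R > 0" "cball z R \<subseteq> \<Omega>" using O z by (meson open_contains_cball)
      let ?B = "ball z R"
      have Bs: "?B \<in> sets borel" "?B \<subseteq> \<Omega>" using R by auto
      have "\<exists>v. v \<in> borel_measurable borel \<and> (\<forall>x. x \<notin> ?B \<longrightarrow> v x = 0) \<and> (AE x in lborel. x \<in> ?B \<longrightarrow> v x = f x i)" if "i < m" for i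
        by (rule borel_version[OF fm[OF that] Ol Bs]) (intro exI conjI allI impI)
      then have "\<forall>i. \<exists>v. i < m \<longrightarrow> v \<in> borel_measurable borel \<and> (\<forall>x. x \<notin> ?B \<longrightarrow> v x = 0) \<and> (AE x in lborel. x \<in> ?B \<longrightarrow> v x = f x i)"
        by (simp only: ex_simps) (intro allI impI)
      from choice[OF this] obtain U where U0: "\<forall>i. i < m \<longrightarrow> U i \<in> borel_measurable borel \<and> (\<forall>x. x \<notin> ?B \<longrightarrow> U i x = 0) \<and> (AE x in lborel. x \<in> ?B \<longrightarrow> U i x = f x i)" ..
      have "\<exists>v. (\<forall>j. (\<lambda>x. v x $ j) \<in> borel_measurable borel) \<and> (\<forall>x. x \<notin> ?B \<longrightarrow> v x = 0) \<and> (AE x in lborel. x \<in> ?B \<longrightarrow> v x = D x i)" if "i < m" for i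
        by (rule borel_version_vec[OF Dm[OF that] Ol Bs]) (intro exI conjI allI impI)
      then have "\<forall>i. \<exists>v. i < m \<longrightarrow> (\<forall>j. (\<lambda>x. v x $ j) \<in> borel_measurable borel) \<and> (\<forall>x. x \<notin> ?B \<longrightarrow> v x = 0) \<and> (AE x in lborel. x \<in> ?B \<longrightarrow> v x = D x i)"
        by (simp only: ex_simps) (intro allI impI)
      from choice[OF this] obtain G where G0: "\<forall>i. i < m \<longrightarrow> (\<forall>j. (\<lambda>x. G i x $ j) \<in> borel_measurable borel) \<and> (\<forall>x. x \<notin> ?B \<longrightarrow> G i x = 0) \<and> (AE x in lborel. x \<in> ?B \<longrightarrow> G i x = D x i)" ..
      have "\<exists>v. (\<forall>j. (\<lambda>x. v x $ j) \<in> borel_measurable borel) \<and> (\<forall>x. x \<notin> ?B \<longrightarrow> v x = 0) \<and> (AE x in lborel. x \<in> ?B \<longrightarrow> v x = g i x)" if "i < m" for i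
        by (rule borel_version_vec[OF gm[OF that] Ol Bs]) (intro exI conjI allI impI)
      then have "\<forall>i. \<exists>v. i < m \<longrightarrow> (\<forall>j. (\<lambda>x. v x $ j) \<in> borel_measurable borel) \<and> (\<forall>x. x \<notin> ?B \<longrightarrow> v x = 0) \<and> (AE x in lborel. x \<in> ?B \<longrightarrow> v x = g i x)"
        by (simp only: ex_simps) (intro allI impI)
      from choice[OF this] obtain G' where G0': "\<forall>i. i < m \<longrightarrow> (\<forall>j. (\<lambda>x. G' i x $ j) \<in> borel_measurable borel) \<and> (\<forall>x. x \<notin> ?B \<longrightarrow> G' i x = 0) \<and> (AE x in lborel. x \<in> ?B \<longrightarrow> G' i x = g i x)" ..
      note U = conjunct1[OF U0[rule_format]] conjunct1[OF conjunct2[OF U0[rule_format]], rule_format]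
        conjunct2[OF conjunct2[OF U0[rule_format]]]
      note G = conjunct1[OF G0[rule_format], rule_format] conjunct1[OF conjunct2[OF G0[rule_format]], rule_format]
        conjunct2[OF conjunct2[OF G0[rule_format]]]
      note G' = conjunct1[OF G0'[rule_format], rule_format] conjunct1[OF conjunct2[OF G0'[rule_format]], rule_format]
        conjunct2[OF conjunct2[OF G0'[rule_format]]]
      have wG: "weak_grad_on ?B (U i) (G i)" if i: "i < m" for i
        by (rule weak_gradient_localize[OF wD[OF i] O R(2) U(1)[OF i] U(2)[OF i] U(3)[OF i] G(1)[OF i] G(2)[OF i] G(3)[OF i]])
      have wG': "weak_grad_on ?B (U i) (G' i)" if i: "i < m" for i
        by (rule weak_gradient_localize[OF g(1)[OF i] O R(2) U(1)[OF i] U(2)[OF i] U(3)[OF i] G'(1)[OF i] G'(2)[OF i] G'(3)[OF i]])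
      define R' where "R' = norm z + R"
      have out: "x \<notin> ?B" if "norm x > R'" for x
        using that norm_triangle_ineq[of z "x - z"] by (auto simp: R'_def dist_norm norm_minus_commute)
      have cl: "cball z R \<in> sets lebesgue" by auto
      have UN: "integrable lborel (\<lambda>x. \<bar>U i x\<bar> ^ N)" if i: "i < m" for i
      proof -
        have fi: "integrable (lebesgue_on (cball z R)) (\<lambda>x. norm (f x i) powr real N)"
          using Lf[OF i] R(2) by (simp add: Lp_loc_def)
        have "integrable lborel (\<lambda>x. norm (U i x) powr real N)"
          by (rule integrable_borel_version[OF _ U(3)[OF i] U(2)[OF i] Bs(1) _ cl fi]) (use U(1)[OF i] N in auto)
        then show ?thesis using N by (simp add: powr_realpow')
      qed
      \<comment> \<open>\<open>D\<close> is only a locally integrable weak gradient; it inherits integrability to the power \<open>n\<close> from the gradient \<open>g\<close> by uniqueness\<close>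
      have GN: "integrable lborel (\<lambda>x. \<bar>G i x $ k\<bar> ^ N)" if i: "i < m" for i k
      proof -
        have gi: "integrable (lebesgue_on (cball z R)) (\<lambda>x. norm (g i x) powr real N)"
          using g(2)[OF i] R(2) by (simp add: Lp_loc_def)
        have i1: "integrable lborel (\<lambda>x. norm (G' i x) powr real N)"
          by (rule integrable_borel_version[OF measurable_norm_vec[OF G'(1)[OF i]] G'(3)[OF i] G'(2)[OF i] Bs(1) _ cl gi]) (use N in auto)
        have ae: "AE x in lborel. x \<in> ?B \<longrightarrow> G i x = G' i x"
          by (rule weak_grad_on_unique[OF wG[OF i] wG'[OF i], of R']) (use G(2)[OF i] G'(2)[OF i] out in auto)
        show ?thesis
        proof (rule Bochner_Integration.integrable_bound[OF i1])
          show "AE x in lborel. norm (\<bar>G i x $ k\<bar> ^ N) \<le> norm (norm (G' i x) powr real N)"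
            using ae
          proof eventually_elim
            case (elim x)
            have "G i x = G' i x" using elim G(2)[OF i, of x] G'(2)[OF i, of x] by (cases "x \<in> ?B") auto
            then show ?case using N component_le_norm_cart[of "G' i x" k] by (simp add: powr_realpow' power_mono)
          qed
        qed (use G(1)[OF i] in auto)
      qed
      have gn: "integrable lborel (\<lambda>y. (\<Sum>i<m. \<bar>U i y\<bar> + (\<Sum>k\<in>UNIV. \<bar>G i y $ k\<bar>)) ^ CARD('n))"
      proof -
        define w where "w i y = \<bar>U i y\<bar> + (\<Sum>k\<in>UNIV. \<bar>G i y $ k\<bar>)" for i y
        have w0: "w i y \<ge> 0" for i y by (simp add: w_def sum_nonneg)
        \<comment> \<open>\<open>None\<close> stands for the function, \<open>Some k\<close> for its \<open>k\<close>-th derivative\<close>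
        define v where "v i k y = (case k of None \<Rightarrow> U i y | Some k \<Rightarrow> G i y $ k)" for i y and k :: "'n option"
        have wv: "w i y = (\<Sum>k\<in>UNIV. \<bar>v i k y\<bar>)" for i y
          by (simp add: w_def v_def UNIV_option_conv sum.reindex)
        have wN: "integrable lborel (\<lambda>y. \<bar>w i y\<bar> ^ N)" if i: "i < m" for i
          unfolding abs_of_nonneg[OF w0] unfolding wv
        proof (rule integrable_power_sum)
          show "v i k \<in> borel_measurable lborel" for k using U(1)[OF i] G(1)[OF i] by (cases k) (auto simp: v_def[abs_def])
          show "integrable lborel (\<lambda>y. \<bar>v i k y\<bar> ^ N)" for k using UN[OF i] GN[OF i] by (cases k) (auto simp: v_def)
        qed (use N in auto)
        have wm: "w i \<in> borel_measurable lborel" if i: "i < m" for i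
          unfolding w_def[abs_def] using U(1)[OF i] G(1)[OF i] by (intro borel_measurable_add borel_measurable_sum borel_measurable_abs) auto
        have "integrable lborel (\<lambda>y. (\<Sum>i\<in>{..<m}. \<bar>w i y\<bar>) ^ N)"
          by (rule integrable_power_sum) (use wN wm N in auto)
        then show ?thesis unfolding abs_of_nonneg[OF w0] by (simp add: w_def N_def)
      qed
      have aeG: "AE x in lborel. \<forall>i\<in>{..<m}. x \<in> ?B \<longrightarrow> G i x = D x i"
        by (rule AE_finite_allI) (use G(3) in auto)
      have qrG: "AE y in lborel. y \<in> ?B \<longrightarrow> hs_norm m (\<lambda>i. G i y) ^ CARD('n) \<le> K' * \<omega> (\<lambda>k. tuple m (\<lambda>i. G i y $ k))"
        using qrb aeG
      proof eventually_elim
        case (elim y)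
        show ?case
        proof
          assume y: "y \<in> ?B"
          have e1: "G i y = D y i" if "i < m" for i using elim(2) y that by auto
          have "hs_norm m (\<lambda>i. G i y) = hs_norm m (D y)" unfolding hs_norm_def by (rule L2_set_cong) (auto simp: e1)
          moreover have "tuple m (\<lambda>i. G i y $ k) = tuple m (\<lambda>i. D y i $ k)" for k by (auto simp: tuple_def e1)
          ultimately show "hs_norm m (\<lambda>i. G i y) ^ CARD('n) \<le> K' * \<omega> (\<lambda>k. tuple m (\<lambda>i. G i y $ k))"
            using elim(1) y Bs(2) by (auto simp: N_def)
        qed
      qed
      have sup: "\<forall>i<m. \<forall>x. norm x > R' \<longrightarrow> U i x = 0 \<and> G i x = 0" using U(2) G(2) out by blast
      have wGa: "\<forall>i<m. weak_grad_on ?B (U i) (G i)" using wG by blast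
      have quasi: "quasiregular_on K' m \<omega> U G R' ?B"
        unfolding quasiregular_on_def by (intro conjI cov com wGa sup gn qrG)
      note res = lhi[OF R(1) quasi conjunct1[OF s] conjunct2[OF s]]
      show ?thesis
      proof (intro exI[of _ "R/3"] conjI allI impI)
        show "R/3 > 0" using R by simp
        fix i assume i: "i < m"
        have C3: "ball z (R/3) \<in> sets borel" "ball z (R/3) \<subseteq> ?B" using R by auto
        have "(\<integral>\<^sup>+x. ennreal (norm (f x i) powr s) * indicator (ball z (R/3)) x \<partial>lebesgue) = (\<integral>\<^sup>+x. ennreal (norm (U i x) powr s) * indicator (ball z (R/3)) x \<partial>lborel)"
          by (rule nn_integral_borel_version[OF _ U(3)[OF i] C3]) (use U(1)[OF i] in auto)
        also have "\<dots> \<le> (\<integral>\<^sup>+x. ennreal (\<bar>U i x\<bar> powr s) * indicator (cball z (R/3)) x \<partial>lborel)"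
          by (intro nn_integral_mono) (auto simp: indicator_def)
        also have "\<dots> < \<infinity>" using res i by blast
        finally show "(\<integral>\<^sup>+x. ennreal (norm (f x i) powr s) * indicator (ball z (R/3)) x \<partial>lebesgue) < \<infinity>" .
        have "(\<integral>\<^sup>+x. ennreal (norm (D x i) powr s) * indicator (ball z (R/3)) x \<partial>lebesgue) = (\<integral>\<^sup>+x. ennreal (norm (G i x) powr s) * indicator (ball z (R/3)) x \<partial>lborel)"
          by (rule nn_integral_borel_version[OF measurable_norm_vec[OF G(1)[OF i]] G(3)[OF i] C3])
        also have "\<dots> \<le> (\<integral>\<^sup>+x. ennreal (hs_norm m (\<lambda>i. G i x) powr s) * indicator (ball z (R/2)) x \<partial>lborel)"
        proof (rule nn_integral_mono)
          fix x
          have "norm (G i x) \<le> hs_norm m (\<lambda>i. G i x)" unfolding hs_norm_def using i by (intro member_le_L2_set) auto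
          then have "norm (G i x) powr s \<le> hs_norm m (\<lambda>i. G i x) powr s" using s N by (intro powr_mono2) (auto simp: N_def)
          then show "ennreal (norm (G i x) powr s) * indicator (ball z (R/3)) x \<le> ennreal (hs_norm m (\<lambda>i. G i x) powr s) * indicator (ball z (R/2)) x"
            using R by (auto simp: indicator_def ennreal_leI)
        qed
        also have "\<dots> < \<infinity>" using res by blast
        finally show "(\<integral>\<^sup>+x. ennreal (norm (D x i) powr s) * indicator (ball z (R/3)) x \<partial>lebesgue) < \<infinity>" .
      qed
    qed
    show "W1p_loc_map \<Omega> m s f"
      unfolding W1p_loc_map_def
    proof (intro conjI allI impI)
      show "\<forall>x\<in>\<Omega>. f x \<in> topspace (Euclidean_space m)" using W by (simp add: W1p_loc_map_def)
      fix i assume i: "i < m"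
      have a: "Lp_loc \<Omega> s (\<lambda>x. f x i)" by (rule Lp_loc_of_balls[OF O fm[OF i]]) (use local i in blast)
      have b: "Lp_loc \<Omega> s (\<lambda>x. D x i)" by (rule Lp_loc_of_balls[OF O Dm[OF i]]) (use local i in blast)
      show "W1p_loc \<Omega> s (\<lambda>x. f x i)" unfolding W1p_loc_def using a b wD[OF i] by blast
    qed
  qed
qed

end
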